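(* Let $V:\mathbb{R}\setminus\{0\}\to\mathbb{R}$ and $W:\mathbb{R}\to\mathbb{R}$ satisfy the standing assumptions (A1)--(A4) of the context. For each integer $n\ge 2$ let $(x^{n,\circ},b^{n,\circ})\in\mathbb{R}^n\times\{-1,1\}^n$ with $x^{n,\circ}_1<x^{n,\circ}_2<\dots<x^{n,\circ}_n$, and let $\boldsymbol\mu_n^\circ=(\mu_n^{+,\circ},\mu_n^{-,\circ})$ with $\mu_n^{\pm,\circ}:=\frac1n\sum_{i:\,b_i^{n,\circ}=\pm1}\delta_{x_i^{n,\circ}}$. Assume that (i) $E_n(x^{n,\circ};b^{n,\circ})$ is bounded uniformly in $n$; (ii) $(\boldsymbol\mu_n^\circ)_n$ has bounded fourth moment uniformly in $n$, i.e. $\sup_n \int_{\mathbb{R}} y^4\,\mathrm d(\mu_n^{+,\circ}+\mu_n^{-,\circ})(y)<\infty$; (iii) there exists $L\in\mathbb{N}$ independent of $n$ such that for every $n$ there exist (possibly $n$-dependent) $-\infty<a_0\le a_1\le\dots\le a_{2L}<+\infty$ with $$\{x_i^{n,\circ}: b_i^{n,\circ}=1\}\subset\bigcup_{\ell=1}^L(a_{2\ell-2},a_{2\ell-1}),\qquad \{x_i^{n,\circ}: b_i^{n,\circ}=-1\}\subset\bigcup_{\ell=1}^L(a_{2\ell-1},a_{2\ell}).$$ Let $T>0$. For each $n$ let $(x^n,b^n)$ be the solution on $[0,T]$ of the discrete problem with annihilation (see context) with initial datum $(x^{n,\circ},b^{n,\circ})$, and let $\boldsymbol\mu_n=(\mu_n^+,\mu_n^-)\in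 \mathrm{AC}^2(0,T;\mathcal P_2(\mathbb{R}\times\{\pm1\}))$, where $\mu_n^\pm(t):=\frac1n\sum_{i:\,b_i^{n,\circ}=\pm1}\delta_{x^n_i(t)}$. Then there exist a subsequence $(n_k)_k$ and a curve $\boldsymbol\rho=(\rho^+,\rho^-)$ on $[0,T]$ with values in $\mathcal P_2(\mathbb{R}\times\{\pm1\})$ such that $\boldsymbol\mu_{n_k}\to\boldsymbol\rho$ weakly as measures, uniformly in time, that is, for every bounded continuous $\varphi:\mathbb{R}\to\mathbb{R}$ and each sign $\pm$, $$\sup_{t\in[0,T]}\Big|\int_{\mathbb{R}}\varphi\,\mathrm d\mu_{n_k}^\pm(t)-\int_{\mathbb{R}}\varphi\,\mathrm d\rho^\pm(t)\Big|\to0\quad\text{as }k\to\infty,$$ and $\boldsymbol\rho$ is a solution of the continuum problem (weak form, see context) whose initial condition $\boldsymbol\rho^\circ$ is the limit of $(\boldsymbol\mu^\circ_{n_k})_k$ along the same subsequence.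
   Context: **Assumptions on the potentials.** (A1) $V\in C^1(\mathbb{R}\setminus\{0\})$, $W\in C^1(\mathbb{R})$, $V'$ is locally Lipschitz on $\mathbb{R}\setminus\{0\}$, $W'$ is Lipschitz on $\mathbb{R}$. (A2) $V$ and $W$ are even. (A3) $V(r)\to+\infty$ as $r\to0$. (A4) $r\mapsto rV'(r)$ and $r\mapsto rW'(r)$ are in $L^\infty(\mathbb{R})$. Convention: $V'(0):=0$ and, in the energy, $V(0):=+\infty$. **Energy.** For $x\in\mathbb{R}^n$, $b\in\{-1,0,1\}^n$, $$E_n(x;b):=\frac1{2n^2}\sum_{i=1}^n\Big(\sum_{j\neq i,\ b_ib_j=1}V(x_i-x_j)+\sum_{j:\ b_ib_j=-1}W(x_i-x_j)\Big).$$ **Discrete problem with annihilation.** Let $(x^\circ,b^\circ)\in\mathbb{R}^n\times\{\pm1\}^n$ with $x_1^\circ<\dots<x_n^\circ$. Let $H$ be the Heaviside function on $\mathbb{R}\cup\{+\infty\}$ with $H(0)=0$, $H(+\infty)=1$. A solution on $[0,T]$ is a map $(x,b):[0,T]\to\mathbb{R}^n\times\{-1,0,1\}^n$ such that: (a) $x\in\mathrm{Lip}([0,T];\mathbb{R}^n)$; (b) $(x(0),b(0))=(x^\circ,b^\circ)$ and, in the classical sense, for every $i$, $$\frac{\mathrm d}{\mathrm dt}x_i=-\frac1n\sum_{j:\,b_ib_j=1}V'(x_i-x_j)-\frac1n\sum_{j:\,b_ib_j=-1}W'(x_i-x_j)\quad\text{on }(0,T)\setminus T_{\mathrm{col}},$$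 where $T_{\mathrm{col}}$ is the jump set of $b$; (c) there are collision times $\tau_i\in(0,T)\cup\{+\infty\}$, $i=1,\dots,n$, such that $T_{\mathrm{col}}=\{\tau_i:1\le i\le n\}\setminus\{+\infty\}=\{t_1<\dots<t_K\}\subset(0,T)$ and $b_i(t)=b_i^\circ H(\tau_i-t)$ for all $i$; (d) with $t_0:=0$, for all $k=1,\dots,K$: $t_k=\inf\{t\in(0,T):\exists(i,j)\text{ with }b_i(t_{k-1})b_j(t_{k-1})=-1\text{ and }x_i(t)=x_j(t)\}>t_{k-1}$; moreover the set $\{t\in(0,T):\exists(i,j)\text{ with }b_i(t_K)b_j(t_K)=-1\text{ and }x_i(t)=x_j(t)\}$ is empty; (e) for each $t\in[0,T]$ there is a bijection $\alpha:\{i:b_i^\circ=1,\tau_i\le t\}\to\{j:b_j^\circ=-1,\tau_j\le t\}$ with $x_i(t)=x_{\alpha(i)}(t)$. Under (A1)--(A4) such a solution exists and is unique. **Measure spaces.** $\mathcal P(\mathbb{R}\times\{\pm1\})$ is the set of probability measures on $\mathbb{R}\times\{\pm1\}$, identified with pairs $\boldsymbol\mu=(\mu^+,\mu^-)$ of non-negative Borel measures on $\mathbb{R}$ with $\mu^+(\mathbb{R})+\mu^-(\mathbb{R})=1$ ($\mu^\pm$ being the part on $\mathbb{R}\times\{\pm1\}$). $\mathcal P_2(\mathbb{R}\times\{\pm1\})$ is the subset with finite second moments $\int x^2\,\mathrm d\mu^\pm<\infty$, and $\mathcal P_2^m(\mathbb{R}\times\{\pm1\})$ the subset of the latter with $\mu^+(\mathbb{R})=m$,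 $m\in[0,1]$. On $\mathcal P_2(\mathbb{R}\times\{\pm1\})$ the metric $\mathbf W$ is the 2-Wasserstein distance with respect to the distance $\mathsf d$ on $\mathbb{R}\times\{\pm1\}$ given by $\mathsf d^2((x,p),(y,q))=|x-y|^2+|p-q|$. $\mathrm{AC}^p(0,T;\cdot)$ denotes curves $\boldsymbol\mu$ with $\mathbf W(\boldsymbol\mu(s),\boldsymbol\mu(t))\le\int_s^t f(r)\,\mathrm dr$ for all $0<s\le t<T$ for some non-negative $f\in L^p(0,T)$; $\mathrm{AC}:=\mathrm{AC}^1$. **Continuum problem (weak form).** For a signed measure $\kappa$, $[\kappa]_\pm$ denotes its positive/negative part (Jordan decomposition). Given $\boldsymbol\rho^\circ=(\rho^{+,\circ},\rho^{-,\circ})\in\mathcal P_2(\mathbb{R}\times\{\pm1\})$, a solution with initial condition $\boldsymbol\rho^\circ$ is a curve $\boldsymbol\rho=(\rho^+,\rho^-)\in\mathrm{AC}(0,T;\mathcal P_2^m(\mathbb{R}\times\{\pm1\}))$, $m=\rho^{+,\circ}(\mathbb{R})$, whose (continuous) value at $t=0$ is $\boldsymbol\rho^\circ$ and such that, with $\kappa(t):=\rho^+(t)-\rho^-(t)$, for all $\varphi^\pm\in C_c^\infty((0,T)\times\mathbb{R})$ (prime denoting the $x$-derivative), $$\begin{aligned}0=&\int_0^T\!\!\int_{\mathbb{R}}\partial_t\varphi^\pm(t,x)\,\mathrm d\rho^\pm(t)(x)\,\mathrm dt\\&-\frac12\int_0^T\!\!\iint_{\mathbb{R}\times\mathbb{R}}\big((\varphi^\pm)'(t,x)-(\varphi^\pm)'(t,y)\big)V'(x-y)\,\mathrm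 d([\kappa(t)]_\pm\otimes[\kappa(t)]_\pm)(x,y)\,\mathrm dt\\&-\int_0^T\!\!\int_{\mathbb{R}}(\varphi^\pm)'(t,x)\,(W'*[\kappa(t)]_\mp)(x)\,\mathrm d[\kappa(t)]_\pm(x)\,\mathrm dt.\end{aligned}$$ *)

theory Defs
  imports "HOL-Probability.Probability"
begin

text \<open>Throughout, \<open>\<real>\<^sup>n\<close>-valued quantities are functions on \<^typ>\<open>nat\<close> that are only looked at on
  the index set \<open>{1..n}\<close>; the signs \<open>\<pm>1\<close> and \<open>0\<close> are integers.\<close>

section \<open>Potentials\<close>

text \<open>The derivative of \<open>V\<close>, with the convention \<open>V'(0) = 0\<close>.  (The function \<open>V\<close> is total in HOL,
  but its value at \<open>0\<close> is never used.)\<close>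

definition dV :: "(real \<Rightarrow> real) \<Rightarrow> real \<Rightarrow> real" where
  "dV V r = (if r = 0 then 0 else deriv V r)"

definition Linfty :: "(real \<Rightarrow> real) \<Rightarrow> bool" where
  "Linfty f \<longleftrightarrow> f \<in> borel_measurable lebesgue \<and> (\<exists>C. AE r in lebesgue. \<bar>f r\<bar> \<le> C)"

text \<open>The library's \<^const>\<open>local_lipschitz\<close> is about parametrised families; here the parameter is a
  dummy.\<close>

definition standing_assumptions :: "(real \<Rightarrow> real) \<Rightarrow> (real \<Rightarrow> real) \<Rightarrow> bool" where
  "standing_assumptions V W \<longleftrightarrow>
     V C1_differentiable_on (- {0}) \<and> W C1_differentiable_on UNIV \<and>
     local_lipschitz (UNIV :: real set) (- {0}) (\<lambda>_. dV V) \<and>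
     (\<exists>L. L-lipschitz_on UNIV (deriv W)) \<and>
     (\<forall>r. V (- r) = V r) \<and> (\<forall>r. W (- r) = W r) \<and>
     filterlim V at_top (at 0) \<and>
     Linfty (\<lambda>r. r * dV V r) \<and> Linfty (\<lambda>r. r * deriv W r)"


section \<open>Energy\<close>

text \<open>In the energy, \<open>V(0) = +\<infinity>\<close>; hence the energy is an extended real.\<close>

definition V_ext :: "(real \<Rightarrow> real) \<Rightarrow> real \<Rightarrow> ereal" where
  "V_ext V r = (if r = 0 then \<infinity> else ereal (V r))"

definition energy ::
  "(real \<Rightarrow> real) \<Rightarrow> (real \<Rightarrow> real) \<Rightarrow> nat \<Rightarrow> (nat \<Rightarrow> real) \<Rightarrow> (nat \<Rightarrow> int) \<Rightarrow> ereal" where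
  "energy V W n x b = ereal (1 / (2 * real n ^ 2)) *
     (\<Sum>i\<in>{1..n}.
        (\<Sum>j\<in>{j\<in>{1..n}. j \<noteq> i \<and> b i * b j = 1}. V_ext V (x i - x j)) +
        (\<Sum>j\<in>{j\<in>{1..n}. b i * b j = -1}. ereal (W (x i - x j))))"


section \<open>The discrete problem with annihilation\<close>

definition heaviside :: "ereal \<Rightarrow> int" where
  "heaviside s = (if s > 0 then 1 else 0)"

definition jump_set :: "nat \<Rightarrow> real \<Rightarrow> (real \<Rightarrow> nat \<Rightarrow> int) \<Rightarrow> real set" where
  "jump_set n T b = {t\<in>{0..T}. \<exists>i\<in>{1..n}. \<not> continuous (at t within {0..T}) (\<lambda>s. b s i)}"

text \<open>The times in \<open>(0, T)\<close> at which two particles meet whose signs, as prescribed by \<open>c\<close>, are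
  opposite.\<close>

definition meeting_times :: "nat \<Rightarrow> real \<Rightarrow> (real \<Rightarrow> nat \<Rightarrow> real) \<Rightarrow> (nat \<Rightarrow> int) \<Rightarrow> real set" where
  "meeting_times n T x c =
     {t\<in>{0<..<T}. \<exists>i\<in>{1..n}. \<exists>j\<in>{1..n}. c i * c j = -1 \<and> x t i = x t j}"

text \<open>The infimum defining the collision times is taken in \<^typ>\<open>ereal\<close>, so that \<open>inf \<emptyset> = +\<infinity>\<close>.\<close>

definition discrete_solution ::
  "(real \<Rightarrow> real) \<Rightarrow> (real \<Rightarrow> real) \<Rightarrow> nat \<Rightarrow> real \<Rightarrow> (nat \<Rightarrow> real) \<Rightarrow> (nat \<Rightarrow> int) \<Rightarrow>
   (real \<Rightarrow> nat \<Rightarrow> real) \<Rightarrow> (real \<Rightarrow> nat \<Rightarrow> int) \<Rightarrow> bool" where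
  "discrete_solution V W n T x0 b0 x b \<longleftrightarrow>
     (\<forall>t\<in>{0..T}. \<forall>i\<in>{1..n}. b t i \<in> {-1, 0, 1}) \<and>
     (\<exists>L. \<forall>i\<in>{1..n}. L-lipschitz_on {0..T} (\<lambda>t. x t i)) \<and>
     (\<forall>i\<in>{1..n}. x 0 i = x0 i \<and> b 0 i = b0 i) \<and>
     (\<forall>i\<in>{1..n}. \<forall>t\<in>{0<..<T} - jump_set n T b.
        ((\<lambda>s. x s i) has_real_derivative
           (- (1 / real n) * (\<Sum>j\<in>{j\<in>{1..n}. b t i * b t j = 1}. dV V (x t i - x t j))
            - (1 / real n) * (\<Sum>j\<in>{j\<in>{1..n}. b t i * b t j = -1}. deriv W (x t i - x t j))))
          (at t)) \<and>
     (\<exists>\<tau> :: nat \<Rightarrow> ereal.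
        (\<forall>i\<in>{1..n}. \<tau> i \<in> ereal ` {0<..<T} \<union> {\<infinity>}) \<and>
        ereal ` jump_set n T b = \<tau> ` {1..n} - {\<infinity>} \<and>
        (\<forall>i\<in>{1..n}. \<forall>t\<in>{0..T}. b t i = b0 i * heaviside (\<tau> i - ereal t)) \<and>
        (\<exists>(K :: nat) (tc :: nat \<Rightarrow> real).
           tc 0 = 0 \<and> strict_mono_on {1..K} tc \<and> tc ` {1..K} = jump_set n T b \<and>
           (\<forall>k\<in>{1..K}.
              ereal (tc k) = (INF t\<in>meeting_times n T x (b (tc (k - 1))). ereal t) \<and>
              tc (k - 1) < tc k) \<and>
           meeting_times n T x (b (tc K)) = {}) \<and>
        (\<forall>t\<in>{0..T}. \<exists>\<alpha>.
           bij_betw \<alpha> {i\<in>{1..n}. b0 i = 1 \<and> \<tau> i \<le> ereal t}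
                      {j\<in>{1..n}. b0 j = -1 \<and> \<tau> j \<le> ereal t} \<and>
           (\<forall>i\<in>{i\<in>{1..n}. b0 i = 1 \<and> \<tau> i \<le> ereal t}. x t i = x t (\<alpha> i))))"


section \<open>Measures on the real line with signs\<close>

text \<open>A pair \<open>(\<mu>\<^sup>+, \<mu>\<^sup>-)\<close> of measures on the real line is a family \<open>\<mu>\<close> indexed by the signs:
  \<open>\<mu> 1 = \<mu>\<^sup>+\<close> and \<open>\<mu> (-1) = \<mu>\<^sup>-\<close>. The values of \<open>\<mu>\<close> at other integers are irrelevant.\<close>

type_synonym signed_pair = "int \<Rightarrow> real measure"

definition sgn_space :: "(real \<times> int) measure" where
  "sgn_space = borel \<Otimes>\<^sub>M count_space {-1, 1}"

text \<open>The measure on \<open>\<real> \<times> {\<pm>1}\<close> that is identified with the pair \<open>\<mu>\<close>.\<close>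

definition joint :: "signed_pair \<Rightarrow> (real \<times> int) measure" where
  "joint \<mu> = measure_of (space sgn_space) (sets sgn_space)
     (\<lambda>A. \<Sum>p\<in>{-1, 1}. emeasure (\<mu> p) {x. (x, p) \<in> A})"

lemma emeasure_joint:
  assumes borel: "\<And>p. p \<in> {-1, 1} \<Longrightarrow> sets (\<mu> p) = sets borel" and A: "A \<in> sets sgn_space"
  shows "emeasure (joint \<mu>) A = (\<Sum>p\<in>{-1, 1}. emeasure (\<mu> p) {x. (x, p) \<in> A})"
proof (rule emeasure_measure_of[OF joint_def])
  show "A \<in> sets (joint \<mu>)" using A by (simp add: joint_def)
  have meas: "{x. (x, p) \<in> B} \<in> sets (\<mu> p)" if "B \<in> sets sgn_space" "p \<in> {-1, 1}" for B p
  proof -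
    have "(\<lambda>x. (x, p)) \<in> measurable borel sgn_space"
      using that by (auto simp: sgn_space_def)
    from measurable_sets[OF this that(1)] show ?thesis
      using borel[OF that(2)] by (simp add: vimage_def)
  qed
  show "countably_additive (sets (joint \<mu>)) (\<lambda>A. \<Sum>p\<in>{-1, 1}. emeasure (\<mu> p) {x. (x, p) \<in> A})"
  proof (rule countably_additiveI)
    fix F :: "nat \<Rightarrow> (real \<times> int) set"
    assume F: "range F \<subseteq> sets (joint \<mu>)" and disj: "disjoint_family F"
    have "sets (joint \<mu>) = sets sgn_space"
      by (simp add: joint_def)
    with F have Fm: "F i \<in> sets sgn_space" for i by auto
    have "(\<Sum>i. \<Sum>p\<in>{-1, 1}. emeasure (\<mu> p) {x. (x, p) \<in> F i}) =
          (\<Sum>p\<in>{-1, 1}. \<Sum>i. emeasure (\<mu> p) {x. (x, p) \<in> F i})"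
      by (intro suminf_sum summableI)
    also have "\<dots> = (\<Sum>p\<in>{-1, 1}. emeasure (\<mu> p) {x. (x, p) \<in> \<Union> (range F)})"
    proof (rule sum.cong[OF refl])
      fix p :: int assume p: "p \<in> {-1, 1}"
      have "(\<Sum>i. emeasure (\<mu> p) {x. (x, p) \<in> F i}) = emeasure (\<mu> p) (\<Union>i. {x. (x, p) \<in> F i})"
        using disj meas[OF Fm p]
        by (intro suminf_emeasure) (auto simp: disjoint_family_on_def)
      also have "(\<Union>i. {x. (x, p) \<in> F i}) = {x. (x, p) \<in> \<Union> (range F)}" by auto
      finally show "(\<Sum>i. emeasure (\<mu> p) {x. (x, p) \<in> F i}) = emeasure (\<mu> p) {x. (x, p) \<in> \<Union> (range F)}" .
    qed
    finally show "(\<Sum>i. \<Sum>p\<in>{-1, 1}. emeasure (\<mu> p) {x. (x, p) \<in> F i}) =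
      (\<Sum>p\<in>{-1, 1}. emeasure (\<mu> p) {x. (x, p) \<in> \<Union> (range F)})" .
  qed
qed (auto simp: sets.space_closed positive_def)

definition P2 :: "signed_pair set" where
  "P2 = {\<mu>. (\<forall>p\<in>{-1, 1}. sets (\<mu> p) = sets borel \<and> (\<integral>\<^sup>+ x. ennreal (x\<^sup>2) \<partial>\<mu> p) < \<infinity>) \<and>
            emeasure (\<mu> 1) UNIV + emeasure (\<mu> (-1)) UNIV = 1}"

definition P2m :: "real \<Rightarrow> signed_pair set" where
  "P2m m = {\<mu>\<in>P2. measure (\<mu> 1) UNIV = m}"

definition dist_sgn :: "real \<times> int \<Rightarrow> real \<times> int \<Rightarrow> real" where
  "dist_sgn z w = sqrt (\<bar>fst z - fst w\<bar>\<^sup>2 + \<bar>real_of_int (snd z) - real_of_int (snd w)\<bar>)"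

definition couplings :: "signed_pair \<Rightarrow> signed_pair \<Rightarrow> ((real \<times> int) \<times> (real \<times> int)) measure set" where
  "couplings \<mu> \<nu> = {\<gamma>. sets \<gamma> = sets (sgn_space \<Otimes>\<^sub>M sgn_space) \<and>
     distr \<gamma> sgn_space fst = joint \<mu> \<and> distr \<gamma> sgn_space snd = joint \<nu>}"

text \<open>The 2-Wasserstein distance; meaningful on \<^const>\<open>P2\<close>, where the infimum is finite.\<close>

definition Wass :: "signed_pair \<Rightarrow> signed_pair \<Rightarrow> real" where
  "Wass \<mu> \<nu> = sqrt (enn2real
     (INF \<gamma>\<in>couplings \<mu> \<nu>. \<integral>\<^sup>+ z. ennreal ((dist_sgn (fst z) (snd z))\<^sup>2) \<partial>\<gamma>))"

definition AC_curves :: "real \<Rightarrow> real \<Rightarrow> signed_pair set \<Rightarrow> (real \<Rightarrow> signed_pair) set" where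
  "AC_curves q T X = {\<mu>. (\<forall>t\<in>{0<..<T}. \<mu> t \<in> X) \<and>
     (\<exists>f :: real \<Rightarrow> real.
        (\<forall>r\<in>{0<..<T}. 0 \<le> f r) \<and>
        set_borel_measurable lborel {0<..<T} f \<and>
        set_integrable lborel {0<..<T} (\<lambda>r. f r powr q) \<and>
        (\<forall>s t. 0 < s \<and> s \<le> t \<and> t < T \<longrightarrow> Wass (\<mu> s) (\<mu> t) \<le> (LINT r:{s..t}|lborel. f r)))}"

text \<open>The pair of empirical measures \<open>\<mu>\<^sup>\<pm> = 1/n \<Sum>\<^bsub>i: b\<^sub>i = \<pm>1\<^esub> \<delta>\<^bsub>x\<^sub>i\<^esub>\<close>.\<close>

definition empirical :: "nat \<Rightarrow> (nat \<Rightarrow> real) \<Rightarrow> (nat \<Rightarrow> int) \<Rightarrow> signed_pair" where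
  "empirical n x b p =
     distr (point_measure {i\<in>{1..n}. b i = p} (\<lambda>_. ennreal (1 / real n))) borel x"

lemma emeasure_empirical:
  assumes "A \<in> sets borel"
  shows "emeasure (empirical n x b p) A = (\<Sum>i | i \<in> {1..n} \<and> b i = p. ennreal (1 / real n) * indicator A (x i))"
proof -
  have "emeasure (empirical n x b p) A =
    emeasure (point_measure {i\<in>{1..n}. b i = p} (\<lambda>_. ennreal (1 / real n))) {i\<in>{1..n}. b i = p \<and> x i \<in> A}"
    unfolding empirical_def using assms
    by (subst emeasure_distr)
       (auto simp: space_point_measure measurable_point_measure_eq1 intro!: arg_cong[where f="emeasure _"])
  also have "\<dots> = (\<Sum>i\<in>{i\<in>{1..n}. b i = p \<and> x i \<in> A}. ennreal (1 / real n))"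
    by (subst emeasure_point_measure_finite2) auto
  also have "\<dots> = (\<Sum>i | i \<in> {1..n} \<and> b i = p. ennreal (1 / real n) * indicator A (x i))"
    by (rule sum.mono_neutral_cong_left) auto
  finally show ?thesis .
qed


section \<open>The continuum problem\<close>

text \<open>The positive part \<open>[\<mu> - \<nu>]\<^sub>+\<close> of the difference of two finite Borel measures, i.e.\ its upper
  variation \<open>A \<mapsto> sup {(\<mu> - \<nu>)(B) | B \<subseteq> A Borel}\<close>. The negative part is
  \<open>[\<mu> - \<nu>]\<^sub>- = [\<nu> - \<mu>]\<^sub>+\<close>. The lemmas below identify the two as the Jordan decomposition.
  (Negative differences are mapped to \<open>0\<close> by \<^const>\<open>ennreal\<close>, which is harmless since \<open>B = \<emptyset>\<close> is
  allowed.)\<close>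

definition pos_part :: "real measure \<Rightarrow> real measure \<Rightarrow> real measure" where
  "pos_part \<mu> \<nu> = measure_of UNIV (sets borel)
     (\<lambda>A. SUP B\<in>{B\<in>sets borel. B \<subseteq> A}. ennreal (measure \<mu> B - measure \<nu> B))"

definition Hahn_set :: "real measure \<Rightarrow> real measure \<Rightarrow> real set \<Rightarrow> bool" where
  "Hahn_set \<mu> \<nu> P \<longleftrightarrow> P \<in> sets borel \<and>
     (\<forall>B\<in>sets borel. B \<subseteq> P \<longrightarrow> measure \<nu> B \<le> measure \<mu> B) \<and>
     (\<forall>B\<in>sets borel. B \<inter> P = {} \<longrightarrow> measure \<mu> B \<le> measure \<nu> B)"

lemma Hahn_setD:
  assumes "Hahn_set \<mu> \<nu> P"
  shows "\<And>B. B \<in> sets borel \<Longrightarrow> B \<subseteq> P \<Longrightarrow> measure \<nu> B \<le> measure \<mu> B"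
    and "\<And>B. B \<in> sets borel \<Longrightarrow> B \<inter> P = {} \<Longrightarrow> measure \<mu> B \<le> measure \<nu> B"
  using assms by (auto simp: Hahn_set_def)

lemma Hahn_set_exists:
  assumes "finite_measure \<mu>" "finite_measure \<nu>" "sets \<mu> = sets borel" "sets \<nu> = sets borel"
  shows "\<exists>P. Hahn_set \<mu> \<nu> P"
proof -
  interpret M: finite_measure \<mu> by fact
  interpret N: finite_measure \<nu> by fact
  show ?thesis
    using finite_unsigned_Hahn_decomposition[of \<mu> \<nu>] assms
    by (auto simp: Hahn_set_def M.emeasure_eq_measure N.emeasure_eq_measure)
qed

lemma emeasure_pos_part:
  assumes fin: "finite_measure \<mu>" "finite_measure \<nu>"
    and borel: "sets \<mu> = sets borel" "sets \<nu> = sets borel"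
    and P: "Hahn_set \<mu> \<nu> P" and A: "A \<in> sets borel"
  shows "emeasure (pos_part \<mu> \<nu>) A = ennreal (measure \<mu> (A \<inter> P) - measure \<nu> (A \<inter> P))"
proof -
  interpret M: finite_measure \<mu> by fact
  interpret N: finite_measure \<nu> by fact
  note [measurable_cong] = borel
  have [measurable, simp]: "P \<in> sets borel" using P by (simp add: Hahn_set_def)
  have le: "measure \<mu> B - measure \<nu> B \<le> measure \<mu> (A \<inter> P) - measure \<nu> (A \<inter> P)"
    if [simp]: "B \<in> sets borel" and "B \<subseteq> A" and [simp]: "A \<in> sets borel" for A B
  proof -
    have split: "measure \<mu> B = measure \<mu> (B \<inter> P) + measure \<mu> (B - P)"
         "measure \<nu> B = measure \<nu> (B \<inter> P) + measure \<nu> (B - P)"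
      using M.finite_measure_Diff'[of B P] N.finite_measure_Diff'[of B P] by (auto simp: borel)
    have *: "A \<inter> P \<inter> B = B \<inter> P" using \<open>B \<subseteq> A\<close> by auto
    have split': "measure \<mu> (A \<inter> P) = measure \<mu> (B \<inter> P) + measure \<mu> (A \<inter> P - B)"
         "measure \<nu> (A \<inter> P) = measure \<nu> (B \<inter> P) + measure \<nu> (A \<inter> P - B)"
      using M.finite_measure_Diff'[of "A \<inter> P" B] N.finite_measure_Diff'[of "A \<inter> P" B]
      by (simp_all add: borel * sets.Int)
    have "measure \<mu> (B - P) \<le> measure \<nu> (B - P)"
      by (rule Hahn_setD(2)[OF P]) (auto intro!: sets.Diff)
    moreover have "measure \<nu> (A \<inter> P - B) \<le> measure \<mu> (A \<inter> P - B)"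
      by (rule Hahn_setD(1)[OF P]) (auto intro!: sets.Diff sets.Int)
    ultimately show ?thesis using split split' by linarith
  qed
  have sup: "(SUP B\<in>{B\<in>sets borel. B \<subseteq> A}. ennreal (measure \<mu> B - measure \<nu> B)) =
      ennreal (measure \<mu> (A \<inter> P) - measure \<nu> (A \<inter> P))" if "A \<in> sets borel" for A
    using le[OF _ _ that] that
    by (intro antisym SUP_least SUP_upper2[of "A \<inter> P"] ennreal_leI) auto
  have sup': "(SUP B\<in>{B\<in>sets borel. B \<subseteq> A}. ennreal (measure \<mu> B - measure \<nu> B)) =
      emeasure (diff_measure (density \<mu> (indicator P)) (density \<nu> (indicator P))) A"
    if A: "A \<in> sets borel" for A
  proof -
    have d: "emeasure (density \<mu> (indicator P)) B = ennreal (measure \<mu> (B \<inter> P))"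
            "emeasure (density \<nu> (indicator P)) B = ennreal (measure \<nu> (B \<inter> P))"
      if "B \<in> sets borel" for B
      using that by (auto simp: M.emeasure_eq_measure N.emeasure_eq_measure
          borel emeasure_restricted inf_commute)
    have "finite_measure (density \<mu> (indicator P))" "finite_measure (density \<nu> (indicator P))"
      using d[of UNIV] sets_eq_imp_space_eq[OF borel(1)] sets_eq_imp_space_eq[OF borel(2)]
      by (auto intro!: finite_measureI)
    then have "emeasure (diff_measure (density \<mu> (indicator P)) (density \<nu> (indicator P))) A =
        emeasure (density \<mu> (indicator P)) A - emeasure (density \<nu> (indicator P)) A"
      using A by (intro emeasure_diff_measure) (auto simp: borel d intro!: ennreal_leI Hahn_setD(1)[OF P])
    then show ?thesis
      using A by (simp add: d sup ennreal_minus)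
  qed
  have "emeasure (pos_part \<mu> \<nu>) A =
        (SUP B\<in>{B\<in>sets borel. B \<subseteq> A}. ennreal (measure \<mu> B - measure \<nu> B))"
  proof (rule emeasure_measure_of[OF pos_part_def])
    let ?D = "diff_measure (density \<mu> (indicator P)) (density \<nu> (indicator P))"
    have sp: "sets (pos_part \<mu> \<nu>) = sets borel"
      using sets.sigma_sets_eq[of "borel :: real measure"] by (simp add: pos_part_def)
    have sD: "sets ?D = sets borel" by (simp add: borel)
    show "countably_additive (sets (pos_part \<mu> \<nu>))
      (\<lambda>A. SUP B\<in>{B\<in>sets borel. B \<subseteq> A}. ennreal (measure \<mu> B - measure \<nu> B))"
    proof (rule countably_additiveI)
      fix F :: "nat \<Rightarrow> real set"
      assume F: "range F \<subseteq> sets (pos_part \<mu> \<nu>)" "disjoint_family F"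
      then have Fb: "F i \<in> sets borel" for i by (auto simp: sp)
      have U: "\<Union> (range F) \<in> sets borel" using Fb by auto
      have "(\<Sum>i. emeasure ?D (F i)) = emeasure ?D (\<Union> (range F))"
        using F by (intro suminf_emeasure) (auto simp: sp sD)
      then show "(\<Sum>i. SUP B\<in>{B\<in>sets borel. B \<subseteq> F i}. ennreal (measure \<mu> B - measure \<nu> B)) =
        (SUP B\<in>{B\<in>sets borel. B \<subseteq> \<Union> (range F)}. ennreal (measure \<mu> B - measure \<nu> B))"
        by (simp only: sup'[OF Fb] sup'[OF U])
    qed
    show "A \<in> sets (pos_part \<mu> \<nu>)" using A by (simp add: sp)
  qed (auto simp: positive_def bot_ennreal)
  with sup[OF A] show ?thesis by simp
qed

lemma Hahn_set_Compl:
  assumes "Hahn_set \<mu> \<nu> P"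
  shows "Hahn_set \<nu> \<mu> (- P)"
  using assms unfolding Hahn_set_def by (auto simp: disjoint_eq_subset_Compl)

text \<open>The Jordan decomposition: \<open>\<mu> - \<nu> = [\<mu> - \<nu>]\<^sub>+ - [\<mu> - \<nu>]\<^sub>-\<close>, with mutually singular parts.\<close>

lemma Jordan_decomposition:
  assumes fin: "finite_measure \<mu>" "finite_measure \<nu>"
    and borel: "sets \<mu> = sets borel" "sets \<nu> = sets borel"
  shows "\<And>A. A \<in> sets borel \<Longrightarrow>
           measure \<mu> A - measure \<nu> A = measure (pos_part \<mu> \<nu>) A - measure (pos_part \<nu> \<mu>) A"
    and "\<exists>P\<in>sets borel. emeasure (pos_part \<mu> \<nu>) (- P) = 0 \<and> emeasure (pos_part \<nu> \<mu>) P = 0"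
proof -
  interpret M: finite_measure \<mu> by fact
  interpret N: finite_measure \<nu> by fact
  obtain P where P: "Hahn_set \<mu> \<nu> P" using Hahn_set_exists[OF assms] by blast
  then have Pb: "P \<in> sets borel" by (simp add: Hahn_set_def)
  note pos = emeasure_pos_part[OF fin borel P]
  note neg = emeasure_pos_part[OF fin(2,1) borel(2,1) Hahn_set_Compl[OF P]]
  show "\<exists>P\<in>sets borel. emeasure (pos_part \<mu> \<nu>) (- P) = 0 \<and> emeasure (pos_part \<nu> \<mu>) P = 0"
    using Pb pos[of "- P"] neg[of P] by (intro bexI[of _ P]) auto
  fix A :: "real set" assume A: "A \<in> sets borel"
  have "A \<inter> P \<in> sets borel" "A - P \<in> sets borel" using A Pb by auto
  then have le1: "measure \<nu> (A \<inter> P) \<le> measure \<mu> (A \<inter> P)"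
    and le2: "measure \<mu> (A - P) \<le> measure \<nu> (A - P)"
    using Hahn_setD[OF P] by (simp_all add: Diff_Int_distrib2)
  have "measure (pos_part \<mu> \<nu>) A = measure \<mu> (A \<inter> P) - measure \<nu> (A \<inter> P)"
    using pos[OF A] le1 by (simp add: measure_def[of "pos_part \<mu> \<nu>"])
  moreover have "measure (pos_part \<nu> \<mu>) A = measure \<nu> (A - P) - measure \<mu> (A - P)"
    using neg[OF A] le2 by (simp add: measure_def[of "pos_part \<nu> \<mu>"] Diff_eq[symmetric])
  moreover have "measure \<mu> A = measure \<mu> (A \<inter> P) + measure \<mu> (A - P)"
       "measure \<nu> A = measure \<nu> (A \<inter> P) + measure \<nu> (A - P)"
    using M.finite_measure_Diff'[of A P] N.finite_measure_Diff'[of A P] A Pb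
    by (auto simp: borel)
  ultimately show "measure \<mu> A - measure \<nu> A = measure (pos_part \<mu> \<nu>) A - measure (pos_part \<nu> \<mu>) A"
    by linarith
qed

primrec Ck :: "nat \<Rightarrow> ('a::real_normed_vector \<Rightarrow> real) \<Rightarrow> bool" where
  "Ck 0 f = continuous_on UNIV f"
| "Ck (Suc k) f = ((\<forall>z. f differentiable (at z)) \<and> (\<forall>v. Ck k (\<lambda>z. frechet_derivative f (at z) v)))"

text \<open>\<open>C\<^sub>c\<^sup>\<infinity>((0,T) \<times> \<real>)\<close>; the test functions are extended by zero to \<open>\<real> \<times> \<real>\<close>.\<close>

definition test_functions :: "real \<Rightarrow> (real \<times> real \<Rightarrow> real) set" where
  "test_functions T = {\<phi>. (\<forall>k. Ck k \<phi>) \<and> compact (closure {z. \<phi> z \<noteq> 0}) \<and>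
     closure {z. \<phi> z \<noteq> 0} \<subseteq> {0<..<T} \<times> UNIV}"

definition dt :: "(real \<times> real \<Rightarrow> real) \<Rightarrow> real \<Rightarrow> real \<Rightarrow> real" where
  "dt \<phi> t x = deriv (\<lambda>s. \<phi> (s, x)) t"

definition dx :: "(real \<times> real \<Rightarrow> real) \<Rightarrow> real \<Rightarrow> real \<Rightarrow> real" where
  "dx \<phi> t x = deriv (\<lambda>y. \<phi> (t, y)) x"

text \<open>For \<open>\<kappa> = \<rho>\<^sup>+ - \<rho>\<^sup>-\<close> and a sign \<open>p\<close>, the measure \<open>[\<kappa>]\<^sub>p\<close>.\<close>

definition kappa_part :: "signed_pair \<Rightarrow> int \<Rightarrow> real measure" where
  "kappa_part \<rho> p = pos_part (\<rho> p) (\<rho> (- p))"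

definition weak_solution ::
  "(real \<Rightarrow> real) \<Rightarrow> (real \<Rightarrow> real) \<Rightarrow> real \<Rightarrow> signed_pair \<Rightarrow> (real \<Rightarrow> signed_pair) \<Rightarrow> bool" where
  "weak_solution V W T \<rho>0 \<rho> \<longleftrightarrow>
     \<rho>0 \<in> P2 \<and>
     \<rho> \<in> AC_curves 1 T (P2m (measure (\<rho>0 1) UNIV)) \<and>
     ((\<lambda>t. Wass (\<rho> t) \<rho>0) \<longlongrightarrow> 0) (at_right 0) \<and>
     (\<forall>p\<in>{-1, 1}. \<forall>\<phi>\<in>test_functions T.
        0 = (LINT t:{0<..<T}|lborel. (\<integral>x. dt \<phi> t x \<partial>\<rho> t p))
          - 1 / 2 * (LINT t:{0<..<T}|lborel.
              (\<integral>(x, y). (dx \<phi> t x - dx \<phi> t y) * dV V (x - y)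
                 \<partial>(kappa_part (\<rho> t) p \<Otimes>\<^sub>M kappa_part (\<rho> t) p)))
          - (LINT t:{0<..<T}|lborel.
              (\<integral>x. dx \<phi> t x * (\<integral>y. deriv W (x - y) \<partial>kappa_part (\<rho> t) (- p))
                 \<partial>kappa_part (\<rho> t) p)))"

end

theory Submission
  imports Defs "HOL-Library.Diagonal_Subsequence"
begin

text \<open>Adding \<open>C (1 + |x\<^sub>i - x\<^sub>j|\<^sup>2)\<close> to the interaction of every pair makes all pair energies
  non-negative, so the energy can only drop at an annihilation; between annihilations the equation is a
  gradient flow up to a bounded error. This bounds the speeds in \<open>L\<^sup>2\<close> uniformly in \<open>n\<close>, and it keeps
  live particles of equal sign apart, so that all live particles retain their order. Second moments
  and the speed bound give compactness of the curves of measures, and a weak limit of the speeds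
  controls the Wasserstein distance along the limit curve, because the optimal quadratic cost is lower
  semicontinuous.

  Since \<open>V\<close> blows up at \<open>0\<close>, limits of the live measures have no atoms; since the at most \<open>2L\<close> blocks of
  live particles stay ordered, the limits of the two live measures are mutually singular. Annihilated
  pairs cancel in \<open>\<mu>\<^sub>n\<^sup>+ - \<mu>\<^sub>n\<^sup>-\<close>, so these limits are the Jordan parts of \<open>\<kappa>\<close>. The discrete
  weak form involves only bounded kernels, discontinuous at most on the diagonal, which is null for the
  atomless limits; hence it passes to the limit.\<close>

section \<open>Weak convergence of finite measures on the line\<close>

text \<open>The difficulty is that the Jordan parts of \<open>\<kappa>\<close> are not continuous
  under weak convergence: positive and negative mass may interlace on ever finer scales and cancel
  in the limit, while both live measures keep their mass. A number of blocks bounded uniformly in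
  \<open>n\<close> excludes this. A second difficulty is that the live measures jump at
  annihilations and have no modulus of continuity in time. Time \<open>T\<close> itself is left out
  because particles of opposite sign may meet there. The kernels are bounded although
  \<open>V'\<close> may be singular: the derivative of a test function is Lipschitz, and its
  increment turns \<open>V'(r)\<close> into the bounded \<open>r V'(r)\<close>. The same bound gives
  the virial estimate behind the growth of second moments and of the corrected energy.\<close>

abbreviation fbm :: "real measure \<Rightarrow> bool" where
  "fbm \<equiv> finite_borel_measure"

text \<open>Masses are not fixed at 1; the test function 1 makes them converge as well. Results on
  \<open>real_distribution\<close>s are brought in through \<open>normalise\<close>, so a limit of
  mass 0 has to be treated apart.\<close>

definition wconv :: "(nat \<Rightarrow> real measure) \<Rightarrow> real measure \<Rightarrow> bool" where
  "wconv Ms M \<longleftrightarrow> (\<forall>\<phi> :: real \<Rightarrow> real. continuous_on UNIV \<phi> \<and> bounded (range \<phi>) \<longrightarrow>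
     (\<lambda>n. \<integral>x. \<phi> x \<partial>Ms n) \<longlonglongrightarrow> (\<integral>x. \<phi> x \<partial>M))"

lemma wconvD:
  "wconv Ms M \<Longrightarrow> continuous_on UNIV \<phi> \<Longrightarrow> bounded (range \<phi>) \<Longrightarrow>
    (\<lambda>n. \<integral>x. \<phi> x \<partial>Ms n) \<longlonglongrightarrow> (\<integral>x. (\<phi> x :: real) \<partial>M)"
  by (auto simp: wconv_def)

lemma fbmD:
  assumes "fbm M"
  shows "finite_measure M" "sets M = sets borel" "space M = UNIV" "emeasure M A < \<infinity>"
    "emeasure M A = ennreal (measure M A)"
proof -
  interpret finite_borel_measure M by fact
  show "finite_measure M" "sets M = sets borel" by (unfold_locales, simp add: M_is_borel)
  show "space M = UNIV" by (rule borel_UNIV)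
  show "emeasure M A < \<infinity>" by (simp add: less_top[symmetric])
  show "emeasure M A = ennreal (measure M A)" by (rule emeasure_eq_measure)
qed

lemma fbmI: "sets M = sets borel \<Longrightarrow> emeasure M UNIV < \<infinity> \<Longrightarrow> fbm M"
  unfolding finite_borel_measure_def finite_borel_measure_axioms_def
  using sets_eq_imp_space_eq[of M borel] by (auto intro!: finite_measureI)

lemma real_distribution_fbm: "real_distribution M \<Longrightarrow> fbm M"
  by (rule real_distribution.finite_borel_measure_M)

lemma measurable_fbm: "fbm M \<Longrightarrow> f \<in> borel_measurable borel \<Longrightarrow> f \<in> borel_measurable M"
  using measurable_cong_sets[of M borel borel borel] fbmD(2) by auto

lemma integrable_fbm:
  fixes f :: "real \<Rightarrow> real"
  assumes M: "fbm M" and f: "f \<in> borel_measurable borel" and B: "\<And>x. \<bar>f x\<bar> \<le> B"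
  shows "integrable M f"
  by (rule finite_measure.integrable_const_bound[OF fbmD(1)[OF M], of _ B])
     (use measurable_fbm[OF M f] B in auto)

lemma integrable_fbm_continuous:
  fixes f :: "real \<Rightarrow> real"
  assumes "fbm M" "continuous_on UNIV f" "bounded (range f)"
  shows "integrable M f"
  using assms integrable_fbm[of M f] borel_measurable_continuous_onI[of f]
  by (auto simp: bounded_iff)

lemma integral_fbm_bound:
  fixes f :: "real \<Rightarrow> real"
  assumes M: "fbm M" and B: "\<And>x. \<bar>f x\<bar> \<le> B"
  shows "\<bar>\<integral>x. f x \<partial>M\<bar> \<le> B * measure M UNIV"
proof (cases "integrable M f")
  case True
  interpret finite_measure M by (rule fbmD(1)[OF M])
  have "\<bar>\<integral>x. f x \<partial>M\<bar> \<le> (\<integral>x. \<bar>f x\<bar> \<partial>M)" by (rule integral_abs_bound)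
  also have "\<dots> \<le> (\<integral>x. B \<partial>M)"
    using True B by (intro integral_mono) auto
  also have "\<dots> = B * measure M UNIV" by (simp add: fbmD(3)[OF M])
  finally show ?thesis .
next
  case False
  have "0 \<le> B" using order_trans[OF abs_ge_zero B[of 0]] .
  then show ?thesis by (simp add: not_integrable_integral_eq[OF False])
qed

lemma wconv_mass:
  assumes "wconv Ms M" "\<And>n. fbm (Ms n)" "fbm M"
  shows "(\<lambda>n. measure (Ms n) UNIV) \<longlonglongrightarrow> measure M UNIV"
proof -
  have "(\<lambda>n. \<integral>x. 1 \<partial>Ms n) \<longlonglongrightarrow> (\<integral>x. (1::real) \<partial>M)"
    by (rule wconvD[OF assms(1)]) auto
  then show ?thesis by (simp add: fbmD(3)[OF assms(2)] fbmD(3)[OF assms(3)])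
qed

lemma wconv_subseq: "wconv Ms M \<Longrightarrow> strict_mono r \<Longrightarrow> wconv (\<lambda>n. Ms (r n)) M"
  unfolding wconv_def using LIMSEQ_subseq_LIMSEQ[where f=r] by (auto simp: o_def)

section \<open>Rescaling to probability measures, and Prokhorov's theorem for finite
  measures\<close>

definition normalise :: "real measure \<Rightarrow> real measure" where
  "normalise M = density M (\<lambda>_. ennreal (1 / measure M UNIV))"

lemma real_distribution_normalise:
  assumes M: "fbm M" and pos: "measure M UNIV > 0"
  shows "real_distribution (normalise M)"
proof -
  have "emeasure (normalise M) UNIV = ennreal (1 / measure M UNIV) * emeasure M UNIV"
    unfolding normalise_def by (subst emeasure_density_const) (auto simp: fbmD[OF M])
  also have "\<dots> = 1"
    using pos by (simp add: fbmD(5)[OF M] ennreal_mult[symmetric])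
  finally have "emeasure (normalise M) UNIV = 1" .
  moreover have "sets (normalise M) = sets borel" by (simp add: normalise_def fbmD(2)[OF M])
  ultimately show ?thesis
    unfolding real_distribution_def real_distribution_axioms_def
    using sets_eq_imp_space_eq[of "normalise M" borel] by (auto intro!: prob_spaceI)
qed

lemma integral_density_const:
  fixes f :: "real \<Rightarrow> real"
  assumes "c \<ge> 0" "f \<in> borel_measurable M"
  shows "(\<integral>x. f x \<partial>density M (\<lambda>_. ennreal c)) = c * (\<integral>x. f x \<partial>M)"
  using assms by (subst integral_density) (auto)

lemma integral_normalise:
  fixes f :: "real \<Rightarrow> real"
  assumes "fbm M" and pos: "measure M UNIV > 0" and f: "f \<in> borel_measurable borel"
  shows "(\<integral>x. f x \<partial>M) = measure M UNIV * (\<integral>x. f x \<partial>normalise M)"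
  unfolding normalise_def using pos
  by (subst integral_density_const) (auto intro: measurable_fbm assms)

lemma tendsto_subseq_principle:
  fixes X :: "nat \<Rightarrow> 'a :: metric_space"
  assumes "\<And>s :: nat \<Rightarrow> nat. strict_mono s \<Longrightarrow> \<exists>r :: nat \<Rightarrow> nat. strict_mono r \<and> (\<lambda>n. X (s (r n))) \<longlonglongrightarrow> l"
  shows "X \<longlonglongrightarrow> l"
proof (rule ccontr)
  assume "\<not> X \<longlonglongrightarrow> l"
  then obtain e where e: "e > 0" and inf: "infinite {n. \<not> dist (X n) l < e}"
    by (auto simp: tendsto_iff not_eventually INFM_iff_infinite cofinite_eq_sequentially[symmetric])
  define s where "s = enumerate {n. \<not> dist (X n) l < e}"
  have s: "strict_mono s" unfolding s_def by (rule strict_mono_enumerate[OF inf])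
  have sX: "\<not> dist (X (s n)) l < e" for n
    using enumerate_in_set[OF inf, of n] by (auto simp: s_def)
  obtain r where "strict_mono r" "(\<lambda>n. X (s (r n))) \<longlonglongrightarrow> l" using assms[OF s] by auto
  from tendstoD[OF this(2) e] obtain n where "dist (X (s (r n))) l < e"
    by (auto simp: eventually_sequentially)
  with sX show False by blast
qed

text \<open>Chebyshev: Markov's inequality for \<open>x\<^sup>2 / a\<^sup>2\<close>, which is at
  least 1 exactly off the open interval.\<close>

lemma tail_bound:
  assumes M: "fbm M" and mom: "(\<integral>\<^sup>+x. ennreal (x\<^sup>2) \<partial>M) \<le> ennreal C" and a: "a > 0" and C: "C \<ge> 0"
  shows "measure M (- {-a<..<a}) \<le> C / a\<^sup>2"
proof -
  have "emeasure M (- {-a<..<a}) = emeasure M {x\<in>space M. 1 \<le> ennreal (1 / a\<^sup>2) * ennreal (x\<^sup>2)}"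
  proof (rule arg_cong[where f="emeasure M"])
    have "1 \<le> ennreal (1 / a\<^sup>2) * ennreal (x\<^sup>2) \<longleftrightarrow> \<not> (-a < x \<and> x < a)" for x
    proof -
      have "1 \<le> ennreal (1 / a\<^sup>2) * ennreal (x\<^sup>2) \<longleftrightarrow> 1 \<le> x\<^sup>2 / a\<^sup>2"
        by (simp add: ennreal_mult[symmetric] ennreal_1[symmetric] ennreal_le_iff del: ennreal_1)
      also have "\<dots> \<longleftrightarrow> a\<^sup>2 \<le> x\<^sup>2" using a by (simp add: field_simps)
      also have "\<dots> \<longleftrightarrow> \<bar>a\<bar> \<le> \<bar>x\<bar>" by (simp add: abs_le_square_iff)
      finally show ?thesis using a by auto
    qed
    then have "{x\<in>space M. 1 \<le> ennreal (1 / a\<^sup>2) * ennreal (x\<^sup>2)} = {x. \<not> (-a < x \<and> x < a)}"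
      by (simp only: fbmD(3)[OF M] UNIV_I simp_thms)
    then show "- {-a<..<a} = {x\<in>space M. 1 \<le> ennreal (1 / a\<^sup>2) * ennreal (x\<^sup>2)}"
      by (simp only: set_eq_iff) simp
  qed
  also have "\<dots> \<le> ennreal (1 / a\<^sup>2) * (\<integral>\<^sup>+x. ennreal (x\<^sup>2) * indicator (space M) x \<partial>M)"
    by (rule order_trans[OF _ nn_integral_Markov_inequality])
       (auto intro!: measurable_fbm[OF M] simp: measurable_cong_sets[OF fbmD(2)[OF M] refl] fbmD(2,3)[OF M])
  also have "\<dots> \<le> ennreal (1 / a\<^sup>2) * ennreal C"
    using mom by (intro mult_left_mono) (auto simp: fbmD(3)[OF M])
  also have "\<dots> = ennreal (C / a\<^sup>2)" using C by (simp add: ennreal_mult[symmetric])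
  finally show ?thesis using C by (simp add: fbmD(5)[OF M])
qed

text \<open>The masses converge along a subsequence; if their limit \<open>m\<close> is 0, the null
  measure is the limit. Otherwise the rescaled measures are tight, because masses above
  \<open>m / 2\<close> inflate the second moment by a factor of at most
  \<open>2 / m\<close>.\<close>

theorem fbm_subsequence:
  fixes Ms :: "nat \<Rightarrow> real measure"
  assumes fbm: "\<And>n. fbm (Ms n)" and mass: "\<And>n. measure (Ms n) UNIV \<le> 1"
    and mom: "\<And>n. (\<integral>\<^sup>+x. ennreal (x\<^sup>2) \<partial>Ms n) \<le> ennreal C"
  shows "\<exists>(r :: nat \<Rightarrow> nat) M. strict_mono r \<and> fbm M \<and> wconv (\<lambda>n. Ms (r n)) M"
proof -
  \<comment> \<open>\<open>ennreal C\<close> is 0 for negative \<open>C\<close>, so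
    \<open>max C 0\<close> gives the same bound with a nonnegative constant.\<close>
  define D where "D = max C 0"
  have D: "D \<ge> 0" and momD: "\<And>n. (\<integral>\<^sup>+x. ennreal (x\<^sup>2) \<partial>Ms n) \<le> ennreal D"
    using mom order_trans[OF mom ennreal_leI] by (auto simp: D_def)
  have "bounded (range (\<lambda>n. measure (Ms n) UNIV))"
    using mass by (auto simp: bounded_iff intro!: exI[of _ 1])
  from bounded_imp_convergent_subsequence[OF this] obtain m r1 where r1: "strict_mono r1"
    and lim: "((\<lambda>n. measure (Ms n) UNIV) \<circ> r1) \<longlonglongrightarrow> m"
    by blast
  have m: "m \<ge> 0" by (rule LIMSEQ_le_const[OF lim]) auto
  show ?thesis
  proof (cases "m = 0")
    case True
    have "wconv (\<lambda>n. Ms (r1 n)) (null_measure borel)"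
      unfolding wconv_def
    proof safe
      fix \<phi> :: "real \<Rightarrow> real" assume "bounded (range \<phi>)"
      then obtain B where B: "\<And>x. \<bar>\<phi> x\<bar> \<le> B" by (auto simp: bounded_iff)
      have "(\<lambda>n. \<integral>x. \<phi> x \<partial>Ms (r1 n)) \<longlonglongrightarrow> 0"
      proof (rule Lim_null_comparison)
        show "\<forall>\<^sub>F n in sequentially. norm (\<integral>x. \<phi> x \<partial>Ms (r1 n)) \<le> B * measure (Ms (r1 n)) UNIV"
          using integral_fbm_bound[OF fbm, of \<phi>, OF B] by simp
        show "(\<lambda>n. B * measure (Ms (r1 n)) UNIV) \<longlonglongrightarrow> 0"
          using tendsto_mult_right_zero[of _ sequentially B] lim True by (simp add: o_def)
      qed
      then show "(\<lambda>n. \<integral>x. \<phi> x \<partial>Ms (r1 n)) \<longlonglongrightarrow> (\<integral>x. \<phi> x \<partial>null_measure borel)" by simp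
    qed
    moreover have "fbm (null_measure borel)" by (rule fbmI) auto
    ultimately show ?thesis using r1 by blast
  next
    case False
    with m have m0: "m > 0" by simp
    from order_tendstoD(1)[OF lim, of "m/2"] m0
    obtain N where N: "\<And>n. n \<ge> N \<Longrightarrow> measure (Ms (r1 n)) UNIV > m / 2"
      by (auto simp: eventually_sequentially)
    define r2 where "r2 n = r1 (n + N)" for n
    have r2: "strict_mono r2" using r1 by (auto simp: r2_def strict_mono_def)
    have big: "measure (Ms (r2 n)) UNIV > m / 2" for n unfolding r2_def by (rule N) simp
    have pos: "measure (Ms (r2 n)) UNIV > 0" for n using m0 big[of n] by linarith
    have lim2: "(\<lambda>n. measure (Ms (r2 n)) UNIV) \<longlonglongrightarrow> m"
      using LIMSEQ_ignore_initial_segment[OF lim, of N] by (simp add: r2_def o_def)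
    define P where "P n = normalise (Ms (r2 n))" for n
    have P: "real_distribution (P n)" for n
      unfolding P_def by (rule real_distribution_normalise[OF fbm pos])
    have "tight P"
      unfolding tight_def
    proof (intro conjI allI impI P)
      fix e :: real assume e: "e > 0"
      define K where "K = 2 * D / m"
      have K: "K \<ge> 0" using D m0 by (simp add: K_def)
      \<comment> \<open>Chosen so that Chebyshev's bound \<open>K / a\<^sup>2\<close> falls below
        \<open>e\<close>; the summand 1 provides strictness and positivity.\<close>
      define a where "a = sqrt (K / e) + 1"
      have a: "a > 0" using K e by (simp add: a_def add_nonneg_pos)
      have "K / e = (sqrt (K / e))\<^sup>2" using K e by simp
      also have "\<dots> < a\<^sup>2" unfolding a_def using K e by (intro power_strict_mono) auto
      finally have Ka: "K / a\<^sup>2 < e" using e a by (simp add: field_simps)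
      have "measure (P n) {-a<..a} > 1 - e" for n
      proof -
        interpret P: real_distribution "P n" by (rule P)
        have "(\<integral>\<^sup>+x. ennreal (x\<^sup>2) \<partial>P n) = ennreal (1 / measure (Ms (r2 n)) UNIV) * (\<integral>\<^sup>+x. ennreal (x\<^sup>2) \<partial>Ms (r2 n))"
          unfolding P_def normalise_def
          by (subst nn_integral_density, simp, simp add: measurable_cong_sets[OF fbmD(2)[OF fbm] refl],
              subst nn_integral_cmult) (auto simp: measurable_cong_sets[OF fbmD(2)[OF fbm] refl])
        also have "\<dots> \<le> ennreal (2 / m) * ennreal D"
          using big[of n] pos[of n] m0
          by (intro mult_mono momD ennreal_leI) (auto simp: field_simps)
        also have "\<dots> = ennreal K" using D m0 by (simp add: K_def ennreal_mult[symmetric])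
        finally have "measure (P n) (- {-a<..<a}) \<le> K / a\<^sup>2"
          by (intro tail_bound real_distribution_fbm P a K)
        then have "measure (P n) (space (P n) - {-a<..<a}) < e" using Ka by (simp add: Compl_eq_Diff_UNIV)
        then have "measure (P n) {-a<..<a} > 1 - e" by (subst (asm) P.prob_compl) auto
        moreover have "measure (P n) {-a<..<a} \<le> measure (P n) {-a<..a}"
          by (rule P.finite_measure_mono) auto
        ultimately show ?thesis by linarith
      qed
      then show "\<exists>a b. a < b \<and> (\<forall>n. measure (P n) {a<..b} > 1 - e)"
        using a by (intro exI[of _ "-a"] exI[of _ a]) auto
    qed
    from tight_imp_convergent_subsubsequence[OF this strict_mono_id]
    obtain r3 Q where r3: "strict_mono r3" and Q: "real_distribution Q" and conv: "weak_conv_m (P \<circ> id \<circ> r3) Q"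
      by auto
    define M where "M = density Q (\<lambda>_. ennreal m)"
    have QM: "(\<integral>x. f x \<partial>M) = m * (\<integral>x. f x \<partial>Q)" if "f \<in> borel_measurable borel" for f :: "real \<Rightarrow> real"
      unfolding M_def using m0 that
      by (intro integral_density_const) (auto intro: measurable_fbm real_distribution_fbm[OF Q])
    have "fbm M"
      unfolding M_def using fbmD[OF real_distribution_fbm[OF Q]]
      by (intro fbmI) (auto simp: emeasure_density_const ennreal_mult_less_top)
    moreover have "wconv (\<lambda>n. Ms (r2 (r3 n))) M"
      unfolding wconv_def
    proof safe
      fix \<phi> :: "real \<Rightarrow> real" assume c: "continuous_on UNIV \<phi>" and "bounded (range \<phi>)"
      then obtain B where B: "\<And>x. \<bar>\<phi> x\<bar> \<le> B" by (auto simp: bounded_iff)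
      have \<phi>: "\<phi> \<in> borel_measurable borel" by (rule borel_measurable_continuous_onI[OF c])
      have "(\<lambda>n. \<integral>x. \<phi> x \<partial>(P \<circ> id \<circ> r3) n) \<longlonglongrightarrow> (\<integral>x. \<phi> x \<partial>Q)"
        using P Q conv c B
        by (intro weak_conv_imp_integral_bdd_continuous_conv[where B=B]) (auto simp: continuous_on_eq_continuous_at o_def)
      moreover have "(\<lambda>n. measure (Ms (r2 (r3 n))) UNIV) \<longlonglongrightarrow> m"
        using LIMSEQ_subseq_LIMSEQ[OF lim2 r3] by (simp add: o_def)
      ultimately have "(\<lambda>n. measure (Ms (r2 (r3 n))) UNIV * (\<integral>x. \<phi> x \<partial>P (r3 n))) \<longlonglongrightarrow> m * (\<integral>x. \<phi> x \<partial>Q)"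
        by (auto intro!: tendsto_mult)
      then show "(\<lambda>n. \<integral>x. \<phi> x \<partial>Ms (r2 (r3 n))) \<longlonglongrightarrow> (\<integral>x. \<phi> x \<partial>M)"
        by (simp add: QM[OF \<phi>] integral_normalise[OF fbm pos \<phi>] P_def)
    qed
    moreover have "strict_mono (\<lambda>n. r2 (r3 n))" using r2 r3 by (auto simp: strict_mono_def)
    ultimately show ?thesis by blast
  qed
qed

text \<open>Lipschitz functions decreasing to the indicator of \<open>{..a}\<close>. They recover
  cdfs from integrals of Lipschitz tests, the tests for which estimates in time are
  available.\<close>

definition step_fun :: "real \<Rightarrow> nat \<Rightarrow> real \<Rightarrow> real" where
  "step_fun a k x = max 0 (min 1 (1 - real k * (x - a)))"

lemma step_fun_lipschitz: "(real k)-lipschitz_on UNIV (step_fun a k)"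
proof (rule lipschitz_onI)
  fix x y
  have *: "\<bar>max 0 (min 1 u) - max 0 (min 1 v)\<bar> \<le> \<bar>u - v\<bar>" for u v :: real
    unfolding max_def min_def by (auto split: if_split)
  have "(1 - real k * (x - a)) - (1 - real k * (y - a)) = real k * (y - x)" by (simp add: algebra_simps)
  then have "\<bar>(1 - real k * (x - a)) - (1 - real k * (y - a))\<bar> = real k * \<bar>x - y\<bar>"
    by (simp only: abs_mult) (simp add: abs_minus_commute)
  with *[of "1 - real k * (x - a)" "1 - real k * (y - a)"]
  show "dist (step_fun a k x) (step_fun a k y) \<le> real k * dist x y"
    unfolding step_fun_def dist_real_def by (rule order_trans[OF _ eq_refl])
qed auto

lemma step_fun_continuous: "continuous_on S (step_fun a k)"
  unfolding step_fun_def by (intro continuous_intros)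

lemma step_fun_bound: "0 \<le> step_fun a k x" "step_fun a k x \<le> 1" "\<bar>step_fun a k x\<bar> \<le> 1"
  by (auto simp: step_fun_def)

lemma step_fun_bounded: "bounded (range (step_fun a k))"
  using step_fun_bound(3)[of a k] by (auto simp: bounded_iff)

lemma step_fun_lim: "(\<lambda>k. step_fun a k x) \<longlonglongrightarrow> indicator {..a} x"
proof (cases "x \<le> a")
  case True
  have "real k * (x - a) \<le> 0" for k using True by (simp add: mult_nonneg_nonpos)
  then have "step_fun a k x = 1" for k by (simp add: step_fun_def)
  then show ?thesis using True by simp
next
  case False
  obtain N where N: "1 / (x - a) \<le> real N" using real_nat_ceiling_ge by blast
  have "step_fun a k x = 0" if "k \<ge> N" for k
  proof -
    have "1 / (x - a) \<le> real k" using N that by linarith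
    then have "1 \<le> real k * (x - a)" using False by (simp add: field_simps)
    then show ?thesis by (simp add: step_fun_def)
  qed
  then have "\<forall>\<^sub>F k in sequentially. step_fun a k x = 0" by (auto simp: eventually_sequentially)
  then show ?thesis using False by (simp add: tendsto_eventually)
qed

lemma cdf_step_fun:
  assumes M: "fbm M" shows "(\<lambda>k. \<integral>x. step_fun a k x \<partial>M) \<longlonglongrightarrow> cdf M a"
proof -
  interpret finite_measure M by (rule fbmD(1)[OF M])
  have "(\<lambda>k. \<integral>x. step_fun a k x \<partial>M) \<longlonglongrightarrow> (\<integral>x. indicator {..a} x \<partial>M)"
    using step_fun_lim[of a]
    by (intro integral_dominated_convergence[where w="\<lambda>_. 1"])
       (auto intro!: measurable_fbm[OF M] borel_measurable_continuous_onI[OF step_fun_continuous] simp: step_fun_bound)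
  then show ?thesis by (simp add: cdf_def fbmD(3)[OF M])
qed

lemma fbm_eqI_lipschitz:
  assumes M: "fbm M" and N: "fbm N"
    and eq: "\<And>(\<psi> :: real \<Rightarrow> real) K. K-lipschitz_on UNIV \<psi> \<Longrightarrow> bounded (range \<psi>) \<Longrightarrow> (\<integral>x. \<psi> x \<partial>M) = (\<integral>x. \<psi> x \<partial>N)"
  shows "M = N"
proof (rule cdf_unique'[OF M N], rule ext)
  fix a
  have "(\<integral>x. step_fun a k x \<partial>M) = (\<integral>x. step_fun a k x \<partial>N)" for k
    by (rule eq[OF step_fun_lipschitz step_fun_bounded])
  then show "cdf M a = cdf N a"
    using LIMSEQ_unique[OF cdf_step_fun[OF M, of a]] cdf_step_fun[OF N, of a] by simp
qed

text \<open>Second moments give every subsequence a convergent subsequence, and Lipschitz tests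
  determine its limit, so the whole sequence converges. This upgrades Lipschitz tests to arbitrary
  bounded continuous ones.\<close>

lemma wconv_lipschitzI:
  fixes Ms :: "nat \<Rightarrow> real measure"
  assumes fbm: "\<And>n. fbm (Ms n)" and mass: "\<And>n. measure (Ms n) UNIV \<le> 1"
    and mom: "\<And>n. (\<integral>\<^sup>+x. ennreal (x\<^sup>2) \<partial>Ms n) \<le> ennreal C" and M: "fbm M"
    and conv: "\<And>(\<psi> :: real \<Rightarrow> real) K. K-lipschitz_on UNIV \<psi> \<Longrightarrow> bounded (range \<psi>) \<Longrightarrow>
       (\<lambda>n. \<integral>x. \<psi> x \<partial>Ms n) \<longlonglongrightarrow> (\<integral>x. \<psi> x \<partial>M)"
  shows "wconv Ms M"
  unfolding wconv_def
proof (intro allI impI, rule tendsto_subseq_principle)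
  fix \<phi> :: "real \<Rightarrow> real" and s :: "nat \<Rightarrow> nat"
  assume \<phi>: "continuous_on UNIV \<phi> \<and> bounded (range \<phi>)" and s: "strict_mono s"
  obtain r N where r: "strict_mono r" and N: "fbm N" and w: "wconv (\<lambda>n. Ms (s (r n))) N"
    using fbm_subsequence[of "\<lambda>n. Ms (s n)" C] fbm mass mom by blast
  have "N = M"
  proof (rule fbm_eqI_lipschitz[OF N M])
    fix \<psi> :: "real \<Rightarrow> real" and K assume \<psi>: "K-lipschitz_on UNIV \<psi>" "bounded (range \<psi>)"
    have "(\<lambda>n. \<integral>x. \<psi> x \<partial>Ms (s (r n))) \<longlonglongrightarrow> (\<integral>x. \<psi> x \<partial>N)"
      using w \<psi> by (intro wconvD) (auto intro: lipschitz_on_continuous_on)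
    moreover have "(\<lambda>n. \<integral>x. \<psi> x \<partial>Ms (s (r n))) \<longlonglongrightarrow> (\<integral>x. \<psi> x \<partial>M)"
      using LIMSEQ_subseq_LIMSEQ[OF conv[OF \<psi>] strict_mono_o[OF s r]] by (simp add: o_def)
    ultimately show "(\<integral>x. \<psi> x \<partial>N) = (\<integral>x. \<psi> x \<partial>M)" by (rule LIMSEQ_unique)
  qed
  then show "\<exists>r. strict_mono r \<and> (\<lambda>n. \<integral>x. \<phi> x \<partial>Ms (s (r n))) \<longlonglongrightarrow> (\<integral>x. \<phi> x \<partial>M)"
    using r w \<phi> by (auto intro: wconvD)
qed

text \<open>\<open>x\<^sup>2\<close> is not an admissible test function; its truncations are, and
  monotone convergence removes the truncation.\<close>

lemma wconv_moment:
  assumes fbm: "\<And>n. fbm (Ms n)" and M: "fbm M" and w: "wconv Ms M" and C: "C \<ge> 0"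
    and mom: "\<And>n. (\<integral>\<^sup>+x. ennreal (x\<^sup>2) \<partial>Ms n) \<le> ennreal C"
  shows "(\<integral>\<^sup>+x. ennreal (x\<^sup>2) \<partial>M) \<le> ennreal C"
proof -
  have le: "(\<integral>\<^sup>+x. ennreal (min (x\<^sup>2) (real k)) \<partial>M) \<le> ennreal C" for k
  proof -
    let ?f = "\<lambda>x::real. min (x\<^sup>2) (real k)"
    have c: "continuous_on UNIV ?f" by (intro continuous_intros)
    have b: "bounded (range ?f)" by (auto simp: bounded_iff intro!: exI[of _ "real k"])
    have *: "(\<integral>\<^sup>+x. ennreal (?f x) \<partial>N) = ennreal (\<integral>x. ?f x \<partial>N)" if "fbm N" for N
      by (rule nn_integral_eq_integral[OF integrable_fbm_continuous[OF that c b]]) auto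
    have "(\<integral>x. ?f x \<partial>Ms n) \<le> C" for n
    proof -
      have "ennreal (\<integral>x. ?f x \<partial>Ms n) \<le> (\<integral>\<^sup>+x. ennreal (x\<^sup>2) \<partial>Ms n)"
        unfolding *[OF fbm, symmetric] by (intro nn_integral_mono ennreal_leI) auto
      then have "ennreal (\<integral>x. ?f x \<partial>Ms n) \<le> ennreal C" using mom order_trans by blast
      then show ?thesis using C by simp
    qed
    then have "(\<integral>x. ?f x \<partial>M) \<le> C"
      by (intro LIMSEQ_le_const2[OF wconvD[OF w c b]]) auto
    then show ?thesis unfolding *[OF M] by (rule ennreal_leI)
  qed
  have "(\<integral>\<^sup>+x. ennreal (x\<^sup>2) \<partial>M) = (\<integral>\<^sup>+x. (SUP k. ennreal (min (x\<^sup>2) (real k))) \<partial>M)"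
  proof (rule nn_integral_cong)
    fix x
    obtain N where N: "x\<^sup>2 \<le> real N" using real_nat_ceiling_ge by blast
    show "ennreal (x\<^sup>2) = (SUP k. ennreal (min (x\<^sup>2) (real k)))"
      using N by (intro antisym SUP_least SUP_upper2[of N] ennreal_leI) auto
  qed
  also have "\<dots> = (SUP k. (\<integral>\<^sup>+x. ennreal (min (x\<^sup>2) (real k)) \<partial>M))"
    by (rule nn_integral_monotone_convergence_SUP)
       (auto simp: incseq_def le_fun_def measurable_cong_sets[OF fbmD(2)[OF M] refl] intro!: ennreal_leI)
  also have "\<dots> \<le> ennreal C" by (intro SUP_least le)
  finally show ?thesis .
qed

lemma measure_normalise:
  assumes M: "fbm M" and pos: "measure M UNIV > 0" and A: "A \<in> sets borel"
  shows "measure M A = measure M UNIV * measure (normalise M) A"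
proof -
  have "emeasure (normalise M) A = ennreal (1 / measure M UNIV) * emeasure M A"
    unfolding normalise_def using A by (subst emeasure_density_const) (auto simp: fbmD(2)[OF M])
  then have "measure (normalise M) A = (1 / measure M UNIV) * measure M A"
    by (simp add: measure_def enn2real_mult)
  then show ?thesis using pos by simp
qed

lemma normalise_weak_conv:
  assumes fbm: "\<And>n. fbm (Ms n)" and M: "fbm M" and w: "wconv Ms M"
    and pos: "measure M UNIV > 0" "\<And>n. measure (Ms n) UNIV > 0"
  shows "weak_conv_m (\<lambda>n. normalise (Ms n)) (normalise M)"
proof (rule integral_bdd_continuous_conv_imp_weak_conv)
  fix f :: "real \<Rightarrow> real" assume c: "\<And>x. isCont f x" and b: "\<And>x. \<bar>f x\<bar> \<le> 1"
  have c': "continuous_on UNIV f" using c by (simp add: continuous_at_imp_continuous_on)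
  have f: "f \<in> borel_measurable borel" by (rule borel_measurable_continuous_onI[OF c'])
  have "bounded (range f)" using b by (auto simp: bounded_iff)
  with w c' have "(\<lambda>n. \<integral>x. f x \<partial>Ms n) \<longlonglongrightarrow> (\<integral>x. f x \<partial>M)" by (intro wconvD)
  then have "(\<lambda>n. (\<integral>x. f x \<partial>Ms n) / measure (Ms n) UNIV) \<longlonglongrightarrow> (\<integral>x. f x \<partial>M) / measure M UNIV"
    using pos by (intro tendsto_divide wconv_mass[OF w fbm M]) auto
  moreover have "(\<integral>x. f x \<partial>N) / measure N UNIV = (\<integral>x. f x \<partial>normalise N)" if "fbm N" "measure N UNIV > 0" for N
    using integral_normalise[OF that f] that by simp
  ultimately show "(\<lambda>n. \<integral>x. f x \<partial>normalise (Ms n)) \<longlonglongrightarrow> (\<integral>x. f x \<partial>normalise M)"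
    using fbm M pos by simp
qed (use assms in \<open>auto intro: real_distribution_normalise\<close>)

lemma AE_normalise: "fbm M \<Longrightarrow> AE x in M. P x \<Longrightarrow> AE x in normalise M. P x"
  unfolding normalise_def by (subst AE_density) auto

text \<open>Turns weak into pointwise convergence of random variables on a single space, so that
  dominated convergence can handle discontinuous integrands.\<close>

lemma wconv_Skorohod:
  assumes fbm: "\<And>n. fbm (Ms n)" and M: "fbm M" and w: "wconv Ms M"
    and pos: "measure M UNIV > 0" "\<And>n. measure (Ms n) UNIV > 0"
  shows "\<exists>(\<Omega> :: real measure) (Ys :: nat \<Rightarrow> real \<Rightarrow> real) (Y :: real \<Rightarrow> real).
    prob_space \<Omega> \<and> (\<forall>n. Ys n \<in> borel_measurable \<Omega>) \<and> Y \<in> borel_measurable \<Omega> \<and>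
    (\<forall>n. distr \<Omega> borel (Ys n) = normalise (Ms n)) \<and> distr \<Omega> borel Y = normalise M \<and>
    (\<forall>x\<in>space \<Omega>. (\<lambda>n. Ys n x) \<longlonglongrightarrow> Y x)"
proof -
  have "\<exists> (\<Omega> :: real measure) (Ys :: nat \<Rightarrow> real \<Rightarrow> real) (Y :: real \<Rightarrow> real).
    prob_space \<Omega> \<and> (\<forall>n. Ys n \<in> measurable \<Omega> borel) \<and> (\<forall>n. distr \<Omega> borel (Ys n) = normalise (Ms n)) \<and>
    Y \<in> measurable \<Omega> lborel \<and> distr \<Omega> borel Y = normalise M \<and> (\<forall>x \<in> space \<Omega>. (\<lambda>n. Ys n x) \<longlonglongrightarrow> Y x)"
    by (rule Skorohod) (use assms in \<open>auto intro: real_distribution_normalise normalise_weak_conv\<close>)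
  then show ?thesis by simp blast
qed

section \<open>Limits of double integrals\<close>

lemma borel_measurable_slice:
  fixes g :: "real \<times> real \<Rightarrow> real"
  assumes "g \<in> borel_measurable borel"
  shows "(\<lambda>y. g (x, y)) \<in> borel_measurable borel"
  by (rule measurable_compose[OF _ assms]) (simp flip: borel_prod)

lemma borel_measurable_inner_integral:
  fixes g :: "real \<times> real \<Rightarrow> real"
  assumes g: "g \<in> borel_measurable borel" and N: "fbm N"
  shows "(\<lambda>x. \<integral>y. g (x, y) \<partial>N) \<in> borel_measurable borel"
proof -
  interpret finite_measure N by (rule fbmD(1)[OF N])
  have s: "sets (borel \<Otimes>\<^sub>M N) = sets (borel :: (real \<times> real) measure)"
    by (simp add: borel_prod[symmetric] fbmD(2)[OF N] cong: sets_pair_measure_cong)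
  have "g \<in> borel_measurable (borel \<Otimes>\<^sub>M N)"
    using g measurable_cong_sets[OF s refl] by auto
  then show ?thesis
    by (intro borel_measurable_lebesgue_integral) simp
qed

lemma fbm_pair_integral:
  fixes g :: "real \<times> real \<Rightarrow> real"
  assumes g: "g \<in> borel_measurable borel" and B: "\<And>z. \<bar>g z\<bar> \<le> B" and M: "fbm M" and N: "fbm N"
  shows "(\<integral>z. g z \<partial>(M \<Otimes>\<^sub>M N)) = (\<integral>x. \<integral>y. g (x, y) \<partial>N \<partial>M)"
proof -
  interpret M: finite_measure M by (rule fbmD(1)[OF M])
  interpret N: finite_measure N by (rule fbmD(1)[OF N])
  interpret P: pair_sigma_finite M N ..
  interpret P: finite_measure "M \<Otimes>\<^sub>M N"
    by (intro finite_measure_pair_measure fbmD(1) M N)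
  have s: "sets (M \<Otimes>\<^sub>M N) = sets (borel :: (real \<times> real) measure)"
    by (simp add: borel_prod[symmetric] fbmD(2)[OF N] fbmD(2)[OF M] cong: sets_pair_measure_cong)
  have "integrable (M \<Otimes>\<^sub>M N) g"
    by (rule P.integrable_const_bound[of _ B]) (use g B measurable_cong_sets[OF s refl] in auto)
  from P.integral_fst'[OF this] show ?thesis by simp
qed

lemma integral_fbm_bound2:
  fixes g :: "real \<times> real \<Rightarrow> real"
  assumes M: "fbm M" and N: "fbm N" and B: "\<And>z. \<bar>g z\<bar> \<le> B"
  shows "\<bar>\<integral>x. \<integral>y. g (x, y) \<partial>N \<partial>M\<bar> \<le> B * measure N UNIV * measure M UNIV"
  by (rule integral_fbm_bound[OF M integral_fbm_bound[OF N B]])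

text \<open>Both sequences get a Skorohod representation, on two separate spaces; dominated
  convergence is then applied once in each variable. Continuity is asked only at almost every point
  of the limit, which is what lets kernels jump on the diagonal of atomless measures.\<close>

theorem wconv_pair:
  fixes g :: "real \<times> real \<Rightarrow> real"
  assumes fbm: "\<And>n. fbm (Ms n)" "\<And>n. fbm (Ns n)" and M: "fbm M" and N: "fbm N"
    and w: "wconv Ms M" "wconv Ns N"
    and g: "g \<in> borel_measurable borel" and B: "\<And>z. \<bar>g z\<bar> \<le> B"
    and cont: "AE x in M. AE y in N. isCont g (x, y)"
  shows "(\<lambda>n. \<integral>x. \<integral>y. g (x, y) \<partial>Ns n \<partial>Ms n) \<longlonglongrightarrow> (\<integral>x. \<integral>y. g (x, y) \<partial>N \<partial>M)"
proof (cases "measure M UNIV = 0 \<or> measure N UNIV = 0")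
  \<comment> \<open>A limit mass vanishes and cannot be normalised, but the bound by
    \<open>B\<close> times both masses sends both sides to 0.\<close>
  case True
  have "(\<lambda>n. \<integral>x. \<integral>y. g (x, y) \<partial>Ns n \<partial>Ms n) \<longlonglongrightarrow> 0"
  proof (rule Lim_null_comparison)
    show "\<forall>\<^sub>F n in sequentially. norm (\<integral>x. \<integral>y. g (x, y) \<partial>Ns n \<partial>Ms n) \<le> B * measure (Ns n) UNIV * measure (Ms n) UNIV"
      using integral_fbm_bound2[OF fbm(1) fbm(2), of g, OF B] by simp
    have "(\<lambda>n. B * measure (Ns n) UNIV * measure (Ms n) UNIV) \<longlonglongrightarrow> B * measure N UNIV * measure M UNIV"
      by (intro tendsto_intros wconv_mass w fbm M N)
    then show "(\<lambda>n. B * measure (Ns n) UNIV * measure (Ms n) UNIV) \<longlonglongrightarrow> 0" using True by auto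
  qed
  moreover have "(\<integral>x. \<integral>y. g (x, y) \<partial>N \<partial>M) = 0"
    using integral_fbm_bound2[OF M N, of g, OF B] True by auto
  ultimately show ?thesis by simp
next
  case False
  then have pos: "measure M UNIV > 0" "measure N UNIV > 0" by (auto simp: less_le)
  have "\<forall>\<^sub>F n in sequentially. measure (Ms n) UNIV > 0 \<and> measure (Ns n) UNIV > 0"
    using order_tendstoD(1)[OF wconv_mass[OF w(1) fbm(1) M] pos(1)]
      order_tendstoD(1)[OF wconv_mass[OF w(2) fbm(2) N] pos(2)] by eventually_elim auto
  then obtain n0 where n0: "\<And>n. n \<ge> n0 \<Longrightarrow> measure (Ms n) UNIV > 0" "\<And>n. n \<ge> n0 \<Longrightarrow> measure (Ns n) UNIV > 0"
    by (auto simp: eventually_sequentially)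
  define Ms' where "Ms' n = Ms (n + n0)" for n
  define Ns' where "Ns' n = Ns (n + n0)" for n
  have sm: "strict_mono (\<lambda>n. n + n0)" by (auto simp: strict_mono_def)
  have w': "wconv Ms' M" "wconv Ns' N"
    using wconv_subseq[OF w(1) sm] wconv_subseq[OF w(2) sm] by (simp_all add: Ms'_def[abs_def] Ns'_def[abs_def])
  have fbm': "fbm (Ms' n)" "fbm (Ns' n)" for n by (simp_all add: Ms'_def Ns'_def fbm)
  have pos': "measure (Ms' n) UNIV > 0" "measure (Ns' n) UNIV > 0" for n by (simp_all add: Ms'_def Ns'_def n0)
  obtain \<Omega> :: "real measure" and Ys Y where sk: "prob_space \<Omega> \<and> (\<forall>n. Ys n \<in> borel_measurable \<Omega>) \<and>
      Y \<in> borel_measurable \<Omega> \<and> (\<forall>n. distr \<Omega> borel (Ys n) = normalise (Ms' n)) \<and>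
      distr \<Omega> borel Y = normalise M \<and> (\<forall>x\<in>space \<Omega>. (\<lambda>n. Ys n x) \<longlonglongrightarrow> Y x)"
    using wconv_Skorohod[OF fbm'(1) M w'(1) pos(1) pos'(1)] by (elim exE) (rule that)
  then have \<Omega>: "prob_space \<Omega>" and Ym[measurable]: "\<And>n. Ys n \<in> borel_measurable \<Omega>" "Y \<in> borel_measurable \<Omega>"
    and Yd: "\<And>n. distr \<Omega> borel (Ys n) = normalise (Ms' n)" "distr \<Omega> borel Y = normalise M"
    and Yl: "\<And>x. x \<in> space \<Omega> \<Longrightarrow> (\<lambda>n. Ys n x) \<longlonglongrightarrow> Y x" by auto
  obtain \<Theta> :: "real measure" and Zs Z where sk: "prob_space \<Theta> \<and> (\<forall>n. Zs n \<in> borel_measurable \<Theta>) \<and>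
      Z \<in> borel_measurable \<Theta> \<and> (\<forall>n. distr \<Theta> borel (Zs n) = normalise (Ns' n)) \<and>
      distr \<Theta> borel Z = normalise N \<and> (\<forall>x\<in>space \<Theta>. (\<lambda>n. Zs n x) \<longlonglongrightarrow> Z x)"
    using wconv_Skorohod[OF fbm'(2) N w'(2) pos(2) pos'(2)] by (elim exE) (rule that)
  then have \<Theta>: "prob_space \<Theta>" and Zm[measurable]: "\<And>n. Zs n \<in> borel_measurable \<Theta>" "Z \<in> borel_measurable \<Theta>"
    and Zd: "\<And>n. distr \<Theta> borel (Zs n) = normalise (Ns' n)" "distr \<Theta> borel Z = normalise N"
    and Zl: "\<And>x. x \<in> space \<Theta> \<Longrightarrow> (\<lambda>n. Zs n x) \<longlonglongrightarrow> Z x" by auto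
  interpret \<Omega>: prob_space \<Omega> by fact
  interpret \<Theta>: prob_space \<Theta> by fact
  note [measurable] = borel_measurable_slice[OF g] borel_measurable_inner_integral[OF g]
  \<comment> \<open>Change of variables: a double integral against \<open>M'\<close> and
    \<open>N'\<close> becomes a constant times one over the fixed spaces \<open>\<Omega>\<close> and
    \<open>\<Theta>\<close>. It serves the sequence and its limit alike.\<close>
  have rep: "(\<integral>x. \<integral>y. g (x, y) \<partial>N' \<partial>M') =
      measure M' UNIV * measure N' UNIV * (\<integral>\<omega>. \<integral>\<theta>. g (A \<omega>, D \<theta>) \<partial>\<Theta> \<partial>\<Omega>)"
    if "fbm M'" "fbm N'" "measure M' UNIV > 0" "measure N' UNIV > 0"
       and [measurable]: "A \<in> borel_measurable \<Omega>" "D \<in> borel_measurable \<Theta>"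
       and d: "distr \<Omega> borel A = normalise M'" "distr \<Theta> borel D = normalise N'" for M' N' A D
  proof -
    have e1: "(\<integral>x. \<integral>y. g (x, y) \<partial>N' \<partial>M') = measure M' UNIV * (\<integral>x. \<integral>y. g (x, y) \<partial>N' \<partial>normalise M')"
      by (rule integral_normalise) (auto intro: that borel_measurable_inner_integral g)
    have e2: "(\<integral>y. g (x, y) \<partial>N') = measure N' UNIV * (\<integral>\<theta>. g (x, D \<theta>) \<partial>\<Theta>)" for x
    proof -
      have "(\<integral>y. g (x, y) \<partial>N') = measure N' UNIV * (\<integral>y. g (x, y) \<partial>normalise N')"
        by (intro integral_normalise) (auto intro: that)
      also have "(\<integral>y. g (x, y) \<partial>normalise N') = (\<integral>\<theta>. g (x, D \<theta>) \<partial>\<Theta>)"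
        unfolding d(2)[symmetric] by (intro integral_distr) auto
      finally show ?thesis .
    qed
    have e3: "(\<integral>x. (\<integral>\<theta>. g (x, D \<theta>) \<partial>\<Theta>) \<partial>normalise M') = (\<integral>\<omega>. (\<integral>\<theta>. g (A \<omega>, D \<theta>) \<partial>\<Theta>) \<partial>\<Omega>)"
      unfolding d(1)[symmetric]
    proof (rule integral_distr)
      have "(\<lambda>x. \<integral>y. g (x, y) \<partial>normalise N') \<in> borel_measurable borel"
        by (intro borel_measurable_inner_integral g real_distribution_fbm real_distribution_normalise that)
      then show "(\<lambda>x. \<integral>\<theta>. g (x, D \<theta>) \<partial>\<Theta>) \<in> borel_measurable borel"
        unfolding d(2)[symmetric] by (subst (asm) integral_distr) auto
    qed simp
    show ?thesis by (subst e1) (simp only: e2 e3 integral_mult_right_zero mult.assoc)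
  qed
  have ae: "AE \<omega> in \<Omega>. AE \<theta> in \<Theta>. isCont g (Y \<omega>, Z \<theta>)"
  proof -
    have "AE x in normalise M. AE y in N. isCont g (x, y)" by (rule AE_normalise[OF M cont])
    then have "AE \<omega> in \<Omega>. AE y in N. isCont g (Y \<omega>, y)"
      unfolding Yd(2)[symmetric] by (intro AE_distrD[OF Ym(2)])
    then show ?thesis
    proof eventually_elim
      case (elim \<omega>)
      then have "AE y in normalise N. isCont g (Y \<omega>, y)" by (rule AE_normalise[OF N])
      then show ?case unfolding Zd(2)[symmetric] by (intro AE_distrD[OF Zm(2)])
    qed
  qed
  have B0: "B \<ge> 0" using order_trans[OF abs_ge_zero B[of "(0,0)"]] .
  have meas: "(\<lambda>\<omega>. \<integral>\<theta>. g (A \<omega>, D \<theta>) \<partial>\<Theta>) \<in> borel_measurable \<Omega>"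
    if [measurable]: "A \<in> borel_measurable \<Omega>" "D \<in> borel_measurable \<Theta>" for A D
  proof -
    have "(\<lambda>(\<omega>, \<theta>). (A \<omega>, D \<theta>)) \<in> (\<Omega> \<Otimes>\<^sub>M \<Theta>) \<rightarrow>\<^sub>M borel" by (simp flip: borel_prod)
    from measurable_compose[OF this g] have h: "(\<lambda>z. g (case z of (\<omega>, \<theta>) \<Rightarrow> (A \<omega>, D \<theta>))) \<in> borel_measurable (\<Omega> \<Otimes>\<^sub>M \<Theta>)" .
    from \<Theta>.borel_measurable_lebesgue_integral[of "\<lambda>\<omega> \<theta>. g (A \<omega>, D \<theta>)" \<Omega>]
    show ?thesis using h by (simp add: case_prod_beta')
  qed
  have bd: "\<bar>\<integral>\<theta>. g (a, D \<theta>) \<partial>\<Theta>\<bar> \<le> B" if [measurable]: "D \<in> borel_measurable \<Theta>" for a D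
  proof -
    have "\<bar>\<integral>\<theta>. g (a, D \<theta>) \<partial>\<Theta>\<bar> \<le> (\<integral>\<theta>. \<bar>g (a, D \<theta>)\<bar> \<partial>\<Theta>)" by (rule integral_abs_bound)
    also have "\<dots> \<le> (\<integral>\<theta>. B \<partial>\<Theta>)"
    proof (rule integral_mono)
      show "integrable \<Theta> (\<lambda>\<theta>. \<bar>g (a, D \<theta>)\<bar>)"
        by (rule \<Theta>.integrable_const_bound[of _ B]) (use B in auto)
    qed (use B in auto)
    finally show ?thesis by (simp add: \<Theta>.prob_space)
  qed
  have lim: "(\<lambda>n. \<integral>\<omega>. \<integral>\<theta>. g (Ys n \<omega>, Zs n \<theta>) \<partial>\<Theta> \<partial>\<Omega>) \<longlonglongrightarrow> (\<integral>\<omega>. \<integral>\<theta>. g (Y \<omega>, Z \<theta>) \<partial>\<Theta> \<partial>\<Omega>)"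
  proof (rule integral_dominated_convergence[where w="\<lambda>_. B"])
    show "AE \<omega> in \<Omega>. (\<lambda>n. \<integral>\<theta>. g (Ys n \<omega>, Zs n \<theta>) \<partial>\<Theta>) \<longlonglongrightarrow> (\<integral>\<theta>. g (Y \<omega>, Z \<theta>) \<partial>\<Theta>)"
      using ae AE_space
    proof eventually_elim
      case (elim \<omega>)
      show ?case
      proof (rule integral_dominated_convergence[where w="\<lambda>_. B"])
        show "AE \<theta> in \<Theta>. (\<lambda>n. g (Ys n \<omega>, Zs n \<theta>)) \<longlonglongrightarrow> g (Y \<omega>, Z \<theta>)"
          using elim(1) AE_space
        proof eventually_elim
          case (elim \<theta>)
          show ?case
            by (rule isCont_tendsto_compose[OF elim(1)]) (intro tendsto_Pair Yl Zl elim \<open>\<omega> \<in> space \<Omega>\<close>)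
        qed
      qed (use B in auto)
    qed
  qed (use meas bd in auto)
  have "(\<lambda>n. measure (Ms' n) UNIV * measure (Ns' n) UNIV * (\<integral>\<omega>. \<integral>\<theta>. g (Ys n \<omega>, Zs n \<theta>) \<partial>\<Theta> \<partial>\<Omega>))
    \<longlonglongrightarrow> measure M UNIV * measure N UNIV * (\<integral>\<omega>. \<integral>\<theta>. g (Y \<omega>, Z \<theta>) \<partial>\<Theta> \<partial>\<Omega>)"
    by (intro tendsto_mult wconv_mass w' fbm' M N lim)
  then have "(\<lambda>n. \<integral>x. \<integral>y. g (x, y) \<partial>Ns' n \<partial>Ms' n) \<longlonglongrightarrow> (\<integral>x. \<integral>y. g (x, y) \<partial>N \<partial>M)"
    by (subst (asm) rep[symmetric]; (intro M N fbm' pos pos' Ym Zm Yd Zd)?)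
       (subst (asm) rep[symmetric]; (intro M N fbm' pos pos' Ym Zm Yd Zd)?)
  then show ?thesis
    unfolding Ms'_def Ns'_def by (rule LIMSEQ_offset)
qed

text \<open>A point without mass is a continuity point of the limit cdf, where weak convergence
  implies convergence of cdfs.\<close>

lemma wconv_cdf:
  assumes fbm: "\<And>n. fbm (Ms n)" and M: "fbm M" and w: "wconv Ms M" and a: "measure M {a} = 0"
  shows "(\<lambda>n. cdf (Ms n) a) \<longlonglongrightarrow> cdf M a"
proof (cases "measure M UNIV = 0")
  case True
  have "cdf N a \<le> measure N UNIV" if "fbm N" for N
    using finite_borel_measure.cdf_bounded[OF that] by (simp add: fbmD(3)[OF that])
  moreover have "0 \<le> cdf N a" for N by (simp add: cdf_def)
  moreover have "(\<lambda>n. measure (Ms n) UNIV) \<longlonglongrightarrow> 0" using wconv_mass[OF w fbm M] True by simp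
  ultimately have "(\<lambda>n. cdf (Ms n) a) \<longlonglongrightarrow> 0"
    using fbm by (intro tendsto_sandwich[of "\<lambda>_. 0" "\<lambda>n. cdf (Ms n) a" sequentially "\<lambda>n. measure (Ms n) UNIV"]) auto
  moreover have "cdf M a = 0"
    using \<open>\<And>N. fbm N \<Longrightarrow> cdf N a \<le> measure N UNIV\<close>[OF M] \<open>0 \<le> cdf M a\<close> True by linarith
  ultimately show ?thesis by simp
next
  case False
  then have pos: "measure M UNIV > 0" by (auto simp: less_le)
  have "\<forall>\<^sub>F n in sequentially. measure (Ms n) UNIV > 0"
    using order_tendstoD(1)[OF wconv_mass[OF w fbm M] pos] .
  then obtain n0 where n0: "\<And>n. n \<ge> n0 \<Longrightarrow> measure (Ms n) UNIV > 0" by (auto simp: eventually_sequentially)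
  define Ms' where "Ms' n = Ms (n + n0)" for n
  have "strict_mono (\<lambda>n. n + n0)" by (auto simp: strict_mono_def)
  from wconv_subseq[OF w this] have w': "wconv Ms' M" by (simp add: Ms'_def[abs_def])
  have fbm': "fbm (Ms' n)" and pos': "measure (Ms' n) UNIV > 0" for n by (simp_all add: Ms'_def fbm n0)
  interpret P: real_distribution "normalise M" by (rule real_distribution_normalise[OF M pos])
  have "measure (normalise M) {a} = 0"
    using measure_normalise[OF M pos, of "{a}"] a pos by simp
  then have "isCont (cdf (normalise M)) a" by (simp add: P.isCont_cdf)
  with normalise_weak_conv[OF fbm' M w' pos pos']
  have "(\<lambda>n. cdf (normalise (Ms' n)) a) \<longlonglongrightarrow> cdf (normalise M) a"
    by (simp add: weak_conv_m_def weak_conv_def)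
  then have "(\<lambda>n. measure (Ms' n) UNIV * cdf (normalise (Ms' n)) a) \<longlonglongrightarrow> measure M UNIV * cdf (normalise M) a"
    by (intro tendsto_mult wconv_mass w' fbm' M)
  moreover have "cdf N a = measure N UNIV * cdf (normalise N) a" if "fbm N" "measure N UNIV > 0" for N
    unfolding cdf_def by (rule measure_normalise[OF that]) simp
  ultimately have "(\<lambda>n. cdf (Ms' n) a) \<longlonglongrightarrow> cdf M a" using fbm' M pos pos' by simp
  then show ?thesis unfolding Ms'_def by (rule LIMSEQ_offset)
qed

section \<open>The quadratic transport cost\<close>

text \<open>For equal masses this is the optimal quadratic cost between the measures with cdfs
  \<open>F\<close> and \<open>G\<close>: \<open>qcost_le_coupling\<close> and
  \<open>quantile_coupling_cost\<close> are the two inequalities. Since only values of cdfs enter,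
  lower semicontinuity becomes Fatou's lemma. \<open>ennreal\<close> maps negative differences to 0,
  so positive parts are meant.\<close>

definition qcost :: "(real \<Rightarrow> real) \<Rightarrow> (real \<Rightarrow> real) \<Rightarrow> ennreal" where
  "qcost F G = (\<integral>\<^sup>+u. \<integral>\<^sup>+v. (if u < v then 2 * (ennreal (F u - G v) + ennreal (G u - F v)) else 0) \<partial>lborel \<partial>lborel)"

text \<open>For \<open>x \<le> y\<close> the first indicator cuts out the triangle
  \<open>x \<le> u < v < y\<close> of area \<open>(y - x)\<^sup>2 / 2\<close>, whence the factor 2;
  the second one treats the opposite order.\<close>

definition layer :: "real \<Rightarrow> real \<Rightarrow> real \<Rightarrow> real \<Rightarrow> ennreal" where
  "layer x y u v = (if u < v then 2 * ((if x \<le> u \<and> v < y then 1 else 0) + (if y \<le> u \<and> v < x then 1 else 0)) else 0)"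

lemma measurable_layer[measurable]:
  assumes [measurable]: "f \<in> borel_measurable M" "g \<in> borel_measurable M" "h \<in> borel_measurable M" "k \<in> borel_measurable M"
  shows "(\<lambda>w. layer (f w) (g w) (h w) (k w)) \<in> borel_measurable M"
  unfolding layer_def by measurable

lemma nn_integral_layer_le:
  assumes "x \<le> y"
  shows "(\<integral>\<^sup>+u. \<integral>\<^sup>+v. layer x y u v \<partial>lborel \<partial>lborel) = ennreal ((x - y)\<^sup>2)"
proof -
  have "(\<integral>\<^sup>+v. layer x y u v \<partial>lborel) = ennreal (2 * (y - u)) * indicator {x..y} u" for u
  proof -
    have "(\<integral>\<^sup>+v. layer x y u v \<partial>lborel) = (\<integral>\<^sup>+v. (2 * indicator {x..y} u) * indicator {u<..<y} v \<partial>lborel)"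
      using assms by (intro nn_integral_cong) (auto simp: layer_def indicator_def)
    also have "\<dots> = (2 * indicator {x..y} u) * emeasure lborel {u<..<y}"
      by (subst nn_integral_cmult_indicator) auto
    also have "\<dots> = ennreal (2 * (y - u)) * indicator {x..y} u"
      by (cases "u \<in> {x..y}") (simp_all add: ennreal_mult del: right_diff_distrib_numeral)
    finally show ?thesis .
  qed
  then have "(\<integral>\<^sup>+u. \<integral>\<^sup>+v. layer x y u v \<partial>lborel \<partial>lborel) = (\<integral>\<^sup>+u. ennreal (2 * (y - u)) * indicator {x..y} u \<partial>lborel)"
    by simp
  also have "\<dots> = ennreal (- (y - y)\<^sup>2 - (- (y - x)\<^sup>2))"
  proof (rule nn_integral_FTC_Icc)
    show "DERIV (\<lambda>u. - (y - u)\<^sup>2) u :> 2 * (y - u)" for u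
      by (auto intro!: derivative_eq_intros)
  qed (use assms in auto)
  also have "\<dots> = ennreal ((x - y)\<^sup>2)" by (simp add: power2_commute)
  finally show ?thesis .
qed

lemma nn_integral_layer:
  "(\<integral>\<^sup>+u. \<integral>\<^sup>+v. layer x y u v \<partial>lborel \<partial>lborel) = ennreal ((x - y)\<^sup>2)"
proof (cases "x \<le> y")
  case False
  have "layer x y = layer y x" by (simp add: layer_def fun_eq_iff add.commute)
  then show ?thesis using nn_integral_layer_le[of y x] False by (simp add: power2_commute)
qed (rule nn_integral_layer_le)

text \<open>Tonelli: integrating the triangles over \<open>\<omega>\<close> first leaves the masses
  of the events that \<open>X\<close> and \<open>Y\<close> lie on opposite sides of the interval
  from \<open>u\<close> to \<open>v\<close>.\<close>

lemma nn_integral_sq_layer: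
  assumes B: "sigma_finite_measure B" and [measurable]: "X \<in> borel_measurable B" "Y \<in> borel_measurable B"
  shows "(\<integral>\<^sup>+\<omega>. ennreal ((X \<omega> - Y \<omega>)\<^sup>2) \<partial>B) =
    (\<integral>\<^sup>+u. \<integral>\<^sup>+v. (if u < v then 2 * (emeasure B {\<omega>\<in>space B. X \<omega> \<le> u \<and> v < Y \<omega>} + emeasure B {\<omega>\<in>space B. Y \<omega> \<le> u \<and> v < X \<omega>}) else 0)
      \<partial>lborel \<partial>lborel)"
proof -
  interpret B: sigma_finite_measure B by fact
  interpret P: pair_sigma_finite lborel B ..
  have "(\<integral>\<^sup>+\<omega>. ennreal ((X \<omega> - Y \<omega>)\<^sup>2) \<partial>B) = (\<integral>\<^sup>+\<omega>. \<integral>\<^sup>+u. \<integral>\<^sup>+v. layer (X \<omega>) (Y \<omega>) u v \<partial>lborel \<partial>lborel \<partial>B)"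
    by (simp add: nn_integral_layer)
  also have "\<dots> = (\<integral>\<^sup>+u. \<integral>\<^sup>+\<omega>. \<integral>\<^sup>+v. layer (X \<omega>) (Y \<omega>) u v \<partial>lborel \<partial>B \<partial>lborel)"
    by (rule P.Fubini') measurable
  also have "\<dots> = (\<integral>\<^sup>+u. \<integral>\<^sup>+v. \<integral>\<^sup>+\<omega>. layer (X \<omega>) (Y \<omega>) u v \<partial>B \<partial>lborel \<partial>lborel)"
    by (intro nn_integral_cong P.Fubini') measurable
  also have "\<dots> = (\<integral>\<^sup>+u. \<integral>\<^sup>+v. (if u < v then 2 * (emeasure B {\<omega>\<in>space B. X \<omega> \<le> u \<and> v < Y \<omega>} + emeasure B {\<omega>\<in>space B. Y \<omega> \<le> u \<and> v < X \<omega>}) else 0)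
      \<partial>lborel \<partial>lborel)"
  proof (intro nn_integral_cong)
    fix u v :: real
    have "(\<integral>\<^sup>+\<omega>. layer (X \<omega>) (Y \<omega>) u v \<partial>B) = (\<integral>\<^sup>+\<omega>. (if u < v then 2 * (indicator {\<omega>\<in>space B. X \<omega> \<le> u \<and> v < Y \<omega>} \<omega> + indicator {\<omega>\<in>space B. Y \<omega> \<le> u \<and> v < X \<omega>} \<omega>) else 0) \<partial>B)"
      by (intro nn_integral_cong) (auto simp: layer_def indicator_def)
    also have "\<dots> = (if u < v then 2 * (emeasure B {\<omega>\<in>space B. X \<omega> \<le> u \<and> v < Y \<omega>} + emeasure B {\<omega>\<in>space B. Y \<omega> \<le> u \<and> v < X \<omega>}) else 0)"
      by (simp add: nn_integral_cmult nn_integral_add)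
    finally show "(\<integral>\<^sup>+\<omega>. layer (X \<omega>) (Y \<omega>) u v \<partial>B) = (if u < v then 2 * (emeasure B {\<omega>\<in>space B. X \<omega> \<le> u \<and> v < Y \<omega>} + emeasure B {\<omega>\<in>space B. Y \<omega> \<le> u \<and> v < X \<omega>}) else 0)" .
  qed
  finally show ?thesis .
qed

text \<open>The quantile coupling is optimal, because it realises the lower bound
  \<open>P(X \<le> u, Y > v) \<ge> P(X \<le> u) - P(Y \<le> v)\<close> with equality (or \<open>0\<close>).\<close>

lemma qcost_le_coupling:
  assumes B: "finite_measure B" and [measurable]: "X \<in> borel_measurable B" "Y \<in> borel_measurable B"
  shows "qcost (cdf (distr B borel X)) (cdf (distr B borel Y)) \<le> (\<integral>\<^sup>+\<omega>. ennreal ((X \<omega> - Y \<omega>)\<^sup>2) \<partial>B)"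
proof -
  interpret B: finite_measure B by fact
  have *: "ennreal (cdf (distr B borel X) u - cdf (distr B borel Y) v) \<le> emeasure B {\<omega>\<in>space B. X \<omega> \<le> u \<and> v < Y \<omega>}"
    if [measurable]: "X \<in> borel_measurable B" "Y \<in> borel_measurable B" for X Y u v
  proof -
    have "cdf (distr B borel X) u = measure B {\<omega>\<in>space B. X \<omega> \<le> u}"
      unfolding cdf_def by (subst measure_distr) (auto intro!: arg_cong[where f="measure B"])
    also have "\<dots> \<le> measure B ({\<omega>\<in>space B. X \<omega> \<le> u \<and> v < Y \<omega>} \<union> {\<omega>\<in>space B. Y \<omega> \<le> v})"
      by (intro B.finite_measure_mono) auto
    also have "\<dots> \<le> measure B {\<omega>\<in>space B. X \<omega> \<le> u \<and> v < Y \<omega>} + measure B {\<omega>\<in>space B. Y \<omega> \<le> v}"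
      by (intro measure_Un_le) auto
    also have "measure B {\<omega>\<in>space B. Y \<omega> \<le> v} = cdf (distr B borel Y) v"
      unfolding cdf_def by (subst measure_distr) (auto intro!: arg_cong[where f="measure B"])
    finally show ?thesis unfolding B.emeasure_eq_measure by (intro ennreal_leI) simp
  qed
  show ?thesis
    unfolding qcost_def nn_integral_sq_layer[OF B.sigma_finite_measure_axioms assms(2,3)]
    by (intro nn_integral_mono) (auto intro!: mult_left_mono add_mono *)
qed

section \<open>Quantile functions and the quantile coupling\<close>

lemma quantile_exists:
  assumes M: "fbm M"
  shows "\<exists>X. X \<in> borel_measurable borel \<and> (\<forall>\<omega>\<in>{0<..<measure M UNIV}. \<forall>x. X \<omega> \<le> x \<longleftrightarrow> \<omega> \<le> cdf M x)"
proof -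
  interpret M: finite_borel_measure M by fact
  interpret R: right_continuous_mono "cdf M" 0 "measure M UNIV"
    using M.cdf_lim_at_top
    by unfold_locales (auto intro: M.cdf_is_right_cont monoI M.cdf_nondecreasing M.cdf_lim_at_bot simp: M.borel_UNIV)
  define Q where "Q = R.I"
  have Q: "mono_on {0<..<measure M UNIV} Q" unfolding Q_def by (rule R.mono_I)
  define X where "X = (\<lambda>\<omega>. if \<omega> \<in> {0<..<measure M UNIV} then Q \<omega> else 0)"
  have "Q \<in> borel_measurable (restrict_space borel {0<..<measure M UNIV})"
    by (intro borel_measurable_mono_on_fnc Q)
  moreover have "{0<..<measure M UNIV} \<inter> space borel \<in> sets borel" "(0 :: real) \<in> space borel" by simp_all
  ultimately have "X \<in> borel_measurable borel"
    unfolding X_def using measurable_restrict_space_iff[of "{0<..<measure M UNIV}" borel 0 borel Q] by blast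
  moreover have "X \<omega> \<le> x \<longleftrightarrow> \<omega> \<le> cdf M x" if "\<omega> \<in> {0<..<measure M UNIV}" for \<omega> x
    proof -
      have "\<omega> \<le> cdf M x \<longleftrightarrow> Q \<omega> \<le> x" unfolding Q_def by (rule R.pseudoinverse'[rule_format, OF that])
      then show ?thesis using that by (simp add: X_def)
    qed
  ultimately show ?thesis by blast
qed

text \<open>The generalised inverse of the cdf, pinned down between 0 and the total mass by its
  Galois connection with the cdf; the values outside that interval are left open.\<close>

definition quantile :: "real measure \<Rightarrow> real \<Rightarrow> real" where
  "quantile M = (SOME X. X \<in> borel_measurable borel \<and> (\<forall>\<omega>\<in>{0<..<measure M UNIV}. \<forall>x. X \<omega> \<le> x \<longleftrightarrow> \<omega> \<le> cdf M x))"

lemma quantile: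
  assumes "fbm M"
  shows quantile_measurable: "quantile M \<in> borel_measurable borel"
    and quantile_le_iff: "\<omega> \<in> {0<..<measure M UNIV} \<Longrightarrow> quantile M \<omega> \<le> x \<longleftrightarrow> \<omega> \<le> cdf M x"
  using someI_ex[OF quantile_exists[OF assms]] unfolding quantile_def by auto

text \<open>Lebesgue measure on the interval from 0 to \<open>m\<close>, deliberately not
  normalised: the quantile function of a measure of mass \<open>m\<close> pushes it forward to that
  measure.\<close>

definition unif :: "real \<Rightarrow> real measure" where
  "unif m = density lborel (indicator {0<..<m})"

lemma emeasure_unif:
  "A \<in> sets borel \<Longrightarrow> emeasure (unif m) A = emeasure lborel (A \<inter> {0<..<m})"
  unfolding unif_def by (simp add: emeasure_density mult.commute flip: indicator_inter_arith)

lemma fbm_unif: "fbm (unif m)"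
proof (rule fbmI)
  have "emeasure lborel {0<..<m} < \<infinity>" by (cases "0 \<le> m") auto
  then show "emeasure (unif m) UNIV < \<infinity>" by (simp add: emeasure_unif)
qed (simp add: unif_def)

lemma distr_quantile:
  assumes M: "fbm M"
  shows "distr (unif (measure M UNIV)) borel (quantile M) = M"
proof (rule cdf_unique'[OF _ M])
  have sU: "sets (unif m) = sets borel" for m by (simp add: unif_def)
  have X[measurable]: "quantile M \<in> borel_measurable (unif m)" for m
    using quantile_measurable[OF M] measurable_cong_sets[OF sU refl] by auto
  interpret U: finite_measure "unif (measure M UNIV)" by (rule fbmD(1)[OF fbm_unif])
  show "fbm (distr (unif (measure M UNIV)) borel (quantile M))"
    using U.finite_measure_distr[OF X] fbmI[of "distr (unif (measure M UNIV)) borel (quantile M)"]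
      finite_measure.emeasure_finite[of "distr (unif (measure M UNIV)) borel (quantile M)" UNIV]
    by (simp add: less_top)
  show "cdf (distr (unif (measure M UNIV)) borel (quantile M)) = cdf M"
  proof (rule ext)
    fix x
    have c: "0 \<le> cdf M x" "cdf M x \<le> measure M UNIV"
      using finite_borel_measure.cdf_bounded[OF M, of x] by (simp_all add: cdf_def fbmD(3)[OF M])
    have "emeasure (distr (unif (measure M UNIV)) borel (quantile M)) {..x} =
        emeasure (unif (measure M UNIV)) (quantile M -` {..x})"
      by (subst emeasure_distr) (auto simp: fbmD(3)[OF fbm_unif])
    also have "\<dots> = emeasure lborel (quantile M -` {..x} \<inter> {0<..<measure M UNIV})"
      using measurable_sets_borel[OF quantile_measurable[OF M], of "{..x}"] by (intro emeasure_unif) simp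
    also have "quantile M -` {..x} \<inter> {0<..<measure M UNIV} = {0<..<measure M UNIV} \<inter> {..cdf M x}"
      using quantile_le_iff[OF M] by auto
    also have "emeasure lborel \<dots> = emeasure lborel {0<..cdf M x}"
      by (rule emeasure_eq_AE) (use c AE_lborel_singleton[of "measure M UNIV"] in auto)
    also have "\<dots> = ennreal (cdf M x)" using c by simp
    finally show "cdf (distr (unif (measure M UNIV)) borel (quantile M)) x = cdf M x"
      using c by (simp add: cdf_def measure_def)
  qed
qed

text \<open>With a common uniform variable, the event \<open>quantile M \<le> u\<close>,
  \<open>quantile N > v\<close> lies in the interval from \<open>cdf N v\<close> to
  \<open>cdf M u\<close>, so its mass does not exceed the lower bound valid for every
  coupling.\<close>

lemma quantile_coupling_cost:
  assumes M: "fbm M" and N: "fbm N" and eq: "measure M UNIV = m" "measure N UNIV = m"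
  shows "(\<integral>\<^sup>+\<omega>. ennreal ((quantile M \<omega> - quantile N \<omega>)\<^sup>2) \<partial>unif m) \<le> qcost (cdf M) (cdf N)"
proof -
  have sU: "sets (unif m) = sets borel" by (simp add: unif_def)
  have X[measurable]: "quantile M \<in> borel_measurable (unif m)" "quantile N \<in> borel_measurable (unif m)"
    using quantile_measurable[OF M] quantile_measurable[OF N] measurable_cong_sets[OF sU refl] by auto
  interpret U: finite_measure "unif m" by (rule fbmD(1)[OF fbm_unif])
  have *: "emeasure (unif m) {\<omega>\<in>space (unif m). quantile M \<omega> \<le> u \<and> v < quantile N \<omega>} \<le> ennreal (cdf M u - cdf N v)"
    if M: "fbm M" and N: "fbm N" and eq: "measure M UNIV = m" "measure N UNIV = m" for M N u v
  proof -
    have [measurable]: "quantile M \<in> borel_measurable borel" "quantile N \<in> borel_measurable borel"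
      by (rule quantile_measurable, fact)+
    have "emeasure (unif m) {\<omega>\<in>space (unif m). quantile M \<omega> \<le> u \<and> v < quantile N \<omega>} =
        emeasure lborel ({\<omega>. quantile M \<omega> \<le> u \<and> v < quantile N \<omega>} \<inter> {0<..<m})"
      unfolding fbmD(3)[OF fbm_unif] by (subst emeasure_unif) auto
    also have "\<dots> \<le> emeasure lborel {cdf N v<..cdf M u}"
      using quantile_le_iff[OF M] quantile_le_iff[OF N] eq
      by (intro emeasure_mono) (auto simp flip: not_le)
    also have "\<dots> = ennreal (cdf M u - cdf N v)"
      by (cases "cdf N v \<le> cdf M u") (auto simp: ennreal_neg)
    finally show ?thesis .
  qed
  show ?thesis
    unfolding qcost_def nn_integral_sq_layer[OF U.sigma_finite_measure_axioms X]
    by (intro nn_integral_mono) (auto intro!: mult_left_mono add_mono * M N eq)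
qed

lemma measurable_cdf: "fbm M \<Longrightarrow> cdf M \<in> borel_measurable borel"
  by (intro borel_measurable_mono monoI finite_borel_measure.cdf_nondecreasing)

lemma AE_no_atom: "fbm M \<Longrightarrow> AE x in lborel. measure M {x} = 0"
proof -
  assume M: "fbm M"
  have c: "countable {x. measure M {x} > 0}" by (rule finite_borel_measure.countable_atoms[OF M])
  then have "emeasure lborel {x. measure M {x} > 0} = 0" by (rule emeasure_lborel_countable)
  moreover have "{x. measure M {x} > 0} \<in> sets lborel"
    by (rule sets.countable[OF _ c]) simp
  ultimately have "AE x in lborel. x \<notin> {x. measure M {x} > 0}" by (intro AE_not_in) auto
  then show ?thesis by eventually_elim (auto simp: less_le)
qed

text \<open>Cdfs converge wherever the limits have no atom, hence for almost every \<open>u\<close>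
  and almost every \<open>v\<close>; Fatou's lemma is then applied in both variables.\<close>

lemma qcost_lsc:
  assumes fbm: "\<And>n. fbm (Ms n)" "\<And>n. fbm (Ns n)" and M: "fbm M" and N: "fbm N" and w: "wconv Ms M" "wconv Ns N"
  shows "qcost (cdf M) (cdf N) \<le> liminf (\<lambda>n. qcost (cdf (Ms n)) (cdf (Ns n)))"
proof -
  note [measurable] = measurable_cdf[OF fbm(1)] measurable_cdf[OF fbm(2)] measurable_cdf[OF M] measurable_cdf[OF N]
  let ?f = "\<lambda>F G u v. if u < v then 2 * (ennreal (F u - G v) + ennreal (G u - F v)) else 0"
  let ?fn = "\<lambda>n. ?f (cdf (Ms n)) (cdf (Ns n))"
  have lim: "(\<lambda>n. ?fn n u v) \<longlonglongrightarrow> ?f (cdf M) (cdf N) u v"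
    if "measure M {u} = 0" "measure N {u} = 0" "measure M {v} = 0" "measure N {v} = 0" for u v
  proof (cases "u < v")
    case True
    have "(\<lambda>n. 2 * (ennreal (cdf (Ms n) u - cdf (Ns n) v) + ennreal (cdf (Ns n) u - cdf (Ms n) v))) \<longlonglongrightarrow>
       2 * (ennreal (cdf M u - cdf N v) + ennreal (cdf N u - cdf M v))"
      by (intro tendsto_mult_ennreal tendsto_const tendsto_add tendsto_ennrealI tendsto_diff wconv_cdf fbm M N w that) auto
    then show ?thesis using True by simp
  qed auto
  have "qcost (cdf M) (cdf N) = (\<integral>\<^sup>+u. \<integral>\<^sup>+v. ?f (cdf M) (cdf N) u v \<partial>lborel \<partial>lborel)"
    by (simp add: qcost_def)
  also have "\<dots> \<le> (\<integral>\<^sup>+u. liminf (\<lambda>n. \<integral>\<^sup>+v. ?fn n u v \<partial>lborel) \<partial>lborel)"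
  proof (rule nn_integral_mono_AE)
    show "AE u in lborel. (\<integral>\<^sup>+v. ?f (cdf M) (cdf N) u v \<partial>lborel) \<le> liminf (\<lambda>n. \<integral>\<^sup>+v. ?fn n u v \<partial>lborel)"
      using AE_no_atom[OF M] AE_no_atom[OF N]
    proof eventually_elim
      case (elim u)
      have "(\<integral>\<^sup>+v. ?f (cdf M) (cdf N) u v \<partial>lborel) = (\<integral>\<^sup>+v. liminf (\<lambda>n. ?fn n u v) \<partial>lborel)"
      proof (rule nn_integral_cong_AE)
        show "AE v in lborel. ?f (cdf M) (cdf N) u v = liminf (\<lambda>n. ?fn n u v)"
          using AE_no_atom[OF M] AE_no_atom[OF N]
          by eventually_elim (rule lim_imp_Liminf[symmetric, OF _ lim], auto simp: elim)
      qed
      also have "\<dots> \<le> liminf (\<lambda>n. \<integral>\<^sup>+v. ?fn n u v \<partial>lborel)"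
        by (rule nn_integral_liminf) measurable
      finally show ?case .
    qed
  qed
  also have "\<dots> \<le> liminf (\<lambda>n. \<integral>\<^sup>+u. \<integral>\<^sup>+v. ?fn n u v \<partial>lborel \<partial>lborel)"
    by (rule nn_integral_liminf) measurable
  finally show ?thesis by (simp add: qcost_def)
qed

section \<open>Pairs of measures with signs, and the distance \<open>Wass\<close>\<close>

lemma P2D:
  assumes "\<rho> \<in> P2" "p \<in> {-1, 1}"
  shows "sets (\<rho> p) = sets borel" "fbm (\<rho> p)" "measure (\<rho> 1) UNIV + measure (\<rho> (-1)) UNIV = 1"
proof -
  have s: "sets (\<rho> q) = sets borel" if "q \<in> {-1,1}" for q using assms(1) that by (auto simp: P2_def)
  have e: "emeasure (\<rho> 1) UNIV + emeasure (\<rho> (-1)) UNIV = 1" using assms(1) by (simp add: P2_def)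
  then have "emeasure (\<rho> 1) UNIV < \<infinity>" "emeasure (\<rho> (-1)) UNIV < \<infinity>"
    by (auto simp: less_top[symmetric] top_unique)
  with s have f: "fbm (\<rho> q)" if "q \<in> {-1,1}" for q using that by (auto intro: fbmI)
  show "sets (\<rho> p) = sets borel" "fbm (\<rho> p)" by (intro s f assms)+
  have "ennreal (measure (\<rho> 1) UNIV + measure (\<rho> (-1)) UNIV) = ennreal 1"
    using e fbmD(5)[OF f, of 1 UNIV] fbmD(5)[OF f, of "-1" UNIV] by (simp add: ennreal_plus[symmetric] del: ennreal_plus)
  then show "measure (\<rho> 1) UNIV + measure (\<rho> (-1)) UNIV = 1" by (subst (asm) ennreal_inj) auto
qed

lemma sets_joint: "sets (joint \<mu>) = sets sgn_space" by (simp add: joint_def)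

lemma space_joint: "space (joint \<mu>) = UNIV \<times> {-1, 1}"
  using sets_eq_imp_space_eq[OF sets_joint] by (simp add: sgn_space_def space_pair_measure)

lemma measurable_slice_sgn:
  assumes "p \<in> {-1, 1}" shows "(\<lambda>x. (x, p)) \<in> measurable borel sgn_space"
  using assms by (auto simp: sgn_space_def)

lemma nn_integral_joint:
  assumes s: "\<And>p. p \<in> {-1, 1} \<Longrightarrow> sets (\<beta> p) = sets borel" and f: "f \<in> borel_measurable sgn_space"
  shows "(\<integral>\<^sup>+z. f z \<partial>joint \<beta>) = (\<Sum>p\<in>{-1, 1}. \<integral>\<^sup>+x. f (x, p) \<partial>\<beta> p)"
  using f
proof (induction rule: borel_measurable_induct)
  have mp: "(\<lambda>x. (x, p)) \<in> measurable (\<beta> p) sgn_space" if "p \<in> {-1,1}" for p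
    using measurable_slice_sgn[OF that] measurable_cong_sets[OF s[OF that] refl] by auto
  have meas: "u \<in> borel_measurable sgn_space \<Longrightarrow> u \<in> borel_measurable (joint \<beta>)" for u :: "real \<times> int \<Rightarrow> ennreal"
    using measurable_cong_sets[OF sets_joint refl] by blast
  have meas': "u \<in> borel_measurable sgn_space \<Longrightarrow> p \<in> {-1,1} \<Longrightarrow> (\<lambda>x. u (x, p)) \<in> borel_measurable (\<beta> p)" for u :: "real \<times> int \<Rightarrow> ennreal" and p
    using measurable_compose[OF mp] by blast
  {
    case (cong f g)
    have "(\<integral>\<^sup>+z. f z \<partial>joint \<beta>) = (\<integral>\<^sup>+z. g z \<partial>joint \<beta>)"
      using cong(3) by (intro nn_integral_cong) (auto simp: space_joint sgn_space_def space_pair_measure)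
    moreover have "(\<integral>\<^sup>+x. f (x, p) \<partial>\<beta> p) = (\<integral>\<^sup>+x. g (x, p) \<partial>\<beta> p)" if "p \<in> {-1,1}" for p
      using cong(3) that by (intro nn_integral_cong) (auto simp: sgn_space_def space_pair_measure)
    ultimately show ?case using cong(4) by (simp cong: sum.cong)
  next
    case (set A)
    have "(\<integral>\<^sup>+z. indicator A z \<partial>joint \<beta>) = emeasure (joint \<beta>) A"
      using set by (simp add: sets_joint)
    also have "\<dots> = (\<Sum>p\<in>{-1, 1}. emeasure (\<beta> p) {x. (x, p) \<in> A})"
      by (rule emeasure_joint[OF s set])
    also have "\<dots> = (\<Sum>p\<in>{-1, 1}. \<integral>\<^sup>+x. indicator A (x, p) \<partial>\<beta> p)"
    proof (rule sum.cong[OF refl])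
      fix p :: int assume p: "p \<in> {-1, 1}"
      have "{x. (x, p) \<in> A} \<in> sets (\<beta> p)"
        using measurable_sets[OF mp[OF p] set] sets_eq_imp_space_eq[OF s[OF p]] by (simp add: vimage_def)
      then have "emeasure (\<beta> p) {x. (x, p) \<in> A} = (\<integral>\<^sup>+x. indicator {x. (x, p) \<in> A} x \<partial>\<beta> p)"
        by (rule nn_integral_indicator[symmetric])
      also have "\<dots> = (\<integral>\<^sup>+x. indicator A (x, p) \<partial>\<beta> p)"
        by (intro nn_integral_cong) (auto simp: indicator_def)
      finally show "emeasure (\<beta> p) {x. (x, p) \<in> A} = (\<integral>\<^sup>+x. indicator A (x, p) \<partial>\<beta> p)" .
    qed
    finally show ?case .
  next
    case (mult u c)
    then show ?case by (simp add: nn_integral_cmult meas meas' distrib_left)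
  next
    case (add u v)
    then show ?case by (simp add: nn_integral_add meas meas' ac_simps)
  next
    case (seq U)
    have 1: "(\<integral>\<^sup>+z. (SUP i. U i) z \<partial>joint \<beta>) = (SUP i. \<integral>\<^sup>+z. U i z \<partial>joint \<beta>)"
      unfolding SUP_apply using seq.hyps(1,3) by (intro nn_integral_monotone_convergence_SUP meas) auto
    have 2: "(\<integral>\<^sup>+x. (SUP i. U i) (x, p) \<partial>\<beta> p) = (SUP i. \<integral>\<^sup>+x. U i (x, p) \<partial>\<beta> p)" if "p \<in> {-1,1}" for p
      unfolding SUP_apply using seq.hyps(1,3) that by (intro nn_integral_monotone_convergence_SUP meas') (auto simp: incseq_def le_fun_def)
    have inc: "incseq (\<lambda>i. \<integral>\<^sup>+x. U i (x, p) \<partial>\<beta> p)" for p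
      using seq.hyps(3) by (auto simp: incseq_def le_fun_def intro!: nn_integral_mono)
    have "(\<integral>\<^sup>+z. (SUP i. U i) z \<partial>joint \<beta>) = (SUP i. (\<Sum>p\<in>{-1, 1}. \<integral>\<^sup>+x. U i (x, p) \<partial>\<beta> p))"
      unfolding 1 using seq.IH by simp
    also have "\<dots> = (\<Sum>p\<in>{-1, 1}. SUP i. \<integral>\<^sup>+x. U i (x, p) \<partial>\<beta> p)"
      using ennreal_SUP_add[OF inc[of "-1"] inc[of 1]] by simp
    also have "\<dots> = (\<Sum>p\<in>{-1, 1}. \<integral>\<^sup>+x. (SUP i. U i) (x, p) \<partial>\<beta> p)"
      by (rule sum.cong[OF refl]) (rule 2[symmetric])
    finally show ?case .
  }
qed

text \<open>Witness coupling: keep the sign and match positions by quantiles. Equal masses per sign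
  make it admissible, and the sign term of \<open>dist_sgn\<close> vanishes.\<close>

lemma Wass_le:
  assumes \<rho>: "\<rho> \<in> P2" and \<sigma>: "\<sigma> \<in> P2" and mass: "measure (\<rho> 1) UNIV = measure (\<sigma> 1) UNIV"
    and cost: "(\<Sum>p\<in>{-1, 1}. qcost (cdf (\<rho> p)) (cdf (\<sigma> p))) \<le> ennreal D" and D: "D \<ge> 0"
  shows "Wass \<rho> \<sigma> \<le> sqrt D"
proof -
  define m where "m p = measure (\<rho> p) UNIV" for p
  \<comment> \<open>Equality is assumed for sign 1 only; total mass 1 gives it for the other
    sign.\<close>
  have m\<sigma>: "measure (\<sigma> p) UNIV = m p" if "p \<in> {-1, 1}" for p
    using that mass P2D(3)[OF \<rho>, of 1] P2D(3)[OF \<sigma>, of 1] by (auto simp: m_def)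
  \<comment> \<open>\<open>joint \<beta>\<close> is the common source: a sign and a uniform level,
    sent by \<open>h \<rho>\<close> and \<open>h \<sigma>\<close> to the two pairs.\<close>
  define \<beta> where "\<beta> p = unif (m p)" for p :: int
  have s\<beta>: "sets (\<beta> p) = sets borel" for p by (simp add: \<beta>_def unif_def)
  define h where "h \<tau> z = (quantile (\<tau> (snd z)) (fst z), snd z)" for \<tau> :: signed_pair and z :: "real \<times> int"
  have hm: "h \<tau> \<in> measurable sgn_space sgn_space" if "\<tau> \<in> P2" for \<tau>
  proof -
    have "(\<lambda>z. quantile (\<tau> (snd z)) (fst z)) \<in> borel_measurable (borel \<Otimes>\<^sub>M count_space {-1, 1})"
      by (rule measurable_compose_countable'[where g=snd and f="\<lambda>p z. quantile (\<tau> p) (fst z)" and I="{-1, 1}"])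
         (auto intro!: measurable_compose[OF measurable_fst] quantile_measurable P2D(2)[OF that])
    then show ?thesis unfolding h_def[abs_def] sgn_space_def by simp
  qed
  have hj: "h \<tau> \<in> measurable (joint \<beta>) sgn_space" if "\<tau> \<in> P2" for \<tau>
    using hm[OF that] measurable_cong_sets[OF sets_joint refl] by blast
  have marg: "distr (joint \<beta>) sgn_space (h \<tau>) = joint \<tau>" if \<tau>: "\<tau> \<in> P2" and m\<tau>: "\<And>p. p \<in> {-1, 1} \<Longrightarrow> measure (\<tau> p) UNIV = m p" for \<tau>
  proof (rule measure_eqI)
    fix A assume "A \<in> sets (distr (joint \<beta>) sgn_space (h \<tau>))"
    then have A: "A \<in> sets sgn_space" by simp
    have "emeasure (distr (joint \<beta>) sgn_space (h \<tau>)) A = emeasure (joint \<beta>) (h \<tau> -` A \<inter> space (joint \<beta>))"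
      by (rule emeasure_distr[OF hj[OF \<tau>] A])
    also have "\<dots> = (\<Sum>p\<in>{-1, 1}. emeasure (\<beta> p) {x. (x, p) \<in> h \<tau> -` A \<inter> space (joint \<beta>)})"
      using measurable_sets[OF hj[OF \<tau>] A] by (intro emeasure_joint s\<beta>) (simp add: sets_joint)
    also have "\<dots> = (\<Sum>p\<in>{-1, 1}. emeasure (\<tau> p) {y. (y, p) \<in> A})"
    proof (rule sum.cong[OF refl])
      fix p :: int assume p: "p \<in> {-1, 1}"
      have A': "{y. (y, p) \<in> A} \<in> sets borel"
        using measurable_sets[OF measurable_slice_sgn[OF p] A] by (simp add: vimage_def)
      have q: "quantile (\<tau> p) \<in> measurable (\<beta> p) borel"
        using quantile_measurable[OF P2D(2)[OF \<tau> p]] measurable_cong_sets[OF s\<beta> refl] by blast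
      have "emeasure (\<tau> p) {y. (y, p) \<in> A} = emeasure (distr (\<beta> p) borel (quantile (\<tau> p))) {y. (y, p) \<in> A}"
        unfolding \<beta>_def m\<tau>[OF p, symmetric] distr_quantile[OF P2D(2)[OF \<tau> p]] ..
      also have "\<dots> = emeasure (\<beta> p) (quantile (\<tau> p) -` {y. (y, p) \<in> A} \<inter> space (\<beta> p))"
        by (rule emeasure_distr[OF q A'])
      also have "quantile (\<tau> p) -` {y. (y, p) \<in> A} \<inter> space (\<beta> p) = {x. (x, p) \<in> h \<tau> -` A \<inter> space (joint \<beta>)}"
        using p sets_eq_imp_space_eq[OF s\<beta>] by (auto simp: h_def space_joint)
      finally show "emeasure (\<beta> p) {x. (x, p) \<in> h \<tau> -` A \<inter> space (joint \<beta>)} = emeasure (\<tau> p) {y. (y, p) \<in> A}" ..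
    qed
    also have "\<dots> = emeasure (joint \<tau>) A"
      by (rule emeasure_joint[symmetric, OF _ A]) (rule P2D(1)[OF \<tau>])
    finally show "emeasure (distr (joint \<beta>) sgn_space (h \<tau>)) A = emeasure (joint \<tau>) A" .
  qed (simp add: sets_joint)
  define f where "f z = (h \<rho> z, h \<sigma> z)" for z
  have fm: "f \<in> measurable (joint \<beta>) (sgn_space \<Otimes>\<^sub>M sgn_space)"
    unfolding f_def[abs_def] by (intro measurable_Pair hj \<rho> \<sigma>)
  define \<gamma> where "\<gamma> = distr (joint \<beta>) (sgn_space \<Otimes>\<^sub>M sgn_space) f"
  have "distr \<gamma> sgn_space fst = distr (joint \<beta>) sgn_space (h \<rho>)" "distr \<gamma> sgn_space snd = distr (joint \<beta>) sgn_space (h \<sigma>)"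
    unfolding \<gamma>_def by (subst distr_distr[OF _ fm]; simp add: o_def f_def)+
  then have "\<gamma> \<in> couplings \<rho> \<sigma>"
    using marg[OF \<rho>] marg[OF \<sigma> m\<sigma>] by (simp add: couplings_def \<gamma>_def m_def)
  then have "(INF \<gamma>\<in>couplings \<rho> \<sigma>. \<integral>\<^sup>+ z. ennreal ((dist_sgn (fst z) (snd z))\<^sup>2) \<partial>\<gamma>) \<le>
      (\<integral>\<^sup>+ z. ennreal ((dist_sgn (fst z) (snd z))\<^sup>2) \<partial>\<gamma>)"
    by (rule INF_lower)
  also have "\<dots> = (\<integral>\<^sup>+ z. ennreal ((dist_sgn (h \<rho> z) (h \<sigma> z))\<^sup>2) \<partial>joint \<beta>)"
  proof -
    have [measurable]: "real_of_int \<in> borel_measurable (count_space {-1, 1})" by simp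
    have "(\<lambda>z. ennreal ((dist_sgn (fst z) (snd z))\<^sup>2)) \<in> borel_measurable (sgn_space \<Otimes>\<^sub>M sgn_space)"
      unfolding dist_sgn_def sgn_space_def by measurable
    then show ?thesis unfolding \<gamma>_def by (subst nn_integral_distr[OF fm]) (simp_all add: f_def)
  qed
  also have "\<dots> = (\<integral>\<^sup>+ z. ennreal ((quantile (\<rho> (snd z)) (fst z) - quantile (\<sigma> (snd z)) (fst z))\<^sup>2) \<partial>joint \<beta>)"
    by (simp add: dist_sgn_def h_def)
  also have "\<dots> = (\<Sum>p\<in>{-1, 1}. \<integral>\<^sup>+x. ennreal ((quantile (\<rho> p) x - quantile (\<sigma> p) x)\<^sup>2) \<partial>\<beta> p)"
  proof (subst nn_integral_joint[OF s\<beta>])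
    have "(\<lambda>z. quantile (\<tau> (snd z)) (fst z)) \<in> borel_measurable sgn_space" if "\<tau> \<in> P2" for \<tau>
    proof -
      have "fst \<in> borel_measurable sgn_space" by (simp add: sgn_space_def)
      from measurable_compose[OF hm[OF that] this] show ?thesis by (simp add: h_def)
    qed
    from this[OF \<rho>] this[OF \<sigma>]
    show "(\<lambda>z. ennreal ((quantile (\<rho> (snd z)) (fst z) - quantile (\<sigma> (snd z)) (fst z))\<^sup>2)) \<in> borel_measurable sgn_space"
      by measurable
  qed simp
  also have "\<dots> \<le> (\<Sum>p\<in>{-1, 1}. qcost (cdf (\<rho> p)) (cdf (\<sigma> p)))"
    unfolding \<beta>_def using m\<sigma> by (intro sum_mono quantile_coupling_cost P2D \<rho> \<sigma>) (auto simp: m_def)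
  also note cost
  finally have "enn2real (INF \<gamma>\<in>couplings \<rho> \<sigma>. \<integral>\<^sup>+ z. ennreal ((dist_sgn (fst z) (snd z))\<^sup>2) \<partial>\<gamma>) \<le> D"
    using D enn2real_leI by blast
  then show ?thesis unfolding Wass_def by (rule real_sqrt_le_mono)
qed

section \<open>Empirical measures and their transport cost\<close>

lemma fbm_empirical: "fbm (empirical n y c p)"
proof (rule fbmI)
  have "emeasure (empirical n y c p) UNIV = (\<Sum>i | i \<in> {1..n} \<and> c i = p. ennreal (1 / real n))"
    by (simp add: emeasure_empirical)
  also have "\<dots> < \<infinity>" by (simp add: ennreal_mult_less_top of_nat_less_top)
  finally show "emeasure (empirical n y c p) UNIV < \<infinity>" .
qed (simp add: empirical_def)

lemma integral_empirical:
  fixes f :: "real \<Rightarrow> real"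
  assumes "f \<in> borel_measurable borel"
  shows "(\<integral>x. f x \<partial>empirical n y c p) = (1 / real n) * (\<Sum>i | i \<in> {1..n} \<and> c i = p. f (y i))"
  unfolding empirical_def
  by (subst integral_distr[OF _ assms])
     (simp_all add: measurable_point_measure_eq1 lebesgue_integral_point_measure_finite sum_distrib_left)

lemma nn_integral_empirical:
  assumes "f \<in> borel_measurable borel"
  shows "(\<integral>\<^sup>+x. f x \<partial>empirical n y c p) = ennreal (1 / real n) * (\<Sum>i | i \<in> {1..n} \<and> c i = p. f (y i))"
  unfolding empirical_def
  by (subst nn_integral_distr)
     (simp_all add: assms measurable_point_measure_eq1 nn_integral_point_measure_finite sum_distrib_left)

lemma measure_empirical:
  "measure (empirical n y c p) UNIV = (1 / real n) * real (card {i\<in>{1..n}. c i = p})"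
  using integral_empirical[of "\<lambda>_. 1" n y c p] by (simp add: fbmD(3)[OF fbm_empirical])

lemma mass_empirical_le: "measure (empirical n y c p) UNIV \<le> 1"
proof -
  have "card {i\<in>{1..n}. c i = p} \<le> card {1..n}" by (intro card_mono) auto
  then show ?thesis unfolding measure_empirical by (cases "n = 0") (auto simp: field_simps)
qed

text \<open>Particle \<open>i\<close> of one configuration is coupled with particle \<open>i\<close>
  of the other; the common labels \<open>c\<close> make this a coupling.\<close>

lemma qcost_empirical:
  "qcost (cdf (empirical n y c p)) (cdf (empirical n z c p)) \<le>
    ennreal ((1 / real n) * (\<Sum>i | i \<in> {1..n} \<and> c i = p. (y i - z i)\<^sup>2))"
proof -
  let ?B = "point_measure {i\<in>{1..n}. c i = p} (\<lambda>_. ennreal (1 / real n))"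
  have "finite_measure ?B" by (rule finite_measureI) (simp add: space_point_measure emeasure_point_measure_finite ennreal_mult_eq_top_iff)
  then have "qcost (cdf (empirical n y c p)) (cdf (empirical n z c p)) \<le> (\<integral>\<^sup>+i. ennreal ((y i - z i)\<^sup>2) \<partial>?B)"
    unfolding empirical_def by (intro qcost_le_coupling) (auto simp: measurable_point_measure_eq1)
  also have "\<dots> = (\<Sum>i | i \<in> {1..n} \<and> c i = p. ennreal (1 / real n) * ennreal ((y i - z i)\<^sup>2))"
    by (simp add: nn_integral_point_measure_finite)
  also have "\<dots> = ennreal ((1 / real n) * (\<Sum>i | i \<in> {1..n} \<and> c i = p. (y i - z i)\<^sup>2))"
    by (simp add: sum_distrib_left ennreal_mult[symmetric] sum_ennreal)
  finally show ?thesis .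
qed

lemma sum_signs_le:
  fixes g :: "nat \<Rightarrow> real"
  assumes "\<And>i. g i \<ge> 0"
  shows "(\<Sum>p\<in>{-1, 1 :: int}. \<Sum>i | i \<in> {1..n} \<and> c i = p. g i) \<le> (\<Sum>i=1..n. g i)"
proof -
  have "(\<Sum>p\<in>{-1, 1 :: int}. \<Sum>i | i \<in> {1..n} \<and> c i = p. g i) = sum g ({i. i \<in> {1..n} \<and> c i = -1} \<union> {i. i \<in> {1..n} \<and> c i = 1})"
    by (subst sum.union_disjoint) auto
  also have "\<dots> \<le> sum g {1..n}" using assms by (intro sum_mono2) auto
  finally show ?thesis .
qed

lemma qcost_empirical_sum:
  assumes "(1 / real n) * (\<Sum>i=1..n. (y i - z i)\<^sup>2) \<le> D"
  shows "(\<Sum>p\<in>{-1, 1}. qcost (cdf (empirical n y c p)) (cdf (empirical n z c p))) \<le> ennreal D"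
proof -
  have "(\<Sum>p\<in>{-1, 1}. qcost (cdf (empirical n y c p)) (cdf (empirical n z c p))) \<le>
     (\<Sum>p\<in>{-1, 1}. ennreal ((1 / real n) * (\<Sum>i | i \<in> {1..n} \<and> c i = p. (y i - z i)\<^sup>2)))"
    by (intro sum_mono qcost_empirical)
  also have "\<dots> = ennreal ((1 / real n) * (\<Sum>p\<in>{-1, 1}. \<Sum>i | i \<in> {1..n} \<and> c i = p. (y i - z i)\<^sup>2))"
    by (subst sum_ennreal) (auto simp: sum_nonneg distrib_left)
  also have "\<dots> \<le> ennreal D"
    using assms sum_signs_le[of "\<lambda>i. (y i - z i)\<^sup>2" n c]
    by (intro ennreal_leI order_trans[OF _ assms] mult_left_mono) auto
  finally show ?thesis .
qed

text \<open>Superadditivity of \<open>liminf\<close>: only the sum over both signs is bounded,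
  whereas lower semicontinuity is available for each sign separately.\<close>

lemma liminf_sum_le_ennreal:
  fixes a b :: "nat \<Rightarrow> ennreal"
  assumes "\<forall>\<^sub>F n in sequentially. a n + b n \<le> D"
  shows "liminf a + liminf b \<le> D"
proof -
  have "liminf a + liminf b = (SUP k. INF n\<in>{k..}. a n) + (SUP k. INF n\<in>{k..}. b n)"
    by (simp add: liminf_SUP_INF)
  also have "\<dots> = (SUP k. (INF n\<in>{k..}. a n) + (INF n\<in>{k..}. b n))"
    by (rule ennreal_SUP_add[symmetric]) (auto simp: incseq_def intro!: INF_superset_mono)
  also have "\<dots> \<le> D"
  proof (rule SUP_least)
    fix k
    from assms obtain N where N: "\<And>n. n \<ge> N \<Longrightarrow> a n + b n \<le> D" by (auto simp: eventually_sequentially)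
    have "(INF n\<in>{k..}. a n) + (INF n\<in>{k..}. b n) \<le> a (max k N) + b (max k N)"
      by (intro add_mono INF_lower) auto
    also have "\<dots> \<le> D" by (rule N) simp
    finally show "(INF n\<in>{k..}. a n) + (INF n\<in>{k..}. b n) \<le> D" .
  qed
  finally show ?thesis .
qed

text \<open>The passage through \<open>qcost\<close> avoids limits of couplings: the index coupling
  bounds the cost for the particles, lower semicontinuity passes to the limit, and the quantile
  coupling returns to \<open>Wass\<close>.\<close>

theorem Wass_limit_le:
  assumes \<rho>: "\<rho> \<in> P2" and \<sigma>: "\<sigma> \<in> P2"
    and w: "\<And>p. p \<in> {-1, 1} \<Longrightarrow> wconv (\<lambda>k. empirical (n k) (y k) (c k) p) (\<rho> p)"
      "\<And>p. p \<in> {-1, 1} \<Longrightarrow> wconv (\<lambda>k. empirical (n k) (z k) (c k) p) (\<sigma> p)"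
    and le: "\<forall>\<^sub>F k in sequentially. (1 / real (n k)) * (\<Sum>i=1..n k. (y k i - z k i)\<^sup>2) \<le> D" and D: "D \<ge> 0"
  shows "Wass \<rho> \<sigma> \<le> sqrt D"
proof (rule Wass_le[OF \<rho> \<sigma> _ _ D])
  have "(\<lambda>k. measure (empirical (n k) (y k) (c k) 1) UNIV) \<longlonglongrightarrow> measure (\<rho> 1) UNIV"
    "(\<lambda>k. measure (empirical (n k) (z k) (c k) 1) UNIV) \<longlonglongrightarrow> measure (\<sigma> 1) UNIV"
    by (intro wconv_mass w fbm_empirical P2D(2)[OF \<rho>] P2D(2)[OF \<sigma>]; simp)+
  then show "measure (\<rho> 1) UNIV = measure (\<sigma> 1) UNIV"
    unfolding measure_empirical by (rule LIMSEQ_unique)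
  let ?q = "\<lambda>p k. qcost (cdf (empirical (n k) (y k) (c k) p)) (cdf (empirical (n k) (z k) (c k) p))"
  have "(\<Sum>p\<in>{-1, 1}. qcost (cdf (\<rho> p)) (cdf (\<sigma> p))) \<le> (\<Sum>p\<in>{-1, 1}. liminf (?q p))"
    by (intro sum_mono qcost_lsc fbm_empirical P2D(2)[OF \<rho>] P2D(2)[OF \<sigma>] w)
  also have "\<dots> = liminf (?q (-1)) + liminf (?q 1)" by simp
  also have "\<dots> \<le> ennreal D"
  proof (rule liminf_sum_le_ennreal)
    show "\<forall>\<^sub>F k in sequentially. ?q (-1) k + ?q 1 k \<le> ennreal D"
      using le
    proof eventually_elim
      case (elim k)
      from qcost_empirical_sum[OF this, of "c k"] show ?case by simp
    qed
  qed
  finally show "(\<Sum>p\<in>{-1, 1}. qcost (cdf (\<rho> p)) (cdf (\<sigma> p))) \<le> ennreal D" .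
qed

section \<open>Potentials and annihilating particles\<close>

text \<open>Right continuity together with the one-sided condition from the left admits downward
  jumps, as the energy has at annihilations. Exceptional points split the interval, by induction on
  their number; without them the sign of the derivative decides.\<close>

lemma nonincreasing_off_finite:
  fixes h :: "real \<Rightarrow> real"
  assumes "finite S" "a \<le> b"
    and "\<And>t. a < t \<Longrightarrow> t < b \<Longrightarrow> t \<notin> S \<Longrightarrow> \<exists>D. (h has_real_derivative D) (at t) \<and> D \<le> 0"
    and "\<And>t. a \<le> t \<Longrightarrow> t < b \<Longrightarrow> (h \<longlongrightarrow> h t) (at_right t)"
    and "\<And>t e. a < t \<Longrightarrow> t \<le> b \<Longrightarrow> e > 0 \<Longrightarrow> \<forall>\<^sub>F s in at_left t. h t - e \<le> h s"
  shows "h b \<le> h a"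
  using assms(2-)
proof (induction "card (S \<inter> {a<..<b})" arbitrary: a b rule: less_induct)
  case (less a b)
  show ?case
  proof (cases "S \<inter> {a<..<b} = {}")
    case False
    then obtain s where s: "s \<in> S" "a < s" "s < b" by auto
    have fin: "finite (S \<inter> {a<..<b})" using \<open>finite S\<close> by blast
    have "S \<inter> {a<..<s} \<subset> S \<inter> {a<..<b}" "S \<inter> {s<..<b} \<subset> S \<inter> {a<..<b}" using s by auto
    then have c: "card (S \<inter> {a<..<s}) < card (S \<inter> {a<..<b})" "card (S \<inter> {s<..<b}) < card (S \<inter> {a<..<b})"
      by (simp_all only: psubset_card_mono[OF fin])
    have "h s \<le> h a"
      by (rule less.hyps[OF c(1)]) (use s less.prems in auto)
    moreover have "h b \<le> h s"
      by (rule less.hyps[OF c(2)]) (use s less.prems in auto)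
    ultimately show ?thesis by linarith
  next
    case True
    show ?thesis
    proof (cases "a = b")
      case False
      with less.prems(1) have ab: "a < b" by simp
      have uv: "h v \<le> h u" if "a < u" "u \<le> v" "v < b" for u v
      proof (rule DERIV_nonpos_imp_nonincreasing[OF that(2)])
        fix t assume "u \<le> t" "t \<le> v"
        then show "\<exists>y. (h has_real_derivative y) (at t) \<and> y \<le> 0"
          using that True by (intro less.prems(2)) auto
      qed
      have bu: "h b \<le> h u" if u: "a < u" "u < b" for u
      proof (rule field_le_epsilon)
        fix e :: real assume "e > 0"
        from less.prems(4)[OF ab order_refl this] have "\<forall>\<^sub>F s in at_left b. h b - e \<le> h s" .
        moreover have "\<forall>\<^sub>F s in at_left b. s \<in> {u<..<b}"
          using eventually_at_left_real[OF u(2)] .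
        ultimately have "\<forall>\<^sub>F s in at_left b. h b - e \<le> h u"
        proof eventually_elim
          case (elim s)
          then have "h s \<le> h u" using uv[of u s] u by auto
          then show ?case using elim by linarith
        qed
        then show "h b \<le> h u + e" by simp
      qed
      show ?thesis
      proof (rule tendsto_lowerbound[OF less.prems(3)[OF order_refl ab]])
        show "\<forall>\<^sub>F u in at_right a. h b \<le> h u"
          using eventually_at_right_real[OF ab] by eventually_elim (use bu in auto)
      qed simp
    qed simp
  qed
qed

text \<open>Action equals reaction: exchanging the two indices turns the second half of the sum into
  the first.\<close>

lemma sum_antisymmetric:
  fixes K :: "nat \<Rightarrow> nat \<Rightarrow> real"
  assumes "\<And>i j. i \<in> A \<Longrightarrow> j \<in> A \<Longrightarrow> K i j = - K j i"
  shows "(\<Sum>i\<in>A. \<Sum>j\<in>A. K i j * (a i - a j)) = 2 * (\<Sum>i\<in>A. \<Sum>j\<in>A. K i j * a i)"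
proof -
  have "(\<Sum>i\<in>A. \<Sum>j\<in>A. K i j * a j) = (\<Sum>j\<in>A. \<Sum>i\<in>A. K i j * a j)" by (rule sum.swap)
  also have "\<dots> = (\<Sum>j\<in>A. \<Sum>i\<in>A. - (K j i * a j))" by (intro sum.cong refl) (metis assms mult_minus_left)
  finally have "(\<Sum>i\<in>A. \<Sum>j\<in>A. K i j * a j) = - (\<Sum>i\<in>A. \<Sum>j\<in>A. K i j * a i)"
    by (simp add: sum_negf)
  then show ?thesis by (simp add: right_diff_distrib sum_subtractf)
qed

text \<open>Where \<open>f\<close> is continuous an essential bound holds pointwise, since a
  violation would persist on an open set, which is not null. The point 0 is covered by
  \<open>f 0 = 0\<close>.\<close>

lemma Linfty_continuous_bound:
  assumes "Linfty f" and cont: "\<And>r. r \<noteq> 0 \<Longrightarrow> isCont f r" and "f 0 = 0"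
  shows "\<exists>C\<ge>0. \<forall>r. \<bar>f r\<bar> \<le> C"
proof -
  obtain C where C: "AE r in lebesgue. \<bar>f r\<bar> \<le> C" using assms(1) by (auto simp: Linfty_def)
  have "\<bar>f r\<bar> \<le> C" if r: "r \<noteq> 0" for r
  proof (rule ccontr)
    assume "\<not> \<bar>f r\<bar> \<le> C"
    then have "C < \<bar>f r\<bar>" by simp
    moreover have "((\<lambda>s. \<bar>f s\<bar>) \<longlongrightarrow> \<bar>f r\<bar>) (nhds r)"
      using cont[OF r] by (intro tendsto_rabs) (simp add: continuous_at tendsto_nhds_iff[symmetric] tendsto_at_iff_tendsto_nhds)
    ultimately have "\<forall>\<^sub>F s in nhds r. C < \<bar>f s\<bar>" by (rule order_tendstoD(1)[rotated])
    then obtain S where S: "open S" "r \<in> S" "\<And>s. s \<in> S \<Longrightarrow> C < \<bar>f s\<bar>" by (auto simp: eventually_nhds)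
    have "AE s in lebesgue. s \<notin> S" using C by eventually_elim (use S(3) in fastforce)
    then have "S \<in> null_sets lebesgue"
      using S(1) by (subst (asm) AE_iff_null_sets[symmetric]) auto
    then show False
      using open_not_negligible[OF S(1)] S(2) by (auto simp: negligible_iff_null_sets)
  qed
  then have "\<bar>f r\<bar> \<le> max C 0" for r using assms(3) by (cases "r = 0") (auto simp: le_max_iff_disj)
  then show ?thesis by (intro exI[of _ "max C 0"]) auto
qed

lemma has_real_derivative_even:
  fixes f :: "real \<Rightarrow> real"
  assumes "\<And>r. f (- r) = f r" and "(f has_real_derivative D) (at r)"
  shows "(f has_real_derivative - D) (at (- r))"
proof -
  have "((\<lambda>s. f (- s)) has_real_derivative D * - 1) (at (- r))"
    by (rule DERIV_chain2[where f=f]) (auto intro!: derivative_eq_intros simp: assms(2))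
  then show ?thesis by (simp add: assms(1))
qed

lemma potential_facts:
  assumes "standing_assumptions V W"
  shows V_deriv: "\<And>r. r \<noteq> 0 \<Longrightarrow> (V has_real_derivative dV V r) (at r)"
    and dV_isCont: "\<And>r. r \<noteq> 0 \<Longrightarrow> isCont (dV V) r"
    and W_deriv: "\<And>r. (W has_real_derivative deriv W r) (at r)"
    and dW_isCont: "\<And>r. isCont (deriv W) r"
    and dV_odd: "\<And>r. dV V (- r) = - dV V r"
    and dW_odd: "\<And>r. deriv W (- r) = - deriv W r"
    and V_at_top: "filterlim V at_top (at 0)"
proof -
  have VW: "V C1_differentiable_on (- {0})" "W C1_differentiable_on UNIV" "\<And>r. V (- r) = V r" "\<And>r. W (- r) = W r"
    "filterlim V at_top (at 0)" and L: "\<exists>L. L-lipschitz_on UNIV (deriv W)"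
    using assms by (auto simp: standing_assumptions_def)
  show "filterlim V at_top (at 0)" by fact
  obtain D where D: "\<And>r. r \<noteq> 0 \<Longrightarrow> (V has_real_derivative D r) (at r)" "continuous_on (- {0}) D"
    using VW(1) by (auto simp: C1_differentiable_on_def has_real_derivative_iff_has_vector_derivative)
  have dVD: "dV V r = D r" if "r \<noteq> 0" for r
    using DERIV_imp_deriv[OF D(1)[OF that]] that by (simp add: dV_def)
  show Vd: "(V has_real_derivative dV V r) (at r)" if "r \<noteq> 0" for r
    using D(1)[OF that] dVD[OF that] by simp
  have "continuous_on (- {0}) (dV V)"
    using continuous_on_cong[of "- {0}" "- {0}" "dV V" D] dVD D(2) by auto
  then show "isCont (dV V) r" if "r \<noteq> 0" for r
    using that by (subst (asm) continuous_on_eq_continuous_at) auto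
  obtain E where E: "\<And>r. (W has_real_derivative E r) (at r)"
    using VW(2) by (auto simp: C1_differentiable_on_def has_real_derivative_iff_has_vector_derivative)
  show Wd: "(W has_real_derivative deriv W r) (at r)" for r
    using E[of r] DERIV_imp_deriv[OF E[of r]] by simp
  show "isCont (deriv W) r" for r
    using L lipschitz_on_continuous_on continuous_on_eq_continuous_at[OF open_UNIV] by blast
  show "dV V (- r) = - dV V r" for r
  proof (cases "r = 0")
    case False
    then show ?thesis
      using DERIV_unique[OF Vd[of "- r"] has_real_derivative_even[OF VW(3) Vd[of r]]] by simp
  qed (simp add: dV_def)
  show "deriv W (- r) = - deriv W r" for r
    by (rule DERIV_unique[OF Wd[of "- r"] has_real_derivative_even[OF VW(4) Wd[of r]]])
qed

text \<open>\<open>W'\<close> is bounded through \<open>r W'(r)\<close> away from 0 and through its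
  Lipschitz constant near 0, so \<open>W\<close> grows at most linearly. \<open>V\<close> is
  nonnegative near 0 and has bounded slope beyond. Both therefore lie above a negative quadratic;
  one constant serves all bounds.\<close>

lemma potential_bounds:
  assumes pot: "standing_assumptions V W"
  shows "\<exists>C\<ge>0. \<forall>r. \<bar>r * dV V r\<bar> \<le> C \<and> \<bar>r * deriv W r\<bar> \<le> C \<and> \<bar>deriv W r\<bar> \<le> C \<and>
    (r \<noteq> 0 \<longrightarrow> 0 \<le> V r + C * (1 + r\<^sup>2)) \<and> 0 \<le> W r + C * (1 + r\<^sup>2)"
proof -
  note facts = potential_facts[OF pot]
  have "Linfty (\<lambda>r. r * dV V r)" "Linfty (\<lambda>r. r * deriv W r)" and even: "\<And>r. V (- r) = V r" "\<And>r. W (- r) = W r"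
    and "\<exists>L. L-lipschitz_on UNIV (deriv W)"
    using pot by (auto simp: standing_assumptions_def)
  then obtain C1 C2 L where C1: "C1 \<ge> 0" "\<And>r. \<bar>r * dV V r\<bar> \<le> C1" and C2: "C2 \<ge> 0" "\<And>r. \<bar>r * deriv W r\<bar> \<le> C2"
    and L: "L-lipschitz_on UNIV (deriv W)"
    using Linfty_continuous_bound[of "\<lambda>r. r * dV V r"] Linfty_continuous_bound[of "\<lambda>r. r * deriv W r"]
      facts(2,4) by fastforce
  have L0: "L \<ge> 0" using L by (rule lipschitz_on_nonneg)
  define C3 where "C3 = C2 + L + \<bar>deriv W 0\<bar>"
  have C3: "\<bar>deriv W r\<bar> \<le> C3" for r
  proof (cases "\<bar>r\<bar> \<ge> 1")
    case True
    have "\<bar>deriv W r\<bar> \<le> \<bar>r\<bar> * \<bar>deriv W r\<bar>" using True mult_right_mono[of 1 "\<bar>r\<bar>" "\<bar>deriv W r\<bar>"] by simp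
    also have "\<dots> \<le> C2" using C2(2)[of r] by (simp add: abs_mult)
    finally show ?thesis using L0 by (simp add: C3_def)
  next
    case False
    have "\<bar>deriv W r - deriv W 0\<bar> \<le> L * \<bar>r\<bar>" using lipschitz_onD[OF L, of r 0] by (simp add: dist_real_def)
    also have "\<dots> \<le> L * 1" using False L0 by (intro mult_left_mono) auto
    finally show ?thesis using C2(1) by (simp add: C3_def)
  qed
  have C30: "C3 \<ge> 0" using C3[of 0] by linarith
  have quad: "\<bar>r\<bar> \<le> 1 + r\<^sup>2" for r :: real
  proof -
    have "0 \<le> (\<bar>r\<bar> - 1)\<^sup>2" by simp
    then have "2 * \<bar>r\<bar> \<le> 1 + r\<^sup>2" by (simp add: power2_diff)
    then show ?thesis by simp
  qed
  define C4 where "C4 = \<bar>W 0\<bar> + C3"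
  have C4: "0 \<le> W r + C4 * (1 + r\<^sup>2)" for r
  proof -
    have "\<exists>\<xi>. W r = W 0 + r * deriv W \<xi>"
    proof (cases "r = 0")
      case False
      then consider "0 < r" | "r < 0" by linarith
      then show ?thesis
      proof cases
        case 1 from MVT2[OF this, of W "deriv W"] facts(3) show ?thesis by (auto simp: algebra_simps)
      next
        case 2
        from MVT2[OF this, of W "deriv W"] facts(3) obtain z where "W 0 - W r = (0 - r) * deriv W z" by auto
        then have "W r = W 0 + r * deriv W z" by (simp add: algebra_simps)
        then show ?thesis ..
      qed
    qed auto
    then obtain \<xi> where \<xi>: "W r = W 0 + r * deriv W \<xi>" by blast
    have "\<bar>r * deriv W \<xi>\<bar> \<le> C3 * (1 + r\<^sup>2)"
      using mult_mono[OF quad C3, of r \<xi>] by (simp add: abs_mult mult.commute)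
    moreover have "\<bar>W 0\<bar> * 1 \<le> \<bar>W 0\<bar> * (1 + r\<^sup>2)" by (intro mult_left_mono) auto
    ultimately show ?thesis unfolding C4_def \<xi> by (simp add: distrib_right)
  qed
  have "\<forall>\<^sub>F r in at 0. V r \<ge> 0" using facts(7) by (simp add: filterlim_at_top)
  then obtain d where d: "d > 0" "\<And>r. r \<noteq> 0 \<Longrightarrow> \<bar>r\<bar> < d \<Longrightarrow> V r \<ge> 0"
    by (auto simp: eventually_at dist_real_def)
  \<comment> \<open>\<open>V\<close> is nonnegative up to \<open>a\<close>, and beyond
    \<open>a\<close> its slope is at most \<open>C1 / a\<close>, by the bound on
    \<open>r V'(r)\<close>.\<close>
  define a where "a = d / 2"
  have a: "a > 0" "V a \<ge> 0" using d by (auto simp: a_def)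
  define C5 where "C5 = C1 / a"
  have C50: "C5 \<ge> 0" using C1 a by (simp add: C5_def)
  have C5pos: "0 \<le> V r + C5 * (1 + r\<^sup>2)" if r: "r > 0" for r
  proof (cases "r \<le> a")
    case True
    then have "V r \<ge> 0" using d r by (auto simp: a_def)
    then show ?thesis using C50 by (simp add: add_nonneg_nonneg)
  next
    case False
    then have "a < r" by simp
    from MVT2[OF this, of V "dV V"] facts(1) a obtain \<xi> where \<xi>: "a < \<xi>" "\<xi> < r" "V r - V a = (r - a) * dV V \<xi>" by auto
    have "a * \<bar>dV V \<xi>\<bar> \<le> \<bar>\<xi>\<bar> * \<bar>dV V \<xi>\<bar>" using \<xi> a by (intro mult_right_mono) auto
    also have "\<dots> \<le> C1" using C1(2)[of \<xi>] by (simp add: abs_mult)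
    finally have "\<bar>dV V \<xi>\<bar> \<le> C5" using a by (simp add: C5_def field_simps)
    then have "\<bar>(r - a) * dV V \<xi>\<bar> \<le> r * C5" using \<xi> a by (auto simp: abs_mult intro!: mult_mono)
    also have "\<dots> \<le> (1 + r\<^sup>2) * C5" using quad[of r] r C50 by (intro mult_right_mono) auto
    finally show ?thesis using \<xi>(3) a by (simp add: mult.commute)
  qed
  have C5: "0 \<le> V r + C5 * (1 + r\<^sup>2)" if "r \<noteq> 0" for r
    using C5pos[of r] C5pos[of "- r"] that even(1)[of r] by (cases "r > 0") auto
  define C where "C = C1 + C2 + C3 + C4 + C5"
  have C40: "C4 \<ge> 0" using C30 by (simp add: C4_def)
  note ge = C1(1) C2(1) C30 C40 C50
  have up: "0 \<le> y + C * (1 + r\<^sup>2)" if "0 \<le> y + K * (1 + r\<^sup>2)" "K \<le> C" for y K r :: real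
    using mult_right_mono[OF that(2), of "1 + r\<^sup>2"] that(1) by (smt (verit) zero_le_power2)
  show ?thesis
  proof (intro exI[of _ C] conjI allI impI)
    show "0 \<le> C" using ge by (simp add: C_def)
    fix r
    show "\<bar>r * dV V r\<bar> \<le> C" using C1(2)[of r] ge by (simp add: C_def)
    show "\<bar>r * deriv W r\<bar> \<le> C" using C2(2)[of r] ge by (simp add: C_def)
    show "\<bar>deriv W r\<bar> \<le> C" using C3[of r] ge by (simp add: C_def)
    show "0 \<le> V r + C * (1 + r\<^sup>2)" if "r \<noteq> 0" by (rule up[OF C5[OF that]]) (use ge in \<open>simp add: C_def\<close>)
    show "0 \<le> W r + C * (1 + r\<^sup>2)" by (rule up[OF C4]) (use ge in \<open>simp add: C_def\<close>)
  qed
qed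

text \<open>A discrete solution in the form used below. Signs are expressed by the death times
  \<open>\<tau>\<close>: a particle is already dead at its death time, since the Heaviside function
  vanishes at 0. The chain of infima defining the collision times is condensed into
  \<open>no_meeting\<close>.\<close>

locale annihilating_particles =
  fixes V W :: "real \<Rightarrow> real" and n :: nat and T :: real and x0 :: "nat \<Rightarrow> real" and b0 :: "nat \<Rightarrow> int"
    and x :: "real \<Rightarrow> nat \<Rightarrow> real" and b :: "real \<Rightarrow> nat \<Rightarrow> int" and \<tau> :: "nat \<Rightarrow> ereal" and Lx C :: real
  assumes n_pos: "n \<ge> 1" and T_pos: "T > 0"
    and signs: "\<And>i. i \<in> {1..n} \<Longrightarrow> b0 i \<in> {-1, 1}"
    and ordered: "strict_mono_on {1..n} x0"
    and potentials: "standing_assumptions V W"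
    and C_nonneg: "C \<ge> 0"
    and dV_bound: "\<And>r. \<bar>r * dV V r\<bar> \<le> C" and rdW_bound: "\<And>r. \<bar>r * deriv W r\<bar> \<le> C" and dW_bound: "\<And>r. \<bar>deriv W r\<bar> \<le> C"
    and V_lower: "\<And>r. r \<noteq> 0 \<Longrightarrow> 0 \<le> V r + C * (1 + r\<^sup>2)" and W_lower: "\<And>r. 0 \<le> W r + C * (1 + r\<^sup>2)"
    and lip: "\<And>i. i \<in> {1..n} \<Longrightarrow> Lx-lipschitz_on {0..T} (\<lambda>t. x t i)"
    and init: "\<And>i. i \<in> {1..n} \<Longrightarrow> x 0 i = x0 i"
    and \<tau>: "\<And>i. i \<in> {1..n} \<Longrightarrow> \<tau> i \<in> ereal ` {0<..<T} \<union> {\<infinity>}"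
    and b_eq: "\<And>i t. i \<in> {1..n} \<Longrightarrow> t \<in> {0..T} \<Longrightarrow> b t i = (if ereal t < \<tau> i then b0 i else 0)"
    and ode: "\<And>i t. i \<in> {1..n} \<Longrightarrow> t \<in> {0<..<T} \<Longrightarrow> (\<And>k. k \<in> {1..n} \<Longrightarrow> \<tau> k \<noteq> ereal t) \<Longrightarrow>
       ((\<lambda>s. x s i) has_real_derivative
          (- (1 / real n) * (\<Sum>j\<in>{j\<in>{1..n}. b t i * b t j = 1}. dV V (x t i - x t j))
            - (1 / real n) * (\<Sum>j\<in>{j\<in>{1..n}. b t i * b t j = -1}. deriv W (x t i - x t j)))) (at t)"
    and no_meeting: "\<And>i j t. i \<in> {1..n} \<Longrightarrow> j \<in> {1..n} \<Longrightarrow> t \<in> {0<..<T} \<Longrightarrow> ereal t < \<tau> i \<Longrightarrow> ereal t < \<tau> j \<Longrightarrow>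
       b0 i * b0 j = -1 \<Longrightarrow> x t i \<noteq> x t j"
    and annihilation: "\<And>t. t \<in> {0..T} \<Longrightarrow> \<exists>\<alpha>.
       bij_betw \<alpha> {i\<in>{1..n}. b0 i = 1 \<and> \<tau> i \<le> ereal t} {j\<in>{1..n}. b0 j = -1 \<and> \<tau> j \<le> ereal t} \<and>
       (\<forall>i\<in>{i\<in>{1..n}. b0 i = 1 \<and> \<tau> i \<le> ereal t}. x t i = x t (\<alpha> i))"

lemma annihilating_particlesI:
  assumes n: "n \<ge> 1" and T: "T > 0" and sgn: "\<And>i. i \<in> {1..n} \<Longrightarrow> b0 i \<in> {-1, 1}" and ord: "strict_mono_on {1..n} x0"
    and pot: "standing_assumptions V W" and C: "C \<ge> 0"
      "\<And>r. \<bar>r * dV V r\<bar> \<le> C" "\<And>r. \<bar>r * deriv W r\<bar> \<le> C" "\<And>r. \<bar>deriv W r\<bar> \<le> C"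
      "\<And>r. r \<noteq> 0 \<Longrightarrow> 0 \<le> V r + C * (1 + r\<^sup>2)" "\<And>r. 0 \<le> W r + C * (1 + r\<^sup>2)"
    and sol: "discrete_solution V W n T x0 b0 x b"
  shows "\<exists>\<tau> Lx. annihilating_particles V W n T x0 b0 x b \<tau> Lx C"
proof -
  from sol obtain Lx \<tau> K tc where lip: "\<forall>i\<in>{1..n}. Lx-lipschitz_on {0..T} (\<lambda>t. x t i)"
    and init: "\<forall>i\<in>{1..n}. x 0 i = x0 i \<and> b 0 i = b0 i"
    and ode: "\<forall>i\<in>{1..n}. \<forall>t\<in>{0<..<T} - jump_set n T b. ((\<lambda>s. x s i) has_real_derivative
           (- (1 / real n) * (\<Sum>j\<in>{j\<in>{1..n}. b t i * b t j = 1}. dV V (x t i - x t j))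
            - (1 / real n) * (\<Sum>j\<in>{j\<in>{1..n}. b t i * b t j = -1}. deriv W (x t i - x t j)))) (at t)"
    and \<tau>: "\<forall>i\<in>{1..n}. \<tau> i \<in> ereal ` {0<..<T} \<union> {\<infinity>}"
    and J: "ereal ` jump_set n T b = \<tau> ` {1..n} - {\<infinity>}"
    and b: "\<forall>i\<in>{1..n}. \<forall>t\<in>{0..T}. b t i = b0 i * heaviside (\<tau> i - ereal t)"
    and tc0: "tc (0::nat) = 0" and tcmono: "strict_mono_on {1..K} tc" and tcJ: "tc ` {1..K} = jump_set n T b"
    and inf: "\<forall>k\<in>{1..K}. ereal (tc k) = (INF t\<in>meeting_times n T x (b (tc (k - 1))). ereal t) \<and> tc (k - 1) < tc k"
    and last: "meeting_times n T x (b (tc K)) = {}"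
    and ann: "\<forall>t\<in>{0..T}. \<exists>\<alpha>.
           bij_betw \<alpha> {i\<in>{1..n}. b0 i = 1 \<and> \<tau> i \<le> ereal t} {j\<in>{1..n}. b0 j = -1 \<and> \<tau> j \<le> ereal t} \<and>
           (\<forall>i\<in>{i\<in>{1..n}. b0 i = 1 \<and> \<tau> i \<le> ereal t}. x t i = x t (\<alpha> i))"
    unfolding discrete_solution_def by (elim conjE exE) (rule that; assumption)
  have b_eq: "b t i = (if ereal t < \<tau> i then b0 i else 0)" if "i \<in> {1..n}" "t \<in> {0..T}" for i t
  proof -
    have "\<tau> i - ereal t > 0 \<longleftrightarrow> ereal t < \<tau> i" by (cases "\<tau> i") auto
    then show ?thesis using b that by (auto simp: heaviside_def)
  qed
  have tcT: "tc k \<in> {0..T}" if "k \<le> K" for k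
  proof (cases "k = 0")
    case False
    then have "tc k \<in> jump_set n T b" using that tcJ by force
    then show ?thesis by (auto simp: jump_set_def)
  qed (use tc0 T in auto)
  have no_meeting: False
    if ij: "i \<in> {1..n}" "j \<in> {1..n}" and t: "t \<in> {0<..<T}" and live: "ereal t < \<tau> i" "ereal t < \<tau> j"
      and opp: "b0 i * b0 j = -1" and meet: "x t i = x t j" for i j t
  proof -
    \<comment> \<open>The last collision index with time not after \<open>t\<close>. Both particles
      still carry their signs there, so \<open>t\<close> is a meeting time for that sign pattern:
      either the next collision comes no later than \<open>t\<close>, or a meeting happens after the
      last collision. Both are impossible.\<close>
    define k where "k = Max {k\<in>{0..K}. tc k \<le> t}"
    have "0 \<in> {k\<in>{0..K}. tc k \<le> t}" using t tc0 by auto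
    then have ne: "{k\<in>{0..K}. tc k \<le> t} \<noteq> {}" by blast
    have k: "k \<le> K" "tc k \<le> t" using Max_in[OF _ ne] by (auto simp: k_def)
    have "ereal (tc k) < \<tau> i" "ereal (tc k) < \<tau> j"
      using k(2) live by (auto intro: le_less_trans[of _ "ereal t"])
    then have "b (tc k) i = b0 i" "b (tc k) j = b0 j" using b_eq[OF _ tcT[OF k(1)]] ij by auto
    then have mt: "t \<in> meeting_times n T x (b (tc k))"
      unfolding meeting_times_def using ij t opp meet by (intro CollectI conjI bexI[of _ i] bexI[of _ j]) auto
    show False
    proof (cases "k = K")
      case True
      then show False using mt last by simp
    next
      case False
      then have k1: "Suc k \<in> {1..K}" using k by auto
      from inf[rule_format, OF k1] have "ereal (tc (Suc k)) \<le> ereal t"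
        using INF_lower[OF mt, of ereal] by simp
      then have "Suc k \<in> {k\<in>{0..K}. tc k \<le> t}" using k1 by auto
      then have "Suc k \<le> k" unfolding k_def by (intro Max_ge) auto
      then show False by simp
    qed
  qed
  have ode': "((\<lambda>s. x s i) has_real_derivative
           (- (1 / real n) * (\<Sum>j\<in>{j\<in>{1..n}. b t i * b t j = 1}. dV V (x t i - x t j))
            - (1 / real n) * (\<Sum>j\<in>{j\<in>{1..n}. b t i * b t j = -1}. deriv W (x t i - x t j)))) (at t)"
    if "i \<in> {1..n}" "t \<in> {0<..<T}" "\<And>k. k \<in> {1..n} \<Longrightarrow> \<tau> k \<noteq> ereal t" for i t
  proof -
    have "t \<notin> jump_set n T b"
    proof
      assume "t \<in> jump_set n T b"
      then have "ereal t \<in> \<tau> ` {1..n}" using J by blast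
      then obtain k where "k \<in> {1..n}" "\<tau> k = ereal t" by force
      then show False using that(3) by blast
    qed
    then show ?thesis using ode that by blast
  qed
  have "annihilating_particles V W n T x0 b0 x b \<tau> Lx C"
    by unfold_locales (use assms lip init \<tau> b_eq ode' no_meeting ann in blast)+
  then show ?thesis by blast
qed

section \<open>Velocities, virial identities and one-sided limits of the live set\<close>

context annihilating_particles
begin

definition live :: "real \<Rightarrow> nat \<Rightarrow> bool" where
  "live t i \<longleftrightarrow> ereal t < \<tau> i"

text \<open>Self-interaction vanishes because \<open>dV V 0 = 0\<close>, so sums over
  \<open>j\<close> run over the diagonal, as in the equation.\<close>

definition K :: "real \<Rightarrow> nat \<Rightarrow> nat \<Rightarrow> real" where
  "K t i j = (if live t i \<and> live t j then if b0 i = b0 j then dV V (x t i - x t j) else deriv W (x t i - x t j) else 0)"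

definition vel :: "real \<Rightarrow> nat \<Rightarrow> real" where
  "vel t i = - (1 / real n) * (\<Sum>j=1..n. K t i j)"

definition J :: "real set" where
  "J = {t. \<exists>i\<in>{1..n}. \<tau> i = ereal t}"

lemma finite_J: "finite J"
proof (rule finite_subset)
  show "J \<subseteq> (\<lambda>i. real_of_ereal (\<tau> i)) ` {1..n}"
  proof
    fix t assume "t \<in> J"
    then obtain i where "i \<in> {1..n}" "\<tau> i = ereal t" by (auto simp: J_def)
    then show "t \<in> (\<lambda>i. real_of_ereal (\<tau> i)) ` {1..n}" by (intro image_eqI[of _ _ i]) auto
  qed
qed simp

lemma \<tau>_cases:
  assumes "i \<in> {1..n}"
  obtains "\<tau> i = \<infinity>" | r where "\<tau> i = ereal r" "0 < r" "r < T"
  using \<tau>[OF assms] by auto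

lemma sgn_product:
  assumes "i \<in> {1..n}" "j \<in> {1..n}"
  shows "b0 i * b0 j = 1 \<longleftrightarrow> b0 i = b0 j" "b0 i * b0 j = -1 \<longleftrightarrow> b0 i \<noteq> b0 j"
  using signs[OF assms(1)] signs[OF assms(2)] by auto

lemma ode_vel:
  assumes i: "i \<in> {1..n}" and t: "t \<in> {0<..<T}" "t \<notin> J"
  shows "((\<lambda>s. x s i) has_real_derivative vel t i) (at t)"
proof -
  have bt: "b t k = (if live t k then b0 k else 0)" if "k \<in> {1..n}" for k
    using b_eq[OF that, of t] t by (auto simp: live_def)
  have "(\<Sum>j\<in>{j\<in>{1..n}. b t i * b t j = 1}. dV V (x t i - x t j)) + (\<Sum>j\<in>{j\<in>{1..n}. b t i * b t j = -1}. deriv W (x t i - x t j))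
    = (\<Sum>j=1..n. (if b t i * b t j = 1 then dV V (x t i - x t j) else 0) + (if b t i * b t j = -1 then deriv W (x t i - x t j) else 0))"
    by (simp only: sum.distrib sum.inter_filter finite_atLeastAtMost)
  also have "\<dots> = (\<Sum>j=1..n. K t i j)"
  proof (rule sum.cong[OF refl])
    fix j assume j: "j \<in> {1..n}"
    show "(if b t i * b t j = 1 then dV V (x t i - x t j) else 0) + (if b t i * b t j = -1 then deriv W (x t i - x t j) else 0) = K t i j"
      using sgn_product[OF i j] unfolding K_def bt[OF i] bt[OF j] by (cases "live t i"; cases "live t j") auto
  qed
  finally have h: "(\<Sum>j\<in>{j\<in>{1..n}. b t i * b t j = 1}. dV V (x t i - x t j)) + (\<Sum>j\<in>{j\<in>{1..n}. b t i * b t j = -1}. deriv W (x t i - x t j)) = (\<Sum>j=1..n. K t i j)" .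
  have "- (1 / real n) * (\<Sum>j\<in>{j\<in>{1..n}. b t i * b t j = 1}. dV V (x t i - x t j))
            - (1 / real n) * (\<Sum>j\<in>{j\<in>{1..n}. b t i * b t j = -1}. deriv W (x t i - x t j)) = vel t i"
    unfolding vel_def h[symmetric] by (simp add: distrib_left)
  then show ?thesis using ode[OF i t(1)] t(2) by (auto simp: J_def)
qed

lemma K_antisym: "K t i j = - K t j i"
  using dV_odd[OF potentials, of "x t j - x t i"] dW_odd[OF potentials, of "x t j - x t i"] by (simp add: K_def)

lemma K_bound: "\<bar>K t i j * (x t i - x t j)\<bar> \<le> C"
  using dV_bound[of "x t i - x t j"] rdW_bound[of "x t i - x t j"] C_nonneg by (simp add: K_def mult.commute)

lemma vel_dead: "\<not> live t i \<Longrightarrow> vel t i = 0"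
  by (simp add: vel_def K_def)

lemma sum_K: "(\<Sum>j=1..n. K t i j) = - real n * vel t i"
  using n_pos by (simp add: vel_def)

lemma sum_K_vel: "(\<Sum>i=1..n. \<Sum>j=1..n. K t i j * a i) = - real n * (\<Sum>i=1..n. vel t i * a i)"
proof -
  have "(\<Sum>j=1..n. K t i j * a i) = - real n * (vel t i * a i)" for i
    by (simp only: sum_distrib_right[symmetric] sum_K mult.assoc)
  then show ?thesis by (simp add: sum_distrib_left)
qed

text \<open>The forces cancel in pairs: this is \<open>sum_antisymmetric\<close> with a constant
  \<open>a\<close>.\<close>

lemma sum_vel: "(\<Sum>i=1..n. vel t i) = 0"
proof -
  have "2 * (\<Sum>i=1..n. \<Sum>j=1..n. K t i j * 1) = (\<Sum>i=1..n. \<Sum>j=1..n. K t i j * (1 - 1))"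
    by (rule sum_antisymmetric[symmetric]) (rule K_antisym)
  then show ?thesis using n_pos unfolding sum_K_vel by simp
qed

text \<open>Virial identity: symmetrising replaces \<open>x i\<close> by half of
  \<open>x i - x j\<close>, against which every force is bounded by \<open>C\<close>.\<close>

lemma sum_x_vel: "\<bar>\<Sum>i=1..n. x t i * vel t i\<bar> \<le> real n * C / 2"
proof -
  have "2 * (- real n * (\<Sum>i=1..n. vel t i * x t i)) = (\<Sum>i=1..n. \<Sum>j=1..n. K t i j * (x t i - x t j))"
    unfolding sum_K_vel[symmetric] by (rule sum_antisymmetric[symmetric]) (rule K_antisym)
  also have "\<bar>\<dots>\<bar> \<le> (\<Sum>i=1..n. \<Sum>j=1..n. C)"
    by (rule order_trans[OF sum_abs sum_mono], rule order_trans[OF sum_abs sum_mono], rule K_bound)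
  finally have "2 * real n * \<bar>\<Sum>i=1..n. vel t i * x t i\<bar> \<le> real n * (real n * C)"
    by (simp add: abs_mult)
  then show ?thesis using n_pos by (simp add: mult.commute)
qed

lemma x_cont: "i \<in> {1..n} \<Longrightarrow> continuous_on {0..T} (\<lambda>t. x t i)"
  using lip by (rule lipschitz_on_continuous_on)

lemma x_tendsto:
  assumes i: "i \<in> {1..n}"
  shows x_right: "0 \<le> t \<Longrightarrow> t < T \<Longrightarrow> ((\<lambda>s. x s i) \<longlongrightarrow> x t i) (at_right t)"
    and x_left: "0 < t \<Longrightarrow> t \<le> T \<Longrightarrow> ((\<lambda>s. x s i) \<longlongrightarrow> x t i) (at_left t)"
proof -
  have *: "((\<lambda>s. x s i) \<longlongrightarrow> x t i) (at t within {0..T})" if "t \<in> {0..T}"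
    using x_cont[OF i] that by (auto simp: continuous_on_def)
  { assume t: "0 \<le> t" "t < T"
    then have "((\<lambda>s. x s i) \<longlongrightarrow> x t i) (at t within {t..T})"
      by (intro tendsto_within_subset[OF *]) auto
    then show "((\<lambda>s. x s i) \<longlongrightarrow> x t i) (at_right t)" using t by (simp add: at_within_Icc_at_right) }
  { assume t: "0 < t" "t \<le> T"
    then have "((\<lambda>s. x s i) \<longlongrightarrow> x t i) (at t within {0..t})"
      by (intro tendsto_within_subset[OF *]) auto
    then show "((\<lambda>s. x s i) \<longlongrightarrow> x t i) (at_left t)" using t by (simp add: at_within_Icc_at_left) }
qed

lemma live_near:
  assumes "t \<notin> J" shows "\<forall>\<^sub>F s in nhds t. \<forall>i\<in>{1..n}. live s i = live t i"
proof (rule eventually_ball_finite, simp, rule ballI)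
  fix i assume i: "i \<in> {1..n}"
  show "\<forall>\<^sub>F s in nhds t. live s i = live t i"
  proof (cases rule: \<tau>_cases[OF i])
    case (2 r)
    have "t \<noteq> r" using assms i 2 by (auto simp: J_def)
    then consider "t < r" | "r < t" by linarith
    then show ?thesis
    proof cases
      case 1
      have "\<forall>\<^sub>F s in nhds t. s < r" by (rule order_tendstoD(2)[OF filterlim_ident 1])
      then show ?thesis by eventually_elim (use 1 2 in \<open>auto simp: live_def\<close>)
    next
      case b: 2
      have "\<forall>\<^sub>F s in nhds t. r < s" by (rule order_tendstoD(1)[OF filterlim_ident b])
      then show ?thesis by eventually_elim (use b 2 in \<open>auto simp: live_def\<close>)
    qed
  qed (simp add: live_def)
qed

lemma live_right: "\<forall>\<^sub>F s in at_right t. \<forall>i\<in>{1..n}. live s i = live t i"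
proof (rule eventually_ball_finite, simp, rule ballI)
  fix i assume i: "i \<in> {1..n}"
  show "\<forall>\<^sub>F s in at_right t. live s i = live t i"
  proof (cases rule: \<tau>_cases[OF i])
    case (2 r)
    show ?thesis
    proof (cases "t < r")
      case True
      have "\<forall>\<^sub>F s in at_right t. s < r" by (rule order_tendstoD(2)[OF tendsto_ident_at True])
      then show ?thesis by eventually_elim (use True 2 in \<open>auto simp: live_def\<close>)
    next
      case False
      have "\<forall>\<^sub>F s in at_right t. t < s" by (rule eventually_at_right_less)
      then show ?thesis by eventually_elim (use False 2 in \<open>auto simp: live_def\<close>)
    qed
  qed (simp add: live_def)
qed

text \<open>The non-strict inequality matters: particles that die at \<open>t\<close> are alive just
  before it, whereas in \<open>live_right\<close> they are dead.\<close>

lemma live_left: "\<forall>\<^sub>F s in at_left t. \<forall>i\<in>{1..n}. live s i = (ereal t \<le> \<tau> i)"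
proof (rule eventually_ball_finite, simp, rule ballI)
  fix i assume i: "i \<in> {1..n}"
  show "\<forall>\<^sub>F s in at_left t. live s i = (ereal t \<le> \<tau> i)"
  proof (cases rule: \<tau>_cases[OF i])
    case (2 r)
    show ?thesis
    proof (cases "r < t")
      case True
      have "\<forall>\<^sub>F s in at_left t. r < s" by (rule order_tendstoD(1)[OF tendsto_ident_at True])
      then show ?thesis by eventually_elim (use True 2 in \<open>auto simp: live_def\<close>)
    next
      case False
      have "\<forall>\<^sub>F s in at_left t. s \<in> {t - 1<..<t}" by (rule eventually_at_left_real) simp
      then show ?thesis by eventually_elim (use False 2 in \<open>auto simp: live_def\<close>)
    qed
  qed (simp add: live_def)
qed

definition pair_energy :: "real \<Rightarrow> nat \<Rightarrow> nat \<Rightarrow> real" where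
  "pair_energy t i j = (if b0 i = b0 j then V (x t i - x t j) else W (x t i - x t j)) + C * (1 + (x t i - x t j)\<^sup>2)"

text \<open>The quadratic part makes every pair contribute a non-negative amount, so that annihilation can
  only decrease \<open>G\<close>; its growth along the flow is bounded because the mean position of the live
  particles is conserved and \<open>r V'(r)\<close>, \<open>r W'(r)\<close> are bounded.\<close>

definition G :: "real \<Rightarrow> real" where
  "G t = 1 / (2 * (real n)\<^sup>2) * (\<Sum>i=1..n. \<Sum>j=1..n. if i \<noteq> j \<and> live t i \<and> live t j then pair_energy t i j else 0)"

text \<open>A clash at \<open>t\<close> involves particles alive just before \<open>t\<close>, including those annihilated at \<open>t\<close>.\<close>

definition clash :: "real \<Rightarrow> bool" where
  "clash t \<longleftrightarrow> (\<exists>i\<in>{1..n}. \<exists>j\<in>{1..n}. i \<noteq> j \<and> b0 i = b0 j \<and> ereal t \<le> \<tau> i \<and> ereal t \<le> \<tau> j \<and> x t i = x t j)"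

section \<open>Evolution of the corrected energy and absence of clashes\<close>

lemma no_clashD:
  "\<not> clash t \<Longrightarrow> i \<in> {1..n} \<Longrightarrow> j \<in> {1..n} \<Longrightarrow> i \<noteq> j \<Longrightarrow> ereal t \<le> \<tau> i \<Longrightarrow> ereal t \<le> \<tau> j \<Longrightarrow> b0 i \<noteq> b0 j \<or> x t i \<noteq> x t j"
  unfolding clash_def by blast

lemma pair_energy_nonneg: "b0 i \<noteq> b0 j \<or> x t i \<noteq> x t j \<Longrightarrow> 0 \<le> pair_energy t i j"
  using V_lower[of "x t i - x t j"] W_lower[of "x t i - x t j"] by (auto simp: pair_energy_def)

lemma pair_energy_tendsto:
  assumes "((\<lambda>s. x s i) \<longlongrightarrow> x t i) F" "((\<lambda>s. x s j) \<longlongrightarrow> x t j) F" and ne: "b0 i \<noteq> b0 j \<or> x t i \<noteq> x t j"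
  shows "((\<lambda>s. pair_energy s i j) \<longlongrightarrow> pair_energy t i j) F"
proof -
  have d: "((\<lambda>s. x s i - x s j) \<longlongrightarrow> x t i - x t j) F" by (intro tendsto_diff assms)
  have "((\<lambda>s. if b0 i = b0 j then V (x s i - x s j) else W (x s i - x s j)) \<longlongrightarrow>
     (if b0 i = b0 j then V (x t i - x t j) else W (x t i - x t j))) F"
  proof (cases "b0 i = b0 j")
    case True
    then have "isCont V (x t i - x t j)"
      using ne V_deriv[OF potentials, of "x t i - x t j"] by (intro DERIV_isCont) auto
    then show ?thesis using True isCont_tendsto_compose[OF _ d] by simp
  next
    case False
    have "isCont W (x t i - x t j)" using W_deriv[OF potentials] by (rule DERIV_isCont)
    then show ?thesis using False isCont_tendsto_compose[OF _ d] by simp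
  qed
  then show ?thesis unfolding pair_energy_def by (intro tendsto_intros d)
qed

lemma pair_energy_deriv:
  assumes i: "i \<in> {1..n}" and j: "j \<in> {1..n}" and t: "t \<in> {0<..<T}" "t \<notin> J" and live: "live t i" "live t j"
    and ne: "b0 i \<noteq> b0 j \<or> x t i \<noteq> x t j"
  shows "((\<lambda>s. pair_energy s i j) has_real_derivative (K t i j + 2 * C * (x t i - x t j)) * (vel t i - vel t j)) (at t)"
proof -
  have d: "((\<lambda>s. x s i - x s j) has_real_derivative vel t i - vel t j) (at t)"
    by (intro DERIV_diff ode_vel i j t)
  have "((\<lambda>s. if b0 i = b0 j then V (x s i - x s j) else W (x s i - x s j)) has_real_derivative K t i j * (vel t i - vel t j)) (at t)"
  proof (cases "b0 i = b0 j")
    case True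
    then have "x t i - x t j \<noteq> 0" using ne by auto
    from DERIV_chain2[OF V_deriv[OF potentials this] d] show ?thesis using True live by (simp add: K_def)
  next
    case False
    from DERIV_chain2[OF W_deriv[OF potentials] d] show ?thesis using False live by (simp add: K_def)
  qed
  moreover have "((\<lambda>s. C * (1 + (x s i - x s j)\<^sup>2)) has_real_derivative 2 * C * (x t i - x t j) * (vel t i - vel t j)) (at t)"
    by (rule DERIV_cong[OF DERIV_cmult[OF DERIV_add[OF DERIV_const DERIV_power[OF d]]]]) simp
  ultimately show ?thesis
    unfolding pair_energy_def distrib_right by (rule DERIV_add)
qed

text \<open>The interaction part dissipates exactly the mean square velocity, by the gradient flow
  structure. The quadratic part reduces to the virial \<open>\<Sum> x * vel\<close>, times the
  number of live particles, and contributes at most \<open>C\<^sup>2\<close>.\<close>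

lemma G_deriv:
  assumes t: "t \<in> {0<..<T}" "t \<notin> J" and nc: "\<not> clash t"
  shows "\<exists>D. (G has_real_derivative D) (at t) \<and> D \<le> C\<^sup>2 - (1 / real n) * (\<Sum>i=1..n. (vel t i)\<^sup>2)"
proof -
  define l where "l i = (if live t i then 1 else 0 :: real)" for i
  \<comment> \<open>\<open>G\<close> with the live set frozen at \<open>t\<close>: differentiable
    there, and equal to \<open>G\<close> near \<open>t\<close> since \<open>t\<close> is not in
    \<open>J\<close>.\<close>
  define Gt where "Gt s = 1 / (2 * (real n)\<^sup>2) * (\<Sum>i=1..n. \<Sum>j=1..n. if i \<noteq> j \<and> live t i \<and> live t j then pair_energy s i j else 0)" for s
  define S where "S = (\<Sum>i=1..n. \<Sum>j=1..n. if i \<noteq> j \<and> live t i \<and> live t j then (K t i j + 2 * C * (x t i - x t j)) * (vel t i - vel t j) else 0)"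
  have "((\<lambda>s. if i \<noteq> j \<and> live t i \<and> live t j then pair_energy s i j else 0) has_real_derivative
     (if i \<noteq> j \<and> live t i \<and> live t j then (K t i j + 2 * C * (x t i - x t j)) * (vel t i - vel t j) else 0)) (at t)"
    if "i \<in> {1..n}" "j \<in> {1..n}" for i j
  proof (cases "i \<noteq> j \<and> live t i \<and> live t j")
    case True
    then have ne: "b0 i \<noteq> b0 j \<or> x t i \<noteq> x t j" and lv: "live t i" "live t j"
      using no_clashD[OF nc that] by (simp_all add: live_def less_imp_le)
    show ?thesis unfolding if_P[OF True] by (rule pair_energy_deriv[OF that t lv ne])
  next
    case False
    show ?thesis by (simp only: if_not_P[OF False] DERIV_const)
  qed
  then have "(Gt has_real_derivative 1 / (2 * (real n)\<^sup>2) * S) (at t)"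
    unfolding Gt_def[abs_def] S_def by (intro DERIV_cmult DERIV_sum)
  moreover have "\<forall>\<^sub>F s in nhds t. G s = Gt s"
    using live_near[OF t(2)]
  proof eventually_elim
    case (elim s)
    show ?case unfolding G_def Gt_def
      by (intro arg_cong2[where f="(*)"] refl sum.cong) (use elim in auto)
  qed
  ultimately have "(G has_real_derivative 1 / (2 * (real n)\<^sup>2) * S) (at t)"
    using DERIV_cong_ev[OF refl _ refl] by blast
  moreover have "1 / (2 * (real n)\<^sup>2) * S \<le> C\<^sup>2 - (1 / real n) * (\<Sum>i=1..n. (vel t i)\<^sup>2)"
  proof -
    have "S = (\<Sum>i=1..n. \<Sum>j=1..n. K t i j * (vel t i - vel t j) + 2 * C * ((l i * l j * (x t i - x t j)) * (vel t i - vel t j)))"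
      unfolding S_def by (intro sum.cong refl) (auto simp: l_def K_def algebra_simps)
    also have "\<dots> = (\<Sum>i=1..n. \<Sum>j=1..n. K t i j * (vel t i - vel t j)) +
        2 * C * (\<Sum>i=1..n. \<Sum>j=1..n. (l i * l j * (x t i - x t j)) * (vel t i - vel t j))"
      by (simp only: sum.distrib sum_distrib_left)
    also have "(\<Sum>i=1..n. \<Sum>j=1..n. K t i j * (vel t i - vel t j)) = - (2 * real n) * (\<Sum>i=1..n. (vel t i)\<^sup>2)"
      by (subst sum_antisymmetric[OF K_antisym], subst sum_K_vel) (simp add: power2_eq_square)
    also have "(\<Sum>i=1..n. \<Sum>j=1..n. (l i * l j * (x t i - x t j)) * (vel t i - vel t j)) =
        2 * (\<Sum>i=1..n. \<Sum>j=1..n. (l i * l j * (x t i - x t j)) * vel t i)"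
      by (rule sum_antisymmetric) (simp add: algebra_simps)
    also have "(\<Sum>i=1..n. \<Sum>j=1..n. (l i * l j * (x t i - x t j)) * vel t i) =
        (\<Sum>i=1..n. (\<Sum>j=1..n. l j) * (x t i * vel t i) - (\<Sum>j=1..n. l j * x t j) * vel t i)"
    proof (rule sum.cong[OF refl])
      fix i
      have lv: "l i * vel t i = vel t i" by (simp add: l_def vel_dead)
      have "(\<Sum>j=1..n. (l i * l j * (x t i - x t j)) * vel t i) = (\<Sum>j=1..n. l j * (x t i * (l i * vel t i)) - l j * x t j * (l i * vel t i))"
        by (intro sum.cong refl) (simp add: algebra_simps)
      then show "(\<Sum>j=1..n. (l i * l j * (x t i - x t j)) * vel t i) = (\<Sum>j=1..n. l j) * (x t i * vel t i) - (\<Sum>j=1..n. l j * x t j) * vel t i"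
        by (simp only: lv sum_subtractf sum_distrib_right)
    qed
    \<comment> \<open>The mean position of the live particles drops out because the velocities sum
      to 0.\<close>
    also have "\<dots> = (\<Sum>j=1..n. l j) * (\<Sum>i=1..n. x t i * vel t i)"
      by (simp only: sum_subtractf sum_distrib_left[symmetric] sum_vel mult_zero_right diff_0_right)
    finally have S: "S = - (2 * real n) * (\<Sum>i=1..n. (vel t i)\<^sup>2) + 2 * C * (2 * ((\<Sum>j=1..n. l j) * (\<Sum>i=1..n. x t i * vel t i)))" .
    have "(\<Sum>j=1..n. l j) \<le> (\<Sum>j=1..n. 1)" by (intro sum_mono) (simp add: l_def)
    then have N: "0 \<le> (\<Sum>j=1..n. l j)" "(\<Sum>j=1..n. l j) \<le> real n" by (auto simp: l_def sum_nonneg)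
    have "(\<Sum>j=1..n. l j) * (\<Sum>i=1..n. x t i * vel t i) \<le> (\<Sum>j=1..n. l j) * \<bar>\<Sum>i=1..n. x t i * vel t i\<bar>"
      by (intro mult_left_mono N) simp
    also have "\<dots> \<le> real n * (real n * C / 2)" by (intro mult_mono N sum_x_vel) auto
    finally have "2 * C * (2 * ((\<Sum>j=1..n. l j) * (\<Sum>i=1..n. x t i * vel t i))) \<le> 2 * C * (2 * (real n * (real n * C / 2)))"
      using C_nonneg by (intro mult_left_mono) auto
    then have "S \<le> - (2 * real n) * (\<Sum>i=1..n. (vel t i)\<^sup>2) + 2 * C * (2 * (real n * (real n * C / 2)))"
      unfolding S by simp
    then have "1 / (2 * (real n)\<^sup>2) * S \<le> 1 / (2 * (real n)\<^sup>2) * (- (2 * real n) * (\<Sum>i=1..n. (vel t i)\<^sup>2) + 2 * C * (2 * (real n * (real n * C / 2))))"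
      by (intro mult_left_mono) auto
    also have "\<dots> = C\<^sup>2 - (1 / real n) * (\<Sum>i=1..n. (vel t i)\<^sup>2)"
      using n_pos by (simp add: power2_eq_square field_simps)
    finally show ?thesis .
  qed
  ultimately show ?thesis by blast
qed

lemma G_right:
  assumes t: "0 \<le> t" "t < T" and nc: "\<not> clash t"
  shows "(G \<longlongrightarrow> G t) (at_right t)"
proof -
  define Gt where "Gt s = 1 / (2 * (real n)\<^sup>2) * (\<Sum>i=1..n. \<Sum>j=1..n. if i \<noteq> j \<and> live t i \<and> live t j then pair_energy s i j else 0)" for s
  have "((\<lambda>s. if i \<noteq> j \<and> live t i \<and> live t j then pair_energy s i j else 0) \<longlongrightarrow>
     (if i \<noteq> j \<and> live t i \<and> live t j then pair_energy t i j else 0)) (at_right t)"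
    if "i \<in> {1..n}" "j \<in> {1..n}" for i j
  proof (cases "i \<noteq> j \<and> live t i \<and> live t j")
    case True
    then have "b0 i \<noteq> b0 j \<or> x t i \<noteq> x t j" using no_clashD[OF nc that] by (simp add: live_def less_imp_le)
    from pair_energy_tendsto[OF x_right[OF that(1) t] x_right[OF that(2) t] this]
    show ?thesis by (simp only: if_P[OF True])
  next
    case False
    show ?thesis by (simp only: if_not_P[OF False] tendsto_const)
  qed
  then have "(Gt \<longlongrightarrow> Gt t) (at_right t)"
    unfolding Gt_def[abs_def] by (intro tendsto_mult tendsto_const tendsto_sum)
  moreover have "\<forall>\<^sub>F s in at_right t. Gt s = G s"
    using live_right
  proof eventually_elim
    case (elim s)
    show ?case unfolding G_def Gt_def
      by (intro arg_cong2[where f="(*)"] refl sum.cong) (use elim in auto)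
  qed
  moreover have "Gt t = G t" by (simp add: Gt_def G_def)
  ultimately show ?thesis using tendsto_cong[of Gt G "at_right t"] by simp
qed

text \<open>Only an inequality: pairs lost at \<open>t\<close> are still counted just before it, in
  \<open>Gl\<close>, and their energies are nonnegative.\<close>

lemma G_left:
  assumes t: "0 < t" "t \<le> T" and nc: "\<not> clash t" and e: "e > 0"
  shows "\<forall>\<^sub>F s in at_left t. G t - e \<le> G s"
proof -
  define Gl where "Gl s = 1 / (2 * (real n)\<^sup>2) * (\<Sum>i=1..n. \<Sum>j=1..n. if i \<noteq> j \<and> ereal t \<le> \<tau> i \<and> ereal t \<le> \<tau> j then pair_energy s i j else 0)" for s
  have "((\<lambda>s. if i \<noteq> j \<and> ereal t \<le> \<tau> i \<and> ereal t \<le> \<tau> j then pair_energy s i j else 0) \<longlongrightarrow>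
     (if i \<noteq> j \<and> ereal t \<le> \<tau> i \<and> ereal t \<le> \<tau> j then pair_energy t i j else 0)) (at_left t)"
    if "i \<in> {1..n}" "j \<in> {1..n}" for i j
  proof (cases "i \<noteq> j \<and> ereal t \<le> \<tau> i \<and> ereal t \<le> \<tau> j")
    case True
    then have "b0 i \<noteq> b0 j \<or> x t i \<noteq> x t j" using no_clashD[OF nc that] by simp
    from pair_energy_tendsto[OF x_left[OF that(1) t] x_left[OF that(2) t] this]
    show ?thesis by (simp only: if_P[OF True])
  next
    case False
    show ?thesis by (simp only: if_not_P[OF False] tendsto_const)
  qed
  then have "(Gl \<longlongrightarrow> Gl t) (at_left t)"
    unfolding Gl_def[abs_def] by (intro tendsto_mult tendsto_const tendsto_sum)
  then have "\<forall>\<^sub>F s in at_left t. Gl t - e < Gl s" using e by (intro order_tendstoD(1)[of Gl "Gl t"]) auto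
  moreover have "\<forall>\<^sub>F s in at_left t. Gl s = G s"
    using live_left
  proof eventually_elim
    case (elim s)
    show ?case unfolding G_def Gl_def
      by (intro arg_cong2[where f="(*)"] refl sum.cong) (use elim in auto)
  qed
  moreover have le: "G t \<le> Gl t"
    unfolding G_def Gl_def
  proof (intro mult_left_mono sum_mono)
    fix i j assume ij: "i \<in> {1..n}" "j \<in> {1..n}"
    show "(if i \<noteq> j \<and> live t i \<and> live t j then pair_energy t i j else 0) \<le>
      (if i \<noteq> j \<and> ereal t \<le> \<tau> i \<and> ereal t \<le> \<tau> j then pair_energy t i j else 0)"
      using pair_energy_nonneg no_clashD[OF nc ij] by (auto simp: live_def dest: less_imp_le)
  qed auto
  ultimately show ?thesis by (auto elim: eventually_elim2)
qed

lemma G_bound_before: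
  assumes t: "0 \<le> t" "t \<le> T" and nc: "\<And>s. 0 \<le> s \<Longrightarrow> s \<le> t \<Longrightarrow> \<not> clash s"
  shows "G t \<le> G 0 + C\<^sup>2 * t"
proof -
  have "G t - C\<^sup>2 * t \<le> G 0 - C\<^sup>2 * 0"
  proof (rule nonincreasing_off_finite[where h="\<lambda>s. G s - C\<^sup>2 * s" and S=J, OF finite_J t(1)])
    fix s assume s: "0 < s" "s < t" "s \<notin> J"
    then obtain D where D: "(G has_real_derivative D) (at s)" "D \<le> C\<^sup>2 - (1 / real n) * (\<Sum>i=1..n. (vel s i)\<^sup>2)"
      using G_deriv[of s] nc[of s] t by auto
    have "0 \<le> (1 / real n) * (\<Sum>i=1..n. (vel s i)\<^sup>2)" by (simp add: sum_nonneg)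
    then have "D - C\<^sup>2 \<le> 0" using D(2) by linarith
    moreover have "((\<lambda>s. G s - C\<^sup>2 * s) has_real_derivative D - C\<^sup>2) (at s)"
      by (auto intro!: derivative_eq_intros D(1))
    ultimately show "\<exists>D. ((\<lambda>s. G s - C\<^sup>2 * s) has_real_derivative D) (at s) \<and> D \<le> 0" by blast
  next
    fix s assume "0 \<le> s" "s < t"
    then show "((\<lambda>s. G s - C\<^sup>2 * s) \<longlongrightarrow> G s - C\<^sup>2 * s) (at_right s)"
      using nc[of s] t by (intro tendsto_intros G_right) auto
  next
    fix s e :: real assume s: "0 < s" "s \<le> t" and e: "e > 0"
    have "\<forall>\<^sub>F r in at_left s. G s - e \<le> G r" using nc[of s] s t e by (intro G_left) auto
    moreover have "\<forall>\<^sub>F r in at_left s. r \<in> {s - 1<..<s}" by (rule eventually_at_left_real) simp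
    ultimately show "\<forall>\<^sub>F r in at_left s. G s - C\<^sup>2 * s - e \<le> G r - C\<^sup>2 * r"
    proof eventually_elim
      case (elim r)
      then have "C\<^sup>2 * r \<le> C\<^sup>2 * s" by (intro mult_left_mono) auto
      then show ?case using elim by linarith
    qed
  qed
  then show ?thesis by simp
qed

lemma live_0: "i \<in> {1..n} \<Longrightarrow> live 0 i"
  by (rule \<tau>_cases) (auto simp: live_def)

text \<open>All other pairs are nonnegative, so \<open>G\<close> controls each single pair. The
  factor depends on \<open>n\<close>, which is enough to exclude clashes at fixed
  \<open>n\<close>.\<close>

lemma pair_energy_le_G:
  assumes nc: "\<not> clash t" and ij: "i \<in> {1..n}" "j \<in> {1..n}" "i \<noteq> j" and live: "live t i" "live t j"
  shows "pair_energy t i j \<le> 2 * (real n)\<^sup>2 * G t"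
proof -
  let ?f = "\<lambda>i j. if i \<noteq> j \<and> live t i \<and> live t j then pair_energy t i j else 0"
  have nn: "0 \<le> ?f i j" if "i \<in> {1..n}" "j \<in> {1..n}" for i j
    using pair_energy_nonneg no_clashD[OF nc that] by (auto simp: live_def dest: less_imp_le)
  have "pair_energy t i j = ?f i j" using ij live by simp
  also have "\<dots> \<le> (\<Sum>j=1..n. ?f i j)" using ij nn by (intro member_le_sum) auto
  also have "\<dots> \<le> (\<Sum>i=1..n. \<Sum>j=1..n. ?f i j)"
    using ij nn by (intro member_le_sum[of i _ "\<lambda>i. \<Sum>j=1..n. ?f i j"] sum_nonneg) auto
  also have "\<dots> = 2 * (real n)\<^sup>2 * G t" using n_pos by (simp add: G_def)
  finally show ?thesis .
qed

text \<open>Strictly before a first clash the energy bound keeps \<open>V (x i - x j)\<close> below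
  \<open>A\<close>, while the distance tends to 0 and \<open>V\<close> blows up. A first time exists
  because the conditions \<open>ereal t \<le> \<tau> i\<close> defining clashes are closed; it is
  not 0 since the initial positions are distinct.\<close>

theorem no_clash: "0 \<le> t \<Longrightarrow> t \<le> T \<Longrightarrow> \<not> clash t"
proof (rule ccontr)
  assume t: "0 \<le> t" "t \<le> T" "\<not> \<not> clash t"
  define Z where "Z = {t\<in>{0..T}. clash t}"
  have "Z = (\<Union>p\<in>{p\<in>{1..n} \<times> {1..n}. fst p \<noteq> snd p \<and> b0 (fst p) = b0 (snd p)}.
      {t\<in>{0..T} \<inter> {t. ereal t \<le> \<tau> (fst p)} \<inter> {t. ereal t \<le> \<tau> (snd p)}. x t (fst p) - x t (snd p) = 0})"
    unfolding Z_def clash_def by fastforce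
  also have "closed \<dots>"
  proof (rule closed_UN)
    show "\<forall>p\<in>{p\<in>{1..n} \<times> {1..n}. fst p \<noteq> snd p \<and> b0 (fst p) = b0 (snd p)}.
      closed {t\<in>{0..T} \<inter> {t. ereal t \<le> \<tau> (fst p)} \<inter> {t. ereal t \<le> \<tau> (snd p)}. x t (fst p) - x t (snd p) = 0}"
    proof (rule ballI, rule continuous_closed_preimage_constant)
      fix p assume p: "p \<in> {p\<in>{1..n} \<times> {1..n}. fst p \<noteq> snd p \<and> b0 (fst p) = b0 (snd p)}"
      show "continuous_on ({0..T} \<inter> {t. ereal t \<le> \<tau> (fst p)} \<inter> {t. ereal t \<le> \<tau> (snd p)}) (\<lambda>t. x t (fst p) - x t (snd p))"
        using p by (intro continuous_on_diff continuous_on_subset[OF x_cont]) auto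
      show "closed ({0..T} \<inter> {t. ereal t \<le> \<tau> (fst p)} \<inter> {t. ereal t \<le> \<tau> (snd p)})"
        by (intro closed_Int closed_Collect_le continuous_intros)
    qed
  qed simp
  finally have "closed Z" .
  moreover have "bounded Z" by (rule bounded_subset[of "{0..T}"]) (auto simp: Z_def)
  ultimately have "compact Z" by (simp add: compact_eq_bounded_closed)
  moreover have "Z \<noteq> {}" using t by (auto simp: Z_def)
  ultimately have "\<exists>s\<in>Z. \<forall>r\<in>Z. s \<le> r" by (rule compact_attains_inf)
  then obtain s where s: "s \<in> Z" "\<And>r. r \<in> Z \<Longrightarrow> s \<le> r" by auto
  have sT: "0 \<le> s" "s \<le> T" and "clash s" using s(1) by (auto simp: Z_def)
  then obtain i j where ij: "i \<in> {1..n}" "j \<in> {1..n}" "i \<noteq> j" "b0 i = b0 j"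
    and pre: "ereal s \<le> \<tau> i" "ereal s \<le> \<tau> j" and eq: "x s i = x s j"
    by (auto simp: clash_def)
  have nc: "\<not> clash r" if "0 \<le> r" "r < s" for r
    using s(2)[of r] that sT by (force simp: Z_def)
  have "s \<noteq> 0"
  proof
    assume "s = 0"
    then have "x0 i = x0 j" using eq init ij by simp
    then show False using ordered ij by (metis strict_mono_on_eqD)
  qed
  then have s0: "0 < s" using sT by simp
  define A where "A = 2 * (real n)\<^sup>2 * (G 0 + C\<^sup>2 * T)"
  have le: "V (x r i - x r j) \<le> A" and ne: "x r i - x r j \<noteq> 0" if r: "0 \<le> r" "r < s" for r
  proof -
    have "ereal r < ereal s" using r by simp
    then have live: "live r i" "live r j" using pre unfolding live_def by (metis less_le_trans)+
    show "x r i - x r j \<noteq> 0" using no_clashD[OF nc[OF r] ij(1-3)] live ij(4) by (simp add: live_def)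
    have "V (x r i - x r j) \<le> pair_energy r i j" using ij(4) C_nonneg by (simp add: pair_energy_def)
    also have "\<dots> \<le> 2 * (real n)\<^sup>2 * G r" by (rule pair_energy_le_G[OF nc[OF r] ij(1-3) live])
    also have "\<dots> \<le> 2 * (real n)\<^sup>2 * (G 0 + C\<^sup>2 * r)"
      using r sT nc by (intro mult_left_mono G_bound_before) auto
    also have "\<dots> \<le> A" unfolding A_def using r sT by (intro mult_left_mono add_left_mono) auto
    finally show "V (x r i - x r j) \<le> A" .
  qed
  have "((\<lambda>r. x r i - x r j) \<longlongrightarrow> x s i - x s j) (at_left s)"
    by (intro tendsto_diff x_left ij s0 sT)
  moreover have ev: "\<forall>\<^sub>F r in at_left s. r \<in> {0<..<s}" by (rule eventually_at_left_real[OF s0])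
  moreover have "\<forall>\<^sub>F r in at_left s. x r i - x r j \<noteq> 0"
    using ev by eventually_elim (rule ne, auto)
  ultimately have "filterlim (\<lambda>r. x r i - x r j) (at 0) (at_left s)"
    unfolding filterlim_at using eq by simp
  from filterlim_compose[OF V_at_top[OF potentials] this]
  have "\<forall>\<^sub>F r in at_left s. A + 1 \<le> V (x r i - x r j)" by (simp add: filterlim_at_top)
  with ev have "\<forall>\<^sub>F r in at_left s. False"
  proof eventually_elim
    case (elim r)
    then show ?case using le[of r] by auto
  qed
  then show False by simp
qed

end

section \<open>Speed and displacement\<close>

lemma set_integrable_bounded:
  fixes f :: "real \<Rightarrow> real"
  assumes "f \<in> borel_measurable borel" "\<And>t. \<bar>f t\<bar> \<le> B"
  shows "set_integrable lborel {a..b} f"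
proof -
  have "emeasure lborel {a..b} < \<infinity>" by (cases "a \<le> b") auto
  then show ?thesis
    unfolding set_integrable_def real_scaleR_def
    by (intro integrableI_bounded_set[where A="{a..b}" and B=B])
       (use assms in \<open>auto simp: indicator_def\<close>)
qed

lemma indefinite_integral_facts:
  fixes f :: "real \<Rightarrow> real"
  assumes f: "set_integrable lborel {a..b} f"
  shows "continuous_on {a..b} (\<lambda>t. integral {a..t} f)"
    and "\<And>t. a < t \<Longrightarrow> t < b \<Longrightarrow> isCont f t \<Longrightarrow> ((\<lambda>t. integral {a..t} f) has_real_derivative f t) (at t)"
proof -
  have i: "f integrable_on {a..b}" using f by (rule set_borel_integral_eq_integral(1))
  show "continuous_on {a..b} (\<lambda>t. integral {a..t} f)" by (rule indefinite_integral_continuous_1[OF i])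
  fix t assume t: "a < t" "t < b" and c: "isCont f t"
  have "((\<lambda>u. integral {a..u} f) has_vector_derivative f t) (at t within {a..b} - {})"
    using t c by (intro integral_has_vector_derivative_continuous_at i) (auto intro: continuous_at_imp_continuous_at_within)
  then show "((\<lambda>t. integral {a..t} f) has_real_derivative f t) (at t)"
    using t by (simp add: has_real_derivative_iff_has_vector_derivative at_within_Icc_at)
qed

lemma continuous_on_Icc_right_left:
  fixes h :: "real \<Rightarrow> real"
  assumes "continuous_on {a..b} h"
  shows "a \<le> t \<Longrightarrow> t < b \<Longrightarrow> (h \<longlongrightarrow> h t) (at_right t)" "a < t \<Longrightarrow> t \<le> b \<Longrightarrow> (h \<longlongrightarrow> h t) (at_left t)"
proof -
  have *: "(h \<longlongrightarrow> h t) (at t within {a..b})" if "t \<in> {a..b}"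
    using assms that by (auto simp: continuous_on_def)
  { assume t: "a \<le> t" "t < b"
    then have "(h \<longlongrightarrow> h t) (at t within {t..b})" by (intro tendsto_within_subset[OF *]) auto
    then show "(h \<longlongrightarrow> h t) (at_right t)" using t by (simp add: at_within_Icc_at_right) }
  { assume t: "a < t" "t \<le> b"
    then have "(h \<longlongrightarrow> h t) (at t within {a..t})" by (intro tendsto_within_subset[OF *]) auto
    then show "(h \<longlongrightarrow> h t) (at_left t)" using t by (simp add: at_within_Icc_at_left) }
qed

lemma nonincreasing_continuous_off_finite:
  fixes h :: "real \<Rightarrow> real"
  assumes "finite S" "a \<le> b" and c: "continuous_on {a..b} h"
    and "\<And>t. a < t \<Longrightarrow> t < b \<Longrightarrow> t \<notin> S \<Longrightarrow> \<exists>D. (h has_real_derivative D) (at t) \<and> D \<le> 0"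
  shows "h b \<le> h a"
proof (rule nonincreasing_off_finite[OF assms(1,2,4)])
  show "\<forall>\<^sub>F s in at_left t. h t - e \<le> h s" if "a < t" "t \<le> b" "0 < e" for t e
    using order_tendstoD(1)[OF continuous_on_Icc_right_left(2)[OF c that(1,2)], of "h t - e"] that(3)
    by (auto elim: eventually_mono)
qed (auto intro: continuous_on_Icc_right_left(1)[OF c])

context annihilating_particles
begin

lemma x_isCont: "i \<in> {1..n} \<Longrightarrow> t \<in> {0<..<T} \<Longrightarrow> isCont (\<lambda>s. x s i) t"
  using continuous_on_interior[OF x_cont, of i t] by (simp add: interior_atLeastAtMost_real)

text \<open>Off \<open>J\<close> the live set is locally constant and \<open>no_clash\<close> keeps
  equal signs apart, so the singularity of \<open>V'\<close> is avoided; on the diagonal the force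
  is constant.\<close>

lemma K_isCont:
  assumes ij: "i \<in> {1..n}" "j \<in> {1..n}" and t: "t \<in> {0<..<T}" "t \<notin> J"
  shows "isCont (\<lambda>s. K s i j) t"
proof -
  define Kt where "Kt s = (if live t i \<and> live t j then if b0 i = b0 j then dV V (x s i - x s j) else deriv W (x s i - x s j) else 0)" for s
  have d: "isCont (\<lambda>s. x s i - x s j) t" by (intro continuous_diff x_isCont ij t)
  have dVc: "isCont (\<lambda>s. dV V (x s i - x s j)) t" if "x t i - x t j \<noteq> 0"
    using isCont_o2[OF d dV_isCont[OF potentials that]] .
  have dWc: "isCont (\<lambda>s. deriv W (x s i - x s j)) t"
    using isCont_o2[OF d dW_isCont[OF potentials]] .
  have "isCont Kt t"
  proof (cases "live t i \<and> live t j \<and> b0 i = b0 j")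
    case True
    show ?thesis
    proof (cases "i = j")
      case False
      have "x t i \<noteq> x t j"
        using no_clashD[OF no_clash ij False, of t] t True by (auto simp: live_def less_imp_le)
      then show ?thesis using dVc True by (simp add: Kt_def[abs_def])
    next
      case ij: True
      have "Kt = (\<lambda>s. dV V 0)" using True ij by (auto simp: Kt_def fun_eq_iff)
      then show ?thesis by simp
    qed
  next
    case False
    then show ?thesis using dWc by (cases "live t i"; cases "live t j") (auto simp: Kt_def[abs_def])
  qed
  moreover have "\<forall>\<^sub>F s in nhds t. K s i j = Kt s"
    using live_near[OF t(2)] by eventually_elim (use ij in \<open>simp add: K_def Kt_def\<close>)
  note isCont_cong[OF this]
  ultimately show ?thesis by simp
qed

lemma vel_isCont:
  assumes "i \<in> {1..n}" "t \<in> {0<..<T}" "t \<notin> J"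
  shows "isCont (\<lambda>s. vel s i) t"
  unfolding vel_def by (intro continuous_mult continuous_const continuous_sum K_isCont assms)

lemma Lx_nonneg: "0 \<le> Lx"
  using lip[of 1] n_pos by (intro lipschitz_on_nonneg) auto

text \<open>This bound depends on \<open>n\<close> and serves integrability only; uniform bounds
  come from the energy.\<close>

lemma vel_bound:
  assumes i: "i \<in> {1..n}" and t: "t \<in> {0<..<T}" "t \<notin> J"
  shows "\<bar>vel t i\<bar> \<le> Lx"
proof (rule tendsto_upperbound)
  show "((\<lambda>s. \<bar>(x s i - x t i) / (s - t)\<bar>) \<longlongrightarrow> \<bar>vel t i\<bar>) (at t)"
    using ode_vel[OF i t] by (intro tendsto_rabs) (simp add: has_field_derivative_iff)
  have "\<forall>\<^sub>F s in at t. s \<in> {0<..<T}"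
    using t by (intro eventually_at_in_open') auto
  moreover have "\<forall>\<^sub>F s in at t. s \<noteq> t" by (simp add: eventually_at_filter)
  ultimately show "\<forall>\<^sub>F s in at t. \<bar>(x s i - x t i) / (s - t)\<bar> \<le> Lx"
  proof eventually_elim
    case (elim s)
    have "\<bar>x s i - x t i\<bar> \<le> Lx * \<bar>s - t\<bar>"
      using lipschitz_onD[OF lip[OF i], of s t] elim t by (auto simp: dist_real_def)
    then show ?case using elim(2) by (simp add: abs_divide field_simps)
  qed
qed simp

text \<open>Root mean square velocity; the value 0 at exceptional times and outside the open
  interval makes it bounded and Borel on the whole line.\<close>

definition speed :: "real \<Rightarrow> real" where
  "speed t = (if t \<in> {0<..<T} - J then sqrt ((1 / real n) * (\<Sum>i=1..n. (vel t i)\<^sup>2)) else 0)"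

lemma open_regular: "open ({0<..<T} - J)"
  using finite_J by (intro open_Diff finite_imp_closed) auto

lemma speed_nonneg: "0 \<le> speed t"
  by (simp add: speed_def sum_nonneg)

lemma speed_sq: "t \<in> {0<..<T} - J \<Longrightarrow> (speed t)\<^sup>2 = (1 / real n) * (\<Sum>i=1..n. (vel t i)\<^sup>2)"
  by (simp add: speed_def sum_nonneg)

lemma speed_le: "speed t \<le> Lx"
proof (cases "t \<in> {0<..<T} - J")
  case True
  have "(\<Sum>i=1..n. (vel t i)\<^sup>2) \<le> (\<Sum>i=1..n. Lx\<^sup>2)"
    using vel_bound True by (intro sum_mono) (metis DiffD1 DiffD2 abs_le_square_iff abs_of_nonneg Lx_nonneg)
  then have "real n * (speed t)\<^sup>2 \<le> real n * Lx\<^sup>2" using speed_sq[OF True] n_pos by simp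
  then have "(speed t)\<^sup>2 \<le> Lx\<^sup>2" using n_pos by simp
  then show ?thesis using Lx_nonneg by (rule power2_le_imp_le)
qed (auto simp: speed_def Lx_nonneg)

lemma speed_isCont: "t \<in> {0<..<T} - J \<Longrightarrow> isCont speed t"
proof -
  assume t: "t \<in> {0<..<T} - J"
  have c: "isCont (\<lambda>t. sqrt ((1 / real n) * (\<Sum>i=1..n. (vel t i)\<^sup>2))) t"
    using t by (intro continuous_intros continuous_real_sqrt vel_isCont) auto
  have "\<forall>\<^sub>F s in nhds t. s \<in> {0<..<T} - J"
    using t open_regular by (auto simp: eventually_nhds)
  then have "\<forall>\<^sub>F s in nhds t. speed s = sqrt ((1 / real n) * (\<Sum>i=1..n. (vel s i)\<^sup>2))"
    by eventually_elim (auto simp: speed_def)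
  from isCont_cong[OF this] c show ?thesis by simp
qed

lemma speed_measurable: "speed \<in> borel_measurable borel"
proof -
  have "continuous_on ({0<..<T} - J) speed"
    using speed_isCont by (intro continuous_at_imp_continuous_on) auto
  then have "(\<lambda>t. if t \<in> {0<..<T} - J then speed t else 0) \<in> borel_measurable borel"
    using open_regular by (intro borel_measurable_continuous_on_if) auto
  moreover have "(\<lambda>t. if t \<in> {0<..<T} - J then speed t else 0) = speed"
    by (auto simp: speed_def fun_eq_iff)
  ultimately show ?thesis by simp
qed

lemma speed_integrable: "set_integrable lborel {c..d} speed"
  using speed_measurable speed_nonneg speed_le by (intro set_integrable_bounded[of _ Lx]) auto

lemma speed_sq_integrable: "set_integrable lborel {c..d} (\<lambda>t. (speed t)\<^sup>2)"
  using speed_measurable speed_nonneg speed_le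
  by (intro set_integrable_bounded[of _ "Lx\<^sup>2"]) (auto intro: power_mono)

text \<open>\<open>G_deriv\<close> in integrated form: with the accumulated squared speed added and
  \<open>C\<^sup>2 * t\<close> subtracted, the energy is nonincreasing, downward jumps
  included.\<close>

theorem energy_dissipation:
  "G T + integral {0..T} (\<lambda>t. (speed t)\<^sup>2) \<le> G 0 + C\<^sup>2 * T"
proof -
  let ?P = "\<lambda>t. integral {0..t} (\<lambda>t. (speed t)\<^sup>2)"
  let ?h = "\<lambda>t. G t + (?P t - C\<^sup>2 * t)"
  have Pc: "continuous_on {0..T} (\<lambda>t. ?P t - C\<^sup>2 * t)"
    by (intro continuous_intros indefinite_integral_facts(1) speed_sq_integrable)
  have "?h T \<le> ?h 0"
  proof (rule nonincreasing_off_finite[OF finite_J, of 0 T])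
    fix t assume t: "0 < t" "t < T" "t \<notin> J"
    then have nc: "\<not> clash t" using no_clash by simp
    obtain D where D: "(G has_real_derivative D) (at t)" "D \<le> C\<^sup>2 - (1 / real n) * (\<Sum>i=1..n. (vel t i)\<^sup>2)"
      using G_deriv[OF _ t(3) nc] t by auto
    have "isCont (\<lambda>t. (speed t)\<^sup>2) t" using speed_isCont[of t] t by (intro continuous_power) auto
    then have "(?P has_real_derivative (speed t)\<^sup>2) (at t)"
      using t by (intro indefinite_integral_facts(2) speed_sq_integrable) auto
    then have "(?h has_real_derivative D + ((speed t)\<^sup>2 - C\<^sup>2)) (at t)"
      by (auto intro!: derivative_eq_intros D(1))
    moreover have "D + ((speed t)\<^sup>2 - C\<^sup>2) \<le> 0" using D(2) speed_sq[of t] t by simp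
    ultimately show "\<exists>D. (?h has_real_derivative D) (at t) \<and> D \<le> 0" by blast
  next
    fix t assume "0 \<le> t" "t < T"
    then show "(?h \<longlongrightarrow> ?h t) (at_right t)"
      by (intro tendsto_add G_right no_clash continuous_on_Icc_right_left(1)[OF Pc]) auto
  next
    fix t e :: real assume t: "0 < t" "t \<le> T" and e: "0 < e"
    have "\<forall>\<^sub>F s in at_left t. G t - e / 2 \<le> G s" using t e no_clash by (intro G_left) auto
    moreover have "\<forall>\<^sub>F s in at_left t. (?P t - C\<^sup>2 * t) - e / 2 < ?P s - C\<^sup>2 * s"
      using e by (intro order_tendstoD(1)[OF continuous_on_Icc_right_left(2)[OF Pc t]]) auto
    ultimately show "\<forall>\<^sub>F s in at_left t. ?h t - e \<le> ?h s" by eventually_elim (simp add: field_simps)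
  qed (use T_pos in auto)
  then show ?thesis by simp
qed

section \<open>A priori bounds in terms of the initial energy and second moment\<close>

lemma G_nonneg: "0 \<le> t \<Longrightarrow> t \<le> T \<Longrightarrow> 0 \<le> G t"
  unfolding G_def using pair_energy_nonneg no_clashD[OF no_clash]
  by (intro mult_nonneg_nonneg sum_nonneg) (auto simp: live_def dest: less_imp_le)

lemma G_bound: "0 \<le> t \<Longrightarrow> t \<le> T \<Longrightarrow> G t \<le> G 0 + C\<^sup>2 * T"
  using G_bound_before[of t] no_clash mult_left_mono[of t T "C\<^sup>2"] by fastforce

lemma dissipation: "(LINT t:{0..T}|lborel. (speed t)\<^sup>2) \<le> G 0 + C\<^sup>2 * T"
  using energy_dissipation G_nonneg[of T] T_pos set_borel_integral_eq_integral(2)[OF speed_sq_integrable[of 0 T]] by simp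

text \<open>Pairing with the total displacement \<open>v\<close>, a fixed vector, makes the claim
  scalar: the derivative of the pairing is at most \<open>R * speed\<close> by Cauchy-Schwarz, and
  its total increment is \<open>R\<^sup>2\<close>.\<close>

theorem displacement:
  assumes st: "0 \<le> s" "s \<le> t" "t \<le> T"
  shows "sqrt ((1 / real n) * (\<Sum>i=1..n. (x t i - x s i)\<^sup>2)) \<le> (LINT r:{s..t}|lborel. speed r)"
proof -
  define v where "v i = x t i - x s i" for i
  define R where "R = sqrt ((1 / real n) * (\<Sum>i=1..n. (v i)\<^sup>2))"
  have R2: "R\<^sup>2 = (1 / real n) * (\<Sum>i=1..n. (v i)\<^sup>2)" by (simp add: R_def sum_nonneg)
  have R0: "0 \<le> R" by (simp add: R_def sum_nonneg)
  let ?h = "\<lambda>r. (1 / real n) * (\<Sum>i=1..n. v i * x r i) - R * integral {s..r} speed"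
  have "?h t \<le> ?h s"
  proof (rule nonincreasing_continuous_off_finite[OF finite_J st(2)])
    show "continuous_on {s..t} ?h"
      using st by (intro continuous_intros continuous_on_subset[OF x_cont] indefinite_integral_facts(1) speed_integrable) auto
    fix r assume r: "s < r" "r < t" "r \<notin> J"
    then have r': "r \<in> {0<..<T}" "r \<in> {0<..<T} - J" using st by auto
    have "((\<lambda>r. \<Sum>i=1..n. v i * x r i) has_real_derivative (\<Sum>i=1..n. v i * vel r i)) (at r)"
      by (intro DERIV_sum DERIV_cmult ode_vel r' r) auto
    then have "(?h has_real_derivative (1 / real n) * (\<Sum>i=1..n. v i * vel r i) - R * speed r) (at r)"
      using r by (intro DERIV_diff DERIV_cmult indefinite_integral_facts(2)[OF speed_integrable] speed_isCont r') auto
    moreover have "(1 / real n) * (\<Sum>i=1..n. v i * vel r i) \<le> R * speed r"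
    proof -
      have "(\<Sum>i=1..n. v i * vel r i) \<le> (\<Sum>i=1..n. \<bar>v i\<bar> * \<bar>vel r i\<bar>)"
        by (intro sum_mono) (simp add: abs_mult[symmetric])
      also have "\<dots> \<le> L2_set v {1..n} * L2_set (vel r) {1..n}" by (rule L2_set_mult_ineq)
      finally have "(1 / real n) * (\<Sum>i=1..n. v i * vel r i) \<le> (1 / real n) * (L2_set v {1..n} * L2_set (vel r) {1..n})"
        by (intro mult_left_mono) auto
      also have "\<dots> = R * speed r"
        using r'(2) n_pos by (simp add: R_def speed_def L2_set_def real_sqrt_divide field_simps flip: real_sqrt_mult)
      finally show ?thesis .
    qed
    ultimately show "\<exists>D. (?h has_real_derivative D) (at r) \<and> D \<le> 0" by (intro exI conjI) auto
  qed
  then have "(1 / real n) * ((\<Sum>i=1..n. v i * x t i) - (\<Sum>i=1..n. v i * x s i)) \<le> R * integral {s..t} speed"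
    by (simp add: right_diff_distrib)
  also have "(\<Sum>i=1..n. v i * x t i) - (\<Sum>i=1..n. v i * x s i) = (\<Sum>i=1..n. (v i)\<^sup>2)"
    by (simp add: sum_subtractf[symmetric] v_def power2_eq_square algebra_simps)
  finally have "R * R \<le> R * integral {s..t} speed" using R2 by (simp add: power2_eq_square)
  moreover have int: "integral {s..t} speed = (LINT r:{s..t}|lborel. speed r)"
    by (rule set_borel_integral_eq_integral(2)[OF speed_integrable, symmetric])
  moreover have "0 \<le> (LINT r:{s..t}|lborel. speed r)"
    unfolding set_lebesgue_integral_def using speed_nonneg by (intro integral_nonneg_AE) auto
  ultimately have "R \<le> (LINT r:{s..t}|lborel. speed r)"
    using R0 by (cases "R = 0") auto
  then show ?thesis by (simp add: R_def v_def)
qed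

text \<open>The derivative is twice the virial divided by \<open>n\<close>, hence at most
  \<open>C\<close>. Annihilation causes no jump: positions are continuous, and dead particles stay
  in the sum at rest.\<close>

theorem second_moment:
  assumes t: "0 \<le> t" "t \<le> T"
  shows "(1 / real n) * (\<Sum>i=1..n. (x t i)\<^sup>2) \<le> (1 / real n) * (\<Sum>i=1..n. (x0 i)\<^sup>2) + C * t"
proof -
  let ?h = "\<lambda>s. (1 / real n) * (\<Sum>i=1..n. (x s i)\<^sup>2) - C * s"
  have "?h t \<le> ?h 0"
  proof (rule nonincreasing_continuous_off_finite[OF finite_J t(1)])
    show "continuous_on {0..t} ?h"
      using t by (intro continuous_intros continuous_on_subset[OF x_cont]) auto
    fix s assume s: "0 < s" "s < t" "s \<notin> J"
    have "((\<lambda>s. (x s i)\<^sup>2) has_real_derivative 2 * (x s i * vel s i)) (at s)" if i: "i \<in> {1..n}" for i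
      by (rule DERIV_cong[OF DERIV_power[OF ode_vel[OF i]]]) (use s t in auto)
    then have "(?h has_real_derivative (1 / real n) * (\<Sum>i=1..n. 2 * (x s i * vel s i)) - C * 1) (at s)"
      by (intro DERIV_diff DERIV_cmult DERIV_sum DERIV_ident)
    moreover have "(1 / real n) * (\<Sum>i=1..n. 2 * (x s i * vel s i)) - C * 1 \<le> 0"
      using sum_x_vel[of s] n_pos by (simp add: sum_distrib_left[symmetric] field_simps)
    ultimately show "\<exists>D. (?h has_real_derivative D) (at s) \<and> D \<le> 0" by blast
  qed
  then show ?thesis using init by simp
qed

text \<open>Live particles never meet before the final time, so they keep their initial order.\<close>

lemma live_order:
  assumes ij: "i \<in> {1..n}" "j \<in> {1..n}" "i < j" and live: "live t i" "live t j" and t: "0 \<le> t" "t < T"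
  shows "x t i < x t j"
proof (rule ccontr)
  assume "\<not> x t i < x t j"
  then have le: "x t j - x t i \<le> 0" by simp
  have x0: "0 < x 0 j - x 0 i" using init ij ordered by (simp add: strict_mono_onD)
  have "continuous_on {0..t} (\<lambda>s. x s j - x s i)"
    using t ij by (intro continuous_intros continuous_on_subset[OF x_cont]) auto
  \<comment> \<open>A meeting time in \<open>[0, t]\<close>. It is not 0 by the initial order, and
    not \<open>T\<close> since \<open>t < T\<close>; the latter matters because
    \<open>no_meeting\<close> is silent about the final time.\<close>
  then obtain s where s: "0 \<le> s" "s \<le> t" "x s j - x s i = 0"
    using IVT2'[of "\<lambda>s. x s j - x s i" t 0 0] le x0 t by auto
  have "s \<noteq> 0" using s(3) x0 by auto
  then have sT: "s \<in> {0<..<T}" using s t by auto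
  have "ereal s \<le> ereal t" using s by simp
  then have ls: "ereal s < \<tau> i" "ereal s < \<tau> j" using live unfolding live_def by (metis le_less_trans)+
  show False
  proof (cases "b0 i = b0 j")
    case True
    then show False using no_clashD[OF no_clash ij(1,2), of s] sT ls ij s by (auto dest: less_imp_le)
  next
    case False
    then show False using no_meeting[OF ij(1,2) sT ls] sgn_product(2)[OF ij(1,2)] s by auto
  qed
qed

text \<open>Close pairs of live particles of equal sign are expensive; hence few of them fit in a short interval.\<close>

lemma concentration:
  assumes t: "0 \<le> t" "t \<le> T" and M: "M > 0" and V: "\<And>r. r \<noteq> 0 \<Longrightarrow> \<bar>r\<bar> < 2 * d \<Longrightarrow> M \<le> V r"
  shows "(real (card {i\<in>{1..n}. live t i \<and> b0 i = p \<and> \<bar>x t i - z\<bar> < d}) / real n)\<^sup>2 \<le> 1 / real n + 2 * (G 0 + C\<^sup>2 * T) / M"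
proof -
  define A where "A = {i\<in>{1..n}. live t i \<and> b0 i = p \<and> \<bar>x t i - z\<bar> < d}"
  have A: "finite A" "A \<subseteq> {1..n}" by (auto simp: A_def)
  have nc: "\<not> clash t" using no_clash t by simp
  let ?f = "\<lambda>i j. if i \<noteq> j \<and> live t i \<and> live t j then pair_energy t i j else 0"
  have nn: "0 \<le> ?f i j" if "i \<in> {1..n}" "j \<in> {1..n}" for i j
    using pair_energy_nonneg no_clashD[OF nc that] by (auto simp: live_def dest: less_imp_le)
  have low: "(if i \<noteq> j then M else 0) \<le> ?f i j" if "i \<in> A" "j \<in> A" for i j
  proof (cases "i = j")
    case False
    have ij: "i \<in> {1..n}" "j \<in> {1..n}" "live t i" "live t j" "b0 i = b0 j" "\<bar>x t i - x t j\<bar> < 2 * d"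
      using that by (auto simp: A_def)
    then have "x t i - x t j \<noteq> 0" using no_clashD[OF nc ij(1,2) False] by (auto simp: live_def less_imp_le)
    then have "M \<le> V (x t i - x t j)" using V ij by simp
    also have "\<dots> \<le> pair_energy t i j" using ij C_nonneg by (simp add: pair_energy_def)
    finally show ?thesis using False ij by simp
  qed simp
  \<comment> \<open>Counts ordered pairs of distinct particles; the missing diagonal is the source
    of the term \<open>1 / n\<close> in the claim.\<close>
  have "M * ((real (card A))\<^sup>2 - real (card A)) = (\<Sum>i\<in>A. \<Sum>j\<in>A. if i \<noteq> j then M else 0)"
  proof -
    have "(\<Sum>j\<in>A. if i \<noteq> j then M else 0) = M * (real (card A) - 1)" if "i \<in> A" for i
    proof -
      have "(\<Sum>j\<in>A. if i \<noteq> j then M else 0) = (\<Sum>j\<in>A. M - (if j = i then M else 0))" by (intro sum.cong) auto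
      also have "\<dots> = real (card A) * M - M" using that A by (simp add: sum_subtractf)
      finally show ?thesis by (simp add: algebra_simps)
    qed
    then have "(\<Sum>i\<in>A. \<Sum>j\<in>A. if i \<noteq> j then M else 0) = (\<Sum>i\<in>A. M * (real (card A) - 1))"
      by (intro sum.cong refl)
    then show ?thesis by (simp add: power2_eq_square algebra_simps)
  qed
  also have "\<dots> \<le> (\<Sum>i\<in>A. \<Sum>j\<in>A. ?f i j)" by (intro sum_mono low)
  also have "\<dots> \<le> (\<Sum>i\<in>A. \<Sum>j=1..n. ?f i j)"
  proof (intro sum_mono sum_mono2)
    show "0 \<le> ?f i j" if "i \<in> A" "j \<in> {1..n} - A" for i j using nn[of i j] that A by blast
  qed (use A in auto)
  also have "\<dots> \<le> (\<Sum>i=1..n. \<Sum>j=1..n. ?f i j)" using A nn by (intro sum_mono2 sum_nonneg) auto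
  also have "\<dots> = 2 * (real n)\<^sup>2 * G t" using n_pos by (simp add: G_def)
  also have "\<dots> \<le> 2 * (real n)\<^sup>2 * (G 0 + C\<^sup>2 * T)" by (intro mult_left_mono G_bound t) auto
  finally have *: "M * (real (card A))\<^sup>2 \<le> M * real (card A) + 2 * (real n)\<^sup>2 * (G 0 + C\<^sup>2 * T)"
    by (simp add: right_diff_distrib)
  have "card A \<le> card {1..n}" by (intro card_mono A) auto
  then have "M * real (card A) \<le> M * real n" using M by (intro mult_left_mono) auto
  with * have "M * (real (card A))\<^sup>2 \<le> M * real n + 2 * (real n)\<^sup>2 * (G 0 + C\<^sup>2 * T)" by linarith
  then have "(real (card A))\<^sup>2 / (real n)\<^sup>2 \<le> (real n + 2 * (real n)\<^sup>2 * (G 0 + C\<^sup>2 * T) / M) / (real n)\<^sup>2"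
    using M by (intro divide_right_mono) (auto simp: field_simps)
  also have "\<dots> = 1 / real n + 2 * (G 0 + C\<^sup>2 * T) / M"
    using n_pos M by (simp add: field_simps power2_eq_square)
  finally show ?thesis by (simp add: A_def power_divide)
qed

end

section \<open>Compactness of curves of measures\<close>

lemma sqrt_modulus:
  assumes "e > 0"
  shows "\<exists>d>0. \<forall>s. \<bar>s - t\<bar> < d \<longrightarrow> K * sqrt (A * \<bar>t - s\<bar>) < (e::real)"
proof -
  have "((\<lambda>s. K * sqrt (A * \<bar>t - s\<bar>)) \<longlongrightarrow> K * sqrt (A * \<bar>t - t\<bar>)) (nhds t)"
    by (intro tendsto_intros filterlim_ident)
  then have "\<forall>\<^sub>F s in nhds t. K * sqrt (A * \<bar>t - s\<bar>) < e" using assms by (intro order_tendstoD(2)) auto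
  then show ?thesis by (auto simp: eventually_nhds_metric dist_real_def)
qed

text \<open>An argument of Arzela-Ascoli type: a diagonal sequence converges at the rational times,
  and equicontinuity against Lipschitz tests carries this to every time, where the second moments
  turn it into weak convergence.\<close>

theorem curve_compactness:
  fixes \<mu> :: "nat \<Rightarrow> real \<Rightarrow> real measure"
  assumes T: "T > 0"
    and fbm: "\<And>n t. t \<in> {0..T} \<Longrightarrow> fbm (\<mu> n t)" and mass: "\<And>n t. t \<in> {0..T} \<Longrightarrow> measure (\<mu> n t) UNIV \<le> 1"
    and mom: "\<And>n t. t \<in> {0..T} \<Longrightarrow> (\<integral>\<^sup>+x. ennreal (x\<^sup>2) \<partial>\<mu> n t) \<le> ennreal B"
    and equi: "\<And>n s t \<psi> K. s \<in> {0..T} \<Longrightarrow> t \<in> {0..T} \<Longrightarrow> K-lipschitz_on UNIV \<psi> \<Longrightarrow> bounded (range \<psi>) \<Longrightarrow>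
       \<bar>(\<integral>x. \<psi> x \<partial>\<mu> n t) - (\<integral>x. \<psi> x \<partial>\<mu> n s)\<bar> \<le> K * sqrt (A * \<bar>t - s\<bar>)"
  shows "\<exists>(r :: nat \<Rightarrow> nat) \<rho>. strict_mono r \<and> (\<forall>t\<in>{0..T}. fbm (\<rho> t) \<and> wconv (\<lambda>n. \<mu> (r n) t) (\<rho> t))"
proof -
  define D where "D = {0..T} \<inter> \<rat>"
  have D: "countable D" "0 \<in> D" using T by (auto simp: D_def countable_rat countable_Int2)
  define q where "q = from_nat_into D"
  have q: "q k \<in> {0..T}" for k 
  proof -
    have "D \<noteq> {}" using D by auto
    from from_nat_into[OF this, of k] show ?thesis by (auto simp: q_def D_def)
  qed
  have dense: "\<exists>k. \<bar>q k - t\<bar> < d" if t: "t \<in> {0..T}" and d: "d > 0" for t d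
  proof -
    obtain s where s: "s \<in> \<rat>" "s \<in> {0..T}" "\<bar>s - t\<bar> < d"
    proof (cases "t < T")
      case True
      then have "t < min T (t + d)" using d by simp
      from Rats_dense_in_real[OF this] obtain s where "s \<in> \<rat>" "t < s" "s < min T (t + d)" by auto
      then show ?thesis using t by (intro that[of s]) auto
    next
      case False
      then have "max 0 (t - d) < t" using d t T by auto
      from Rats_dense_in_real[OF this] obtain s where "s \<in> \<rat>" "max 0 (t - d) < s" "s < t" by auto
      then show ?thesis using t by (intro that[of s]) auto
    qed
    then have "s \<in> D" by (simp add: D_def)
    then obtain k where "q k = s" using from_nat_into_surj[OF D(1)] by (auto simp: q_def)
    then show ?thesis using s by blast
  qed
  interpret S: subseqs "\<lambda>k s. \<exists>M. fbm M \<and> wconv (\<lambda>n. \<mu> (s n) (q k)) M"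
  proof
    fix k and s :: "nat \<Rightarrow> nat" assume "strict_mono s"
    from fbm_subsequence[of "\<lambda>n. \<mu> (s n) (q k)" B] fbm mass mom q
    obtain r M where "strict_mono r" "fbm M" "wconv (\<lambda>n. \<mu> (s (r n)) (q k)) M" by blast
    then show "\<exists>r'. strict_mono r' \<and> (\<exists>M. fbm M \<and> wconv (\<lambda>n. \<mu> ((s \<circ> r') n) (q k)) M)"
      by (intro exI[of _ r]) auto
  qed
  define r where "r = S.diagseq"
  have r: "strict_mono r" unfolding r_def by (rule S.subseq_diagseq)
  have conv_q: "convergent (\<lambda>n. \<integral>x. \<psi> x \<partial>\<mu> (r n) (q k))" if "continuous_on UNIV \<psi>" "bounded (range \<psi>)" for k and \<psi> :: "real \<Rightarrow> real"
  proof -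
    have "\<exists>M. fbm M \<and> wconv (\<lambda>n. \<mu> ((S.diagseq \<circ> (+) (Suc k)) n) (q k)) M"
      by (rule S.diagseq_holds) (auto intro: wconv_subseq)
    then obtain M where "wconv (\<lambda>n. \<mu> (r (n + Suc k)) (q k)) M" by (auto simp: r_def add.commute)
    from wconvD[OF this that] have "(\<lambda>n. \<integral>x. \<psi> x \<partial>\<mu> (r n) (q k)) \<longlonglongrightarrow> (\<integral>x. \<psi> x \<partial>M)"
      by (rule LIMSEQ_offset)
    then show ?thesis by (rule convergentI)
  qed
  have "\<exists>M. fbm M \<and> wconv (\<lambda>n. \<mu> (r n) t) M" if t: "t \<in> {0..T}" for t
  proof -
    \<comment> \<open>Cauchy property by comparison with a nearby rational time, at the cost of two
      further terms \<open>e / 3\<close>.\<close>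
    have conv: "convergent (\<lambda>n. \<integral>x. \<psi> x \<partial>\<mu> (r n) t)" if \<psi>: "K-lipschitz_on UNIV \<psi>" "bounded (range \<psi>)" for K and \<psi> :: "real \<Rightarrow> real"
    proof (rule Cauchy_convergent, rule metric_CauchyI)
      fix e :: real assume "e > 0"
      then have e: "e / 3 > 0" by simp
      from sqrt_modulus[OF e, of t K A] obtain d where d: "d > 0" "\<And>s. \<bar>s - t\<bar> < d \<Longrightarrow> K * sqrt (A * \<bar>t - s\<bar>) < e / 3" by blast
      from dense[OF t d(1)] obtain k where k: "\<bar>q k - t\<bar> < d" by blast
      have close: "\<bar>(\<integral>x. \<psi> x \<partial>\<mu> (r n) t) - (\<integral>x. \<psi> x \<partial>\<mu> (r n) (q k))\<bar> < e / 3" for n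
        using equi[OF q t \<psi>, of "r n" k] d(2)[OF k] by linarith
      have "Cauchy (\<lambda>n. \<integral>x. \<psi> x \<partial>\<mu> (r n) (q k))"
        using \<psi> by (intro convergent_Cauchy conv_q) (auto intro: lipschitz_on_continuous_on)
      from metric_CauchyD[OF this e] obtain N where N: "\<And>m n. m \<ge> N \<Longrightarrow> n \<ge> N \<Longrightarrow>
          dist (\<integral>x. \<psi> x \<partial>\<mu> (r m) (q k)) (\<integral>x. \<psi> x \<partial>\<mu> (r n) (q k)) < e / 3" by blast
      show "\<exists>N. \<forall>m\<ge>N. \<forall>n\<ge>N. dist (\<integral>x. \<psi> x \<partial>\<mu> (r m) t) (\<integral>x. \<psi> x \<partial>\<mu> (r n) t) < e"
      proof (intro exI allI impI)
        fix m n assume "m \<ge> N" "n \<ge> N"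
        from N[OF this, unfolded dist_real_def] close[of m] close[of n]
        show "dist (\<integral>x. \<psi> x \<partial>\<mu> (r m) t) (\<integral>x. \<psi> x \<partial>\<mu> (r n) t) < e" unfolding dist_real_def by linarith
      qed
    qed
    \<comment> \<open>A further subsequence, depending on \<open>t\<close>, only supplies a limit
      measure; convergence of all Lipschitz integrals then makes it the limit along \<open>r\<close>
      itself.\<close>
    from fbm_subsequence[of "\<lambda>n. \<mu> (r n) t" B] fbm mass mom t
    obtain r' M where r': "strict_mono r'" and M: "fbm M" and w: "wconv (\<lambda>n. \<mu> (r (r' n)) t) M" by blast
    have "wconv (\<lambda>n. \<mu> (r n) t) M"
    proof (rule wconv_lipschitzI[where C=B])
      fix \<psi> :: "real \<Rightarrow> real" and K assume \<psi>: "K-lipschitz_on UNIV \<psi>" "bounded (range \<psi>)"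
      from conv[OF \<psi>] obtain l where l: "(\<lambda>n. \<integral>x. \<psi> x \<partial>\<mu> (r n) t) \<longlonglongrightarrow> l" by (auto simp: convergent_def)
      have "(\<lambda>n. \<integral>x. \<psi> x \<partial>\<mu> (r (r' n)) t) \<longlonglongrightarrow> l" using LIMSEQ_subseq_LIMSEQ[OF l r'] by (simp add: o_def)
      moreover have "(\<lambda>n. \<integral>x. \<psi> x \<partial>\<mu> (r (r' n)) t) \<longlonglongrightarrow> (\<integral>x. \<psi> x \<partial>M)"
        using \<psi> by (intro wconvD[OF w]) (auto intro: lipschitz_on_continuous_on)
      ultimately have "l = (\<integral>x. \<psi> x \<partial>M)" by (rule LIMSEQ_unique)
      with l show "(\<lambda>n. \<integral>x. \<psi> x \<partial>\<mu> (r n) t) \<longlonglongrightarrow> (\<integral>x. \<psi> x \<partial>M)" by simp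
    qed (use fbm mass mom t M in auto)
    then show ?thesis using M by blast
  qed
  then have "\<exists>\<rho>. \<forall>t\<in>{0..T}. fbm (\<rho> t) \<and> wconv (\<lambda>n. \<mu> (r n) t) (\<rho> t)" by (intro bchoice) blast
  then show ?thesis using r by blast
qed

text \<open>A general \<open>\<phi>\<close> has no explicit modulus along the curve, so times
  \<open>s n\<close> nearly attaining the supremum are followed instead. Along subsequences they
  converge to some \<open>t\<close>, and the approximations and the limit curve, taken at these
  times, both tend to \<open>\<rho> t\<close>.\<close>

theorem uniform_wconv:
  fixes \<mu> :: "nat \<Rightarrow> real \<Rightarrow> real measure" and \<phi> :: "real \<Rightarrow> real"
  assumes T: "T > 0"
    and fbm: "\<And>n t. t \<in> {0..T} \<Longrightarrow> fbm (\<mu> n t)" and mass: "\<And>n t. t \<in> {0..T} \<Longrightarrow> measure (\<mu> n t) UNIV \<le> 1"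
    and mom: "\<And>n t. t \<in> {0..T} \<Longrightarrow> (\<integral>\<^sup>+x. ennreal (x\<^sup>2) \<partial>\<mu> n t) \<le> ennreal B" and B: "B \<ge> 0"
    and equi: "\<And>n s t \<psi> K. s \<in> {0..T} \<Longrightarrow> t \<in> {0..T} \<Longrightarrow> K-lipschitz_on UNIV \<psi> \<Longrightarrow> bounded (range \<psi>) \<Longrightarrow>
       \<bar>(\<integral>x. \<psi> x \<partial>\<mu> n t) - (\<integral>x. \<psi> x \<partial>\<mu> n s)\<bar> \<le> K * sqrt (A * \<bar>t - s\<bar>)"
    and lim: "\<And>t. t \<in> {0..T} \<Longrightarrow> fbm (\<rho> t)" "\<And>t. t \<in> {0..T} \<Longrightarrow> wconv (\<lambda>n. \<mu> n t) (\<rho> t)"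
    and \<phi>: "continuous_on UNIV \<phi>" "bounded (range \<phi>)"
  shows "(\<lambda>n. SUP t\<in>{0..T}. \<bar>(\<integral>x. \<phi> x \<partial>\<mu> n t) - (\<integral>x. \<phi> x \<partial>\<rho> t)\<bar>) \<longlonglongrightarrow> 0"
proof -
  have mass\<rho>: "measure (\<rho> t) UNIV \<le> 1" if "t \<in> {0..T}" for t
    by (rule LIMSEQ_le_const2[OF wconv_mass[OF lim(2)[OF that]]]) (use that fbm lim mass in auto)
  have mom\<rho>: "(\<integral>\<^sup>+x. ennreal (x\<^sup>2) \<partial>\<rho> t) \<le> ennreal B" if "t \<in> {0..T}" for t
    by (rule wconv_moment[OF fbm lim B mom]) (use that in auto)
  have equi\<rho>: "\<bar>(\<integral>x. \<psi> x \<partial>\<rho> t) - (\<integral>x. \<psi> x \<partial>\<rho> s)\<bar> \<le> K * sqrt (A * \<bar>t - s\<bar>)"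
    if st: "s \<in> {0..T}" "t \<in> {0..T}" and \<psi>: "K-lipschitz_on UNIV \<psi>" "bounded (range \<psi>)" for s t K \<psi>
  proof -
    have c: "continuous_on UNIV \<psi>" using \<psi>(1) by (rule lipschitz_on_continuous_on)
    have "(\<lambda>n. \<bar>(\<integral>x. \<psi> x \<partial>\<mu> n t) - (\<integral>x. \<psi> x \<partial>\<mu> n s)\<bar>) \<longlonglongrightarrow> \<bar>(\<integral>x. \<psi> x \<partial>\<rho> t) - (\<integral>x. \<psi> x \<partial>\<rho> s)\<bar>"
      by (intro tendsto_rabs tendsto_diff wconvD[OF lim(2)] st c \<psi>)
    then show ?thesis by (rule LIMSEQ_le_const2) (use equi[OF st \<psi>] in auto)
  qed
  \<comment> \<open>Stated for a general family \<open>\<nu>\<close>, as it is applied to the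
    approximations and to the constant sequence \<open>\<rho>\<close>.\<close>
  have moving: "wconv (\<lambda>n. \<nu> n (s n)) (\<rho> t)"
    if s: "\<And>n. s n \<in> {0..T}" "s \<longlonglongrightarrow> t" and t: "t \<in> {0..T}"
      and \<nu>: "\<And>n t. t \<in> {0..T} \<Longrightarrow> fbm (\<nu> n t)" "\<And>n t. t \<in> {0..T} \<Longrightarrow> measure (\<nu> n t) UNIV \<le> 1"
        "\<And>n t. t \<in> {0..T} \<Longrightarrow> (\<integral>\<^sup>+x. ennreal (x\<^sup>2) \<partial>\<nu> n t) \<le> ennreal B"
        "\<And>n s t \<psi> K. s \<in> {0..T} \<Longrightarrow> t \<in> {0..T} \<Longrightarrow> K-lipschitz_on UNIV \<psi> \<Longrightarrow> bounded (range \<psi>) \<Longrightarrow>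
           \<bar>(\<integral>x. \<psi> x \<partial>\<nu> n t) - (\<integral>x. \<psi> x \<partial>\<nu> n s)\<bar> \<le> K * sqrt (A * \<bar>t - s\<bar>)"
        "wconv (\<lambda>n. \<nu> n t) (\<rho> t)"
    for s t and \<nu> :: "nat \<Rightarrow> real \<Rightarrow> real measure"
  proof (rule wconv_lipschitzI[where C=B])
    fix \<psi> :: "real \<Rightarrow> real" and K assume \<psi>: "K-lipschitz_on UNIV \<psi>" "bounded (range \<psi>)"
    have "(\<lambda>n. (\<integral>x. \<psi> x \<partial>\<nu> n (s n)) - (\<integral>x. \<psi> x \<partial>\<nu> n t)) \<longlonglongrightarrow> 0"
    proof (rule Lim_null_comparison)
      show "\<forall>\<^sub>F n in sequentially. norm ((\<integral>x. \<psi> x \<partial>\<nu> n (s n)) - (\<integral>x. \<psi> x \<partial>\<nu> n t)) \<le> K * sqrt (A * \<bar>s n - t\<bar>)"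
        using \<nu>(4)[OF t s(1) \<psi>] by simp
      have "(\<lambda>n. K * sqrt (A * \<bar>s n - t\<bar>)) \<longlonglongrightarrow> K * sqrt (A * \<bar>t - t\<bar>)" by (intro tendsto_intros s)
      then show "(\<lambda>n. K * sqrt (A * \<bar>s n - t\<bar>)) \<longlonglongrightarrow> 0" by simp
    qed
    moreover have "(\<lambda>n. \<integral>x. \<psi> x \<partial>\<nu> n t) \<longlonglongrightarrow> (\<integral>x. \<psi> x \<partial>\<rho> t)"
      using \<psi> by (intro wconvD[OF \<nu>(5)]) (auto intro: lipschitz_on_continuous_on)
    ultimately show "(\<lambda>n. \<integral>x. \<psi> x \<partial>\<nu> n (s n)) \<longlonglongrightarrow> (\<integral>x. \<psi> x \<partial>\<rho> t)"
      using tendsto_add by fastforce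
  qed (use \<nu> s lim t in auto)
  define f where "f n t = \<bar>(\<integral>x. \<phi> x \<partial>\<mu> n t) - (\<integral>x. \<phi> x \<partial>\<rho> t)\<bar>" for n t
  obtain b where b: "\<And>x. \<bar>\<phi> x\<bar> \<le> b" using \<phi>(2) by (auto simp: bounded_iff)
  have b0: "b \<ge> 0" using order_trans[OF abs_ge_zero b[of 0]] .
  have "\<bar>\<integral>x. \<phi> x \<partial>M\<bar> \<le> b" if "fbm M" "measure M UNIV \<le> 1" for M
    using integral_fbm_bound[OF that(1), of \<phi>, OF b] mult_left_mono[OF that(2) b0] by linarith
  then have "f n t \<le> b + b" if "t \<in> {0..T}" for n t
    using that fbm[OF that] mass[OF that] lim(1)[OF that] mass\<rho>[OF that]
      abs_triangle_ineq4[of "\<integral>x. \<phi> x \<partial>\<mu> n t" "\<integral>x. \<phi> x \<partial>\<rho> t"] unfolding f_def by (meson add_mono order_trans)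
  then have bdd: "bdd_above (f n ` {0..T})" for n by (rule bdd_aboveI2)
  have ne: "{0..T} \<noteq> {}" using T by simp
  have "\<exists>t\<in>{0..T}. (SUP t\<in>{0..T}. f n t) - 1 / real (Suc n) < f n t" for n
    using less_cSUP_iff[OF ne bdd, of "(SUP t\<in>{0..T}. f n t) - 1 / real (Suc n)" n] by simp
  then obtain s where s: "\<And>n. s n \<in> {0..T}" "\<And>n. (SUP t\<in>{0..T}. f n t) - 1 / real (Suc n) < f n (s n)" by metis
  have fs: "(\<lambda>n. f n (s n)) \<longlonglongrightarrow> 0"
  proof (rule tendsto_subseq_principle)
    fix r :: "nat \<Rightarrow> nat" assume r: "strict_mono r"
    have "bounded (range (\<lambda>n. s (r n)))" using s(1) by (intro bounded_subset[OF bounded_closed_interval[of 0 T]]) auto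
    from bounded_imp_convergent_subsequence[OF this] obtain t r' where r': "strict_mono r'" and t: "(\<lambda>n. s (r (r' n))) \<longlonglongrightarrow> t"
      by (auto simp: o_def)
    have tT: "t \<in> {0..T}"
      by (rule closed_sequentially[OF closed_real_atLeastAtMost _ t]) (rule s(1))
    have rr: "strict_mono (\<lambda>n. r (r' n))" using strict_mono_o[OF r r'] by (simp add: o_def)
    have "wconv (\<lambda>n. \<mu> (r (r' n)) (s (r (r' n)))) (\<rho> t)"
      by (rule moving[where \<nu>="\<lambda>n. \<mu> (r (r' n))", OF s(1) t tT fbm mass mom equi])
         (use wconv_subseq[OF lim(2)[OF tT] rr] in auto)
    moreover have "wconv (\<lambda>n. \<rho> (s (r (r' n)))) (\<rho> t)"
      by (rule moving[where \<nu>="\<lambda>_. \<rho>", OF s(1) t tT lim(1) mass\<rho> mom\<rho> equi\<rho>]) (auto simp: wconv_def)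
    ultimately have "(\<lambda>n. f (r (r' n)) (s (r (r' n)))) \<longlonglongrightarrow> \<bar>(\<integral>x. \<phi> x \<partial>\<rho> t) - (\<integral>x. \<phi> x \<partial>\<rho> t)\<bar>"
      unfolding f_def by (intro tendsto_rabs tendsto_diff wconvD \<phi>)
    then show "\<exists>r'. strict_mono r' \<and> (\<lambda>n. f (r (r' n)) (s (r (r' n)))) \<longlonglongrightarrow> 0" using r' by auto
  qed
  have "(\<lambda>n. SUP t\<in>{0..T}. f n t) \<longlonglongrightarrow> 0"
  proof (rule tendsto_sandwich)
    show "\<forall>\<^sub>F n in sequentially. 0 \<le> (SUP t\<in>{0..T}. f n t)"
      using T by (intro always_eventually allI cSUP_upper2[OF bdd, of 0]) (auto simp: f_def)
    show "\<forall>\<^sub>F n in sequentially. (SUP t\<in>{0..T}. f n t) \<le> f n (s n) + 1 / real (Suc n)"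
      using s(2) by (intro always_eventually allI) (smt (verit))
    show "(\<lambda>n. f n (s n) + 1 / real (Suc n)) \<longlonglongrightarrow> 0"
      using tendsto_add[OF fs LIMSEQ_inverse_real_of_nat] by (simp add: inverse_eq_divide)
  qed simp
  then show ?thesis by (simp add: f_def)
qed

section \<open>Limits of the speeds\<close>

text \<open>Continuous functions decreasing to the indicator of a closed set; for positive
  \<open>k\<close> they vanish at distance \<open>1 / k\<close> or more from
  \<open>S\<close>.\<close>

definition bump :: "real set \<Rightarrow> nat \<Rightarrow> real \<Rightarrow> real" where
  "bump S k u = max 0 (1 - real k * infdist u S)"

lemma bump_bounds: "0 \<le> bump S k u" "bump S k u \<le> 1" "u \<in> S \<Longrightarrow> bump S k u = 1"
  using infdist_nonneg[of u S] by (auto simp: bump_def)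

lemma bump_continuous: "continuous_on X (bump S k)"
  unfolding bump_def by (intro continuous_intros)

lemma bump_measurable[measurable]: "bump S k \<in> borel_measurable borel"
  by (rule borel_measurable_continuous_onI[OF bump_continuous])

lemma bump_bounded: "bounded (range (bump S k))"
  using bump_bounds[where S=S and k=k] by (auto simp: bounded_iff intro!: exI[of _ 1])

lemma bump_lim:
  assumes "closed S" "S \<noteq> {}"
  shows "(\<lambda>k. bump S k u) \<longlonglongrightarrow> indicator S u"
proof (cases "u \<in> S")
  case False
  then have d: "infdist u S > 0" using assms infdist_pos_not_in_closed by blast
  obtain N where N: "1 / infdist u S \<le> real N" using real_nat_ceiling_ge by blast
  have "bump S k u = 0" if "k \<ge> N" for k
  proof -
    have "1 / infdist u S \<le> real k" using N that by linarith
    then have "1 \<le> real k * infdist u S" using d by (simp add: field_simps)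
    then show ?thesis by (simp add: bump_def)
  qed
  then have "\<forall>\<^sub>F k in sequentially. bump S k u = 0" by (auto simp: eventually_sequentially)
  then show ?thesis using False by (simp add: tendsto_eventually)
qed (simp add: bump_bounds)

lemma bump_integral_lim:
  assumes S: "closed S" "S \<noteq> {}" and N: "fbm N"
  shows "(\<lambda>k. \<integral>u. bump S k u \<partial>N) \<longlonglongrightarrow> measure N S"
proof -
  interpret finite_measure N by (rule fbmD(1)[OF N])
  have "(\<lambda>k. \<integral>u. bump S k u \<partial>N) \<longlonglongrightarrow> (\<integral>u. indicator S u \<partial>N)"
    by (rule integral_dominated_convergence[where w="\<lambda>_. 1"])
       (use S bump_lim bump_bounds in \<open>auto intro!: measurable_fbm[OF N] borel_closed\<close>)
  then show ?thesis by (simp add: fbmD(3)[OF N])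
qed

text \<open>A weak limit of densities bounded in \<open>L\<^sup>2\<close> is absolutely continuous; this replaces weak
  compactness in \<open>L\<^sup>2\<close>.\<close>

theorem velocity_compactness:
  fixes f :: "nat \<Rightarrow> real \<Rightarrow> real"
  assumes T: "T > 0" and fm[measurable]: "\<And>n. f n \<in> borel_measurable borel" and f0: "\<And>n t. 0 \<le> f n t"
    and fL: "\<And>n t. f n t \<le> L n"
    and A: "\<And>n. (LINT t:{0..T}|lborel. (f n t)\<^sup>2) \<le> A"
  shows "\<exists>(r :: nat \<Rightarrow> nat) g. strict_mono r \<and> g \<in> borel_measurable borel \<and> (\<forall>t. 0 \<le> g t) \<and> set_integrable lborel {0..T} g \<and>
    (\<forall>s t D. 0 \<le> s \<longrightarrow> s \<le> t \<longrightarrow> t \<le> T \<longrightarrow> (LINT u:{s..t}|lborel. g u) < D \<longrightarrow>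
       (\<forall>\<^sub>F n in sequentially. (LINT u:{s..t}|lborel. f (r n) u) < D))"
proof -
  have A0: "0 \<le> A"
    by (rule order_trans[OF _ A[of 0]]) (auto simp: set_lebesgue_integral_def intro!: integral_nonneg_AE)
  define Z where "Z = 1 + T + A"
  have Z: "Z > 0" using T A0 by (simp add: Z_def)
  have int: "set_integrable lborel {0..T} (\<lambda>u. f n u * \<phi> u)"
    if [measurable]: "\<phi> \<in> borel_measurable borel" and \<phi>: "\<And>u. 0 \<le> \<phi> u" "\<And>u. \<phi> u \<le> 1" for n \<phi>
  proof (rule set_integrable_bounded)
    show "\<bar>f n u * \<phi> u\<bar> \<le> L n" for u
      using mult_mono[OF fL \<phi>(2), of n u u] \<phi> f0 order_trans[OF f0 fL] by (simp add: abs_mult)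
  qed measurable
  \<comment> \<open>The free weight \<open>c\<close> will make the energy term small, while the
    other term vanishes as the test functions shrink to a null set.\<close>
  have young: "(LINT u:{0..T}|lborel. f n u * \<phi> u) \<le> c / 2 * A + (1 / (2 * c)) * (LINT u:{0..T}|lborel. (\<phi> u)\<^sup>2)"
    if [measurable]: "\<phi> \<in> borel_measurable borel" and \<phi>: "\<And>u. 0 \<le> \<phi> u" "\<And>u. \<phi> u \<le> 1" and c: "c > 0" for n \<phi> c
  proof -
    have i1: "set_integrable lborel {0..T} (\<lambda>u. (f n u)\<^sup>2)"
      using f0 fL by (intro set_integrable_bounded[of _ "(L n)\<^sup>2"]) (auto intro: power_mono)
    have i2: "set_integrable lborel {0..T} (\<lambda>u. (\<phi> u)\<^sup>2)"
      using \<phi> by (intro set_integrable_bounded[of _ 1]) (auto intro: power_le_one)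
    have "(LINT u:{0..T}|lborel. f n u * \<phi> u) \<le> (LINT u:{0..T}|lborel. c / 2 * (f n u)\<^sup>2 + (1 / (2 * c)) * (\<phi> u)\<^sup>2)"
    proof (rule set_integral_mono)
      show "set_integrable lborel {0..T} (\<lambda>u. c / 2 * (f n u)\<^sup>2 + (1 / (2 * c)) * (\<phi> u)\<^sup>2)"
        using i1 i2 by (intro set_integral_add set_integrable_mult_right) auto
      fix u
      have "0 \<le> (c * f n u - \<phi> u)\<^sup>2 / (2 * c)" using c by simp
      also have "\<dots> = c / 2 * (f n u)\<^sup>2 + (1 / (2 * c)) * (\<phi> u)\<^sup>2 - f n u * \<phi> u"
        using c by (simp add: power2_eq_square field_simps)
      finally show "f n u * \<phi> u \<le> c / 2 * (f n u)\<^sup>2 + (1 / (2 * c)) * (\<phi> u)\<^sup>2" by simp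
    qed (intro int \<phi>, simp)
    also have "\<dots> = c / 2 * (LINT u:{0..T}|lborel. (f n u)\<^sup>2) + (1 / (2 * c)) * (LINT u:{0..T}|lborel. (\<phi> u)\<^sup>2)"
      using i1 i2 by (subst set_integral_add(2)) (auto simp: set_integrable_mult_right)
    also have "\<dots> \<le> c / 2 * A + (1 / (2 * c)) * (LINT u:{0..T}|lborel. (\<phi> u)\<^sup>2)"
      using A[of n] c by (intro add_right_mono mult_left_mono) auto
    finally show ?thesis .
  qed
  define h where "h n u = indicator {0..T} u * f n u / Z" for n u
  have hm[measurable]: "h n \<in> borel_measurable borel" for n unfolding h_def by measurable
  have h0: "0 \<le> h n u" for n u using f0 Z by (simp add: h_def)
  define M where "M n = density lborel (\<lambda>u. ennreal (h n u))" for n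
  have intM: "(\<integral>u. \<phi> u \<partial>M n) = (1 / Z) * (LINT u:{0..T}|lborel. f n u * \<phi> u)"
    if [measurable]: "\<phi> \<in> borel_measurable borel" for n \<phi>
  proof -
    have "(\<integral>u. \<phi> u \<partial>M n) = (\<integral>u. h n u * \<phi> u \<partial>lborel)"
      unfolding M_def using h0 by (subst integral_density) auto
    also have "\<dots> = (\<integral>u. (1 / Z) * (indicator {0..T} u * (f n u * \<phi> u)) \<partial>lborel)"
      by (intro Bochner_Integration.integral_cong) (auto simp: h_def)
    finally show ?thesis by (simp add: set_lebesgue_integral_def)
  qed
  have hint: "integrable lborel (h n)" for n
  proof -
    have "integrable lborel (\<lambda>u. (1 / Z) * (indicator {0..T} u *\<^sub>R (f n u * 1)))"
      using int[of "\<lambda>_. 1" n] unfolding set_integrable_def by (intro integrable_mult_right) auto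
    then show ?thesis by (simp add: h_def[abs_def])
  qed
  have mass: "(\<integral>u. h n u \<partial>lborel) \<le> 1" for n
  proof -
    have "(\<integral>u. h n u \<partial>lborel) = (1 / Z) * (LINT u:{0..T}|lborel. f n u * 1)"
      by (simp add: h_def[abs_def] set_lebesgue_integral_def)
    also have "\<dots> \<le> (1 / Z) * (1 / 2 * A + (1 / (2 * 1)) * (LINT u:{0..T}|lborel. 1\<^sup>2))"
      using Z by (intro mult_left_mono young) auto
    also have "(LINT u:{0..T}|lborel. 1\<^sup>2) = T" using T by (simp add: set_lebesgue_integral_def)
    also have "(1 / Z) * (1 / 2 * A + (1 / (2 * 1)) * T) \<le> 1" using Z A0 T by (simp add: Z_def field_simps)
    finally show ?thesis .
  qed
  have eM: "emeasure (M n) UNIV = ennreal (\<integral>u. h n u \<partial>lborel)" for n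
    unfolding M_def using nn_integral_eq_integral[OF hint] h0 by (simp add: emeasure_density)
  have fbmM: "fbm (M n)" for n
    by (rule fbmI) (simp_all add: M_def[symmetric] eM, simp add: M_def)
  have massM: "measure (M n) UNIV \<le> 1" for n
    using eM[of n] mass[of n] h0 by (simp add: measure_def integral_nonneg_AE)
  have momM: "(\<integral>\<^sup>+u. ennreal (u\<^sup>2) \<partial>M n) \<le> ennreal (T\<^sup>2)" for n
  proof -
    have "(\<integral>\<^sup>+u. ennreal (u\<^sup>2) \<partial>M n) = (\<integral>\<^sup>+u. ennreal (h n u) * ennreal (u\<^sup>2) \<partial>lborel)"
      unfolding M_def by (subst nn_integral_density) auto
    also have "\<dots> \<le> (\<integral>\<^sup>+u. ennreal (T\<^sup>2) * ennreal (h n u) \<partial>lborel)"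
    proof (rule nn_integral_mono)
      fix u
      show "ennreal (h n u) * ennreal (u\<^sup>2) \<le> ennreal (T\<^sup>2) * ennreal (h n u)"
      proof (cases "u \<in> {0..T}")
        case True
        then have "u\<^sup>2 \<le> T\<^sup>2" by (intro power_mono) auto
        then show ?thesis by (subst mult.commute) (intro mult_right_mono ennreal_leI, auto)
      qed (simp add: h_def)
    qed
    also have "\<dots> = ennreal (T\<^sup>2) * ennreal (\<integral>u. h n u \<partial>lborel)"
      using nn_integral_eq_integral[OF hint] h0 by (simp add: nn_integral_cmult)
    also have "\<dots> \<le> ennreal (T\<^sup>2) * ennreal 1" using mass by (intro mult_left_mono ennreal_leI) auto
    finally show ?thesis by simp
  qed
  from fbm_subsequence[of M, OF fbmM massM momM] obtain r N where r: "strict_mono r" and N: "fbm N" and w: "wconv (\<lambda>n. M (r n)) N"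
    by blast
  \<comment> \<open>Bumps shrinking to \<open>S\<close> remove the second term of Young's
    inequality; what remains is a multiple of \<open>c\<close>, and \<open>c\<close> is
    arbitrary.\<close>
  have compact_null: "measure N S = 0" if S: "compact S" "emeasure lborel S = 0" for S
  proof (cases "S = {}")
    case False
    have Sc: "closed S" using S(1) by (rule compact_imp_closed)
    have le: "measure N S \<le> (1 / Z) * (c / 2 * A)" if c: "c > 0" for c
    proof (rule LIMSEQ_le[OF bump_integral_lim[OF Sc False N]])
      have i2: "(\<lambda>k. LINT u:{0..T}|lborel. (bump S k u)\<^sup>2) \<longlonglongrightarrow> (LINT u:{0..T}|lborel. (indicator S u)\<^sup>2)"
        unfolding set_lebesgue_integral_def
      proof (rule integral_dominated_convergence[where w="\<lambda>u. indicator {0..T} u"])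
        have [measurable]: "S \<in> sets borel" using Sc by auto
        show "(\<lambda>u. indicat_real {0..T} u *\<^sub>R (indicat_real S u)\<^sup>2) \<in> borel_measurable lborel" by measurable
        show "integrable lborel (\<lambda>u. indicator {0..T} u :: real)" using T by (simp add: integrable_indicator_iff)
        show "AE u in lborel. (\<lambda>k. indicat_real {0..T} u *\<^sub>R (bump S k u)\<^sup>2) \<longlonglongrightarrow> indicat_real {0..T} u *\<^sub>R (indicat_real S u)\<^sup>2"
          by (intro AE_I2 tendsto_intros bump_lim Sc False)
        show "AE u in lborel. norm (indicat_real {0..T} u *\<^sub>R (bump S k u)\<^sup>2) \<le> indicator {0..T} u" for k
          using bump_bounds[where S=S and k=k] by (intro AE_I2) (auto simp: indicator_def intro: power_le_one)
      qed measurable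
      have "(LINT u:{0..T}|lborel. (indicat_real S u)\<^sup>2) = 0"
        unfolding set_lebesgue_integral_def
      proof (rule integral_eq_zero_AE)
        have "S \<in> null_sets lborel" using S(2) Sc by (auto simp: null_sets_def)
        then have "AE u in lborel. u \<notin> S" by (rule AE_not_in)
        then show "AE u in lborel. indicat_real {0..T} u *\<^sub>R (indicat_real S u)\<^sup>2 = 0" by eventually_elim auto
      qed
      with i2 have "(\<lambda>k. (1 / Z) * (c / 2 * A + (1 / (2 * c)) * (LINT u:{0..T}|lborel. (bump S k u)\<^sup>2))) \<longlonglongrightarrow> (1 / Z) * (c / 2 * A + (1 / (2 * c)) * 0)"
        by (intro tendsto_intros) simp
      then show "(\<lambda>k. (1 / Z) * (c / 2 * A + (1 / (2 * c)) * (LINT u:{0..T}|lborel. (bump S k u)\<^sup>2))) \<longlonglongrightarrow> (1 / Z) * (c / 2 * A)" by simp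
      show "\<exists>n0. \<forall>k\<ge>n0. (\<integral>u. bump S k u \<partial>N) \<le> (1 / Z) * (c / 2 * A + (1 / (2 * c)) * (LINT u:{0..T}|lborel. (bump S k u)\<^sup>2))"
      proof (intro exI allI impI)
        fix k
        show "(\<integral>u. bump S k u \<partial>N) \<le> (1 / Z) * (c / 2 * A + (1 / (2 * c)) * (LINT u:{0..T}|lborel. (bump S k u)\<^sup>2))"
        proof (rule LIMSEQ_le_const2[OF wconvD[OF w bump_continuous bump_bounded]], intro exI allI impI)
          show "(\<integral>u. bump S k u \<partial>M (r n)) \<le> (1 / Z) * (c / 2 * A + (1 / (2 * c)) * (LINT u:{0..T}|lborel. (bump S k u)\<^sup>2))" for n
            unfolding intM[OF bump_measurable] using Z c bump_bounds by (intro mult_left_mono young) auto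
        qed
      qed
    qed
    have "measure N S \<le> 0 + e" if "e > 0" for e
    proof -
      define c where "c = e * Z / (A + 1)"
      have c: "c > 0" using that Z A0 by (simp add: c_def)
      have "(1 / Z) * (c / 2 * A) = e * (A / (2 * (A + 1)))" using Z A0 by (simp add: c_def field_simps)
      also have "\<dots> \<le> e * 1" using that A0 by (intro mult_left_mono) (auto simp: field_simps)
      finally show ?thesis using le[OF c] by simp
    qed
    then have "measure N S \<le> 0" by (rule field_le_epsilon)
    then show ?thesis using measure_nonneg[of N S] by linarith
  qed simp
  have ac: "absolutely_continuous lborel N"
    unfolding absolutely_continuous_def
  proof
    fix B assume B: "B \<in> null_sets (lborel :: real measure)"
    then have Bb: "B \<in> sets borel" "emeasure lborel B = 0" by auto
    \<comment> \<open>Inner regularity reduces null Borel sets to compact ones.\<close>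
    have "emeasure N B = (SUP K \<in> {K. K \<subseteq> B \<and> compact K}. emeasure N K)"
      using fbmD(4)[OF N, of UNIV] by (intro inner_regular Bb fbmD(2)[OF N]) (simp add: fbmD(3)[OF N])
    also have "\<dots> \<le> 0"
    proof (rule SUP_least)
      fix K assume K: "K \<in> {K. K \<subseteq> B \<and> compact K}"
      have "emeasure lborel K \<le> emeasure lborel B" using K Bb by (intro emeasure_mono) auto
      then have "measure N K = 0" using K Bb by (intro compact_null) auto
      then show "emeasure N K \<le> 0" by (simp add: fbmD(5)[OF N])
    qed
    finally show "B \<in> null_sets N" using Bb fbmD(2)[OF N] by (auto simp: null_sets_def)
  qed
  have sN: "sets N = sets (lborel :: real measure)" using fbmD(2)[OF N] by simp
  \<comment> \<open>A real-valued version of the density, which is finite almost everywhere because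
    \<open>N\<close> is sigma-finite.\<close>
  define D where "D x = enn2real (RN_deriv lborel N x)" for x
  have Dm[measurable]: "D \<in> borel_measurable borel" unfolding D_def[abs_def] by simp
  have D0: "0 \<le> D x" for x by (simp add: D_def)
  have ND: "N = density lborel (\<lambda>x. ennreal (D x))"
  proof -
    have "sigma_finite_measure N" using fbmD(1)[OF N] by (simp add: finite_measure_def)
    then have fin: "AE x in lborel. RN_deriv lborel N x \<noteq> \<infinity>"
      by (intro sigma_finite_measure.RN_deriv_finite[OF lborel.sigma_finite_measure_axioms] ac sN)
    have "N = density lborel (RN_deriv lborel N)"
      by (rule sigma_finite_measure.density_RN_deriv[OF lborel.sigma_finite_measure_axioms ac sN, symmetric])
    also have "\<dots> = density lborel (\<lambda>x. ennreal (D x))"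
    proof (rule density_cong)
      show "AE x in lborel. RN_deriv lborel N x = ennreal (D x)"
        using fin by eventually_elim (simp add: D_def less_top)
    qed auto
    finally show ?thesis .
  qed
  have meas: "set_integrable lborel S D" "(LINT u:S|lborel. D u) = measure N S" if [measurable]: "S \<in> sets borel" for S
  proof -
    have "emeasure N S = (\<integral>\<^sup>+u. ennreal (indicator S u * D u) \<partial>lborel)"
      by (subst ND, subst emeasure_density) (auto intro!: nn_integral_cong simp: indicator_def)
    then have *: "(\<integral>\<^sup>+u. ennreal (indicator S u * D u) \<partial>lborel) = ennreal (measure N S)" by (simp add: fbmD(5)[OF N])
    then show "set_integrable lborel S D"
      unfolding set_integrable_def using D0 by (intro integrableI_nonneg) auto
    show "(LINT u:S|lborel. D u) = measure N S"
      unfolding set_lebesgue_integral_def using D0 * by (subst integral_eq_nn_integral) auto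
  qed
  have "\<forall>\<^sub>F n in sequentially. (LINT u:{s..t}|lborel. f (r n) u) < E"
    if st: "0 \<le> s" "s \<le> t" "t \<le> T" and E: "(LINT u:{s..t}|lborel. Z * D u) < E" for s t E
  proof -
    \<comment> \<open>Upper half of the portmanteau theorem: a bump dominates the indicator of the
      closed interval, and for large \<open>k\<close> its integral against \<open>N\<close> is still
      below the strict bound \<open>E\<close>.\<close>
    have "Z * measure N {s..t} < E" using E meas[of "{s..t}"] by simp
    moreover have "(\<lambda>k. Z * (\<integral>u. bump {s..t} k u \<partial>N)) \<longlonglongrightarrow> Z * measure N {s..t}"
      using st by (intro tendsto_intros bump_integral_lim N) auto
    ultimately have "\<forall>\<^sub>F k in sequentially. Z * (\<integral>u. bump {s..t} k u \<partial>N) < E" by (intro order_tendstoD(2))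
    then obtain k where k: "Z * (\<integral>u. bump {s..t} k u \<partial>N) < E" by (auto simp: eventually_sequentially)
    have "(\<lambda>n. Z * (\<integral>u. bump {s..t} k u \<partial>M (r n))) \<longlonglongrightarrow> Z * (\<integral>u. bump {s..t} k u \<partial>N)"
      by (intro tendsto_intros wconvD[OF w] bump_continuous bump_bounded)
    then have "\<forall>\<^sub>F n in sequentially. Z * (\<integral>u. bump {s..t} k u \<partial>M (r n)) < E" using k by (rule order_tendstoD(2))
    then show ?thesis
    proof eventually_elim
      case (elim n)
      have "(LINT u:{s..t}|lborel. f (r n) u) \<le> (LINT u:{0..T}|lborel. f (r n) u * bump {s..t} k u)"
        unfolding set_lebesgue_integral_def
      proof (rule integral_mono)
        show "integrable lborel (\<lambda>u. indicat_real {s..t} u *\<^sub>R f (r n) u)"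
          using set_integrable_bounded[of "f (r n)" "L (r n)" s t] f0 fL by (auto simp: set_integrable_def)
        show "integrable lborel (\<lambda>u. indicat_real {0..T} u *\<^sub>R (f (r n) u * bump {s..t} k u))"
          using int[of "bump {s..t} k" "r n"] bump_bounds by (auto simp: set_integrable_def)
        show "indicat_real {s..t} u *\<^sub>R f (r n) u \<le> indicat_real {0..T} u *\<^sub>R (f (r n) u * bump {s..t} k u)" for u
          using st f0[of "r n" u] bump_bounds(1)[where S="{s..t}" and k=k and u=u] bump_bounds(3)[where S="{s..t}" and k=k and u=u] by (auto simp: indicator_def)
      qed
      also have "\<dots> = Z * (\<integral>u. bump {s..t} k u \<partial>M (r n))" using Z by (simp add: intM)
      also have "\<dots> < E" by fact
      finally show ?case .
    qed
  qed
  moreover have "set_integrable lborel {0..T} (\<lambda>u. Z * D u)" using meas(1) by (intro set_integrable_mult_right) auto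
  moreover have "\<forall>t. 0 \<le> Z * D t" using D0 Z by auto
  moreover have "(\<lambda>u. Z * D u) \<in> borel_measurable borel" by measurable
  ultimately show ?thesis using r by blast
qed

section \<open>Limits of the live measures\<close>

text \<open>A signed combination is not a measure, so uniqueness of cdfs does not apply directly.
  Instead, the sets on which the combination vanishes form a Dynkin system containing the half-lines
  \<open>{..a}\<close>.\<close>

lemma signed_combination_zero:
  fixes M :: "'i \<Rightarrow> real measure" and c :: "'i \<Rightarrow> real"
  assumes I: "finite I" and fbm: "\<And>j. j \<in> I \<Longrightarrow> fbm (M j)"
    and eq: "\<And>\<phi> :: real \<Rightarrow> real. continuous_on UNIV \<phi> \<Longrightarrow> bounded (range \<phi>) \<Longrightarrow> (\<Sum>j\<in>I. c j * (\<integral>x. \<phi> x \<partial>M j)) = 0"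
    and S: "S \<in> sets borel"
  shows "(\<Sum>j\<in>I. c j * measure (M j) S) = 0"
proof -
  have borel: "sets (borel :: real measure) = sigma_sets UNIV (range (\<lambda>a. {..a}))"
    by (subst borel_eq_atMost) simp
  have atMost: "(\<Sum>j\<in>I. c j * measure (M j) {..a}) = 0" for a
  proof -
    have "(\<lambda>k. \<Sum>j\<in>I. c j * (\<integral>x. step_fun a k x \<partial>M j)) \<longlonglongrightarrow> (\<Sum>j\<in>I. c j * cdf (M j) a)"
      by (intro tendsto_intros cdf_step_fun fbm)
    then show ?thesis
      unfolding eq[OF step_fun_continuous step_fun_bounded] cdf_def
      by (simp add: LIMSEQ_const_iff)
  qed
  have UN: "(\<Sum>j\<in>I. c j * measure (M j) UNIV) = 0"
    using eq[of "\<lambda>_. 1"] by (simp add: fbmD(3)[OF fbm] cong: sum.cong)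
  have Int: "Int_stable (range (\<lambda>a::real. {..a}))"
    by (auto simp: Int_stable_def)
  have sub: "range (\<lambda>a::real. {..a}) \<subseteq> Pow UNIV" by simp
  have "S \<in> sigma_sets UNIV (range (\<lambda>a. {..a}))" using S borel by simp
  with Int sub show ?thesis
  proof (induction S rule: sigma_sets_induct_disjoint)
    case (compl B)
    then have B: "B \<in> sets borel" using borel by blast
    have "measure (M j) (UNIV - B) = measure (M j) UNIV - measure (M j) B" if "j \<in> I" for j
      using finite_measure.finite_measure_compl[OF fbmD(1)[OF fbm[OF that]], of B] B
      by (simp add: fbmD(2,3)[OF fbm[OF that]])
    then show ?case using compl UN by (simp add: right_diff_distrib sum_subtractf cong: sum.cong)
  next
    case (union B)
    then have B: "range B \<subseteq> sets borel" using borel by blast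
    have "(\<lambda>i. measure (M j) (B i)) sums measure (M j) (\<Union>i. B i)" if "j \<in> I" for j
      using finite_measure.finite_measure_UNION[OF fbmD(1)[OF fbm[OF that]], of B] B union(1)
      by (simp add: fbmD(2)[OF fbm[OF that]])
    then have "(\<lambda>i. \<Sum>j\<in>I. c j * measure (M j) (B i)) sums (\<Sum>j\<in>I. c j * measure (M j) (\<Union>i. B i))"
      by (intro sums_sum sums_mult)
    then show ?case unfolding union(3) using sums_unique2[OF _ sums_zero] by blast
  qed (use atMost in auto)
qed

text \<open>Uniqueness of the Jordan decomposition: a set separating \<open>A\<close> from
  \<open>B\<close> is a Hahn set for \<open>\<mu> - \<nu>\<close>.\<close>

lemma pos_part_eqI:
  assumes fbm: "fbm \<mu>" "fbm \<nu>" "fbm A" "fbm B"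
    and eq: "\<And>S. S \<in> sets borel \<Longrightarrow> measure \<mu> S - measure \<nu> S = measure A S - measure B S"
    and P: "P \<in> sets borel" "measure A (- P) = 0" "measure B P = 0"
  shows "pos_part \<mu> \<nu> = A"
proof -
  have A0: "measure A S = 0" if "S \<in> sets borel" "S \<inter> P = {}" for S
  proof -
    have "measure A S \<le> measure A (- P)"
      using that P by (intro finite_measure.finite_measure_mono[OF fbmD(1)[OF fbm(3)]]) (auto simp: fbmD(2)[OF fbm(3)])
    then show ?thesis using P measure_nonneg[of A S] by linarith
  qed
  have B0: "measure B S = 0" if "S \<in> sets borel" "S \<subseteq> P" for S
  proof -
    have "measure B S \<le> measure B P"
      using that P by (intro finite_measure.finite_measure_mono[OF fbmD(1)[OF fbm(4)]]) (auto simp: fbmD(2)[OF fbm(4)])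
    then show ?thesis using P measure_nonneg[of B S] by linarith
  qed
  have H: "Hahn_set \<mu> \<nu> P"
    unfolding Hahn_set_def
  proof (intro conjI ballI impI P)
    fix S :: "real set" assume "S \<in> sets borel" "S \<subseteq> P"
    then show "measure \<nu> S \<le> measure \<mu> S" using eq[of S] B0[of S] measure_nonneg[of A S] by linarith
  next
    fix S :: "real set" assume "S \<in> sets borel" "S \<inter> P = {}"
    then show "measure \<mu> S \<le> measure \<nu> S" using eq[of S] A0[of S] measure_nonneg[of B S] by linarith
  qed
  have sp: "sets (pos_part \<mu> \<nu>) = sets borel"
    using sets.sigma_sets_eq[of "borel :: real measure"] by (simp add: pos_part_def)
  show ?thesis
  proof (rule measure_eqI)
    show "sets (pos_part \<mu> \<nu>) = sets A" by (simp add: sp fbmD(2)[OF fbm(3)])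
    fix S assume "S \<in> sets (pos_part \<mu> \<nu>)"
    then have S: "S \<in> sets borel" by (simp add: sp)
    have "emeasure (pos_part \<mu> \<nu>) S = ennreal (measure \<mu> (S \<inter> P) - measure \<nu> (S \<inter> P))"
      by (rule emeasure_pos_part[OF fbmD(1)[OF fbm(1)] fbmD(1)[OF fbm(2)] fbmD(2)[OF fbm(1)] fbmD(2)[OF fbm(2)] H S])
    also have "measure \<mu> (S \<inter> P) - measure \<nu> (S \<inter> P) = measure A (S \<inter> P)"
      using eq[of "S \<inter> P"] B0[of "S \<inter> P"] S P by auto
    also have "measure A (S \<inter> P) = measure A S"
    proof -
      have "measure A S = measure A (S \<inter> P) + measure A (S - P)"
        using finite_measure.finite_measure_Diff'[OF fbmD(1)[OF fbm(3)], of S P] S P by (simp add: fbmD(2)[OF fbm(3)])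
      then show ?thesis using A0[of "S - P"] S P by auto
    qed
    finally show "emeasure (pos_part \<mu> \<nu>) S = emeasure A S" by (simp add: fbmD(5)[OF fbm(3)])
  qed
qed

text \<open>Zero exactly when the first coordinate does not exceed the second: a bounded continuous
  function that turns the order of particles into a statement stable under weak limits.\<close>

definition overlap :: "real \<times> real \<Rightarrow> real" where
  "overlap z = min 1 (max 0 (fst z - snd z))"

lemma overlap_bound: "\<bar>overlap z\<bar> \<le> 1" "0 \<le> overlap z"
  by (auto simp: overlap_def)

lemma overlap_cont: "isCont overlap z"
  unfolding overlap_def by (intro continuous_intros)

lemma overlap_measurable: "overlap \<in> borel_measurable borel"
  by (intro borel_measurable_continuous_onI continuous_at_imp_continuous_on ballI overlap_cont)

text \<open>The threshold is the supremum \<open>s\<close> of the points up to which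
  \<open>B\<close> has no mass: \<open>B\<close> is null to the left of \<open>s\<close> and
  \<open>A\<close> to the right. Their common endpoint is harmless since \<open>A\<close> has no
  atoms, so \<open>{..<s}\<close> separates.\<close>

lemma singular_of_ordered:
  assumes A: "fbm A" and B: "fbm B" and atom: "\<And>z. measure A {z} = 0"
    and ord: "(\<integral>x. \<integral>y. overlap (x, y) \<partial>B \<partial>A) = 0"
  shows "\<exists>P\<in>sets borel. measure A (- P) = 0 \<and> measure B P = 0"
proof -
  interpret A: finite_borel_measure A by fact
  interpret B: finite_borel_measure B by fact
  note [simp] = fbmD(2)[OF A] fbmD(2)[OF B]
  \<comment> \<open>Mass of \<open>A\<close> from \<open>c\<close> on and of \<open>B\<close> up to
    \<open>a < c\<close> would make the overlap integral at least \<open>d\<close> times their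
    product.\<close>
  have or: "measure A {c..} = 0 \<or> measure B {..a} = 0" if ac: "a < c" for a c
  proof (rule ccontr)
    assume "\<not> ?thesis"
    then have pos: "measure A {c..} > 0" "measure B {..a} > 0" by (auto simp: less_le)
    define d where "d = min 1 (c - a)"
    have d: "d > 0" using ac by (simp add: d_def)
    have le: "d * (indicator {c..} x * indicator {..a} y) \<le> overlap (x, y)" for x y
      using d by (auto simp: indicator_def overlap_def d_def)
    have inner: "d * measure B {..a} * indicator {c..} x \<le> (\<integral>y. overlap (x, y) \<partial>B)" for x
    proof -
      have "d * measure B {..a} * indicator {c..} x = (\<integral>y. d * (indicator {c..} x * indicator {..a} y) \<partial>B)"
        by (simp add: fbmD(3)[OF B])
      also have "\<dots> \<le> (\<integral>y. overlap (x, y) \<partial>B)"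
        using le overlap_bound
        by (intro integral_mono integrable_fbm[OF B, of _ 1] integrable_fbm[OF B, of _ "d"] borel_measurable_slice overlap_measurable)
           (use d in \<open>auto simp: indicator_def\<close>)
      finally show ?thesis .
    qed
    have "0 < d * measure B {..a} * measure A {c..}" using d pos by simp
    also have "\<dots> = (\<integral>x. d * measure B {..a} * indicator {c..} x \<partial>A)" by (simp add: fbmD(3)[OF A])
    also have "\<dots> \<le> (\<integral>x. \<integral>y. overlap (x, y) \<partial>B \<partial>A)"
      using inner d pos integral_fbm_bound[OF B, of "\<lambda>y. overlap (x, y)" 1 for x] overlap_bound
      by (intro integral_mono integrable_fbm[OF A, of _ "d * measure B {..a}"]
          integrable_fbm[OF A, of _ "1 * measure B UNIV"] borel_measurable_inner_integral overlap_measurable B)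
         (auto simp: indicator_def)
    finally show False using ord by simp
  qed
  have A_UN: "measure A S = 0" if "\<And>c. c \<in> X \<Longrightarrow> measure A {c..} = 0" "countable X" "S = (\<Union>c\<in>X. {c..})" for S X
  proof -
    have "(\<Union>c\<in>X. {c..}) \<in> null_sets A"
      using that by (intro null_sets_UN') (auto simp: null_sets_def fbmD(5)[OF A])
    then show ?thesis using that(3) by (simp add: measure_eq_0_null_sets)
  qed
  have B_UN: "measure B S = 0" if "\<And>c. c \<in> X \<Longrightarrow> measure B {..c} = 0" "countable X" "S = (\<Union>c\<in>X. {..c})" for S X
  proof -
    have "(\<Union>c\<in>X. {..c}) \<in> null_sets B"
      using that by (intro null_sets_UN') (auto simp: null_sets_def fbmD(5)[OF B])
    then show ?thesis using that(3) by (simp add: measure_eq_0_null_sets)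
  qed
  define S where "S = {a. measure B {..a} = 0}"
  have down: "a \<in> S" if "b \<in> S" "a \<le> b" for a b
  proof -
    have "measure B {..a} \<le> measure B {..b}" using that by (intro B.finite_measure_mono) auto
    then show ?thesis using that measure_nonneg[of B "{..a}"] unfolding S_def mem_Collect_eq by linarith
  qed
  \<comment> \<open>Without a finite threshold one measure is zero: \<open>A\<close> in the first
    case, \<open>B\<close> in the second.\<close>
  consider "S = {}" | "S \<noteq> {}" "\<not> bdd_above S" | "S \<noteq> {}" "bdd_above S" by satx
  then show ?thesis
  proof cases
    case 1
    then have "measure A {c..} = 0" for c using or[of "c - 1" c] by (auto simp: S_def)
    moreover have "UNIV = (\<Union>c\<in>range (\<lambda>k. - real k). {c..})"
    proof -
      have "\<exists>k. - real k \<le> x" for x using real_nat_ceiling_ge[of "- x"] by (intro exI[of _ "nat \<lceil>- x\<rceil>"]) linarith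
      then show ?thesis by auto
    qed
    ultimately have "measure A UNIV = 0" by (simp add: A_UN[of "range (\<lambda>k. - real k)"])
    then show ?thesis by (intro bexI[of _ "{}"]) auto
  next
    case 2
    have "a \<in> S" for a
    proof -
      obtain b where "b \<in> S" "a < b" using 2(2) by (auto simp: bdd_above_def not_le)
      then show ?thesis using down by auto
    qed
    then have "measure B {..c} = 0" for c by (simp add: S_def)
    moreover have "UNIV = (\<Union>c\<in>range (\<lambda>k. real k). {..c})"
      using real_nat_ceiling_ge by auto
    ultimately have "measure B UNIV = 0" by (simp add: B_UN[of "range (\<lambda>k. real k)"])
    then show ?thesis by (intro bexI[of _ "UNIV"]) auto
  next
    case 3
    define s where "s = Sup S"
    have lt: "a \<in> S" if "a < s" for a
    proof -
      from that have "\<exists>b\<in>S. a < b" using less_cSup_iff[OF 3, of a] by (simp add: s_def)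
      then obtain b where "b \<in> S" "a < b" by blast
      then show ?thesis using down by auto
    qed
    have gt: "measure A {c..} = 0" if "s < c" for c
    proof -
      have "\<exists>a. s < a \<and> a < c" using that dense by blast
      then obtain a where a: "s < a" "a < c" by blast
      then have "a \<notin> S" using cSup_upper[OF _ 3(2), of a] by (auto simp: s_def)
      then show ?thesis using or[OF a(2)] by (simp add: S_def)
    qed
    have "measure B {..<s} = 0"
    proof (rule B_UN[of "range (\<lambda>k. s - 1 / real (Suc k))"])
      show "measure B {..c} = 0" if "c \<in> range (\<lambda>k. s - 1 / real (Suc k))" for c
        using lt[of c] that by (auto simp: S_def)
      show "{..<s} = (\<Union>c\<in>range (\<lambda>k. s - 1 / real (Suc k)). {..c})"
      proof safe
        fix y assume "y < s"
        then obtain k where "inverse (real (Suc k)) < s - y" using reals_Archimedean[of "s - y"] by auto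
        then show "y \<in> (\<Union>c\<in>range (\<lambda>k. s - 1 / real (Suc k)). {..c})"
          by (auto simp: inverse_eq_divide intro!: exI[of _ k])
      next
        fix y k assume "y \<le> s - 1 / real (Suc k)"
        then show "y < s" by (smt (verit) divide_pos_pos of_nat_0_less_iff zero_less_Suc)
      qed
    qed auto
    moreover have "measure A {s<..} = 0"
    proof (rule A_UN[of "range (\<lambda>k. s + 1 / real (Suc k))"])
      show "measure A {c..} = 0" if "c \<in> range (\<lambda>k. s + 1 / real (Suc k))" for c
        using gt[of c] that by auto
      show "{s<..} = (\<Union>c\<in>range (\<lambda>k. s + 1 / real (Suc k)). {c..})"
      proof safe
        fix y assume "s < y"
        then obtain k where "inverse (real (Suc k)) < y - s" using reals_Archimedean[of "y - s"] by auto
        then show "y \<in> (\<Union>c\<in>range (\<lambda>k. s + 1 / real (Suc k)). {c..})"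
          by (auto simp: inverse_eq_divide intro!: exI[of _ k])
      next
        fix y k assume "s + 1 / real (Suc k) \<le> y"
        then show "s < y" by (smt (verit) divide_pos_pos of_nat_0_less_iff zero_less_Suc)
      qed
    qed auto
    moreover have "measure A (- {..<s}) \<le> measure A {s} + measure A {s<..}"
    proof -
      have "- {..<s} = {s} \<union> {s<..}" by auto
      then show ?thesis using measure_Un_le[of "{s}" A "{s<..}"] by simp
    qed
    ultimately have "measure A (- {..<s}) = 0" using atom[of s] measure_nonneg[of A "- {..<s}"] by linarith
    then show ?thesis using \<open>measure B {..<s} = 0\<close> by (intro bexI[of _ "{..<s}"]) auto
  qed
qed

text \<open>Extraction one index at a time; the blocks and the live measures have to converge along
  a common subsequence.\<close>

lemma finite_extraction:
  fixes Ms :: "nat \<Rightarrow> nat \<Rightarrow> real measure"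
  assumes "\<And>l n. fbm (Ms l n)" "\<And>l n. measure (Ms l n) UNIV \<le> 1" "\<And>l n. (\<integral>\<^sup>+x. ennreal (x\<^sup>2) \<partial>Ms l n) \<le> ennreal B"
  shows "\<exists>(r :: nat \<Rightarrow> nat) M. strict_mono r \<and> (\<forall>l<m. fbm (M l) \<and> wconv (\<lambda>n. Ms l (r n)) (M l))"
proof (induction m)
  case 0
  show ?case by (intro exI[of _ id]) (auto simp: strict_mono_id)
next
  case (Suc m)
  then obtain r M where r: "strict_mono r" and M: "\<And>l. l < m \<Longrightarrow> fbm (M l)" "\<And>l. l < m \<Longrightarrow> wconv (\<lambda>n. Ms l (r n)) (M l)" by blast
  from fbm_subsequence[of "\<lambda>n. Ms m (r n)" B] assms obtain r' M' where r': "strict_mono r'" "fbm M'" "wconv (\<lambda>n. Ms m (r (r' n))) M'" by blast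
  have "fbm ((M(m := M')) l) \<and> wconv (\<lambda>n. Ms l (r (r' n))) ((M(m := M')) l)" if "l < Suc m" for l
    using that M[of l] r' wconv_subseq[OF M(2)[of l] r'(1)] by (cases "l = m") auto
  then show ?case using strict_mono_o[OF r r'(1)]
    by (intro exI[of _ "\<lambda>n. r (r' n)"] exI[of _ "M(m := M')"]) (auto simp: o_def)
qed

text \<open>Nonnegativity of the variance around the mean \<open>m\<close>; the case
  \<open>s = t\<close> is separate because the mean divides by the length.\<close>

lemma set_Cauchy_Schwarz:
  fixes f :: "real \<Rightarrow> real"
  assumes f: "set_integrable lborel {s..t} f" "set_integrable lborel {s..t} (\<lambda>r. (f r)\<^sup>2)" and st: "s \<le> t"
  shows "(LINT r:{s..t}|lborel. f r)\<^sup>2 \<le> (t - s) * (LINT r:{s..t}|lborel. (f r)\<^sup>2)"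
proof (cases "s = t")
  case True
  have "(LINT r:{s..t}|lborel. f r) = (LINT r|lborel. indicator {t} r * f r)"
    by (simp add: True set_lebesgue_integral_def)
  also have "\<dots> = 0"
    by (rule integral_eq_zero_AE) (use AE_lborel_singleton[of t] in \<open>auto elim: eventually_mono\<close>)
  finally show ?thesis using True by simp
next
  case False
  then have d: "t - s > 0" using st by simp
  define I where "I = (LINT r:{s..t}|lborel. f r)"
  define m where "m = I / (t - s)"
  have c: "set_integrable lborel {s..t} (\<lambda>r. m\<^sup>2)"
    by (rule set_integrable_bounded[of _ "m\<^sup>2"]) auto
  have "0 \<le> (LINT r:{s..t}|lborel. (f r - m)\<^sup>2)"
    unfolding set_lebesgue_integral_def by (rule integral_nonneg_AE) auto
  also have "\<dots> = (LINT r:{s..t}|lborel. ((f r)\<^sup>2 - (2 * m) * f r) + m\<^sup>2)"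
    by (intro set_lebesgue_integral_cong) (auto simp: power2_diff)
  also have "\<dots> = (LINT r:{s..t}|lborel. (f r)\<^sup>2) - 2 * m * I + (LINT r:{s..t}|lborel. m\<^sup>2)"
    using f c by (simp add: I_def set_integral_add(2) set_integral_diff set_integrable_mult_right)
  also have "(LINT r:{s..t}|lborel. m\<^sup>2) = m\<^sup>2 * (t - s)"
    using st by (simp add: set_lebesgue_integral_def)
  also have "m\<^sup>2 * (t - s) = m * I" using d by (simp add: m_def power2_eq_square)
  finally have "m * I \<le> (LINT r:{s..t}|lborel. (f r)\<^sup>2)" by linarith
  then have "(t - s) * (m * I) \<le> (t - s) * (LINT r:{s..t}|lborel. (f r)\<^sup>2)"
    using d by (intro mult_left_mono) auto
  moreover have "(t - s) * (m * I) = I\<^sup>2" using d by (simp add: m_def power2_eq_square)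
  ultimately show ?thesis by (simp add: I_def)
qed

section \<open>Hoelder continuity in time, and cancellation of annihilated pairs\<close>

context annihilating_particles
begin

lemma displacement_sq:
  assumes st: "0 \<le> s" "s \<le> t" "t \<le> T" and A: "G 0 + C\<^sup>2 * T \<le> A"
  shows "(1 / real n) * (\<Sum>i=1..n. (x t i - x s i)\<^sup>2) \<le> A * (t - s)"
proof -
  have nn: "0 \<le> (1 / real n) * (\<Sum>i=1..n. (x t i - x s i)\<^sup>2)" by (simp add: sum_nonneg)
  have "(1 / real n) * (\<Sum>i=1..n. (x t i - x s i)\<^sup>2) = (sqrt ((1 / real n) * (\<Sum>i=1..n. (x t i - x s i)\<^sup>2)))\<^sup>2"
    using nn by simp
  also have "\<dots> \<le> (LINT r:{s..t}|lborel. speed r)\<^sup>2"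
    using nn by (intro power_mono displacement st) auto
  also have "\<dots> \<le> (t - s) * (LINT r:{s..t}|lborel. (speed r)\<^sup>2)"
    by (rule set_Cauchy_Schwarz[OF speed_integrable speed_sq_integrable st(2)])
  also have "\<dots> \<le> (t - s) * A"
  proof (rule mult_left_mono)
  have "(LINT r:{s..t}|lborel. (speed r)\<^sup>2) \<le> (LINT r:{0..T}|lborel. (speed r)\<^sup>2)"
    unfolding set_lebesgue_integral_def
  proof (rule integral_mono)
    show "indicat_real {s..t} r *\<^sub>R (speed r)\<^sup>2 \<le> indicat_real {0..T} r *\<^sub>R (speed r)\<^sup>2" for r
      using st by (auto simp: indicator_def)
  qed (use speed_sq_integrable in \<open>auto simp: set_integrable_def\<close>)
  then show "(LINT r:{s..t}|lborel. (speed r)\<^sup>2) \<le> A" using dissipation A by linarith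
  qed (use st in simp)
  finally show ?thesis by (simp only: mult.commute)
qed

lemma b_live:
  assumes "i \<in> {1..n}" "t \<in> {0..T}"
  shows "b t i = (if live t i then b0 i else 0)"
  using b_eq[OF assms] by (simp add: live_def)

lemma live_labels:
  assumes "t \<in> {0..T}" "p \<in> {-1, 1}"
  shows "{i. i \<in> {1..n} \<and> b t i = p} = {i\<in>{1..n}. live t i \<and> b0 i = p}"
  using assms b_live[of _ t] by (auto split: if_splits)

text \<open>The annihilated pairs do not contribute to the signed empirical measure.\<close>

lemma signed_sum_live:
  fixes \<phi> :: "real \<Rightarrow> real"
  assumes t: "t \<in> {0..T}"
  shows "(\<Sum>i | i \<in> {1..n} \<and> b0 i = 1. \<phi> (x t i)) - (\<Sum>i | i \<in> {1..n} \<and> b0 i = -1. \<phi> (x t i)) =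
    (\<Sum>i | i \<in> {1..n} \<and> b t i = 1. \<phi> (x t i)) - (\<Sum>i | i \<in> {1..n} \<and> b t i = -1. \<phi> (x t i))"
proof -
  define D where "D p = {i\<in>{1..n}. b0 i = p \<and> \<tau> i \<le> ereal t}" for p
  have split: "(\<Sum>i | i \<in> {1..n} \<and> b0 i = p. \<phi> (x t i)) = (\<Sum>i | i \<in> {1..n} \<and> b t i = p. \<phi> (x t i)) + (\<Sum>i\<in>D p. \<phi> (x t i))"
    if p: "p \<in> {-1, 1}" for p
  proof -
    have "{i. i \<in> {1..n} \<and> b0 i = p} = {i. i \<in> {1..n} \<and> b t i = p} \<union> D p"
      unfolding live_labels[OF t p] by (auto simp: D_def live_def)
    moreover have "{i. i \<in> {1..n} \<and> b t i = p} \<inter> D p = {}"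
      unfolding live_labels[OF t p] by (auto simp: D_def live_def)
    ultimately show ?thesis by (simp add: sum.union_disjoint D_def)
  qed
  obtain \<alpha> where \<alpha>: "bij_betw \<alpha> (D 1) (D (-1))" "\<And>i. i \<in> D 1 \<Longrightarrow> x t i = x t (\<alpha> i)"
    using annihilation[OF t] unfolding D_def by blast
  have "(\<Sum>i\<in>D 1. \<phi> (x t i)) = (\<Sum>i\<in>D 1. \<phi> (x t (\<alpha> i)))" using \<alpha>(2) by (intro sum.cong) auto
  also have "\<dots> = (\<Sum>i\<in>D (-1). \<phi> (x t i))" by (rule sum.reindex_bij_betw[OF \<alpha>(1)])
  finally show ?thesis using split[of 1] split[of "-1"] by simp
qed

end

text \<open>\<open>lev k i\<close> is the number \<open>l\<close> of the interval \<open>(a (l - 1), a l)\<close> that contains particle \<open>i\<close> initially.\<close>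

locale particle_sequence =
  fixes V W :: "real \<Rightarrow> real" and T C A B :: real and L :: nat and N :: "nat \<Rightarrow> nat"
    and x0 :: "nat \<Rightarrow> nat \<Rightarrow> real" and b0 :: "nat \<Rightarrow> nat \<Rightarrow> int"
    and x :: "nat \<Rightarrow> real \<Rightarrow> nat \<Rightarrow> real" and b :: "nat \<Rightarrow> real \<Rightarrow> nat \<Rightarrow> int"
    and \<tau> :: "nat \<Rightarrow> nat \<Rightarrow> ereal" and Lx :: "nat \<Rightarrow> real" and lev :: "nat \<Rightarrow> nat \<Rightarrow> nat"
  assumes sys: "\<And>k. annihilating_particles V W (N k) T (x0 k) (b0 k) (x k) (b k) (\<tau> k) (Lx k) C"
    and N_lim: "filterlim N at_top sequentially"
    and energy: "\<And>k. annihilating_particles.G V W (N k) (b0 k) (x k) (\<tau> k) C 0 + C\<^sup>2 * T \<le> A"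
    and moment: "\<And>k. (1 / real (N k)) * (\<Sum>i=1..N k. (x0 k i)\<^sup>2) + C * T \<le> B"
    and lev_range: "\<And>k i. i \<in> {1..N k} \<Longrightarrow> lev k i \<in> {1..2 * L}"
    and lev_sign: "\<And>k i. i \<in> {1..N k} \<Longrightarrow> b0 k i = (if odd (lev k i) then 1 else -1)"
    and lev_mono: "\<And>k i j. i \<in> {1..N k} \<Longrightarrow> j \<in> {1..N k} \<Longrightarrow> i \<le> j \<Longrightarrow> lev k i \<le> lev k j"
begin

sublocale S: annihilating_particles V W "N k" T "x0 k" "b0 k" "x k" "b k" "\<tau> k" "Lx k" C for k
  by (rule sys)

lemma A_nonneg: "0 \<le> A"
  using order_trans[OF S.G_bound[of 0] energy, of 0] S.G_nonneg[of 0 0] S.T_pos by simp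

lemma second_moment_bound: "t \<in> {0..T} \<Longrightarrow> (1 / real (N k)) * (\<Sum>i=1..N k. (x k t i)\<^sup>2) \<le> B"
  using S.second_moment[of t k] moment[of k] mult_left_mono[of t T C] S.C_nonneg by simp

lemma B_nonneg: "0 \<le> B"
  using order_trans[OF _ second_moment_bound[of 0 0]] S.T_pos by (simp add: sum_nonneg)

lemma moment_empirical:
  assumes t: "t \<in> {0..T}"
  shows "(\<integral>\<^sup>+y. ennreal (y\<^sup>2) \<partial>empirical (N k) (x k t) c p) \<le> ennreal B"
proof -
  have "(\<integral>\<^sup>+y. ennreal (y\<^sup>2) \<partial>empirical (N k) (x k t) c p) = ennreal ((1 / real (N k)) * (\<Sum>i | i \<in> {1..N k} \<and> c i = p. (x k t i)\<^sup>2))"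
    by (subst nn_integral_empirical) (simp_all add: sum_ennreal ennreal_mult[symmetric] sum_nonneg)
  also have "\<dots> \<le> ennreal B"
  proof (rule ennreal_leI)
    have "(1 / real (N k)) * (\<Sum>i | i \<in> {1..N k} \<and> c i = p. (x k t i)\<^sup>2) \<le> (1 / real (N k)) * (\<Sum>i=1..N k. (x k t i)\<^sup>2)"
      by (intro mult_left_mono sum_mono2) auto
    then show "(1 / real (N k)) * (\<Sum>i | i \<in> {1..N k} \<and> c i = p. (x k t i)\<^sup>2) \<le> B"
      using second_moment_bound[OF t, of k] by linarith
  qed
  finally show ?thesis .
qed

text \<open>Exponent 1/2 comes from the energy bound on the squared speed. The labels
  \<open>c\<close> are frozen in time, as the initial signs are; live measures, whose labels change
  at annihilations, have no such modulus.\<close>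

lemma equicontinuous:
  assumes st: "s \<in> {0..T}" "t \<in> {0..T}" and \<psi>: "K-lipschitz_on UNIV \<psi>"
  shows "\<bar>(\<integral>y. \<psi> y \<partial>empirical (N k) (x k t) c p) - (\<integral>y. \<psi> y \<partial>empirical (N k) (x k s) c p)\<bar> \<le> K * sqrt (A * \<bar>t - s\<bar>)"
proof -
  let ?n = "real (N k)"
  have n: "?n \<ge> 1" using S.n_pos[of k] by simp
  have K: "K \<ge> 0" using \<psi> by (rule lipschitz_on_nonneg)
  have \<psi>m: "\<psi> \<in> borel_measurable borel"
    using \<psi> by (intro borel_measurable_continuous_onI lipschitz_on_continuous_on)
  have sq: "(1 / ?n) * (\<Sum>i=1..N k. (x k t i - x k s i)\<^sup>2) \<le> A * \<bar>t - s\<bar>"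
  proof (cases "s \<le> t")
    case True
    then show ?thesis using S.displacement_sq[OF _ True _ energy, of k] st by simp
  next
    case False
    then show ?thesis using S.displacement_sq[OF _ _ _ energy, of t s k] st by (simp add: power2_commute)
  qed
  have "\<bar>(\<integral>y. \<psi> y \<partial>empirical (N k) (x k t) c p) - (\<integral>y. \<psi> y \<partial>empirical (N k) (x k s) c p)\<bar> =
      (1 / ?n) * \<bar>\<Sum>i | i \<in> {1..N k} \<and> c i = p. \<psi> (x k t i) - \<psi> (x k s i)\<bar>"
    by (simp add: integral_empirical[OF \<psi>m] sum_subtractf diff_divide_distrib[symmetric] abs_divide)
  also have "\<dots> \<le> (1 / ?n) * (\<Sum>i | i \<in> {1..N k} \<and> c i = p. K * \<bar>x k t i - x k s i\<bar>)"
    using lipschitz_onD[OF \<psi>] by (intro mult_left_mono order_trans[OF sum_abs sum_mono]) (auto simp: dist_real_def)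
  also have "\<dots> \<le> (1 / ?n) * (\<Sum>i=1..N k. K * \<bar>x k t i - x k s i\<bar>)"
    using K by (intro mult_left_mono sum_mono2) auto
  also have "\<dots> = K * ((1 / ?n) * (\<Sum>i=1..N k. \<bar>x k t i - x k s i\<bar>))"
    by (simp add: sum_distrib_left[symmetric])
  also have "\<dots> \<le> K * sqrt (A * \<bar>t - s\<bar>)"
  proof (rule mult_left_mono[OF _ K], rule real_le_rsqrt)
    have "(\<Sum>i=1..N k. \<bar>x k t i - x k s i\<bar>)\<^sup>2 \<le> (\<Sum>i=1..N k. \<bar>x k t i - x k s i\<bar>\<^sup>2) * real (card {1..N k})"
      by (rule sum_squared_le_sum_of_squares)
    then have "(1 / ?n)\<^sup>2 * (\<Sum>i=1..N k. \<bar>x k t i - x k s i\<bar>)\<^sup>2 \<le> (1 / ?n)\<^sup>2 * ((\<Sum>i=1..N k. (x k t i - x k s i)\<^sup>2) * ?n)"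
      by (intro mult_left_mono) auto
    also have "\<dots> = (1 / ?n) * (\<Sum>i=1..N k. (x k t i - x k s i)\<^sup>2)"
      using n by (simp add: power2_eq_square)
    finally show "((1 / ?n) * (\<Sum>i=1..N k. \<bar>x k t i - x k s i\<bar>))\<^sup>2 \<le> A * \<bar>t - s\<bar>"
      using sq by (simp only: power_mult_distrib)
  qed
  finally show ?thesis .
qed

text \<open>Pairs within a small ball cost at least \<open>R\<close> each, so the squared limit mass
  at \<open>z\<close> is at most \<open>2 * A / R\<close>, for every \<open>R\<close>. The labels
  \<open>c\<close> are general because the lemma is applied to single blocks.\<close>

lemma no_atoms:
  assumes t: "t \<in> {0..T}" and s: "strict_mono s" and M: "fbm M"
    and w: "wconv (\<lambda>k. empirical (N (s k)) (x (s k) t) (c k) l) M"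
    and sub: "\<And>k. {i. i \<in> {1..N (s k)} \<and> c k i = l} \<subseteq> {i\<in>{1..N (s k)}. S.live (s k) t i \<and> b0 (s k) i = p}"
  shows "measure M {z} = 0"
proof -
  have le: "(measure M {z})\<^sup>2 \<le> 2 * A / R" if R: "R > 0" for R
  proof -
    have "\<forall>\<^sub>F r in at 0. R \<le> V r" using V_at_top[OF S.potentials] by (simp add: filterlim_at_top)
    then obtain d where d: "d > 0" "\<And>r. r \<noteq> 0 \<Longrightarrow> \<bar>r\<bar> < d \<Longrightarrow> R \<le> V r"
      by (auto simp: eventually_at dist_real_def)
    \<comment> \<open>The bump of index \<open>Suc m\<close> vanishes outside distance
      \<open>d / 2\<close> of \<open>z\<close>, so the particles that it sees are at mutual distance
      below \<open>d\<close>.\<close>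
    obtain m where m: "1 / real (Suc m) < d / 2" using nat_approx_posE[of "d / 2"] d(1) by auto
    let ?\<phi> = "bump {z} (Suc m)"
    have "(\<lambda>k. (\<integral>y. ?\<phi> y \<partial>empirical (N (s k)) (x (s k) t) (c k) l)\<^sup>2) \<longlonglongrightarrow> (\<integral>y. ?\<phi> y \<partial>M)\<^sup>2"
      by (intro tendsto_power wconvD[OF w] bump_continuous bump_bounded)
    moreover have "(\<lambda>k. 1 / real (N (s k)) + 2 * A / R) \<longlonglongrightarrow> 0 + 2 * A / R"
    proof (intro tendsto_intros)
      have "filterlim (\<lambda>k. real (N (s k))) at_top sequentially"
        by (intro filterlim_compose[OF filterlim_real_sequentially] filterlim_compose[OF N_lim] filterlim_subseq s)
      then show "(\<lambda>k. 1 / real (N (s k))) \<longlonglongrightarrow> 0"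
        by (intro tendsto_divide_0[OF tendsto_const] filterlim_at_top_imp_at_infinity)
    qed
    moreover have "(\<integral>y. ?\<phi> y \<partial>empirical (N (s k)) (x (s k) t) (c k) l)\<^sup>2 \<le> 1 / real (N (s k)) + 2 * A / R" for k
    proof -
      let ?X = "{i\<in>{1..N (s k)}. S.live (s k) t i \<and> b0 (s k) i = p \<and> \<bar>x (s k) t i - z\<bar> < d / 2}"
      have "(\<Sum>i | i \<in> {1..N (s k)} \<and> c k i = l. ?\<phi> (x (s k) t i)) \<le> (\<Sum>i | i \<in> {1..N (s k)} \<and> c k i = l. if \<bar>x (s k) t i - z\<bar> < d / 2 then 1 else 0)"
      proof (rule sum_mono)
        fix i
        show "?\<phi> (x (s k) t i) \<le> (if \<bar>x (s k) t i - z\<bar> < d / 2 then 1 else 0)"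
        proof (cases "\<bar>x (s k) t i - z\<bar> < d / 2")
          case False
          then have "1 / real (Suc m) \<le> \<bar>x (s k) t i - z\<bar>" using m by linarith
          then have "1 \<le> real (Suc m) * \<bar>x (s k) t i - z\<bar>" by (simp add: field_simps)
          then show ?thesis using False by (simp add: bump_def dist_real_def)
        qed (simp add: bump_bounds)
      qed
      also have "\<dots> = real (card {i \<in> {i. i \<in> {1..N (s k)} \<and> c k i = l}. \<bar>x (s k) t i - z\<bar> < d / 2})"
        by (simp add: sum.inter_filter[symmetric])
      also have "\<dots> \<le> real (card ?X)"
        using sub[of k] by (intro of_nat_mono card_mono) auto
      finally have "(\<integral>y. ?\<phi> y \<partial>empirical (N (s k)) (x (s k) t) (c k) l) \<le> real (card ?X) / real (N (s k))"
        by (simp add: integral_empirical divide_right_mono)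
      moreover have "0 \<le> (\<integral>y. ?\<phi> y \<partial>empirical (N (s k)) (x (s k) t) (c k) l)"
        by (intro integral_nonneg_AE) (simp add: bump_bounds)
      ultimately have "(\<integral>y. ?\<phi> y \<partial>empirical (N (s k)) (x (s k) t) (c k) l)\<^sup>2 \<le> (real (card ?X) / real (N (s k)))\<^sup>2"
        by (intro power_mono)
      also have "\<dots> \<le> 1 / real (N (s k)) + 2 * (S.G (s k) 0 + C\<^sup>2 * T) / R"
        using t d by (intro S.concentration R) auto
      also have "\<dots> \<le> 1 / real (N (s k)) + 2 * A / R"
        using energy[of "s k"] R by (intro add_left_mono divide_right_mono) auto
      finally show ?thesis .
    qed
    ultimately have "(\<integral>y. ?\<phi> y \<partial>M)\<^sup>2 \<le> 0 + 2 * A / R"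
      by (intro LIMSEQ_le[of _ _ "\<lambda>k. 1 / real (N (s k)) + 2 * A / R"]) auto
    moreover have "measure M {z} \<le> (\<integral>y. ?\<phi> y \<partial>M)"
    proof -
      have "(\<integral>y. indicator {z} y \<partial>M) \<le> (\<integral>y. ?\<phi> y \<partial>M)"
        using bump_bounds[where S="{z}" and k="Suc m"]
        by (intro integral_mono integrable_fbm[OF M, of _ 1]) (auto simp: indicator_def)
      then show ?thesis by (simp add: fbmD(3)[OF M])
    qed
    then have "(measure M {z})\<^sup>2 \<le> (\<integral>y. ?\<phi> y \<partial>M)\<^sup>2" by (intro power_mono) auto
    ultimately show ?thesis by simp
  qed
  have "(measure M {z})\<^sup>2 \<le> 0"
  proof (rule field_le_epsilon)
    fix e :: real assume e: "e > 0"
    \<comment> \<open>\<open>R\<close> is chosen as \<open>2 * (A + 1) / e\<close>, with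
      \<open>A + 1\<close> because \<open>A\<close> may be 0.\<close>
    have "(measure M {z})\<^sup>2 \<le> 2 * A / (2 * (A + 1) / e)" by (rule le) (use e A_nonneg in auto)
    also have "\<dots> = e * (A / (A + 1))" using e A_nonneg by (simp add: field_simps)
    also have "\<dots> \<le> e * 1" using e A_nonneg by (intro mult_left_mono) auto
    finally show "(measure M {z})\<^sup>2 \<le> 0 + e" by simp
  qed
  then show ?thesis by simp
qed

text \<open>Levels start at 1, so the label 0 can mark dead particles.\<close>

abbreviation live_level :: "nat \<Rightarrow> real \<Rightarrow> nat \<Rightarrow> int" where
  "live_level k t i \<equiv> (if S.live k t i then int (lev k i) else 0)"

text \<open>Live particles keep the order of their blocks, so limits of different blocks are mutually
  singular once they have no atoms. Hence the limits of the two live measures are the Jordan parts of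
  the limit of their difference.\<close>

lemma alive_limit:
  assumes t: "0 \<le> t" "t < T" and \<rho>: "\<And>p. p \<in> {-1, 1} \<Longrightarrow> fbm (\<rho> p)"
    and w: "\<And>p. p \<in> {-1, 1} \<Longrightarrow> wconv (\<lambda>k. empirical (N k) (x k t) (b0 k) p) (\<rho> p)"
    and p: "p \<in> {-1, 1}"
  shows "wconv (\<lambda>k. empirical (N k) (x k t) (b k t) p) (kappa_part \<rho> p) \<and> fbm (kappa_part \<rho> p) \<and>
    (\<forall>z. measure (kappa_part \<rho> p) {z} = 0)"
proof -
  have tT: "t \<in> {0..T}" using t by simp
  define alv where "alv k p = empirical (N k) (x k t) (b k t) p" for k p
  define blk where "blk k l = empirical (N k) (x k t) (live_level k t) (int l)" for k l
  have fbm: "fbm (alv k p)" "fbm (blk k l)" for k p l by (simp_all add: alv_def blk_def fbm_empirical)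
  \<comment> \<open>Odd levels hold positive particles and even levels negative ones; each live
    measure is the sum of its blocks over \<open>Lv p\<close>.\<close>
  define O' where "O' = {l\<in>{1..2 * L}. odd l}"
  define E where "E = {l\<in>{1..2 * L}. even l}"
  define Lv where "Lv p = (if p = (1::int) then O' else E)" for p
  have level: "S.live k t i \<and> lev k i = l" if "live_level k t i = int l" "l \<ge> 1" for k i l
    using that by (auto split: if_splits)
  have split: "(\<integral>y. \<phi> y \<partial>alv k p) = (\<Sum>l\<in>Lv p. \<integral>y. \<phi> y \<partial>blk k l)"
    if [measurable]: "\<phi> \<in> borel_measurable borel" and p: "p \<in> {-1, 1}" for \<phi> :: "real \<Rightarrow> real" and k p
  proof -
    let ?S = "{i\<in>{1..N k}. S.live k t i \<and> b0 k i = p}"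
    have "(\<Sum>i\<in>?S. \<phi> (x k t i)) = (\<Sum>l\<in>Lv p. \<Sum>i\<in>{i\<in>?S. lev k i = l}. \<phi> (x k t i))"
    proof (rule sum.group[symmetric])
      show "lev k ` ?S \<subseteq> Lv p"
      proof
        fix l assume "l \<in> lev k ` ?S"
        then obtain i where "i \<in> ?S" "l = lev k i" by blast
        then show "l \<in> Lv p" using lev_range[of i k] lev_sign[of i k] p by (auto simp: Lv_def O'_def E_def split: if_splits)
      qed
    qed (auto simp: Lv_def O'_def E_def)
    also have "\<dots> = (\<Sum>l\<in>Lv p. \<Sum>i | i \<in> {1..N k} \<and> live_level k t i = int l. \<phi> (x k t i))"
    proof (intro sum.cong refl)
      fix l assume "l \<in> Lv p"
      then have l: "l \<ge> 1" "p = (if odd l then 1 else -1)" using p by (auto simp: Lv_def O'_def E_def split: if_splits)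
      show "{i\<in>?S. lev k i = l} = {i. i \<in> {1..N k} \<and> live_level k t i = int l}"
        using level l lev_sign[of _ k] by auto
    qed
    finally show ?thesis
      by (simp only: alv_def blk_def integral_empirical[OF that(1)] S.live_labels[OF tT p] sum_distrib_left[symmetric])
  qed
  have ordered: "(\<integral>y. \<integral>z. overlap (y, z) \<partial>blk k l' \<partial>blk k l) = 0" if "1 \<le> l" "l < l'" for k l l'
  proof -
    have "overlap (x k t i, x k t j) = 0"
      if i: "i \<in> {1..N k}" "live_level k t i = int l" and j: "j \<in> {1..N k}" "live_level k t j = int l'" for i j
    proof -
      have li: "S.live k t i" "lev k i = l" and lj: "S.live k t j" "lev k j = l'"
        using level[OF i(2)] level[OF j(2)] \<open>1 \<le> l\<close> \<open>l < l'\<close> by auto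
      have "i < j"
      proof (rule ccontr)
        assume "\<not> i < j"
        then show False using lev_mono[OF j(1) i(1)] li lj \<open>l < l'\<close> by simp
      qed
      then have "x k t i < x k t j" by (rule S.live_order[OF i(1) j(1) _ li(1) lj(1) t])
      then show ?thesis by (simp add: overlap_def)
    qed
    then have "(\<Sum>i | i \<in> {1..N k} \<and> live_level k t i = int l. 1 / real (N k) * (\<Sum>j | j \<in> {1..N k} \<and> live_level k t j = int l'. overlap (x k t i, x k t j))) = 0"
      by (intro sum.neutral ballI) (simp add: sum.neutral)
    moreover have "(\<integral>y. \<integral>z. overlap (y, z) \<partial>blk k l' \<partial>blk k l) = 1 / real (N k) * (\<Sum>i | i \<in> {1..N k} \<and> live_level k t i = int l. 1 / real (N k) * (\<Sum>j | j \<in> {1..N k} \<and> live_level k t j = int l'. overlap (x k t i, x k t j)))"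
    proof -
      have "(\<lambda>y. \<integral>z. overlap (y, z) \<partial>blk k l') \<in> borel_measurable borel"
        by (rule borel_measurable_inner_integral[OF overlap_measurable fbm(2)])
      then show ?thesis
        unfolding blk_def by (simp only: integral_empirical integral_empirical[OF borel_measurable_slice[OF overlap_measurable]])
    qed
    ultimately show ?thesis by simp
  qed
  \<comment> \<open>Proved along any subsequence \<open>s\<close> with a further extraction
    \<open>r\<close>; the limit does not depend on \<open>s\<close>, which gives convergence of the
    whole sequence at the end.\<close>
  have main: "\<exists>r. strict_mono r \<and> (\<forall>p\<in>{-1, 1}. wconv (\<lambda>k. alv (s (r k)) p) (kappa_part \<rho> p) \<and> fbm (kappa_part \<rho> p) \<and>
      (\<forall>z. measure (kappa_part \<rho> p) {z} = 0))" if s: "strict_mono s" for s :: "nat \<Rightarrow> nat"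
  proof -
    \<comment> \<open>Indices up to \<open>2 * L\<close> are blocks, the next two are the positive
      and the negative live measure; hence the count \<open>2 * L + 3\<close>.\<close>
    define Ms where "Ms l k = (if l \<le> 2 * L then blk (s k) l else if l = 2 * L + 1 then alv (s k) 1 else alv (s k) (-1))" for l k
    have "fbm (Ms l k)" "measure (Ms l k) UNIV \<le> 1" "(\<integral>\<^sup>+y. ennreal (y\<^sup>2) \<partial>Ms l k) \<le> ennreal B" for l k
      by (simp_all add: Ms_def fbm) (simp_all add: alv_def blk_def mass_empirical_le moment_empirical[OF tT])
    from finite_extraction[of Ms B "2 * L + 3", OF this]
    obtain r M where r: "strict_mono r" and M: "\<And>l. l < 2 * L + 3 \<Longrightarrow> fbm (M l)" "\<And>l. l < 2 * L + 3 \<Longrightarrow> wconv (\<lambda>k. Ms l (r k)) (M l)" by blast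
    define q where "q k = s (r k)" for k
    have q: "strict_mono q" using strict_mono_o[OF s r] by (simp add: q_def[abs_def] o_def)
    define A' where "A' p = M (if p = (1::int) then 2 * L + 1 else 2 * L + 2)" for p
    have A: "fbm (A' p)" "wconv (\<lambda>k. alv (q k) p) (A' p)" if "p \<in> {-1, 1}" for p
      using M[of "2 * L + 1"] M[of "2 * L + 2"] that by (auto simp: A'_def Ms_def q_def)
    have blkM: "fbm (M l)" "wconv (\<lambda>k. blk (q k) l) (M l)" if "l \<in> {1..2 * L}" for l
      using M[of l] that by (auto simp: Ms_def q_def)
    have Lv: "Lv p \<subseteq> {1..2 * L}" "finite (Lv p)" for p by (auto simp: Lv_def O'_def E_def)
    have LvD: "l \<in> {1..2 * L}" if "l \<in> Lv p" for l p using that Lv(1) by blast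
    have A_eq: "measure (A' p) X = (\<Sum>l\<in>Lv p. measure (M l) X)" if p: "p \<in> {-1, 1}" and X: "X \<in> sets borel" for p X
    proof -
      \<comment> \<open>Index 0, which is not in \<open>Lv p\<close>, holds the live measure with
        coefficient -1.\<close>
      let ?m = "\<lambda>l. if l = 0 then A' p else M l"
      let ?c = "\<lambda>l. if l = 0 then -1 else 1 :: real"
      have 0: "0 \<notin> Lv p" by (auto simp: Lv_def O'_def E_def)
      have "(\<Sum>l\<in>insert 0 (Lv p). ?c l * measure (?m l) X) = 0"
      proof (rule signed_combination_zero[OF _ _ _ X])
        show "fbm (?m l)" if "l \<in> insert 0 (Lv p)" for l using that Lv(1)[of p] A(1)[OF p] blkM(1)[of l] by (cases "l = 0") (auto dest: subsetD)
        fix \<phi> :: "real \<Rightarrow> real" assume \<phi>: "continuous_on UNIV \<phi>" "bounded (range \<phi>)"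
        have \<phi>m: "\<phi> \<in> borel_measurable borel" by (rule borel_measurable_continuous_onI[OF \<phi>(1)])
        have "(\<lambda>k. \<integral>y. \<phi> y \<partial>alv (q k) p) \<longlonglongrightarrow> (\<integral>y. \<phi> y \<partial>A' p)" by (rule wconvD[OF A(2)[OF p] \<phi>])
        moreover have "(\<lambda>k. \<integral>y. \<phi> y \<partial>alv (q k) p) \<longlonglongrightarrow> (\<Sum>l\<in>Lv p. \<integral>y. \<phi> y \<partial>M l)"
          unfolding split[OF \<phi>m p] by (intro tendsto_sum wconvD[OF blkM(2)[OF LvD] \<phi>])
        ultimately have "(\<integral>y. \<phi> y \<partial>A' p) = (\<Sum>l\<in>Lv p. \<integral>y. \<phi> y \<partial>M l)" by (rule LIMSEQ_unique)
        moreover have "(\<Sum>l\<in>Lv p. ?c l * (\<integral>y. \<phi> y \<partial>?m l)) = (\<Sum>l\<in>Lv p. \<integral>y. \<phi> y \<partial>M l)"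
          using 0 by (intro sum.cong) auto
        ultimately show "(\<Sum>l\<in>insert 0 (Lv p). ?c l * (\<integral>y. \<phi> y \<partial>?m l)) = 0"
          using 0 Lv(2) by simp
      qed (use Lv in simp)
      moreover have "(\<Sum>l\<in>Lv p. ?c l * measure (?m l) X) = (\<Sum>l\<in>Lv p. measure (M l) X)"
        using 0 by (intro sum.cong) auto
      ultimately show ?thesis using 0 Lv(2) by simp
    qed
    have diff: "measure (\<rho> 1) X - measure (\<rho> (-1)) X = measure (A' 1) X - measure (A' (-1)) X" if X: "X \<in> sets borel" for X
    proof -
      let ?m = "\<lambda>l::nat. if l = 0 then \<rho> 1 else if l = 1 then \<rho> (-1) else if l = 2 then A' 1 else A' (-1)"
      let ?c = "\<lambda>l::nat. if l = 0 \<or> l = 3 then 1 else -1 :: real"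
      have "(\<Sum>l\<in>{0, 1, 2, 3}. ?c l * measure (?m l) X) = 0"
      proof (rule signed_combination_zero[OF _ _ _ X])
        show "fbm (?m l)" for l using \<rho> A(1) by auto
        fix \<phi> :: "real \<Rightarrow> real" assume \<phi>: "continuous_on UNIV \<phi>" "bounded (range \<phi>)"
        have \<phi>m: "\<phi> \<in> borel_measurable borel" by (rule borel_measurable_continuous_onI[OF \<phi>(1)])
        have "(\<lambda>k. (\<integral>y. \<phi> y \<partial>empirical (N (q k)) (x (q k) t) (b0 (q k)) 1) - (\<integral>y. \<phi> y \<partial>empirical (N (q k)) (x (q k) t) (b0 (q k)) (-1)))
          \<longlonglongrightarrow> (\<integral>y. \<phi> y \<partial>\<rho> 1) - (\<integral>y. \<phi> y \<partial>\<rho> (-1))"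
          by (intro tendsto_diff wconvD[OF wconv_subseq[OF w q] \<phi>]) auto
        moreover have "(\<lambda>k. (\<integral>y. \<phi> y \<partial>alv (q k) 1) - (\<integral>y. \<phi> y \<partial>alv (q k) (-1))) \<longlonglongrightarrow> (\<integral>y. \<phi> y \<partial>A' 1) - (\<integral>y. \<phi> y \<partial>A' (-1))"
          by (intro tendsto_diff wconvD[OF A(2) \<phi>]) auto
        moreover have "(\<integral>y. \<phi> y \<partial>empirical (N k) (x k t) (b0 k) 1) - (\<integral>y. \<phi> y \<partial>empirical (N k) (x k t) (b0 k) (-1)) =
            (\<integral>y. \<phi> y \<partial>alv k 1) - (\<integral>y. \<phi> y \<partial>alv k (-1))" for k
          unfolding alv_def integral_empirical[OF \<phi>m] right_diff_distrib[symmetric] S.signed_sum_live[OF tT] ..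
        ultimately have "(\<integral>y. \<phi> y \<partial>\<rho> 1) - (\<integral>y. \<phi> y \<partial>\<rho> (-1)) = (\<integral>y. \<phi> y \<partial>A' 1) - (\<integral>y. \<phi> y \<partial>A' (-1))"
          using LIMSEQ_unique by simp
        then show "(\<Sum>l\<in>{0, 1, 2, 3}. ?c l * (\<integral>y. \<phi> y \<partial>?m l)) = 0" by simp
      qed simp
      then show ?thesis by simp
    qed
    have atomM: "measure (M l) {z} = 0" if l: "l \<in> {1..2 * L}" for l z
    proof (rule no_atoms[OF tT q blkM(1)[OF l]])
      show "wconv (\<lambda>k. empirical (N (q k)) (x (q k) t) (live_level (q k) t) (int l)) (M l)"
        using blkM(2)[OF l] by (simp add: blk_def)
      show "{i. i \<in> {1..N (q k)} \<and> live_level (q k) t i = int l} \<subseteq> {i\<in>{1..N (q k)}. S.live (q k) t i \<and> b0 (q k) i = (if odd l then 1 else -1)}" for k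
        using level[of "q k"] lev_sign[of _ "q k"] l by fastforce
    qed
    have sing: "\<exists>P\<in>sets borel. measure (M l) (- P) = 0 \<and> measure (M l') P = 0" if "l \<in> {1..2 * L}" "l' \<in> {1..2 * L}" "l < l'" for l l'
    proof (rule singular_of_ordered[OF blkM(1)[OF that(1)] blkM(1)[OF that(2)] atomM[OF that(1)]])
      have "(\<lambda>k. \<integral>y. \<integral>z. overlap (y, z) \<partial>blk (q k) l' \<partial>blk (q k) l) \<longlonglongrightarrow> (\<integral>y. \<integral>z. overlap (y, z) \<partial>M l' \<partial>M l)"
        by (rule wconv_pair[OF fbm(2) fbm(2) blkM(1)[OF that(1)] blkM(1)[OF that(2)] blkM(2)[OF that(1)] blkM(2)[OF that(2)] overlap_measurable overlap_bound(1)])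
           (simp add: overlap_cont)
      then show "(\<integral>y. \<integral>z. overlap (y, z) \<partial>M l' \<partial>M l) = 0"
        using ordered[of l l'] that by (simp add: LIMSEQ_const_iff)
    qed
    \<comment> \<open>Whichever of the two blocks lies to the left provides the set; if it is the
      negative one, the complement is taken.\<close>
    have "\<exists>P. P \<in> sets borel \<and> measure (M l) (- P) = 0 \<and> measure (M l') P = 0" if ll: "l \<in> O'" "l' \<in> E" for l l'
    proof (cases "l < l'")
      case True
      then show ?thesis using sing[of l l'] ll by (auto simp: O'_def E_def)
    next
      case False
      then have "l' < l" using ll by (cases "l = l'") (auto simp: O'_def E_def)
      then obtain P where "P \<in> sets borel" "measure (M l') (- P) = 0" "measure (M l) P = 0"
        using sing[of l' l] ll by (auto simp: O'_def E_def)
      then show ?thesis by (intro exI[of _ "- P"]) auto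
    qed
    then obtain P where P: "\<And>l l'. l \<in> O' \<Longrightarrow> l' \<in> E \<Longrightarrow> P l l' \<in> sets borel" "\<And>l l'. l \<in> O' \<Longrightarrow> l' \<in> E \<Longrightarrow> measure (M l) (- P l l') = 0"
      "\<And>l l'. l \<in> O' \<Longrightarrow> l' \<in> E \<Longrightarrow> measure (M l') (P l l') = 0" by metis
    have fin: "finite O'" "finite E" "O' \<subseteq> {1..2 * L}" "E \<subseteq> {1..2 * L}" by (auto simp: O'_def E_def)
    \<comment> \<open>Turns pairwise separation into one set, whose complement is null for every
      positive block and which is null for every negative block.\<close>
    define Q where "Q = (\<Union>l\<in>O'. \<Inter>l'\<in>E. P l l')"
    have null: "measure (M l) X = 0" if "l \<in> {1..2 * L}" "X \<in> sets borel" "finite I" "X \<subseteq> (\<Union>i\<in>I. Y i)"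
        "\<And>i. i \<in> I \<Longrightarrow> Y i \<in> sets borel" "\<And>i. i \<in> I \<Longrightarrow> measure (M l) (Y i) = 0" for l X Y and I :: "nat set"
    proof -
      note MB = blkM(1)[OF that(1)]
      have "(\<Union>i\<in>I. Y i) \<in> null_sets (M l)"
        using that by (intro null_sets.finite_UN) (auto simp: null_sets_def fbmD(5)[OF MB] fbmD(2)[OF MB])
      then have "X \<in> null_sets (M l)"
        using that by (intro null_sets_subset[of _ "M l" X]) (auto simp: fbmD(2)[OF MB])
      then show ?thesis by (rule measure_eq_0_null_sets)
    qed
    have Qb: "Q \<in> sets borel"
      unfolding Q_def
    proof (rule sets.finite_UN[OF fin(1)])
      fix l assume l: "l \<in> O'"
      show "(\<Inter>l'\<in>E. P l l') \<in> sets borel"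
        using P(1)[OF l] fin(2) by (cases "E = {}") (auto intro: sets.finite_INT)
    qed
    have MO: "measure (M l) (- Q) = 0" if l: "l \<in> O'" for l
      by (rule null[of l "- Q" E "\<lambda>l'. - P l l'"]) (use l Qb P fin in \<open>auto simp: Q_def\<close>)
    have ME: "measure (M l') Q = 0" if l: "l' \<in> E" for l'
      by (rule null[of l' Q O' "\<lambda>l. P l l'"]) (use l Qb P fin in \<open>auto simp: Q_def\<close>)
    have AQ: "measure (A' 1) (- Q) = 0" "measure (A' (-1)) Q = 0"
      using A_eq[of 1 "- Q"] A_eq[of "-1" Q] Qb MO ME by (auto simp: Lv_def)
    have "pos_part (\<rho> 1) (\<rho> (-1)) = A' 1"
      by (rule pos_part_eqI[OF \<rho> \<rho> A(1) A(1) diff Qb AQ]) auto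
    moreover have "pos_part (\<rho> (-1)) (\<rho> 1) = A' (-1)"
    proof (rule pos_part_eqI[OF \<rho> \<rho> A(1) A(1)])
      show "measure (\<rho> (-1)) X - measure (\<rho> 1) X = measure (A' (-1)) X - measure (A' 1) X" if "X \<in> sets borel" for X
        using diff[OF that] by linarith
      show "- Q \<in> sets borel" "measure (A' (-1)) (- (- Q)) = 0" "measure (A' 1) (- Q) = 0" using Qb AQ by auto
    qed auto
    ultimately have kap: "kappa_part \<rho> p = A' p" if "p \<in> {-1, 1}" for p using that by (auto simp: kappa_part_def)
    have "wconv (\<lambda>k. alv (s (r k)) p) (kappa_part \<rho> p) \<and> fbm (kappa_part \<rho> p) \<and> (\<forall>z. measure (kappa_part \<rho> p) {z} = 0)"
      if p: "p \<in> {-1, 1}" for p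
    proof (intro conjI allI)
      show "measure (kappa_part \<rho> p) {z} = 0" for z
        unfolding kap[OF p] A_eq[OF p, of "{z}", simplified] by (intro sum.neutral ballI atomM LvD)
    qed (use kap[OF p] A[OF p] in \<open>simp_all add: q_def\<close>)
    then show ?thesis using r by blast
  qed
  have "wconv (\<lambda>k. alv k p) (kappa_part \<rho> p)"
    unfolding wconv_def
  proof (intro allI impI, rule tendsto_subseq_principle)
    fix \<phi> :: "real \<Rightarrow> real" and s :: "nat \<Rightarrow> nat" assume "continuous_on UNIV \<phi> \<and> bounded (range \<phi>)" "strict_mono s"
    then show "\<exists>r. strict_mono r \<and> (\<lambda>n. \<integral>y. \<phi> y \<partial>alv (s (r n)) p) \<longlonglongrightarrow> (\<integral>y. \<phi> y \<partial>kappa_part \<rho> p)"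
      using main[of s] p wconvD by blast
  qed
  moreover have "fbm (kappa_part \<rho> p) \<and> (\<forall>z. measure (kappa_part \<rho> p) {z} = 0)"
    using main[OF strict_mono_id] p by blast
  ultimately show ?thesis by (simp add: alv_def)
qed

end

section \<open>Passage to the limit in the weak formulation\<close>

lemma bounded_of_compact_support:
  fixes f :: "'a::topological_space \<Rightarrow> real"
  assumes "continuous_on UNIV f" "compact S" "\<And>z. z \<notin> S \<Longrightarrow> f z = 0"
  shows "\<exists>B\<ge>0. \<forall>z. \<bar>f z\<bar> \<le> B"
proof -
  have "compact (f ` S)" using assms by (intro compact_continuous_image) (auto intro: continuous_on_subset)
  then have "bounded (f ` S)" by (rule compact_imp_bounded)
  then obtain B where B: "\<And>y. y \<in> f ` S \<Longrightarrow> \<bar>y\<bar> \<le> B" by (auto simp: bounded_iff)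
  have "\<bar>f z\<bar> \<le> max B 0" for z using B[of "f z"] assms(3)[of z] by (cases "z \<in> S") auto
  then show ?thesis by (intro exI[of _ "max B 0"]) auto
qed

lemma frechet_derivative_outside_support:
  fixes f :: "'a::real_normed_vector \<Rightarrow> real"
  assumes "closed S" "\<And>z. z \<notin> S \<Longrightarrow> f z = 0" "z \<notin> S"
  shows "frechet_derivative f (at z) = (\<lambda>_. 0)"
proof -
  have "((\<lambda>_. 0) has_derivative (\<lambda>_. 0)) (at z)" by simp
  then have "(f has_derivative (\<lambda>_. 0)) (at z)"
    by (rule has_derivative_transform_within_open[of _ _ _ _ "- S"]) (use assms in auto)
  then show ?thesis by (rule frechet_derivative_at[symmetric])
qed

text \<open>The Lipschitz bound in \<open>x\<close> comes from the second derivative; it is what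
  tames \<open>V'\<close> in the self-interaction term. Vanishing at times 0 and \<open>T\<close>
  removes the boundary terms.\<close>

lemma test_function_facts:
  assumes \<phi>: "\<phi> \<in> test_functions T"
  shows "\<exists>B\<ge>0. (\<forall>t y. (\<phi> has_derivative (\<lambda>h. fst h * dt \<phi> t y + snd h * dx \<phi> t y)) (at (t, y))) \<and>
    continuous_on UNIV (\<lambda>z. dt \<phi> (fst z) (snd z)) \<and> continuous_on UNIV (\<lambda>z. dx \<phi> (fst z) (snd z)) \<and>
    (\<forall>t y. \<bar>dt \<phi> t y\<bar> \<le> B \<and> \<bar>dx \<phi> t y\<bar> \<le> B) \<and> (\<forall>t y z. \<bar>dx \<phi> t y - dx \<phi> t z\<bar> \<le> B * \<bar>y - z\<bar>) \<and>
    (\<forall>y. \<phi> (0, y) = 0 \<and> \<phi> (T, y) = 0)"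
proof -
  define S where "S = closure {z. \<phi> z \<noteq> 0}"
  have Ck: "\<And>k. Ck k \<phi>" and S: "compact S" "S \<subseteq> {0<..<T} \<times> UNIV"
    using \<phi> by (auto simp: test_functions_def S_def)
  have Sc: "closed S" by (simp add: S_def)
  have out: "\<phi> z = 0" if "z \<notin> S" for z using that closure_subset[of "{z. \<phi> z \<noteq> 0}"] by (auto simp: S_def)
  define F where "F v z = frechet_derivative \<phi> (at z) v" for v z
  have D: "(\<phi> has_derivative (\<lambda>v. F v z)) (at z)" for z
  proof -
    have "\<phi> differentiable (at z)" using Ck[of "Suc 0"] unfolding Ck.simps by blast
    then show ?thesis by (simp add: F_def frechet_derivative_works)
  qed
  have CkF: "Ck k (F v)" for k v using Ck[of "Suc k"] unfolding Ck.simps F_def[abs_def] by blast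
  have Fc: "continuous_on UNIV (F v)" for v using CkF[of 0 v] by simp
  have Fout: "F v z = 0" if "z \<notin> S" for v z
    using frechet_derivative_outside_support[OF Sc out that] by (simp add: F_def)
  have lin: "F v z = fst v * F (1, 0) z + snd v * F (0, 1) z" for v z
  proof -
    interpret linear "\<lambda>v. F v z" using D by (rule has_derivative_linear)
    have "F v z = F (fst v *\<^sub>R (1, 0) + snd v *\<^sub>R (0, 1)) z" by simp
    also have "\<dots> = fst v * F (1, 0) z + snd v * F (0, 1) z" by (simp only: add scale real_scaleR_def)
    finally show ?thesis .
  qed
  have dx: "dx \<phi> t y = F (0, 1) (t, y)" for t y
  proof -
    have "((\<lambda>y. \<phi> (t, y)) has_derivative (\<lambda>h. F (0, h) (t, y))) (at y)"
      by (rule has_derivative_compose[where g=\<phi> and f="\<lambda>y. (t, y)", OF _ D]) (auto intro!: derivative_eq_intros)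
    then have "((\<lambda>y. \<phi> (t, y)) has_real_derivative F (0, 1) (t, y)) (at y)"
      unfolding has_field_derivative_def by (rule has_derivative_eq_rhs) (subst lin, simp add: fun_eq_iff mult.commute)
    then show ?thesis unfolding dx_def by (rule DERIV_imp_deriv)
  qed
  have dt: "dt \<phi> t y = F (1, 0) (t, y)" for t y
  proof -
    have "((\<lambda>s. \<phi> (s, y)) has_derivative (\<lambda>h. F (h, 0) (t, y))) (at t)"
      by (rule has_derivative_compose[where g=\<phi> and f="\<lambda>s. (s, y)", OF _ D]) (auto intro!: derivative_eq_intros)
    then have "((\<lambda>s. \<phi> (s, y)) has_real_derivative F (1, 0) (t, y)) (at t)"
      unfolding has_field_derivative_def by (rule has_derivative_eq_rhs) (subst lin, simp add: fun_eq_iff mult.commute)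
    then show ?thesis unfolding dt_def by (rule DERIV_imp_deriv)
  qed
  obtain B1 where B1: "B1 \<ge> 0" "\<And>z. \<bar>F (1, 0) z\<bar> \<le> B1" using bounded_of_compact_support[OF Fc S(1) Fout] by blast
  obtain B2 where B2: "B2 \<ge> 0" "\<And>z. \<bar>F (0, 1) z\<bar> \<le> B2" using bounded_of_compact_support[OF Fc S(1) Fout] by blast
  \<comment> \<open>The second \<open>x\<close>-derivative: continuous and zero off
    \<open>S\<close>, hence bounded.\<close>
  define H where "H z = frechet_derivative (F (0, 1)) (at z) (0, 1)" for z
  have Hd: "(F (0, 1) has_derivative frechet_derivative (F (0, 1)) (at z)) (at z)" for z
  proof -
    have "F (0, 1) differentiable (at z)" using CkF[of "Suc 0" "(0, 1)"] unfolding Ck.simps by blast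
    then show ?thesis by (simp add: frechet_derivative_works)
  qed
  have "continuous_on UNIV H" using CkF[of "Suc 0" "(0, 1)"] unfolding Ck.simps H_def[abs_def] by blast
  moreover have "H z = 0" if "z \<notin> S" for z
    using frechet_derivative_outside_support[where f="F (0, 1)", OF Sc Fout that] by (simp add: H_def)
  ultimately obtain B3 where B3: "B3 \<ge> 0" "\<And>z. \<bar>H z\<bar> \<le> B3" using bounded_of_compact_support[OF _ S(1)] by blast
  have lip: "\<bar>F (0, 1) (t, y) - F (0, 1) (t, z)\<bar> \<le> B3 * \<bar>y - z\<bar>" for t y z
  proof -
    have "((\<lambda>y. F (0, 1) (t, y)) has_real_derivative H (t, y)) (at y)" for y
    proof -
      have "((\<lambda>y. F (0, 1) (t, y)) has_derivative (\<lambda>h. frechet_derivative (F (0, 1)) (at (t, y)) (0, h))) (at y)"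
        by (rule has_derivative_compose[where g="F (0, 1)" and f="\<lambda>y. (t, y)", OF _ Hd]) (auto intro!: derivative_eq_intros)
      moreover have "frechet_derivative (F (0, 1)) (at (t, y)) (0, h) = H (t, y) * h" for h
      proof -
        interpret linear "frechet_derivative (F (0, 1)) (at (t, y))" using Hd by (rule has_derivative_linear)
        have "frechet_derivative (F (0, 1)) (at (t, y)) (h *\<^sub>R (0, 1)) = h *\<^sub>R H (t, y)" unfolding H_def by (rule scale)
        then show ?thesis by (simp add: mult.commute)
      qed
      ultimately show ?thesis by (simp add: has_field_derivative_def)
    qed
    then have "norm (F (0, 1) (t, y) - F (0, 1) (t, z)) \<le> B3 * norm (y - z)"
      using B3 by (intro field_differentiable_bound[of UNIV "\<lambda>y. F (0, 1) (t, y)" "\<lambda>y. H (t, y)"]) auto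
    then show ?thesis by simp
  qed
  define B where "B = B1 + B2 + B3"
  have B: "B1 \<le> B" "B2 \<le> B" "B3 \<le> B" "0 \<le> B" using B1 B2 B3 by (auto simp: B_def)
  show ?thesis
  proof (intro exI[of _ B] conjI allI)
    show "(\<phi> has_derivative (\<lambda>h. fst h * dt \<phi> t y + snd h * dx \<phi> t y)) (at (t, y))" for t y
      using D[of "(t, y)"] unfolding dt dx by (rule has_derivative_eq_rhs) (rule ext, rule lin)
    show "\<bar>dt \<phi> t y\<bar> \<le> B" "\<bar>dx \<phi> t y\<bar> \<le> B" for t y
      unfolding dt dx using B1(2) B2(2) B order_trans by blast+
    show "\<bar>dx \<phi> t y - dx \<phi> t z\<bar> \<le> B * \<bar>y - z\<bar>" for t y z
      unfolding dx using lip[of t y z] mult_right_mono[OF B(3), of "\<bar>y - z\<bar>"] by linarith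
    show "\<phi> (0, y) = 0" "\<phi> (T, y) = 0" for y using out S(2) by force+
  qed (use B(4) Fc in \<open>simp_all add: dt dx\<close>)
qed

text \<open>The values at the finitely many exceptional points are added as a finite sum of
  multiples of indicators.\<close>

lemma set_borel_measurable_off_finite:
  fixes F :: "real \<Rightarrow> real"
  assumes J: "finite J" and c: "\<And>t. t \<in> {a<..<b} - J \<Longrightarrow> isCont F t"
  shows "set_borel_measurable lborel {a<..<b} F"
proof -
  have op: "open ({a<..<b} - J)" using J by (intro open_Diff finite_imp_closed) auto
  have "continuous_on ({a<..<b} - J) F" using c by (intro continuous_at_imp_continuous_on) auto
  then have m1: "(\<lambda>t. if t \<in> {a<..<b} - J then F t else 0) \<in> borel_measurable borel"
    using op by (intro borel_measurable_continuous_on_if) auto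
  have "(\<lambda>t. indicator {a<..<b} t *\<^sub>R F t) =
      (\<lambda>t. (if t \<in> {a<..<b} - J then F t else 0) + (\<Sum>j\<in>J. indicator {j} t * (indicator {a<..<b} j * F j)))"
  proof
    fix t
    show "indicator {a<..<b} t *\<^sub>R F t = (if t \<in> {a<..<b} - J then F t else 0) + (\<Sum>j\<in>J. indicator {j} t * (indicator {a<..<b} j * F j))"
    proof (cases "t \<in> J")
      case True
      have "(\<Sum>j\<in>J. indicator {j} t * (indicator {a<..<b} j * F j)) =
          indicator {t} t * (indicator {a<..<b} t * F t) + (\<Sum>j\<in>J - {t}. indicator {j} t * (indicator {a<..<b} j * F j))"
        by (rule sum.remove[OF J True])
      also have "(\<Sum>j\<in>J - {t}. indicator {j} t * (indicator {a<..<b} j * F j)) = 0"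
        by (intro sum.neutral) (auto simp: indicator_def)
      finally have e: "(\<Sum>j\<in>J. indicator {j} t * (indicator {a<..<b} j * F j)) =
          indicator {t} t * (indicator {a<..<b} t * F t) + 0" .
      show ?thesis unfolding e using True by simp
    next
      case False
      have "(\<Sum>j\<in>J. indicator {j} t * (indicator {a<..<b} j * F j)) = 0"
        using False by (intro sum.neutral) (auto simp: indicator_def)
      then show ?thesis using False by simp
    qed
  qed
  moreover have "(\<lambda>t. \<Sum>j\<in>J. indicator {j} t * (indicator {a<..<b} j * F j)) \<in> borel_measurable borel" by measurable
  note borel_measurable_add[OF m1 this]
  ultimately show ?thesis unfolding set_borel_measurable_def by (simp only: measurable_lborel2)
qed

lemma set_integrable_open_bounded:
  fixes F :: "real \<Rightarrow> real"
  assumes m: "set_borel_measurable lborel {a<..<b} F" and B: "\<And>t. t \<in> {a<..<b} \<Longrightarrow> \<bar>F t\<bar> \<le> B"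
  shows "set_integrable lborel {a<..<b} F"
proof -
  have "emeasure lborel {a<..<b} < \<infinity>" by (cases "a \<le> b") auto
  then show ?thesis
    using m unfolding set_integrable_def set_borel_measurable_def
    by (intro integrableI_bounded_set[where A="{a<..<b}" and B=B]) (use B in \<open>auto simp: indicator_def\<close>)
qed

text \<open>Measurability of the limit \<open>f\<close> is inherited from the \<open>F k\<close>.
  This matters for the terms in \<open>kappa_part (\<rho> t)\<close>, whose dependence on
  \<open>t\<close> is accessible only through such limits.\<close>

lemma set_dominated_convergence:
  fixes F :: "nat \<Rightarrow> real \<Rightarrow> real"
  assumes m: "\<And>k. set_borel_measurable lborel {a<..<b} (F k)" and B: "\<And>k t. t \<in> {a<..<b} \<Longrightarrow> \<bar>F k t\<bar> \<le> B"
    and lim: "\<And>t. t \<in> {a<..<b} \<Longrightarrow> (\<lambda>k. F k t) \<longlonglongrightarrow> f t"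
  shows "(\<lambda>k. LINT t:{a<..<b}|lborel. F k t) \<longlonglongrightarrow> (LINT t:{a<..<b}|lborel. f t)"
proof -
  have l: "(\<lambda>k. indicator {a<..<b} t *\<^sub>R F k t) \<longlonglongrightarrow> indicator {a<..<b} t *\<^sub>R f t" for t
    using lim[of t] by (cases "t \<in> {a<..<b}") auto
  have fin: "emeasure lborel {a<..<b} < \<infinity>" by (cases "a \<le> b") auto
  show ?thesis
    unfolding set_lebesgue_integral_def
  proof (rule integral_dominated_convergence[where w="\<lambda>t. B * indicator {a<..<b} t"])
    show "(\<lambda>t. indicator {a<..<b} t *\<^sub>R f t) \<in> borel_measurable lborel"
      by (rule borel_measurable_LIMSEQ_real[OF l]) (use m in \<open>simp add: set_borel_measurable_def\<close>)
    show "(\<lambda>t. indicator {a<..<b} t *\<^sub>R F k t) \<in> borel_measurable lborel" for k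
      using m by (simp add: set_borel_measurable_def)
    show "integrable lborel (\<lambda>t. B * indicator {a<..<b} t)"
      using fin by (intro integrable_mult_right integrable_real_indicator) auto
    show "AE t in lborel. norm (indicator {a<..<b} t *\<^sub>R F k t) \<le> B * indicator {a<..<b} t" for k
      using B by (intro AE_I2) (auto simp: indicator_def)
  qed (use l in simp)
qed

lemma dV_measurable:
  assumes "standing_assumptions V W" shows "dV V \<in> borel_measurable borel"
proof -
  have "continuous_on (- {0}) (dV V)"
    using dV_isCont[OF assms] by (intro continuous_at_imp_continuous_on) auto
  then have "(\<lambda>r. if r \<in> - {0} then dV V r else 0) \<in> borel_measurable borel"
    by (intro borel_measurable_continuous_on_if) auto
  moreover have "(\<lambda>r. if r \<in> - {0} then dV V r else 0) = dV V" by (auto simp: dV_def fun_eq_iff)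
  ultimately show ?thesis by simp
qed

text \<open>Zero on the diagonal, by the convention \<open>dV V 0 = 0\<close>; only there can
  continuity fail.\<close>

definition self_kernel :: "(real \<Rightarrow> real) \<Rightarrow> (real \<Rightarrow> real) \<Rightarrow> real \<times> real \<Rightarrow> real" where
  "self_kernel V g z = (g (fst z) - g (snd z)) * dV V (fst z - snd z)"

definition cross_kernel :: "(real \<Rightarrow> real) \<Rightarrow> (real \<Rightarrow> real) \<Rightarrow> real \<times> real \<Rightarrow> real" where
  "cross_kernel W g z = g (fst z) * deriv W (fst z - snd z)"

lemma self_kernel_facts:
  assumes pot: "standing_assumptions V W" and g: "continuous_on UNIV g"
  shows self_kernel_measurable: "self_kernel V g \<in> borel_measurable borel"
    and self_kernel_isCont: "y \<noteq> z \<Longrightarrow> isCont (self_kernel V g) (y, z)"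
    and cross_kernel_isCont: "isCont (cross_kernel W g) w"
    and cross_kernel_measurable: "cross_kernel W g \<in> borel_measurable borel"
proof -
  have gc: "isCont g r" for r using g by (simp add: continuous_on_eq_continuous_at)
  have f: "isCont (\<lambda>w :: real \<times> real. g (fst w)) w" "isCont (\<lambda>w :: real \<times> real. g (snd w)) w" for w
    by (intro isCont_o2[OF _ gc] continuous_intros)+
  have d: "isCont (\<lambda>w :: real \<times> real. fst w - snd w) w" for w by (intro continuous_intros)
  have "continuous_on UNIV (\<lambda>w :: real \<times> real. g (fst w) - g (snd w))"
    by (intro continuous_at_imp_continuous_on ballI continuous_diff f)
  then have m1: "(\<lambda>w :: real \<times> real. g (fst w) - g (snd w)) \<in> borel_measurable borel" by (rule borel_measurable_continuous_onI)
  have "continuous_on UNIV (\<lambda>w :: real \<times> real. fst w - snd w)" by (intro continuous_intros)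
  then have "(\<lambda>w :: real \<times> real. fst w - snd w) \<in> borel_measurable borel" by (rule borel_measurable_continuous_onI)
  from measurable_compose[OF this dV_measurable[OF pot]] m1
  show "self_kernel V g \<in> borel_measurable borel" unfolding self_kernel_def[abs_def] by (rule borel_measurable_times[rotated])
  show "isCont (self_kernel V g) (y, z)" if "y \<noteq> z"
    unfolding self_kernel_def[abs_def] using that
    by (intro continuous_mult continuous_diff f isCont_o2[OF d dV_isCont[OF pot]]) auto
  show cc: "isCont (cross_kernel W g) w" for w
    unfolding cross_kernel_def[abs_def] by (intro continuous_mult f isCont_o2[OF d dW_isCont[OF pot]])
  show "cross_kernel W g \<in> borel_measurable borel"
    by (intro borel_measurable_continuous_onI continuous_at_imp_continuous_on ballI cc)
qed

text \<open>The increment of \<open>g\<close> supplies the factor \<open>\<bar>r\<bar>\<close> that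
  turns the singular \<open>V'(r)\<close> into the bounded \<open>r V'(r)\<close>; the cross kernel
  uses that \<open>W'\<close> itself is bounded.\<close>

lemma kernel_bounds:
  assumes C: "\<And>r. \<bar>r * dV V r\<bar> \<le> C" "\<And>r. \<bar>deriv W r\<bar> \<le> C" and B: "B \<ge> 0"
    and g: "\<And>y. \<bar>g y\<bar> \<le> B" "\<And>y z. \<bar>g y - g z\<bar> \<le> B * \<bar>y - z\<bar>"
  shows "\<bar>self_kernel V g w\<bar> \<le> B * C" "\<bar>cross_kernel W g w\<bar> \<le> B * C"
proof -
  have "\<bar>self_kernel V g w\<bar> \<le> B * \<bar>fst w - snd w\<bar> * \<bar>dV V (fst w - snd w)\<bar>"
    unfolding self_kernel_def abs_mult by (intro mult_right_mono g) auto
  also have "\<dots> \<le> B * C" using C(1)[of "fst w - snd w"] B by (simp add: abs_mult mult.assoc mult_left_mono)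
  finally show "\<bar>self_kernel V g w\<bar> \<le> B * C" .
  show "\<bar>cross_kernel W g w\<bar> \<le> B * C"
    unfolding cross_kernel_def abs_mult using B by (intro mult_mono g C) auto
qed

section \<open>The weak form satisfied by the particles\<close>

context annihilating_particles
begin

text \<open>With \<open>Q2\<close> and \<open>Q3\<close>, the integrands of the weak form.
  \<open>Q1\<close> counts all particles by initial sign, the other two only the live ones by
  current sign, mirroring \<open>\<rho>\<close> and the Jordan parts of
  \<open>\<kappa>\<close>.\<close>

definition Q1 :: "(real \<times> real \<Rightarrow> real) \<Rightarrow> int \<Rightarrow> real \<Rightarrow> real" where
  "Q1 \<phi> p t = (\<integral>y. dt \<phi> t y \<partial>empirical n (x t) b0 p)"

definition Q2 :: "(real \<times> real \<Rightarrow> real) \<Rightarrow> int \<Rightarrow> real \<Rightarrow> real" where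
  "Q2 \<phi> p t = (\<integral>y. \<integral>z. self_kernel V (dx \<phi> t) (y, z) \<partial>empirical n (x t) (b t) p \<partial>empirical n (x t) (b t) p)"

definition Q3 :: "(real \<times> real \<Rightarrow> real) \<Rightarrow> int \<Rightarrow> real \<Rightarrow> real" where
  "Q3 \<phi> p t = (\<integral>y. \<integral>z. cross_kernel W (dx \<phi> t) (y, z) \<partial>empirical n (x t) (b t) (- p) \<partial>empirical n (x t) (b t) p)"

lemma double_integral_empirical:
  assumes g: "g \<in> borel_measurable borel" and t: "t \<in> {0..T}" and p: "p \<in> {-1, 1}" "q \<in> {-1, 1}"
  shows "(\<integral>y. \<integral>z. g (y, z) \<partial>empirical n (x t) (b t) q \<partial>empirical n (x t) (b t) p) =
    (1 / (real n)\<^sup>2) * (\<Sum>i=1..n. \<Sum>j=1..n. if live t i \<and> live t j \<and> b0 i = p \<and> b0 j = q then g (x t i, x t j) else 0)"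
proof -
  have "(\<lambda>y. \<integral>z. g (y, z) \<partial>empirical n (x t) (b t) q) \<in> borel_measurable borel"
    by (rule borel_measurable_inner_integral[OF g fbm_empirical])
  then have "(\<integral>y. \<integral>z. g (y, z) \<partial>empirical n (x t) (b t) q \<partial>empirical n (x t) (b t) p) =
    1 / real n * (\<Sum>i\<in>{i\<in>{1..n}. live t i \<and> b0 i = p}. 1 / real n * (\<Sum>j\<in>{j\<in>{1..n}. live t j \<and> b0 j = q}. g (x t i, x t j)))"
    by (simp only: integral_empirical integral_empirical[OF borel_measurable_slice[OF g]] live_labels[OF t p(1)] live_labels[OF t p(2)])
  also have "\<dots> = (1 / (real n)\<^sup>2) * (\<Sum>i=1..n. \<Sum>j=1..n. if live t i \<and> live t j \<and> b0 i = p \<and> b0 j = q then g (x t i, x t j) else 0)"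
    unfolding sum.inter_filter[OF finite_atLeastAtMost] sum_distrib_left
    by (intro sum.cong refl) (auto simp: power2_eq_square sum_distrib_left sum_divide_distrib intro!: sum.cong)
  finally show ?thesis .
qed

context
  fixes \<phi> :: "real \<times> real \<Rightarrow> real" and p :: int and M :: real
  assumes p: "p \<in> {-1, 1}" and M: "M \<ge> 0"
    and D: "\<And>t y. (\<phi> has_derivative (\<lambda>h. fst h * dt \<phi> t y + snd h * dx \<phi> t y)) (at (t, y))"
    and dtc: "continuous_on UNIV (\<lambda>z. dt \<phi> (fst z) (snd z))" and dxc: "continuous_on UNIV (\<lambda>z. dx \<phi> (fst z) (snd z))"
    and bd: "\<And>t y. \<bar>dt \<phi> t y\<bar> \<le> M" "\<And>t y. \<bar>dx \<phi> t y\<bar> \<le> M" "\<And>t y z. \<bar>dx \<phi> t y - dx \<phi> t z\<bar> \<le> M * \<bar>y - z\<bar>"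
    and ends: "\<And>y. \<phi> (0, y) = 0" "\<And>y. \<phi> (T, y) = 0"
begin

lemma dx_cont: "continuous_on UNIV (dx \<phi> t)"
proof -
  have c: "continuous_on UNIV (\<lambda>y :: real. (t, y))" by (intro continuous_intros)
  from continuous_on_compose2[OF dxc c] show ?thesis by simp
qed

lemma dt_cont: "continuous_on UNIV (dt \<phi> t)"
proof -
  have c: "continuous_on UNIV (\<lambda>y :: real. (t, y))" by (intro continuous_intros)
  from continuous_on_compose2[OF dtc c] show ?thesis by simp
qed

lemma along_isCont:
  assumes i: "i \<in> {1..n}" and t: "t \<in> {0<..<T}"
  shows "isCont (\<lambda>t. dt \<phi> t (x t i)) t" "isCont (\<lambda>t. dx \<phi> t (x t i)) t"
proof -
  have c: "isCont (\<lambda>s. (s, x s i)) t" by (intro continuous_Pair continuous_ident x_isCont i t)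
  have "isCont (\<lambda>z. dt \<phi> (fst z) (snd z)) (t, x t i)" "isCont (\<lambda>z. dx \<phi> (fst z) (snd z)) (t, x t i)"
    using dtc dxc by (simp_all add: continuous_on_eq_continuous_at)
  from isCont_o2[OF c this(1)] isCont_o2[OF c this(2)]
  show "isCont (\<lambda>t. dt \<phi> t (x t i)) t" "isCont (\<lambda>t. dx \<phi> t (x t i)) t" by simp_all
qed

lemma Q1_eq: "Q1 \<phi> p t = (1 / real n) * (\<Sum>i | i \<in> {1..n} \<and> b0 i = p. dt \<phi> t (x t i))"
  unfolding Q1_def by (rule integral_empirical) (rule borel_measurable_continuous_onI[OF dt_cont])

lemma Q2_eq:
  assumes t: "t \<in> {0..T}"
  shows "Q2 \<phi> p t = (1 / (real n)\<^sup>2) * (\<Sum>i=1..n. \<Sum>j=1..n. if b0 i = p \<and> b0 j = p then K t i j * (dx \<phi> t (x t i) - dx \<phi> t (x t j)) else 0)"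
  unfolding Q2_def double_integral_empirical[OF self_kernel_measurable[OF potentials dx_cont] t p p]
  by (intro arg_cong2[where f="(*)"] refl sum.cong) (auto simp: K_def self_kernel_def)

lemma Q3_eq:
  assumes t: "t \<in> {0..T}"
  shows "Q3 \<phi> p t = (1 / (real n)\<^sup>2) * (\<Sum>i=1..n. \<Sum>j=1..n. if b0 i = p \<and> b0 j = - p then K t i j * dx \<phi> t (x t i) else 0)"
proof -
  have mp: "- p \<in> {-1, 1}" using p by auto
  show ?thesis
    unfolding Q3_def double_integral_empirical[OF cross_kernel_measurable[OF potentials dx_cont] t p mp]
    using p by (intro arg_cong2[where f="(*)"] refl sum.cong) (auto simp: K_def cross_kernel_def)
qed

lemma Q_measurable:
  "set_borel_measurable lborel {0<..<T} (Q1 \<phi> p)" "set_borel_measurable lborel {0<..<T} (Q2 \<phi> p)" "set_borel_measurable lborel {0<..<T} (Q3 \<phi> p)"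
proof -
  have ev: "\<forall>\<^sub>F s in nhds t. s \<in> {0..T}" if "t \<in> {0<..<T} - J" for t
  proof -
    have "\<forall>\<^sub>F s in nhds t. s \<in> {0<..<T}" using that by (intro eventually_nhds_in_open) auto
    then show ?thesis by eventually_elim auto
  qed
  show "set_borel_measurable lborel {0<..<T} (Q1 \<phi> p)"
  proof (rule set_borel_measurable_off_finite[OF finite_J])
    fix t assume "t \<in> {0<..<T} - J"
    then show "isCont (Q1 \<phi> p) t"
      unfolding Q1_eq[abs_def] by (intro continuous_mult continuous_const continuous_sum along_isCont) auto
  qed
  show "set_borel_measurable lborel {0<..<T} (Q2 \<phi> p)"
  proof (rule set_borel_measurable_off_finite[OF finite_J])
    fix t assume t: "t \<in> {0<..<T} - J"
    have "isCont (\<lambda>t. if b0 i = p \<and> b0 j = p then K t i j * (dx \<phi> t (x t i) - dx \<phi> t (x t j)) else 0) t"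
      if "i \<in> {1..n}" "j \<in> {1..n}" for i j
    proof (cases "b0 i = p \<and> b0 j = p")
      case True
      have "isCont (\<lambda>t. K t i j * (dx \<phi> t (x t i) - dx \<phi> t (x t j))) t"
        using t by (intro continuous_mult continuous_diff K_isCont along_isCont that) auto
      then show ?thesis using True by simp
    qed auto
    then have "isCont (\<lambda>t. (1 / (real n)\<^sup>2) * (\<Sum>i=1..n. \<Sum>j=1..n. if b0 i = p \<and> b0 j = p then K t i j * (dx \<phi> t (x t i) - dx \<phi> t (x t j)) else 0)) t"
      by (intro continuous_mult continuous_const continuous_sum)
    moreover have "\<forall>\<^sub>F s in nhds t. Q2 \<phi> p s = (1 / (real n)\<^sup>2) * (\<Sum>i=1..n. \<Sum>j=1..n. if b0 i = p \<and> b0 j = p then K s i j * (dx \<phi> s (x s i) - dx \<phi> s (x s j)) else 0)"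
      using ev[OF t] by eventually_elim (rule Q2_eq)
    note isCont_cong[OF this]
    ultimately show "isCont (Q2 \<phi> p) t" by simp
  qed
  show "set_borel_measurable lborel {0<..<T} (Q3 \<phi> p)"
  proof (rule set_borel_measurable_off_finite[OF finite_J])
    fix t assume t: "t \<in> {0<..<T} - J"
    have "isCont (\<lambda>t. if b0 i = p \<and> b0 j = - p then K t i j * dx \<phi> t (x t i) else 0) t"
      if "i \<in> {1..n}" "j \<in> {1..n}" for i j
    proof (cases "b0 i = p \<and> b0 j = - p")
      case True
      have "isCont (\<lambda>t. K t i j * dx \<phi> t (x t i)) t"
        using t by (intro continuous_mult K_isCont along_isCont that) auto
      then show ?thesis using True by simp
    qed auto
    then have "isCont (\<lambda>t. (1 / (real n)\<^sup>2) * (\<Sum>i=1..n. \<Sum>j=1..n. if b0 i = p \<and> b0 j = - p then K t i j * dx \<phi> t (x t i) else 0)) t"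
      by (intro continuous_mult continuous_const continuous_sum)
    moreover have "\<forall>\<^sub>F s in nhds t. Q3 \<phi> p s = (1 / (real n)\<^sup>2) * (\<Sum>i=1..n. \<Sum>j=1..n. if b0 i = p \<and> b0 j = - p then K s i j * dx \<phi> s (x s i) else 0)"
      using ev[OF t] by eventually_elim (rule Q3_eq)
    note isCont_cong[OF this]
    ultimately show "isCont (Q3 \<phi> p) t" by simp
  qed
qed

lemma Q_bounds: "\<bar>Q1 \<phi> p t\<bar> \<le> M" "\<bar>Q2 \<phi> p t\<bar> \<le> M * C" "\<bar>Q3 \<phi> p t\<bar> \<le> M * C"
proof -
  have m: "measure (empirical n (x t) c q) UNIV \<le> 1" for c q by (rule mass_empirical_le)
  show "\<bar>Q1 \<phi> p t\<bar> \<le> M"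
    unfolding Q1_def using integral_fbm_bound[OF fbm_empirical, of "dt \<phi> t" M n "x t" b0 p] bd(1) mult_left_mono[OF m M, of b0 p] by simp
  have MC: "M * C \<ge> 0" using M C_nonneg by simp
  note kb = kernel_bounds[OF dV_bound dW_bound M bd(2,3)]
  have two: "\<bar>\<integral>y. \<integral>z. g (y, z) \<partial>empirical n (x t) (b t) q \<partial>empirical n (x t) (b t) p\<bar> \<le> M * C"
    if "\<And>z. \<bar>g z\<bar> \<le> M * C" for g q
  proof -
    have "\<bar>\<integral>y. \<integral>z. g (y, z) \<partial>empirical n (x t) (b t) q \<partial>empirical n (x t) (b t) p\<bar> \<le>
        M * C * measure (empirical n (x t) (b t) q) UNIV * measure (empirical n (x t) (b t) p) UNIV"
      by (rule integral_fbm_bound2[OF fbm_empirical fbm_empirical that])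
    also have "\<dots> \<le> M * C * 1 * 1" using MC m M C_nonneg by (intro mult_mono) auto
    finally show ?thesis by simp
  qed
  show "\<bar>Q2 \<phi> p t\<bar> \<le> M * C" unfolding Q2_def by (rule two) (rule kb(1))
  show "\<bar>Q3 \<phi> p t\<bar> \<le> M * C" unfolding Q3_def by (rule two) (rule kb(2))
qed

text \<open>The equation of motion tested with the \<open>x\<close>-derivative of
  \<open>\<phi>\<close>. Forces between equal signs are symmetrised, which gives the factor 1/2 and
  the difference of derivatives; forces between opposite signs stay as they are. Dead particles
  contribute 0 on both sides.\<close>

lemma transport_identity:
  assumes t: "t \<in> {0..T}"
  shows "(1 / real n) * (\<Sum>i | i \<in> {1..n} \<and> b0 i = p. dx \<phi> t (x t i) * vel t i) = - (1 / 2) * Q2 \<phi> p t - Q3 \<phi> p t"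
proof -
  define a where "a i = dx \<phi> t (x t i)" for i
  let ?f = "\<lambda>i j. if b0 i = p \<and> b0 j = p then K t i j else 0"
  have "(\<Sum>i=1..n. \<Sum>j=1..n. if b0 i = p \<and> b0 j = p then K t i j * (a i - a j) else 0) = (\<Sum>i=1..n. \<Sum>j=1..n. ?f i j * (a i - a j))"
    by (intro sum.cong refl) auto
  also have "\<dots> = 2 * (\<Sum>i=1..n. \<Sum>j=1..n. ?f i j * a i)"
    by (rule sum_antisymmetric) (auto intro: K_antisym)
  finally have Q2: "1 / 2 * Q2 \<phi> p t = (1 / (real n)\<^sup>2) * (\<Sum>i=1..n. \<Sum>j=1..n. ?f i j * a i)"
    unfolding Q2_eq[OF t] a_def by simp
  have "(\<Sum>i | i \<in> {1..n} \<and> b0 i = p. a i * vel t i) = (\<Sum>i=1..n. if b0 i = p then a i * vel t i else 0)"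
    using sum.inter_filter[of "{1..n}" "\<lambda>i. a i * vel t i" "\<lambda>i. b0 i = p"] by simp
  also have "\<dots> = (\<Sum>i=1..n. - (1 / real n) * (\<Sum>j=1..n. ?f i j * a i + (if b0 i = p \<and> b0 j = - p then K t i j * a i else 0)))"
  proof (rule sum.cong[OF refl])
    fix i assume i: "i \<in> {1..n}"
    show "(if b0 i = p then a i * vel t i else 0) = - (1 / real n) * (\<Sum>j=1..n. ?f i j * a i + (if b0 i = p \<and> b0 j = - p then K t i j * a i else 0))"
    proof (cases "b0 i = p")
      case True
      have "(\<Sum>j=1..n. ?f i j * a i + (if b0 i = p \<and> b0 j = - p then K t i j * a i else 0)) = (\<Sum>j=1..n. K t i j * a i)"
      proof (rule sum.cong[OF refl])
        fix j assume j: "j \<in> {1..n}"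
        then have "b0 j \<in> {-1, 1}" using signs by simp
        then have "b0 j = p \<or> b0 j = - p" using p by auto
        then show "?f i j * a i + (if b0 i = p \<and> b0 j = - p then K t i j * a i else 0) = K t i j * a i"
          using True p by auto
      qed
      then show ?thesis using True by (simp add: vel_def sum_distrib_left mult.commute)
    qed simp
  qed
  also have "\<dots> = - (1 / real n) * ((\<Sum>i=1..n. \<Sum>j=1..n. ?f i j * a i) + (\<Sum>i=1..n. \<Sum>j=1..n. if b0 i = p \<and> b0 j = - p then K t i j * a i else 0))"
    by (simp only: sum_distrib_left[symmetric] sum.distrib)
  finally have e: "(\<Sum>i | i \<in> {1..n} \<and> b0 i = p. a i * vel t i) = - (1 / real n) * ((\<Sum>i=1..n. \<Sum>j=1..n. ?f i j * a i) + (\<Sum>i=1..n. \<Sum>j=1..n. if b0 i = p \<and> b0 j = - p then K t i j * a i else 0))" .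
  have "(1 / real n) * (\<Sum>i | i \<in> {1..n} \<and> b0 i = p. a i * vel t i) = - (1 / 2 * Q2 \<phi> p t) - Q3 \<phi> p t"
    unfolding Q2 Q3_eq[OF t] a_def[symmetric] e by (simp add: power2_eq_square distrib_left diff_divide_distrib)
  then show ?thesis by (simp add: a_def)
qed

text \<open>Fundamental theorem of calculus for the sum of \<open>\<phi> (t, x t i)\<close> over all
  particles of initial sign \<open>p\<close>, dead ones included. That sum is continuous through
  annihilations, so finitely many exceptional times do no harm, and it vanishes at both
  ends.\<close>

theorem discrete_weak_form:
  "(LINT t:{0<..<T}|lborel. Q1 \<phi> p t) - 1 / 2 * (LINT t:{0<..<T}|lborel. Q2 \<phi> p t) - (LINT t:{0<..<T}|lborel. Q3 \<phi> p t) = 0"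
proof -
  let ?I = "{i. i \<in> {1..n} \<and> b0 i = p}"
  let ?F = "\<lambda>t. (1 / real n) * (\<Sum>i\<in>?I. \<phi> (t, x t i))"
  let ?f = "\<lambda>t. Q1 \<phi> p t - 1 / 2 * Q2 \<phi> p t - Q3 \<phi> p t"
  have int: "set_integrable lborel {0<..<T} (Q1 \<phi> p)" "set_integrable lborel {0<..<T} (\<lambda>t. 1 / 2 * Q2 \<phi> p t)" "set_integrable lborel {0<..<T} (Q3 \<phi> p)"
    using set_integrable_open_bounded[OF Q_measurable(1) Q_bounds(1)] set_integrable_open_bounded[OF Q_measurable(2) Q_bounds(2)]
      set_integrable_open_bounded[OF Q_measurable(3) Q_bounds(3)] by (auto intro: set_integrable_mult_right)
  have phic: "continuous_on UNIV \<phi>"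
    using D has_derivative_continuous by (intro continuous_at_imp_continuous_on) fastforce
  have "(?f has_integral ?F T - ?F 0) {0..T}"
  proof (rule fundamental_theorem_of_calculus_interior_strong[OF finite_J])
    show "continuous_on {0..T} ?F"
      by (intro continuous_intros continuous_on_compose2[OF phic] x_cont) auto
    fix t assume t: "t \<in> {0<..<T} - J"
    have "((\<lambda>t. \<phi> (t, x t i)) has_real_derivative dt \<phi> t (x t i) + dx \<phi> t (x t i) * vel t i) (at t)" if i: "i \<in> ?I" for i
    proof -
      have "((\<lambda>s. x s i) has_derivative (*) (vel t i)) (at t)"
        using ode_vel[of i t] i t by (simp add: has_field_derivative_def)
      then have "((\<lambda>s. (s, x s i)) has_derivative (\<lambda>h. (h, vel t i * h))) (at t)"
        by (intro has_derivative_Pair has_derivative_ident)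
      from has_derivative_compose[OF this D]
      show ?thesis unfolding has_field_derivative_def
        by (rule has_derivative_eq_rhs) (simp add: fun_eq_iff algebra_simps)
    qed
    then have "(?F has_real_derivative (1 / real n) * (\<Sum>i\<in>?I. dt \<phi> t (x t i) + dx \<phi> t (x t i) * vel t i)) (at t)"
      by (intro DERIV_cmult DERIV_sum)
    moreover have "(1 / real n) * (\<Sum>i\<in>?I. dt \<phi> t (x t i) + dx \<phi> t (x t i) * vel t i) = ?f t"
      using transport_identity[of t] t unfolding Q1_eq by (simp add: sum.distrib distrib_left add_divide_distrib)
    ultimately show "(?F has_vector_derivative ?f t) (at t)" by (simp add: has_real_derivative_iff_has_vector_derivative)
  qed (use T_pos in simp)
  then have "(?f has_integral 0) {0..T}" using ends by simp
  then have "integral {0<..<T} ?f = 0" using integral_open_interval_real[of 0 T ?f] by (simp add: integral_unique)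
  moreover have fi: "set_integrable lborel {0<..<T} ?f" using int by (intro set_integral_diff)
  ultimately have "(LINT t:{0<..<T}|lborel. ?f t) = 0" using set_borel_integral_eq_integral(2)[OF fi] by simp
  then show ?thesis using int by (simp add: set_integral_diff)
qed

end

end

text \<open>All three integrands converge at each \<open>t\<close> in the open interval and are
  bounded uniformly in \<open>k\<close> and \<open>t\<close>, so their time integrals
  converge.\<close>

theorem (in particle_sequence) limit_weak_form:
  assumes \<rho>: "\<And>t p. t \<in> {0..T} \<Longrightarrow> p \<in> {-1, 1} \<Longrightarrow> fbm (\<rho> t p)"
    and w: "\<And>t p. t \<in> {0..T} \<Longrightarrow> p \<in> {-1, 1} \<Longrightarrow> wconv (\<lambda>k. empirical (N k) (x k t) (b0 k) p) (\<rho> t p)"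
    and p: "p \<in> {-1, 1}" and \<phi>: "\<phi> \<in> test_functions T"
  shows "0 = (LINT t:{0<..<T}|lborel. (\<integral>y. dt \<phi> t y \<partial>\<rho> t p))
          - 1 / 2 * (LINT t:{0<..<T}|lborel.
              (\<integral>(y, z). (dx \<phi> t y - dx \<phi> t z) * dV V (y - z) \<partial>(kappa_part (\<rho> t) p \<Otimes>\<^sub>M kappa_part (\<rho> t) p)))
          - (LINT t:{0<..<T}|lborel.
              (\<integral>y. dx \<phi> t y * (\<integral>z. deriv W (y - z) \<partial>kappa_part (\<rho> t) (- p)) \<partial>kappa_part (\<rho> t) p))"
proof -
  obtain M where M: "M \<ge> 0" and D: "\<And>t y. (\<phi> has_derivative (\<lambda>h. fst h * dt \<phi> t y + snd h * dx \<phi> t y)) (at (t, y))"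
    and dtc: "continuous_on UNIV (\<lambda>z. dt \<phi> (fst z) (snd z))" and dxc: "continuous_on UNIV (\<lambda>z. dx \<phi> (fst z) (snd z))"
    and bd: "\<And>t y. \<bar>dt \<phi> t y\<bar> \<le> M" "\<And>t y. \<bar>dx \<phi> t y\<bar> \<le> M" "\<And>t y z. \<bar>dx \<phi> t y - dx \<phi> t z\<bar> \<le> M * \<bar>y - z\<bar>"
    and ends: "\<And>y. \<phi> (0, y) = 0" "\<And>y. \<phi> (T, y) = 0"
    using test_function_facts[OF \<phi>] by blast
  note ctx = p M D dtc dxc bd ends
  have pot: "standing_assumptions V W" by (rule S.potentials)
  have mp: "- p \<in> {-1, 1}" using p by auto
  have dx: "continuous_on UNIV (dx \<phi> t)" for t
  proof -
    have c: "continuous_on UNIV (\<lambda>y :: real. (t, y))" by (intro continuous_intros)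
    from continuous_on_compose2[OF dxc c] show ?thesis by simp
  qed
  have dt: "continuous_on UNIV (dt \<phi> t)" for t
  proof -
    have c: "continuous_on UNIV (\<lambda>y :: real. (t, y))" by (intro continuous_intros)
    from continuous_on_compose2[OF dtc c] show ?thesis by simp
  qed
  note kb = kernel_bounds[OF S.dV_bound S.dW_bound M bd(2,3)]
  note km = self_kernel_measurable[OF pot dx] cross_kernel_measurable[OF pot dx]
  have alive: "wconv (\<lambda>k. empirical (N k) (x k t) (b k t) q) (kappa_part (\<rho> t) q)" "fbm (kappa_part (\<rho> t) q)" "measure (kappa_part (\<rho> t) q) {z} = 0"
    if "t \<in> {0<..<T}" "q \<in> {-1, 1}" for t q z
    using alive_limit[of t "\<rho> t" q] that \<rho>[of t] w[of t] by auto
  let ?l2 = "\<lambda>t. \<integral>y. \<integral>z. self_kernel V (dx \<phi> t) (y, z) \<partial>kappa_part (\<rho> t) p \<partial>kappa_part (\<rho> t) p"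
  let ?l3 = "\<lambda>t. \<integral>y. \<integral>z. cross_kernel W (dx \<phi> t) (y, z) \<partial>kappa_part (\<rho> t) (- p) \<partial>kappa_part (\<rho> t) p"
  have 1: "(\<lambda>k. LINT t:{0<..<T}|lborel. S.Q1 k \<phi> p t) \<longlonglongrightarrow> (LINT t:{0<..<T}|lborel. (\<integral>y. dt \<phi> t y \<partial>\<rho> t p))"
  proof (rule set_dominated_convergence[OF S.Q_measurable(1)[OF ctx] S.Q_bounds(1)[OF ctx]])
    fix t assume t: "t \<in> {0<..<T}"
    have "bounded (range (dt \<phi> t))" using bd(1) by (auto simp: bounded_iff)
    then show "(\<lambda>k. S.Q1 k \<phi> p t) \<longlonglongrightarrow> (\<integral>y. dt \<phi> t y \<partial>\<rho> t p)"
      unfolding S.Q1_def using t p by (intro wconvD[OF w] dt) auto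
  qed
  have 2: "(\<lambda>k. LINT t:{0<..<T}|lborel. S.Q2 k \<phi> p t) \<longlonglongrightarrow> (LINT t:{0<..<T}|lborel. ?l2 t)"
  proof (rule set_dominated_convergence[OF S.Q_measurable(2)[OF ctx] S.Q_bounds(2)[OF ctx]])
    fix t assume t: "t \<in> {0<..<T}"
    note a = alive[OF t p]
    \<comment> \<open>Continuity at \<open>(y, z)\<close> can fail only for \<open>z = y\<close>, a
      null set because the limit has no atoms.\<close>
    have "AE z in kappa_part (\<rho> t) p. isCont (self_kernel V (dx \<phi> t)) (y, z)" for y
    proof -
      have "{y} \<in> null_sets (kappa_part (\<rho> t) p)" using a(3) by (auto simp: null_sets_def fbmD(2,5)[OF a(2)])
      then have "AE z in kappa_part (\<rho> t) p. z \<notin> {y}" by (rule AE_not_in)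
      then show ?thesis by eventually_elim (rule self_kernel_isCont[OF pot dx], auto)
    qed
    then show "(\<lambda>k. S.Q2 k \<phi> p t) \<longlonglongrightarrow> ?l2 t"
      unfolding S.Q2_def by (intro wconv_pair[OF fbm_empirical fbm_empirical a(2) a(2) a(1) a(1) km(1) kb(1)]) simp
  qed
  have 3: "(\<lambda>k. LINT t:{0<..<T}|lborel. S.Q3 k \<phi> p t) \<longlonglongrightarrow> (LINT t:{0<..<T}|lborel. ?l3 t)"
  proof (rule set_dominated_convergence[OF S.Q_measurable(3)[OF ctx] S.Q_bounds(3)[OF ctx]])
    fix t assume t: "t \<in> {0<..<T}"
    note a = alive[OF t p] and a' = alive[OF t mp]
    show "(\<lambda>k. S.Q3 k \<phi> p t) \<longlonglongrightarrow> ?l3 t"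
      unfolding S.Q3_def by (intro wconv_pair[OF fbm_empirical fbm_empirical a(2) a'(2) a(1) a'(1) km(2) kb(2)]) (simp add: cross_kernel_isCont[OF pot dx])
  qed
  have "(\<lambda>k. (LINT t:{0<..<T}|lborel. S.Q1 k \<phi> p t) - 1 / 2 * (LINT t:{0<..<T}|lborel. S.Q2 k \<phi> p t) - (LINT t:{0<..<T}|lborel. S.Q3 k \<phi> p t))
    \<longlonglongrightarrow> (LINT t:{0<..<T}|lborel. (\<integral>y. dt \<phi> t y \<partial>\<rho> t p)) - 1 / 2 * (LINT t:{0<..<T}|lborel. ?l2 t) - (LINT t:{0<..<T}|lborel. ?l3 t)"
    by (intro tendsto_diff tendsto_mult tendsto_const 1 2 3)
  then have lim: "(LINT t:{0<..<T}|lborel. (\<integral>y. dt \<phi> t y \<partial>\<rho> t p)) - 1 / 2 * (LINT t:{0<..<T}|lborel. ?l2 t) - (LINT t:{0<..<T}|lborel. ?l3 t) = 0"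
    unfolding S.discrete_weak_form[OF ctx] by (simp add: LIMSEQ_const_iff)
  have e2: "(LINT t:{0<..<T}|lborel. (\<integral>(y, z). (dx \<phi> t y - dx \<phi> t z) * dV V (y - z) \<partial>(kappa_part (\<rho> t) p \<Otimes>\<^sub>M kappa_part (\<rho> t) p))) = (LINT t:{0<..<T}|lborel. ?l2 t)"
  proof (rule set_lebesgue_integral_cong)
    show "\<forall>t. t \<in> {0<..<T} \<longrightarrow> (\<integral>(y, z). (dx \<phi> t y - dx \<phi> t z) * dV V (y - z) \<partial>(kappa_part (\<rho> t) p \<Otimes>\<^sub>M kappa_part (\<rho> t) p)) = ?l2 t"
    proof (intro allI impI)
      fix t assume t: "t \<in> {0<..<T}"
      have "(\<integral>(y, z). (dx \<phi> t y - dx \<phi> t z) * dV V (y - z) \<partial>(kappa_part (\<rho> t) p \<Otimes>\<^sub>M kappa_part (\<rho> t) p)) =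
          (\<integral>w. self_kernel V (dx \<phi> t) w \<partial>(kappa_part (\<rho> t) p \<Otimes>\<^sub>M kappa_part (\<rho> t) p))"
        by (simp add: self_kernel_def case_prod_beta')
      also have "\<dots> = ?l2 t" by (rule fbm_pair_integral[OF km(1) kb(1) alive(2)[OF t p] alive(2)[OF t p]])
      finally show "(\<integral>(y, z). (dx \<phi> t y - dx \<phi> t z) * dV V (y - z) \<partial>(kappa_part (\<rho> t) p \<Otimes>\<^sub>M kappa_part (\<rho> t) p)) = ?l2 t" .
    qed
  qed simp
  have e3: "(\<integral>y. dx \<phi> t y * (\<integral>z. deriv W (y - z) \<partial>kappa_part (\<rho> t) (- p)) \<partial>kappa_part (\<rho> t) p) = ?l3 t" for t
    by (simp add: cross_kernel_def)
  show ?thesis unfolding e2 e3 using lim by simp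
qed

section \<open>The limit curve\<close>

lemma sum_signs:
  fixes f :: "nat \<Rightarrow> real"
  assumes "\<And>i. i \<in> {1..n} \<Longrightarrow> c i \<in> {-1, 1 :: int}"
  shows "(\<Sum>i | i \<in> {1..n} \<and> c i = 1. f i) + (\<Sum>i | i \<in> {1..n} \<and> c i = -1. f i) = (\<Sum>i=1..n. f i)"
proof -
  let ?P = "{i. i \<in> {1..n} \<and> c i = 1}" and ?M = "{i. i \<in> {1..n} \<and> c i = -1}"
  have "{1..n} = ?P \<union> ?M" using assms by blast
  then have "sum f {1..n} = sum f (?P \<union> ?M)" by (rule arg_cong)
  also have "\<dots> = sum f ?P + sum f ?M" by (rule sum.union_disjoint) auto
  finally show ?thesis by simp
qed

lemma empirical_P2:
  assumes n: "n \<ge> 1" and c: "\<And>i. i \<in> {1..n} \<Longrightarrow> c i \<in> {-1, 1}"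
  shows "empirical n y c \<in> P2"
proof -
  have "(\<integral>\<^sup>+x. ennreal (x\<^sup>2) \<partial>empirical n y c p) < \<infinity>" for p
    by (subst nn_integral_empirical) (simp_all add: sum_ennreal ennreal_mult[symmetric] sum_nonneg)
  moreover have "measure (empirical n y c 1) UNIV + measure (empirical n y c (-1)) UNIV = 1"
    using sum_signs[OF c, where f="\<lambda>_. 1"] n by (simp add: measure_empirical add_divide_distrib[symmetric])
  then have "emeasure (empirical n y c 1) UNIV + emeasure (empirical n y c (-1)) UNIV = 1"
    by (simp add: fbmD(5)[OF fbm_empirical] ennreal_plus[symmetric] del: ennreal_plus)
  ultimately show ?thesis using fbmD(2)[OF fbm_empirical] by (simp add: P2_def)
qed

lemma Wass_empirical_le:
  assumes n: "n \<ge> 1" and c: "\<And>i. i \<in> {1..n} \<Longrightarrow> c i \<in> {-1, 1}"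
  shows "Wass (empirical n y c) (empirical n z c) \<le> sqrt ((1 / real n) * (\<Sum>i=1..n. (y i - z i)\<^sup>2))"
  by (rule Wass_le[OF empirical_P2[OF n c] empirical_P2[OF n c] _ qcost_empirical_sum[OF order_refl]])
    (auto simp: measure_empirical sum_nonneg)

text \<open>Parity of the level encodes the sign, and monotonicity of \<open>a\<close> sorts the
  intervals as the particles are sorted. Only the levels enter the rest of the argument.\<close>

lemma block_levels:
  fixes a :: "nat \<Rightarrow> real" and n :: nat
  assumes c: "\<And>i. i \<in> {1..n} \<Longrightarrow> c i \<in> {-1, 1 :: int}" and y: "strict_mono_on {1..n} y"
    and a: "\<forall>l<2 * L. a l \<le> a (Suc l)"
    and pos: "{y i | i. i \<in> {1..n} \<and> c i = 1} \<subseteq> (\<Union>l\<in>{1..L}. {a (2 * l - 2)<..<a (2 * l - 1)})"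
    and neg: "{y i | i. i \<in> {1..n} \<and> c i = -1} \<subseteq> (\<Union>l\<in>{1..L}. {a (2 * l - 1)<..<a (2 * l)})"
  shows "\<exists>lev. (\<forall>i\<in>{1..n}. lev i \<in> {1..2 * L} \<and> c i = (if odd (lev i) then 1 else -1)) \<and>
    (\<forall>i\<in>{1..n}. \<forall>j\<in>{1..n}. i \<le> j \<longrightarrow> lev i \<le> lev j)"
proof -
  have am: "l \<le> m \<Longrightarrow> m \<le> 2 * L \<Longrightarrow> a l \<le> a m" for l m
  proof (induction m rule: dec_induct)
    case (step m)
    then have "a m \<le> a (Suc m)" using a by simp
    then show ?case using step by simp
  qed simp
  have "\<exists>l\<in>{1..2 * L}. c i = (if odd l then 1 else -1) \<and> a (l - 1) < y i \<and> y i < a l" if i: "i \<in> {1..n}" for i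
  proof (cases "c i = 1")
    case True
    then obtain l where l: "l \<in> {1..L}" "y i \<in> {a (2 * l - 2)<..<a (2 * l - 1)}" using pos i by blast
    have "2 * l - 1 \<in> {1..2 * L}" "2 * l - 1 - 1 = 2 * l - 2" "odd (2 * l - 1)" using l(1) by auto
    then show ?thesis using l(2) True by (intro bexI[of _ "2 * l - 1"]) auto
  next
    case False
    then have "c i = -1" using c[OF i] by auto
    then obtain l where l: "l \<in> {1..L}" "y i \<in> {a (2 * l - 1)<..<a (2 * l)}" using neg i by blast
    then show ?thesis using \<open>c i = -1\<close> by (intro bexI[of _ "2 * l"]) auto
  qed
  then obtain lev where lev: "\<And>i. i \<in> {1..n} \<Longrightarrow> lev i \<in> {1..2 * L} \<and> c i = (if odd (lev i) then 1 else -1) \<and> a (lev i - 1) < y i \<and> y i < a (lev i)"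
    by metis
  have "lev i \<le> lev j" if ij: "i \<in> {1..n}" "j \<in> {1..n}" "i \<le> j" for i j
  proof (rule ccontr)
    assume "\<not> lev i \<le> lev j"
    \<comment> \<open>The interval of level \<open>l\<close> begins at \<open>a (l - 1)\<close>, so
      one of smaller level ends before or where this one begins.\<close>
    then have "a (lev j) \<le> a (lev i - 1)" using lev[OF ij(1)] by (intro am) auto
    moreover have "y i \<le> y j" by (rule strict_mono_on_leD[OF y ij])
    ultimately show False using lev[OF ij(1)] lev[OF ij(2)] by linarith
  qed
  then show ?thesis using lev by (intro exI[of _ lev]) auto
qed

section \<open>Metric regularity of the discrete curves, and the initial energy\<close>

context annihilating_particles
begin

lemma empirical_AC: "(\<lambda>t. empirical n (x t) b0) \<in> AC_curves 2 T P2"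
  unfolding AC_curves_def
proof (intro CollectI conjI ballI exI[of _ speed] allI impI)
  show "empirical n (x t) b0 \<in> P2" for t by (rule empirical_P2[OF n_pos signs])
  show "0 \<le> speed r" for r by (rule speed_nonneg)
  show "set_borel_measurable lborel {0<..<T} speed"
    using speed_measurable by (simp add: set_borel_measurable_def)
  show "set_integrable lborel {0<..<T} (\<lambda>r. speed r powr 2)"
  proof (rule set_integrable_open_bounded)
    show "set_borel_measurable lborel {0<..<T} (\<lambda>r. speed r powr 2)"
      using speed_measurable by (simp add: set_borel_measurable_def)
    show "\<bar>speed t powr 2\<bar> \<le> Lx\<^sup>2" for t using speed_nonneg speed_le by (simp add: power_mono)
  qed
  fix s t assume st: "0 < s \<and> s \<le> t \<and> t < T"
  have "Wass (empirical n (x s) b0) (empirical n (x t) b0) \<le> sqrt ((1 / real n) * (\<Sum>i=1..n. (x s i - x t i)\<^sup>2))"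
    by (rule Wass_empirical_le[OF n_pos signs])
  also have "\<dots> \<le> (LINT r:{s..t}|lborel. speed r)"
    using displacement[of s t] st by (simp add: power2_commute)
  finally show "Wass (empirical n (x s) b0) (empirical n (x t) b0) \<le> (LINT r:{s..t}|lborel. speed r)" .
qed

text \<open>Initial positions are distinct, so \<open>V_ext\<close> does not take the value
  \<open>\<infinity>\<close> and the energy is real.\<close>

lemma energy_0:
  "energy V W n x0 b0 = ereal (1 / (2 * (real n)\<^sup>2) * (\<Sum>i=1..n. \<Sum>j=1..n.
     if i \<noteq> j then (if b0 i = b0 j then V (x0 i - x0 j) else W (x0 i - x0 j)) else 0))"
proof -
  have row: "(\<Sum>j\<in>{j\<in>{1..n}. j \<noteq> i \<and> b0 i * b0 j = 1}. V_ext V (x0 i - x0 j)) +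
        (\<Sum>j\<in>{j\<in>{1..n}. b0 i * b0 j = -1}. ereal (W (x0 i - x0 j))) =
      ereal (\<Sum>j=1..n. if i \<noteq> j then (if b0 i = b0 j then V (x0 i - x0 j) else W (x0 i - x0 j)) else 0)"
    if i: "i \<in> {1..n}" for i
  proof -
    have "(\<Sum>j\<in>{j\<in>{1..n}. j \<noteq> i \<and> b0 i * b0 j = 1}. V_ext V (x0 i - x0 j)) =
        (\<Sum>j\<in>{j\<in>{1..n}. j \<noteq> i \<and> b0 i * b0 j = 1}. ereal (V (x0 i - x0 j)))"
    proof (rule sum.cong[OF refl])
      fix j assume j: "j \<in> {j\<in>{1..n}. j \<noteq> i \<and> b0 i * b0 j = 1}"
      then have "x0 i \<noteq> x0 j" using inj_onD[OF strict_mono_on_imp_inj_on[OF ordered], of i j] i by auto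
      then show "V_ext V (x0 i - x0 j) = ereal (V (x0 i - x0 j))" by (simp add: V_ext_def)
    qed
    moreover have "(\<Sum>j=1..n. if j \<noteq> i \<and> b0 i * b0 j = 1 then V (x0 i - x0 j) else 0) + (\<Sum>j=1..n. if b0 i * b0 j = -1 then W (x0 i - x0 j) else 0) =
        (\<Sum>j=1..n. if i \<noteq> j then (if b0 i = b0 j then V (x0 i - x0 j) else W (x0 i - x0 j)) else 0)"
      unfolding sum.distrib[symmetric]
    proof (rule sum.cong[OF refl])
      fix j assume "j \<in> {1..n}"
      then have "b0 i \<in> {-1, 1}" "b0 j \<in> {-1, 1}" using signs i by auto
      then show "(if j \<noteq> i \<and> b0 i * b0 j = 1 then V (x0 i - x0 j) else 0) + (if b0 i * b0 j = -1 then W (x0 i - x0 j) else 0) =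
          (if i \<noteq> j then (if b0 i = b0 j then V (x0 i - x0 j) else W (x0 i - x0 j)) else 0)"
        by (auto split: if_splits)
    qed
    ultimately show ?thesis
      by (simp only: sum_ereal plus_ereal.simps sum.inter_filter[OF finite_atLeastAtMost])
  qed
  show ?thesis
    unfolding energy_def times_ereal.simps(1)[symmetric]
    by (rule arg_cong2[where f="(*)"], rule refl, rule trans[OF sum.cong[OF refl row] sum_ereal])
qed

text \<open>The quadratic correction is reduced to second moments by
  \<open>(x - y)\<^sup>2 \<le> 2 * x\<^sup>2 + 2 * y\<^sup>2\<close>: its constant part leaves
  \<open>C / 2\<close>, its squares leave \<open>2 * C * m\<close>.\<close>

lemma G_0_le:
  assumes E: "energy V W n x0 b0 \<le> ereal E" and m: "(1 / real n) * (\<Sum>i=1..n. (x0 i)\<^sup>2) \<le> m"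
  shows "G 0 \<le> E + C / 2 + 2 * C * m"
proof -
  let ?u = "\<lambda>i j. if b0 i = b0 j then V (x0 i - x0 j) else W (x0 i - x0 j)"
  have n: "real n > 0" using n_pos by simp
  have "(\<Sum>j=1..n. C * (1 + 2 * (x0 i)\<^sup>2 + 2 * (x0 j)\<^sup>2)) = C * (real n + 2 * real n * (x0 i)\<^sup>2 + 2 * (\<Sum>j=1..n. (x0 j)\<^sup>2))" for i
    by (simp add: sum_distrib_left[symmetric] sum.distrib) (simp add: algebra_simps)
  then have quad: "(\<Sum>i=1..n. \<Sum>j=1..n. C * (1 + 2 * (x0 i)\<^sup>2 + 2 * (x0 j)\<^sup>2)) = C * (real n)\<^sup>2 + 4 * C * real n * (\<Sum>i=1..n. (x0 i)\<^sup>2)"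
    by (simp add: sum_distrib_left[symmetric] sum.distrib) (simp add: algebra_simps power2_eq_square)
  have "(\<Sum>i=1..n. \<Sum>j=1..n. if i \<noteq> j \<and> live 0 i \<and> live 0 j then pair_energy 0 i j else 0) \<le>
      (\<Sum>i=1..n. \<Sum>j=1..n. (if i \<noteq> j then ?u i j else 0) + C * (1 + 2 * (x0 i)\<^sup>2 + 2 * (x0 j)\<^sup>2))"
  proof (intro sum_mono)
    fix i j assume ij: "i \<in> {1..n}" "j \<in> {1..n}"
    have "(x0 i - x0 j)\<^sup>2 \<le> 2 * (x0 i)\<^sup>2 + 2 * (x0 j)\<^sup>2"
      using zero_le_power2[of "x0 i + x0 j"] by (simp add: power2_eq_square algebra_simps)
    then have "C * (1 + (x0 i - x0 j)\<^sup>2) \<le> C * (1 + 2 * (x0 i)\<^sup>2 + 2 * (x0 j)\<^sup>2)"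
      using C_nonneg by (intro mult_left_mono) auto
    moreover have "0 \<le> C * (1 + 2 * (x0 i)\<^sup>2 + 2 * (x0 j)\<^sup>2)" using C_nonneg by simp
    ultimately show "(if i \<noteq> j \<and> live 0 i \<and> live 0 j then pair_energy 0 i j else 0) \<le>
        (if i \<noteq> j then ?u i j else 0) + C * (1 + 2 * (x0 i)\<^sup>2 + 2 * (x0 j)\<^sup>2)"
      using live_0[OF ij(1)] live_0[OF ij(2)] init[OF ij(1)] init[OF ij(2)] by (auto simp: pair_energy_def)
  qed
  also have "\<dots> = (\<Sum>i=1..n. \<Sum>j=1..n. if i \<noteq> j then ?u i j else 0) + (C * (real n)\<^sup>2 + 4 * C * real n * (\<Sum>i=1..n. (x0 i)\<^sup>2))"
    unfolding sum.distrib quad ..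
  finally have "G 0 \<le> 1 / (2 * (real n)\<^sup>2) * ((\<Sum>i=1..n. \<Sum>j=1..n. if i \<noteq> j then ?u i j else 0) + (C * (real n)\<^sup>2 + 4 * C * real n * (\<Sum>i=1..n. (x0 i)\<^sup>2)))"
    unfolding G_def by (intro mult_left_mono) auto
  also have "\<dots> = 1 / (2 * (real n)\<^sup>2) * (\<Sum>i=1..n. \<Sum>j=1..n. if i \<noteq> j then ?u i j else 0) + C / 2 + 2 * C * ((1 / real n) * (\<Sum>i=1..n. (x0 i)\<^sup>2))"
    using n by (simp add: field_simps power2_eq_square)
  also have "\<dots> \<le> E + C / 2 + 2 * C * m"
    using E[unfolded energy_0 ereal_less_eq(3)] m C_nonneg by (intro add_mono mult_left_mono) auto
  finally show ?thesis .
qed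

end

context particle_sequence
begin

lemma subsequence:
  assumes r: "strict_mono r"
  shows "particle_sequence V W T C A B L (\<lambda>k. N (r k)) (\<lambda>k. x0 (r k)) (\<lambda>k. b0 (r k)) (\<lambda>k. x (r k)) (\<lambda>k. b (r k))
    (\<lambda>k. \<tau> (r k)) (\<lambda>k. Lx (r k)) (\<lambda>k. lev (r k))"
proof
  show "filterlim (\<lambda>k. N (r k)) at_top sequentially"
    by (rule filterlim_compose[OF N_lim filterlim_subseq[OF r]])
qed (use sys energy moment lev_range lev_sign lev_mono in auto)

section \<open>Properties of the limit curve, given convergence of the measures and a bound on the
  limit speeds\<close>

context
  fixes \<rho> :: "real \<Rightarrow> signed_pair" and g :: "real \<Rightarrow> real"
  assumes \<rho>: "\<And>t p. t \<in> {0..T} \<Longrightarrow> p \<in> {-1, 1} \<Longrightarrow> fbm (\<rho> t p)"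
    and w: "\<And>t p. t \<in> {0..T} \<Longrightarrow> p \<in> {-1, 1} \<Longrightarrow> wconv (\<lambda>k. empirical (N k) (x k t) (b0 k) p) (\<rho> t p)"
    and g: "g \<in> borel_measurable borel" "\<And>t. 0 \<le> g t" "set_integrable lborel {0..T} g"
    and speed_lim: "\<And>s t D. 0 \<le> s \<Longrightarrow> s \<le> t \<Longrightarrow> t \<le> T \<Longrightarrow> (LINT u:{s..t}|lborel. g u) < D \<Longrightarrow>
       \<forall>\<^sub>F k in sequentially. (LINT u:{s..t}|lborel. S.speed k u) < D"
begin

lemma limit_P2:
  assumes t: "t \<in> {0..T}"
  shows "\<rho> t \<in> P2"
proof -
  have mom: "(\<integral>\<^sup>+x. ennreal (x\<^sup>2) \<partial>\<rho> t p) \<le> ennreal B" if p: "p \<in> {-1, 1}" for p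
    by (rule wconv_moment[OF fbm_empirical \<rho>[OF t p] w[OF t p] B_nonneg moment_empirical[OF t]])
  have fin: "(\<integral>\<^sup>+x. ennreal (x\<^sup>2) \<partial>\<rho> t p) < \<infinity>" if "p \<in> {-1, 1}" for p
    using le_less_trans[OF mom[OF that] ennreal_less_top] by simp
  have "(\<lambda>k. measure (empirical (N k) (x k t) (b0 k) p) UNIV) \<longlonglongrightarrow> measure (\<rho> t p) UNIV" if p: "p \<in> {-1, 1}" for p
    by (rule wconv_mass[OF w[OF t p] fbm_empirical \<rho>[OF t p]])
  then have "(\<lambda>k. measure (empirical (N k) (x k t) (b0 k) 1) UNIV + measure (empirical (N k) (x k t) (b0 k) (-1)) UNIV)
      \<longlonglongrightarrow> measure (\<rho> t 1) UNIV + measure (\<rho> t (-1)) UNIV"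
    by (intro tendsto_add) auto
  moreover have "measure (empirical (N k) (x k t) (b0 k) 1) UNIV + measure (empirical (N k) (x k t) (b0 k) (-1)) UNIV = 1" for k
    by (rule P2D(3)[where p=1, OF empirical_P2[OF S.n_pos S.signs]]) simp_all
  ultimately have "measure (\<rho> t 1) UNIV + measure (\<rho> t (-1)) UNIV = 1" by (simp add: LIMSEQ_const_iff)
  then have "emeasure (\<rho> t 1) UNIV + emeasure (\<rho> t (-1)) UNIV = 1"
    using fbmD(5)[OF \<rho>[OF t], of 1] fbmD(5)[OF \<rho>[OF t], of "-1"] by (simp add: ennreal_plus[symmetric] del: ennreal_plus)
  then show ?thesis using fin fbmD(2)[OF \<rho>[OF t]] by (simp add: P2_def)
qed

lemma limit_mass:
  assumes t: "t \<in> {0..T}"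
  shows "measure (\<rho> t 1) UNIV = measure (\<rho> 0 1) UNIV"
proof -
  have *: "(\<lambda>k. measure (empirical (N k) (x k s) (b0 k) 1) UNIV) \<longlonglongrightarrow> measure (\<rho> s 1) UNIV" if "s \<in> {0..T}" for s
    using that by (intro wconv_mass w fbm_empirical \<rho>) auto
  have "0 \<in> {0..T}" using t by auto
  from LIMSEQ_unique[OF *[OF t, unfolded measure_empirical] *[OF this, unfolded measure_empirical]] show ?thesis .
qed

text \<open>For any \<open>D\<close> above the integral of \<open>g\<close> the root mean square
  displacement is eventually at most \<open>D\<close>; then \<open>D\<close> decreases to the
  integral. Both orders of the arguments are recorded, as absolute continuity and continuity at 0
  use different ones.\<close>

lemma limit_Wass:
  assumes st: "0 \<le> s" "s \<le> t" "t \<le> T"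
  shows "Wass (\<rho> s) (\<rho> t) \<le> (LINT u:{s..t}|lborel. g u)" "Wass (\<rho> t) (\<rho> s) \<le> (LINT u:{s..t}|lborel. g u)"
proof -
  let ?I = "LINT u:{s..t}|lborel. g u"
  have st': "s \<in> {0..T}" "t \<in> {0..T}" using st by auto
  have I0: "0 \<le> ?I" using g(2) by (simp add: set_lebesgue_integral_def integral_nonneg_AE)
  have le: "\<forall>\<^sub>F k in sequentially. (1 / real (N k)) * (\<Sum>i=1..N k. (x k t i - x k s i)\<^sup>2) \<le> D\<^sup>2" if D: "?I < D" for D
    using speed_lim[OF st D]
  proof eventually_elim
    case (elim k)
    have "sqrt ((1 / real (N k)) * (\<Sum>i=1..N k. (x k t i - x k s i)\<^sup>2)) \<le> D"
      using S.displacement[OF st, of k] elim by linarith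
    then show ?case by (rule sqrt_le_D)
  qed
  have "Wass (\<rho> t) (\<rho> s) \<le> D \<and> Wass (\<rho> s) (\<rho> t) \<le> D" if D: "?I < D" for D
  proof -
    have D': "sqrt (D\<^sup>2) = D" using I0 D by simp
    have le': "\<forall>\<^sub>F k in sequentially. (1 / real (N k)) * (\<Sum>i=1..N k. (x k s i - x k t i)\<^sup>2) \<le> D\<^sup>2"
      using le[OF D] by (simp only: power2_commute)
    have "Wass (\<rho> t) (\<rho> s) \<le> sqrt (D\<^sup>2)"
      by (rule Wass_limit_le[OF limit_P2[OF st'(2)] limit_P2[OF st'(1)] w[OF st'(2)] w[OF st'(1)] le[OF D] zero_le_power2])
    moreover have "Wass (\<rho> s) (\<rho> t) \<le> sqrt (D\<^sup>2)"
      by (rule Wass_limit_le[OF limit_P2[OF st'(1)] limit_P2[OF st'(2)] w[OF st'(1)] w[OF st'(2)] le' zero_le_power2])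
    ultimately show ?thesis using D' by simp
  qed
  then show "Wass (\<rho> s) (\<rho> t) \<le> ?I" "Wass (\<rho> t) (\<rho> s) \<le> ?I" by (auto intro: dense_ge)
qed

lemma limit_continuous_at_0: "((\<lambda>t. Wass (\<rho> t) (\<rho> 0)) \<longlongrightarrow> 0) (at_right 0)"
proof (rule tendsto_sandwich)
  have ev: "\<forall>\<^sub>F t in at_right 0. t \<in> {0<..<T}" by (rule eventually_at_right_real[OF S.T_pos])
  show "\<forall>\<^sub>F t in at_right 0. 0 \<le> Wass (\<rho> t) (\<rho> 0)" by (simp add: Wass_def)
  show "\<forall>\<^sub>F t in at_right 0. Wass (\<rho> t) (\<rho> 0) \<le> integral {0..t} g"
    using ev
  proof eventually_elim
    case (elim t)
    have "set_integrable lborel {0..t} g" by (rule set_integrable_subset[OF g(3)]) (use elim in auto)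
    then show ?case using limit_Wass(2)[of 0 t] elim set_borel_integral_eq_integral(2) by fastforce
  qed
  have "((\<lambda>t. integral {0..t} g) \<longlongrightarrow> integral {0..0} g) (at 0 within {0..T})"
    by (rule bspec[OF indefinite_integral_facts(1)[OF g(3), unfolded continuous_on_def]]) (use S.T_pos in simp)
  then show "((\<lambda>t. integral {0..t} g) \<longlongrightarrow> 0) (at_right 0)"
    using S.T_pos by (simp add: at_within_Icc_at_right)
qed simp

lemma limit_AC: "\<rho> \<in> AC_curves 1 T (P2m (measure (\<rho> 0 1) UNIV))"
  unfolding AC_curves_def
proof (intro CollectI conjI ballI exI[of _ g] allI impI)
  show "\<rho> t \<in> P2m (measure (\<rho> 0 1) UNIV)" if "t \<in> {0<..<T}" for t
    using that limit_P2[of t] limit_mass[of t] by (simp add: P2m_def)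
  show "set_borel_measurable lborel {0<..<T} g" using g(1) by (simp add: set_borel_measurable_def)
  show "set_integrable lborel {0<..<T} (\<lambda>r. g r powr 1)"
    using g(2) set_integrable_subset[OF g(3), of "{0<..<T}"] by (simp add: powr_one' subset_eq)
  show "Wass (\<rho> s) (\<rho> t) \<le> (LINT r:{s..t}|lborel. g r)" if "0 < s \<and> s \<le> t \<and> t < T" for s t
    using that by (intro limit_Wass) auto
qed (rule g(2))

lemma limit_weak_solution: "weak_solution V W T (\<rho> 0) \<rho>"
  unfolding weak_solution_def
proof (intro conjI ballI)
  show "\<rho> 0 \<in> P2" using S.T_pos by (intro limit_P2) auto
qed (rule limit_AC limit_continuous_at_0 limit_weak_form[OF \<rho> w]; assumption?)+

end

text \<open>Three successive extractions: one for each sign of the measures and one for the speeds,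
  whose limit \<open>g\<close> bounds the metric speed of the limit curve.\<close>

theorem convergent_subsequence:
  "\<exists>r \<rho>. strict_mono r \<and> (\<forall>t\<in>{0..T}. \<rho> t \<in> P2) \<and>
     (\<forall>p\<in>{-1, 1}. \<forall>\<phi> :: real \<Rightarrow> real. continuous_on UNIV \<phi> \<and> bounded (range \<phi>) \<longrightarrow>
       (\<lambda>k. SUP t\<in>{0..T}. \<bar>(\<integral>y. \<phi> y \<partial>empirical (N (r k)) (x (r k) t) (b0 (r k)) p) - (\<integral>y. \<phi> y \<partial>\<rho> t p)\<bar>) \<longlonglongrightarrow> 0) \<and>
     weak_solution V W T (\<rho> 0) \<rho> \<and>
     (\<forall>p\<in>{-1, 1}. wconv (\<lambda>k. empirical (N (r k)) (x (r k) 0) (b0 (r k)) p) (\<rho> 0 p))"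
proof -
  let ?\<mu> = "\<lambda>p k t. empirical (N k) (x k t) (b0 k) p"
  have "\<exists>r \<rho>. strict_mono r \<and> (\<forall>t\<in>{0..T}. fbm (\<rho> t) \<and> wconv (\<lambda>k. ?\<mu> 1 (r k) t) (\<rho> t))"
    by (rule curve_compactness[OF S.T_pos fbm_empirical mass_empirical_le moment_empirical equicontinuous])
  then obtain r1 \<rho>1 where r1: "strict_mono r1" and 1: "\<forall>t\<in>{0..T}. fbm (\<rho>1 t) \<and> wconv (\<lambda>k. ?\<mu> 1 (r1 k) t) (\<rho>1 t)"
    by (elim exE conjE) (rule that)
  have "\<exists>r \<rho>. strict_mono r \<and> (\<forall>t\<in>{0..T}. fbm (\<rho> t) \<and> wconv (\<lambda>k. ?\<mu> (-1) (r1 (r k)) t) (\<rho> t))"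
    by (rule curve_compactness[OF S.T_pos fbm_empirical mass_empirical_le moment_empirical equicontinuous])
  then obtain r2 \<rho>2 where r2: "strict_mono r2" and 2: "\<forall>t\<in>{0..T}. fbm (\<rho>2 t) \<and> wconv (\<lambda>k. ?\<mu> (-1) (r1 (r2 k)) t) (\<rho>2 t)"
    by (elim exE conjE) (rule that)
  obtain r3 g where r3: "strict_mono r3" and g: "g \<in> borel_measurable borel" "\<forall>t. 0 \<le> g t" "set_integrable lborel {0..T} g"
    "\<forall>s t D. 0 \<le> s \<longrightarrow> s \<le> t \<longrightarrow> t \<le> T \<longrightarrow> (LINT u:{s..t}|lborel. g u) < D \<longrightarrow>
       (\<forall>\<^sub>F k in sequentially. (LINT u:{s..t}|lborel. S.speed (r1 (r2 (r3 k))) u) < D)"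
    using velocity_compactness[of T "\<lambda>k. S.speed (r1 (r2 k))" "\<lambda>k. Lx (r1 (r2 k))" A,
        OF S.T_pos S.speed_measurable S.speed_nonneg S.speed_le order_trans[OF S.dissipation energy]]
    by (elim exE conjE) (rule that)
  define r where "r k = r1 (r2 (r3 k))" for k
  define \<rho> where "\<rho> t p = (if p = 1 then \<rho>1 t else \<rho>2 t)" for t and p :: int
  have r: "strict_mono r" using r1 r2 r3 by (simp add: strict_mono_def r_def)
  have fb: "fbm (\<rho> t p)" if "t \<in> {0..T}" "p \<in> {-1, 1}" for t p
    using that 1 2 by (auto simp: \<rho>_def)
  have w: "wconv (\<lambda>k. ?\<mu> p (r k) t) (\<rho> t p)" if t: "t \<in> {0..T}" and p: "p \<in> {-1, 1}" for t p
  proof (cases "p = 1")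
    case True
    have "strict_mono (\<lambda>k. r2 (r3 k))" using r2 r3 by (simp add: strict_mono_def)
    from wconv_subseq[OF _ this, of "\<lambda>k. ?\<mu> 1 (r1 k) t"] 1 t True show ?thesis by (simp add: r_def \<rho>_def)
  next
    case False
    then have "p = -1" using p by simp
    with wconv_subseq[OF _ r3, of "\<lambda>k. ?\<mu> (-1) (r1 (r2 k)) t"] 2 t show ?thesis by (simp add: r_def \<rho>_def)
  qed
  interpret R: particle_sequence V W T C A B L "\<lambda>k. N (r k)" "\<lambda>k. x0 (r k)" "\<lambda>k. b0 (r k)" "\<lambda>k. x (r k)" "\<lambda>k. b (r k)"
    "\<lambda>k. \<tau> (r k)" "\<lambda>k. Lx (r k)" "\<lambda>k. lev (r k)"
    by (rule subsequence[OF r])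
  note lim = fb w g(1) g(2)[rule_format] g(3) g(4)[rule_format, folded r_def]
  show ?thesis
  proof (intro exI[of _ r] exI[of _ \<rho>] conjI ballI allI impI)
    show "\<rho> t \<in> P2" if "t \<in> {0..T}" for t by (rule R.limit_P2[OF lim that])
    show "weak_solution V W T (\<rho> 0) \<rho>" by (rule R.limit_weak_solution[OF lim])
    show "wconv (\<lambda>k. ?\<mu> p (r k) 0) (\<rho> 0 p)" if "p \<in> {-1, 1}" for p
      using that S.T_pos by (intro w) auto
    show "(\<lambda>k. SUP t\<in>{0..T}. \<bar>(\<integral>y. \<phi> y \<partial>?\<mu> p (r k) t) - (\<integral>y. \<phi> y \<partial>\<rho> t p)\<bar>) \<longlonglongrightarrow> 0"
      if p: "p \<in> {-1, 1}" and \<phi>: "continuous_on UNIV \<phi> \<and> bounded (range \<phi>)" for p and \<phi> :: "real \<Rightarrow> real"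
      by (rule uniform_wconv[OF S.T_pos fbm_empirical mass_empirical_le R.moment_empirical R.B_nonneg R.equicontinuous fb[OF _ p] w[OF _ p]
            conjunct1[OF \<phi>] conjunct2[OF \<phi>]])
  qed (rule r)
qed

end

lemma empirical_cong:
  assumes "\<And>i. i \<in> {1..n} \<Longrightarrow> y i = z i"
  shows "empirical n y c p = empirical n z c p"
  unfolding empirical_def using assms by (intro distr_cong) (auto simp: space_point_measure)

text \<open>From \<open>u\<^sup>2 \<le> 1 + u ^ 4\<close>; second moments are what the energy
  correction and tightness use.\<close>

lemma second_moment_of_fourth:
  assumes n: "n \<ge> 1" and c: "\<And>i. i \<in> {1..n} \<Longrightarrow> c i \<in> {-1, 1}" and M: "M \<ge> 0"
    and m4: "(\<integral>\<^sup>+ y. ennreal (y ^ 4) \<partial>empirical n z c 1) + (\<integral>\<^sup>+ y. ennreal (y ^ 4) \<partial>empirical n z c (-1)) \<le> ennreal M"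
  shows "(1 / real n) * (\<Sum>i=1..n. (z i)\<^sup>2) \<le> 1 + M"
proof -
  have e: "(\<integral>\<^sup>+ y. ennreal (y ^ 4) \<partial>empirical n z c p) = ennreal ((1 / real n) * (\<Sum>i | i \<in> {1..n} \<and> c i = p. z i ^ 4))" for p
    by (subst nn_integral_empirical) (simp_all add: sum_ennreal ennreal_mult[symmetric] sum_nonneg)
  have "ennreal ((1 / real n) * ((\<Sum>i | i \<in> {1..n} \<and> c i = 1. z i ^ 4) + (\<Sum>i | i \<in> {1..n} \<and> c i = -1. z i ^ 4))) \<le> ennreal M"
    using m4 unfolding e distrib_left by (subst ennreal_plus) (auto simp: sum_nonneg)
  moreover have "(\<Sum>i | i \<in> {1..n} \<and> c i = 1. z i ^ 4) + (\<Sum>i | i \<in> {1..n} \<and> c i = -1. z i ^ 4) = (\<Sum>i=1..n. z i ^ 4)"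
    by (rule sum_signs[OF c])
  ultimately have m: "(1 / real n) * (\<Sum>i=1..n. z i ^ 4) \<le> M" using ennreal_le_iff[OF M] by (simp only:)
  have sq: "v \<le> 1 + v\<^sup>2" for v :: real
    using zero_le_power2[of "v - 1 / 2"] by (simp add: power2_eq_square algebra_simps)
  have "u\<^sup>2 \<le> 1 + u ^ 4" for u :: real using sq[of "u\<^sup>2"] by (simp add: power_mult[symmetric])
  then have "(1 / real n) * (\<Sum>i=1..n. (z i)\<^sup>2) \<le> (1 / real n) * (\<Sum>i=1..n. 1 + z i ^ 4)"
    by (intro mult_left_mono sum_mono) auto
  also have "\<dots> = 1 + (1 / real n) * (\<Sum>i=1..n. z i ^ 4)" using n by (simp add: sum.distrib distrib_left add_divide_distrib)
  finally show ?thesis using m by linarith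
qed

theorem theorem5p1:
  fixes V W :: "real \<Rightarrow> real"
    and x0 :: "nat \<Rightarrow> nat \<Rightarrow> real" and b0 :: "nat \<Rightarrow> nat \<Rightarrow> int"
    and x :: "nat \<Rightarrow> real \<Rightarrow> nat \<Rightarrow> real" and b :: "nat \<Rightarrow> real \<Rightarrow> nat \<Rightarrow> int"
    and T :: real
  assumes potentials: "standing_assumptions V W"
    and signs: "\<forall>n\<ge>2. \<forall>i\<in>{1..n}. b0 n i \<in> {-1, 1}"
    and ordered: "\<forall>n\<ge>2. strict_mono_on {1..n} (x0 n)"
    and energy_bound: "\<exists>C::real. \<forall>n\<ge>2. \<bar>energy V W n (x0 n) (b0 n)\<bar> \<le> ereal C"
    and fourth_moments:
      "(SUP n\<in>{2..}. (\<integral>\<^sup>+ y. ennreal (y ^ 4) \<partial>empirical n (x0 n) (b0 n) 1) +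
                     (\<integral>\<^sup>+ y. ennreal (y ^ 4) \<partial>empirical n (x0 n) (b0 n) (-1))) < \<infinity>"
    and separation:
      "\<exists>L::nat. \<forall>n\<ge>2. \<exists>a :: nat \<Rightarrow> real.
         (\<forall>l<2 * L. a l \<le> a (Suc l)) \<and>
         {x0 n i | i. i \<in> {1..n} \<and> b0 n i = 1} \<subseteq> (\<Union>l\<in>{1..L}. {a (2 * l - 2)<..<a (2 * l - 1)}) \<and>
         {x0 n i | i. i \<in> {1..n} \<and> b0 n i = -1} \<subseteq> (\<Union>l\<in>{1..L}. {a (2 * l - 1)<..<a (2 * l)})"
    and T_pos: "T > 0"
    and solutions: "\<forall>n\<ge>2. discrete_solution V W n T (x0 n) (b0 n) (x n) (b n)"
  shows "(\<forall>n\<ge>2. (\<lambda>t. empirical n (x n t) (b0 n)) \<in> AC_curves 2 T P2) \<and>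
    (\<exists>(r :: nat \<Rightarrow> nat) (\<rho> :: real \<Rightarrow> signed_pair) (\<rho>0 :: signed_pair).
       strict_mono r \<and> (\<forall>k. 2 \<le> r k) \<and>
       (\<forall>t\<in>{0..T}. \<rho> t \<in> P2) \<and>
       (\<forall>p\<in>{-1, 1}. \<forall>\<phi> :: real \<Rightarrow> real. continuous_on UNIV \<phi> \<and> bounded (range \<phi>) \<longrightarrow>
          (\<lambda>k. SUP t\<in>{0..T}. \<bar>(\<integral>y. \<phi> y \<partial>empirical (r k) (x (r k) t) (b0 (r k)) p) - (\<integral>y. \<phi> y \<partial>\<rho> t p)\<bar>)
            \<longlonglongrightarrow> 0) \<and>
       weak_solution V W T \<rho>0 \<rho> \<and> \<rho> 0 = \<rho>0 \<and>
       (\<forall>p\<in>{-1, 1}. \<forall>\<phi> :: real \<Rightarrow> real. continuous_on UNIV \<phi> \<and> bounded (range \<phi>) \<longrightarrow>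
          (\<lambda>k. \<integral>y. \<phi> y \<partial>empirical (r k) (x0 (r k)) (b0 (r k)) p) \<longlonglongrightarrow> (\<integral>y. \<phi> y \<partial>\<rho>0 p)))"
proof -
  obtain C where C0: "C \<ge> 0" and C1: "\<forall>r. \<bar>r * dV V r\<bar> \<le> C \<and> \<bar>r * deriv W r\<bar> \<le> C \<and> \<bar>deriv W r\<bar> \<le> C \<and>
    (r \<noteq> 0 \<longrightarrow> 0 \<le> V r + C * (1 + r\<^sup>2)) \<and> 0 \<le> W r + C * (1 + r\<^sup>2)"
    using potential_bounds[OF potentials] by (elim exE conjE) (rule that)
  \<comment> \<open>Death times and Lipschitz constant are packed into one pair, so that a single
    choice selects both for every \<open>n\<close>.\<close>
  have "\<forall>n\<in>{2..}. \<exists>q. annihilating_particles V W n T (x0 n) (b0 n) (x n) (b n) (fst q) (snd q) C"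
  proof
    fix n :: nat assume n: "n \<in> {2..}"
    have "\<exists>\<tau> Lx. annihilating_particles V W n T (x0 n) (b0 n) (x n) (b n) \<tau> Lx C"
      by (rule annihilating_particlesI[OF _ T_pos _ _ potentials C0]) (use n signs ordered solutions C1 in auto)
    then show "\<exists>q. annihilating_particles V W n T (x0 n) (b0 n) (x n) (b n) (fst q) (snd q) C" by auto
  qed
  then obtain q where q: "\<forall>n\<in>{2..}. annihilating_particles V W n T (x0 n) (b0 n) (x n) (b n) (fst (q n)) (snd (q n)) C"
    by (rule bchoice[THEN exE])
  define S where "S = (SUP n\<in>{2..}. (\<integral>\<^sup>+ y. ennreal (y ^ 4) \<partial>empirical n (x0 n) (b0 n) 1) + (\<integral>\<^sup>+ y. ennreal (y ^ 4) \<partial>empirical n (x0 n) (b0 n) (-1)))"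
  define M where "M = enn2real S"
  have M: "M \<ge> 0" "S = ennreal M" using fourth_moments by (simp_all add: M_def S_def)
  have m2: "(1 / real n) * (\<Sum>i=1..n. (x0 n i)\<^sup>2) \<le> 1 + M" if n: "n \<ge> 2" for n
  proof (rule second_moment_of_fourth[OF _ _ M(1)])
    show "(\<integral>\<^sup>+ y. ennreal (y ^ 4) \<partial>empirical n (x0 n) (b0 n) 1) + (\<integral>\<^sup>+ y. ennreal (y ^ 4) \<partial>empirical n (x0 n) (b0 n) (-1)) \<le> ennreal M"
      unfolding M(2)[symmetric] S_def by (rule SUP_upper) (use n in simp)
  qed (use n signs in auto)
  obtain E where E: "\<And>n. n \<ge> 2 \<Longrightarrow> \<bar>energy V W n (x0 n) (b0 n)\<bar> \<le> ereal E" using energy_bound by auto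
  have "e \<le> \<bar>e\<bar>" for e :: ereal by (cases e) auto
  note E' = order_trans[OF this E]
  have G: "annihilating_particles.G V W n (b0 n) (x n) (fst (q n)) C 0 \<le> E + C / 2 + 2 * C * (1 + M)" if n: "n \<ge> 2" for n
  proof -
    interpret annihilating_particles V W n T "x0 n" "b0 n" "x n" "b n" "fst (q n)" "snd (q n)" C using q n by simp
    show ?thesis by (rule G_0_le[OF E'[OF n] m2[OF n]])
  qed
  obtain L where sep: "\<forall>n\<ge>2. \<exists>a :: nat \<Rightarrow> real. (\<forall>l<2 * L. a l \<le> a (Suc l)) \<and>
         {x0 n i | i. i \<in> {1..n} \<and> b0 n i = 1} \<subseteq> (\<Union>l\<in>{1..L}. {a (2 * l - 2)<..<a (2 * l - 1)}) \<and>
         {x0 n i | i. i \<in> {1..n} \<and> b0 n i = -1} \<subseteq> (\<Union>l\<in>{1..L}. {a (2 * l - 1)<..<a (2 * l)})"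
    using separation by (rule exE)
  have "\<forall>n\<in>{2..}. \<exists>lev. (\<forall>i\<in>{1..n}. lev i \<in> {1..2 * L} \<and> b0 n i = (if odd (lev i) then 1 else -1)) \<and>
    (\<forall>i\<in>{1..n}. \<forall>j\<in>{1..n}. i \<le> j \<longrightarrow> lev i \<le> lev j)"
  proof
    fix n :: nat assume n: "n \<in> {2..}"
    then have "n \<ge> 2" by simp
    from sep[rule_format, OF this] obtain a :: "nat \<Rightarrow> real" where a: "\<forall>l<2 * L. a l \<le> a (Suc l)"
      "{x0 n i | i. i \<in> {1..n} \<and> b0 n i = 1} \<subseteq> (\<Union>l\<in>{1..L}. {a (2 * l - 2)<..<a (2 * l - 1)})"
      "{x0 n i | i. i \<in> {1..n} \<and> b0 n i = -1} \<subseteq> (\<Union>l\<in>{1..L}. {a (2 * l - 1)<..<a (2 * l)})"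
      by (elim exE conjE) (rule that)
    show "\<exists>lev. (\<forall>i\<in>{1..n}. lev i \<in> {1..2 * L} \<and> b0 n i = (if odd (lev i) then 1 else -1)) \<and>
      (\<forall>i\<in>{1..n}. \<forall>j\<in>{1..n}. i \<le> j \<longrightarrow> lev i \<le> lev j)"
      by (rule block_levels[OF _ _ a]) (use n signs ordered in auto)
  qed
  from bchoice[OF this] obtain lev where lev: "\<forall>n\<in>{2..}. (\<forall>i\<in>{1..n}. lev n i \<in> {1..2 * L} \<and> b0 n i = (if odd (lev n i) then 1 else -1)) \<and>
    (\<forall>i\<in>{1..n}. \<forall>j\<in>{1..n}. i \<le> j \<longrightarrow> lev n i \<le> lev n j)"
    by (elim exE) (rule that)
  \<comment> \<open>\<open>A\<close> bounds \<open>G 0 + C\<^sup>2 * T\<close> by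
    \<open>G_0_le\<close>, and \<open>B\<close> the second moments up to time \<open>T\<close>;
    neither depends on \<open>n\<close>.\<close>
  define A where "A = E + C / 2 + 2 * C * (1 + M) + C\<^sup>2 * T"
  define B where "B = 1 + M + C * T"
  \<comment> \<open>The data are constrained for \<open>n \<ge> 2\<close> only, hence the shift by
    2, which reappears in the final subsequence \<open>r k + 2\<close>.\<close>
  interpret P: particle_sequence V W T C A B L "\<lambda>k. k + 2" "\<lambda>k. x0 (k + 2)" "\<lambda>k. b0 (k + 2)" "\<lambda>k. x (k + 2)" "\<lambda>k. b (k + 2)"
    "\<lambda>k. fst (q (k + 2))" "\<lambda>k. snd (q (k + 2))" "\<lambda>k. lev (k + 2)"
  proof (rule particle_sequence.intro)
    show "annihilating_particles V W (k + 2) T (x0 (k + 2)) (b0 (k + 2)) (x (k + 2)) (b (k + 2)) (fst (q (k + 2))) (snd (q (k + 2))) C" for k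
      by (rule bspec[OF q]) simp
    show "filterlim (\<lambda>k. k + 2) at_top sequentially" by (rule filterlim_add_const_nat_at_top)
    show "annihilating_particles.G V W (k + 2) (b0 (k + 2)) (x (k + 2)) (fst (q (k + 2))) C 0 + C\<^sup>2 * T \<le> A" for k
      using G[of "k + 2"] by (simp add: A_def)
    show "1 / real (k + 2) * (\<Sum>i=1..k + 2. (x0 (k + 2) i)\<^sup>2) + C * T \<le> B" for k
      using m2[of "k + 2"] unfolding B_def by linarith
    fix k i :: nat assume "i \<in> {1..k + 2}"
    then show "lev (k + 2) i \<in> {1..2 * L}" "b0 (k + 2) i = (if odd (lev (k + 2) i) then 1 else -1)"
      using bspec[OF lev, of "k + 2"] by auto
  next
    fix k i j :: nat assume "i \<in> {1..k + 2}" "j \<in> {1..k + 2}" "i \<le> j"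
    then show "lev (k + 2) i \<le> lev (k + 2) j" using bspec[OF lev, of "k + 2"] by auto
  qed
  obtain r \<rho> where r: "strict_mono r" and \<rho>: "\<forall>t\<in>{0..T}. \<rho> t \<in> P2"
    and unif: "\<forall>p\<in>{-1, 1}. \<forall>\<phi> :: real \<Rightarrow> real. continuous_on UNIV \<phi> \<and> bounded (range \<phi>) \<longrightarrow>
       (\<lambda>k. SUP t\<in>{0..T}. \<bar>(\<integral>y. \<phi> y \<partial>empirical (r k + 2) (x (r k + 2) t) (b0 (r k + 2)) p) - (\<integral>y. \<phi> y \<partial>\<rho> t p)\<bar>) \<longlonglongrightarrow> 0"
    and sol: "weak_solution V W T (\<rho> 0) \<rho>"
    and init: "\<forall>p\<in>{-1, 1}. wconv (\<lambda>k. empirical (r k + 2) (x (r k + 2) 0) (b0 (r k + 2)) p) (\<rho> 0 p)"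
    using P.convergent_subsequence by (elim exE conjE) (rule that)
  have init_eq: "empirical (r k + 2) (x (r k + 2) 0) (b0 (r k + 2)) p = empirical (r k + 2) (x0 (r k + 2)) (b0 (r k + 2)) p" for k p
    by (rule empirical_cong) (rule P.S.init)
  have init': "\<forall>p\<in>{-1, 1}. \<forall>\<phi> :: real \<Rightarrow> real. continuous_on UNIV \<phi> \<and> bounded (range \<phi>) \<longrightarrow>
      (\<lambda>k. \<integral>y. \<phi> y \<partial>empirical (r k + 2) (x0 (r k + 2)) (b0 (r k + 2)) p) \<longlonglongrightarrow> (\<integral>y. \<phi> y \<partial>\<rho> 0 p)"
    using init unfolding init_eq wconv_def .
  show ?thesis
  proof (intro conjI allI impI)
    show "(\<lambda>t. empirical n (x n t) (b0 n)) \<in> AC_curves 2 T P2" if "n \<ge> 2" for n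
      by (rule annihilating_particles.empirical_AC[OF bspec[OF q]]) (use that in simp)
    have "strict_mono (\<lambda>k. r k + 2)" using r by (simp add: strict_mono_def)
    then show "\<exists>(r :: nat \<Rightarrow> nat) (\<rho> :: real \<Rightarrow> signed_pair) (\<rho>0 :: signed_pair).
       strict_mono r \<and> (\<forall>k. 2 \<le> r k) \<and>
       (\<forall>t\<in>{0..T}. \<rho> t \<in> P2) \<and>
       (\<forall>p\<in>{-1, 1}. \<forall>\<phi> :: real \<Rightarrow> real. continuous_on UNIV \<phi> \<and> bounded (range \<phi>) \<longrightarrow>
          (\<lambda>k. SUP t\<in>{0..T}. \<bar>(\<integral>y. \<phi> y \<partial>empirical (r k) (x (r k) t) (b0 (r k)) p) - (\<integral>y. \<phi> y \<partial>\<rho> t p)\<bar>)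
            \<longlonglongrightarrow> 0) \<and>
       weak_solution V W T \<rho>0 \<rho> \<and> \<rho> 0 = \<rho>0 \<and>
       (\<forall>p\<in>{-1, 1}. \<forall>\<phi> :: real \<Rightarrow> real. continuous_on UNIV \<phi> \<and> bounded (range \<phi>) \<longrightarrow>
          (\<lambda>k. \<integral>y. \<phi> y \<partial>empirical (r k) (x0 (r k)) (b0 (r k)) p) \<longlonglongrightarrow> (\<integral>y. \<phi> y \<partial>\<rho>0 p))"
      using \<rho> unif sol init'
      by (intro exI[of _ "\<lambda>k. r k + 2"] exI[of _ \<rho>] exI[of _ "\<rho> 0"] conjI refl) (assumption | simp)+
  qed
qed

end
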